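(* Let $n\ge1$ and $\sigma,\tau\in\mathbb C$ with $\operatorname{Re}(\sigma+\tau)<1$. Then $$\ell_{\sigma|\tau}(g)=\frac{(-1)^{n(n-1)/2}\sin^n(-\pi\sigma)\,2^{-(\sigma+\tau)n}}{\pi^n}\prod_{j=1}^n\Gamma(\sigma+\tau+j)\ \sum_{\mathbf m}\Bigl\{\prod_{1\le\alpha<\beta\le n}(m_\alpha-m_\beta)\prod_{j=1}^n\frac{\Gamma(-\sigma+m_j-n+1)}{\Gamma(\tau+m_j+1)}\ \chi_{\mathbf m}(g)\Bigr\}$$ $$=(-1)^{n(n-1)/2}\,2^{-(\sigma+\tau)n}\prod_{j=1}^n\Gamma(\sigma+\tau+j)\ \sum_{\mathbf m}\Bigl\{\frac{(-1)^{\sum_j m_j}\prod_{1\le\alpha<\beta\le n}(m_\alpha-m_\beta)}{\prod_{j=1}^n\Gamma(\sigma-m_j+n)\,\Gamma(\tau+m_j+1)}\,\chi_{\mathbf m}(g)\Bigr\},$$ where both sums are over all signatures $\mathbf m$.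
   Context: $\mathrm U(n)$ is the unitary group. For an $n\times n$ matrix $z$ with $\|z\|<1$ and $\sigma\in\mathbb C$, $\det(1-z)^\sigma$ denotes the determinant of $(1-z)^\sigma=1-\sigma z+\frac{\sigma(\sigma-1)}{2!}z^2-\dots$ (binomial series); for $\|z\|\le1$, $\det(1-z)\ne0$, it is the limit of $\det(1-z')^\sigma$ as $z'\to z$, $\|z'\|<1$. For $z\in\mathrm U(n)$, $$\ell_{\sigma|\tau}(z):=2^{-(\sigma+\tau)n}\det(1-z)^\sigma\det(1-\overline z)^\tau,$$ regarded as a distribution on $\mathrm U(n)$ depending meromorphically on $(\sigma,\tau)$; the formulas are its expansion in characters. A signature is a collection of integers $\mathbf m:\ m_1>m_2>\dots>m_n$. Signatures parametrize the irreducible representations $\pi_{\mathbf m}$ of $\mathrm U(n)$; the character of $\pi_{\mathbf m}$ is $\chi_{\mathbf m}(z)=\dfrac{\det_{k,j}\{e^{im_j\psi_k}\}}{\det_{k,j}\{e^{i(n-j)\psi_k}\}}$, where $e^{i\psi_1},\dots,e^{i\psi_n}$ are the eigenvalues of $z$. Here $1/\Gamma(-k)=0$ for $k=0,1,2,\dots$. *)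

theory Defs
  imports
    "HOL-Complex_Analysis.Complex_Analysis"
    "HOL-Probability.Probability"
    "Jordan_Normal_Form.Determinant"
begin

section \<open>The unitary group, Haar measure and test functions\<close>

definition cnj_matrix :: "complex^'n^'n \<Rightarrow> complex^'n^'n" where
  "cnj_matrix z = (\<chi> i j. cnj (z $ i $ j))"

definition unitary_group :: "(complex^'n^'n) set" where
  "unitary_group = {z. z ** transpose (cnj_matrix z) = Finite_Cartesian_Product.mat 1 \<and>
                       transpose (cnj_matrix z) ** z = Finite_Cartesian_Product.mat 1}"

text \<open>
  These conditions determine the measure uniquely: it is the Haar measure of the compact group
  \<open>U(n)\<close> with total mass 1, which is invariant on both sides.
\<close>
definition normalized_haar :: "(complex^'n^'n) measure \<Rightarrow> bool" where
  "normalized_haar \<mu> \<longleftrightarrow>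
     prob_space \<mu> \<and>
     space \<mu> = unitary_group \<and>
     sets \<mu> = sets (restrict_space borel unitary_group) \<and>
     (\<forall>u\<in>unitary_group. distr \<mu> \<mu> (\<lambda>g. u ** g) = \<mu> \<and> distr \<mu> \<mu> (\<lambda>g. g ** u) = \<mu>)"

text \<open>\<open>C\<^sup>k\<close> on an open set, in the sense of real derivatives.\<close>
primrec times_cont_diff_on ::
    "nat \<Rightarrow> ('a::real_normed_vector) set \<Rightarrow> ('a \<Rightarrow> 'b::real_normed_vector) \<Rightarrow> bool" where
  "times_cont_diff_on 0 S f \<longleftrightarrow> continuous_on S f"
| "times_cont_diff_on (Suc k) S f \<longleftrightarrow>
     (\<forall>x\<in>S. f differentiable (at x)) \<and>
     (\<forall>v. times_cont_diff_on k S (\<lambda>x. frechet_derivative f (at x) v))"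

text \<open>
  \<open>U(n)\<close> is a closed submanifold of the space of matrices, so its smooth functions are the
  restrictions of functions that are smooth on a neighbourhood.
\<close>
definition test_function :: "(complex^'n^'n \<Rightarrow> complex) \<Rightarrow> bool" where
  "test_function \<phi> \<longleftrightarrow>
     (\<exists>V F. open V \<and> unitary_group \<subseteq> V \<and> (\<forall>k. times_cont_diff_on k V F) \<and>
            (\<forall>g\<in>unitary_group. \<phi> g = F g))"


section \<open>The function \<open>\<ell>\<close>\<close>

definition matrix_power :: "complex^'n^'n \<Rightarrow> nat \<Rightarrow> complex^'n^'n" where
  "matrix_power z k = (((**) z) ^^ k) (Finite_Cartesian_Product.mat 1)"

text \<open>The binomial series for \<open>(1 - z)\<^sup>\<sigma>\<close>, summed entrywise.\<close>
definition one_minus_powr :: "complex^'n^'n \<Rightarrow> complex \<Rightarrow> complex^'n^'n" where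
  "one_minus_powr z \<sigma> =
     (\<chi> i j. \<Sum>k. (-1) ^ k * (\<sigma> gchoose k) * (matrix_power z k $ i $ j))"

definition op_norm :: "complex^'n^'n \<Rightarrow> real" where
  "op_norm z = onorm (\<lambda>x. z *v x)"

text \<open>Meaningful if \<open>op_norm z < 1\<close>, or if \<open>op_norm z \<le> 1\<close> and \<open>det (1 - z) \<noteq> 0\<close>.\<close>
definition det_one_minus_powr :: "complex^'n^'n \<Rightarrow> complex \<Rightarrow> complex" where
  "det_one_minus_powr z \<sigma> =
     (if op_norm z < 1 then Determinants.det (one_minus_powr z \<sigma>)
      else Lim (at z within {z'. op_norm z' < 1})
             (\<lambda>z'. Determinants.det (one_minus_powr z' \<sigma>)))"

text \<open>
  The formula says nothing on the set \<open>det (1 - z) = 0\<close>, which has measure zero in \<open>U(n)\<close>;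
  the value there is set to 0.
\<close>
definition ell :: "complex \<Rightarrow> complex \<Rightarrow> complex^'n^'n \<Rightarrow> complex" where
  "ell \<sigma> \<tau> z =
     (if Determinants.det (Finite_Cartesian_Product.mat 1 - z) = 0 then 0
      else 2 powr (- (\<sigma> + \<tau>) * of_nat CARD('n)) *
           det_one_minus_powr z \<sigma> * det_one_minus_powr (cnj_matrix z) \<tau>)"


section \<open>Meromorphic continuation in two variables\<close>

definition holomorphic2_on :: "(complex \<times> complex \<Rightarrow> complex) \<Rightarrow> (complex \<times> complex) set \<Rightarrow> bool" where
  "holomorphic2_on f S \<longleftrightarrow>
     (\<forall>p\<in>S. \<exists>a b. (f has_derivative (\<lambda>(u, v). a * u + b * v)) (at p))"

text \<open>Locally a quotient of two holomorphic functions, with denominator not identically zero.\<close>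
definition meromorphic2 :: "(complex \<times> complex \<Rightarrow> complex) \<Rightarrow> bool" where
  "meromorphic2 F \<longleftrightarrow>
     (\<forall>p. \<exists>r>0. \<exists>h k. holomorphic2_on h (ball p r) \<and> holomorphic2_on k (ball p r) \<and>
            (\<exists>q\<in>ball p r. k q \<noteq> 0) \<and>
            (\<forall>q\<in>ball p r. k q \<noteq> 0 \<longrightarrow> F q = h q / k q))"

text \<open>
  The value at \<open>p\<close> of the meromorphic continuation of \<open>f\<close> from the open set \<open>D\<close> to the whole
  plane \<open>\<complex>\<^sup>2\<close>, provided that the continuation exists and is regular at \<open>p\<close>.
\<close>
definition continuation_value ::
    "(complex \<times> complex) set \<Rightarrow> (complex \<times> complex \<Rightarrow> complex) \<Rightarrow> complex \<times> complex \<Rightarrow> complex" where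
  "continuation_value D f p =
     (THE c. \<exists>F. meromorphic2 F \<and> (\<forall>q\<in>D. F q = f q) \<and>
                 (\<exists>r>0. holomorphic2_on F (ball p r)) \<and> c = F p)"

text \<open>
  The function \<open>ell \<sigma> \<tau>\<close> is integrable exactly for \<open>Re (\<sigma> + \<tau>) > -1\<close>, where it is identified
  with a distribution by means of the Haar measure \<open>\<mu>\<close>.
\<close>
definition ell_distribution ::
    "(complex^'n^'n) measure \<Rightarrow> complex \<Rightarrow> complex \<Rightarrow> (complex^'n^'n \<Rightarrow> complex) \<Rightarrow> complex" where
  "ell_distribution \<mu> \<sigma> \<tau> \<phi> =
     continuation_value {(s, t). Re (s + t) > -1}
       (\<lambda>(s, t). integral\<^sup>L \<mu> (\<lambda>g. ell s t g * \<phi> g)) (\<sigma>, \<tau>)"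


section \<open>Signatures and characters\<close>

text \<open>Entries are indexed by \<open>1, \<dots>, n\<close>; outside this range a signature is \<open>undefined\<close>.\<close>
definition signatures :: "nat \<Rightarrow> (nat \<Rightarrow> int) set" where
  "signatures n = {m \<in> {1..n} \<rightarrow>\<^sub>E UNIV. \<forall>\<alpha>\<in>{1..n}. \<forall>\<beta>\<in>{1..n}. \<alpha> < \<beta> \<longrightarrow> m \<alpha> > m \<beta>}"

text \<open>Arguments \<open>\<psi> 1, \<dots>, \<psi> n\<close> of the eigenvalues of a unitary matrix, with multiplicities.\<close>
definition eigen_angles :: "complex^'n^'n \<Rightarrow> nat \<Rightarrow> real" where
  "eigen_angles z =
     (SOME \<psi>. \<forall>x. Determinants.det (Finite_Cartesian_Product.mat x - z) = (\<Prod>k=1..CARD('n). x - cis (\<psi> k)))"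

definition distinct_eigenvalues :: "complex^'n^'n \<Rightarrow> bool" where
  "distinct_eigenvalues z \<longleftrightarrow> inj_on (\<lambda>k. cis (eigen_angles z k)) {1..CARD('n)}"

definition weyl_quotient :: "(nat \<Rightarrow> int) \<Rightarrow> complex^'n^'n \<Rightarrow> complex" where
  "weyl_quotient m z =
     (let n = CARD('n); \<psi> = eigen_angles z in
       Determinant.det (Matrix.mat n n (\<lambda>(k, j). cis (of_int (m (Suc j)) * \<psi> (Suc k)))) /
       Determinant.det (Matrix.mat n n (\<lambda>(k, j). cis (of_nat (n - Suc j) * \<psi> (Suc k)))))"

text \<open>
  If \<open>z\<close> has multiple eigenvalues, then the quotient is \<open>0 / 0\<close> and has to be extended by
  continuity from the dense set of unitary matrices with distinct eigenvalues.
\<close>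
definition weyl_character :: "(nat \<Rightarrow> int) \<Rightarrow> complex^'n^'n \<Rightarrow> complex" where
  "weyl_character m z =
     (if distinct_eigenvalues z then weyl_quotient m z
      else Lim (at z within {w \<in> unitary_group. distinct_eigenvalues w}) (weyl_quotient m))"

definition signature_differences :: "nat \<Rightarrow> (nat \<Rightarrow> int) \<Rightarrow> complex" where
  "signature_differences n m =
     (\<Prod>(\<alpha>, \<beta>)\<in>{(\<alpha>, \<beta>). 1 \<le> \<alpha> \<and> \<alpha> < \<beta> \<and> \<beta> \<le> n}. of_int (m \<alpha> - m \<beta>))"

text \<open>The distribution \<open>\<chi>\<^sub>m\<close>.\<close>
definition character_distribution ::
    "(complex^'n^'n) measure \<Rightarrow> (nat \<Rightarrow> int) \<Rightarrow> (complex^'n^'n \<Rightarrow> complex) \<Rightarrow> complex" where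
  "character_distribution \<mu> m \<phi> = integral\<^sup>L \<mu> (\<lambda>g. weyl_character m g * \<phi> g)"

end

theory Submission
  imports
    Defs
    "HOL-Computational_Algebra.Fundamental_Theorem_Algebra"
    "HOL-Real_Asymp.Real_Asymp"
begin

text \<open>
  For large \<open>Re s\<close> and \<open>Re t\<close> the expansion is a computation on the torus of eigenvalues.  On
  the unit circle \<open>(1 - z)\<^sup>s (1 - cnj z)\<^sup>t\<close> has the Fourier coefficients
  \<open>(-1)\<^sup>p \<Gamma>(1 + s + t) / (\<Gamma>(1 + s - p) \<Gamma>(1 + t + p))\<close>, by Gauss's summation of the
  hypergeometric series at 1 (\<open>circle_symbol_fourier\<close>).  The determinant of the values of these
  functions with \<open>s\<close> replaced by \<open>s, \<dots>, s + n - 1\<close> at the eigenvalues of \<open>g\<close> is, up to a sign,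
  \<open>ell s t g\<close> (without the power of 2) times a Vandermonde determinant.  By the Cauchy--Binet formula it
  is also a sum of alternants over all signatures, with determinants of Fourier coefficients as
  coefficients, and these are again of Vandermonde type (\<open>coefficient_eq\<close>).  Dividing by the
  Vandermonde determinant gives the expansion of \<open>ell s t\<close> in characters
  (\<open>ell_integral_expansion\<close>).

  For general exponents the series converges only as a distribution.  Characters are eigenfunctions of
  the Casimir operator with eigenvalues that grow quadratically (\<open>casimir_char_fun\<close>).  The
  operator is symmetric with respect to the Haar measure (\<open>casimir_symmetric\<close>), so the integrals
  of a test function against characters decay faster than every power of the signature
  (\<open>character_distribution_decay\<close>).  The eigenvalue equation is proved with the radial part of the
  operator, first for power sums and the inverse determinant and then for all polynomials in them, to
  which the characters belong by Newton's identities.  Divided by \<open>\<Prod>j. \<Gamma>(s + t + j)\<close>, the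
  coefficients are entire in \<open>(s, t)\<close> and polynomially bounded in the signature, and so the series is
  entire (\<open>reduced_sum_entire\<close>).

  It remains to see that the right-hand side, which is meromorphic, agrees with the integral of
  \<open>ell s t g * \<phi> g\<close> on the whole half-plane \<open>Re (s + t) > -1\<close>, where the latter defines the
  distribution.  Shifting both exponents by \<open>u / 2\<close> multiplies \<open>ell\<close> by
  \<open>exp (- u * singularity g)\<close> with a non-negative function, so the integrals are Laplace integrals.
  For the trivial test function the integrand is non-negative, and Landau's theorem
  (\<open>landau_integrable\<close>) shows that the integral converges as far to the left as its continuation has
  no pole.  This dominates all other cases (\<open>ell_integral_eq\<close>).  Uniqueness of meromorphic
  continuation (\<open>meromorphic2_unique\<close>) then gives the second expansion, and Euler's
  reflection formula the first one.
\<close>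

text \<open>The usual symbols, \<open>det\<close> and \<open>mat\<close> denote the operations on matrices whose index set is a type.\<close>

no_notation vec_index (infixl "$" 100)
no_notation fps_nth (infixl "$" 75)
no_notation scalar_prod (infix "\<bullet>" 70)
no_notation Infinite_Set_Sum.abs_summable_on (infix "abs'_summable'_on" 50)
hide_const (open) Determinant.det Matrix.mat

lemmas cart_eq_iff = Finite_Cartesian_Product.vec_eq_iff
lemmas cart_transpose_def = Finite_Cartesian_Product.transpose_def
lemmas cart_det_def = Determinants.det_def
lemmas integral_cong_on = Bochner_Integration.integral_cong
lemmas integral_of_sum = Bochner_Integration.integral_sum

section \<open>Determinants of matrices of polynomials\<close>

text \<open>Determinants of matrices indexed by \<open>{..<n}\<close>, so that the size can vary.\<close>
abbreviation jdet :: "nat => (nat => nat => 'a::comm_ring_1) => 'a" where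
  "jdet n a \<equiv> Determinant.det (Matrix.mat n n (%(i, j). a i j))"

lemma jdet_leibniz:
  "jdet n a = (\<Sum>p | p permutes {..<n}. of_int (sign p) * (\<Prod>i<n. a i (p i)))"
proof -
  have "(\<Prod>i = 0..<n. Matrix.mat n n (%(i, j). a i j) $$ (i, p i)) = (\<Prod>i<n. a i (p i))"
    if "p permutes {0..<n}" for p
    using that by (auto simp: atLeast0LessThan permutes_in_image intro!: prod.cong)
  then show ?thesis
    by (subst det_def'[of _ n]) (auto simp: atLeast0LessThan intro!: sum.cong)
qed

lemma jdet_cong: "(\<And>i j. i < n ==> j < n ==> a i j = b i j) ==> jdet n a = jdet n b"
  by (rule arg_cong[where f = Determinant.det]) auto

lemma jdet_mult: "jdet n (%i j. \<Sum>k<n. a i k * b k j) = jdet n a * jdet n b"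
proof -
  have "Matrix.mat n n (%(i, j). \<Sum>k<n. a i k * b k j) =
      Matrix.mat n n (%(i, j). a i j) * Matrix.mat n n (%(i, j). b i j)"
    by (rule eq_matI) (auto simp: scalar_prod_def atLeast0LessThan intro!: sum.cong)
  then show ?thesis by (simp add: det_mult[of _ n])
qed

lemma jdet_transpose: "jdet n (%i j. a j i) = jdet n a"
proof -
  have "Matrix.mat n n (%(i, j). a j i) = transpose_mat (Matrix.mat n n (%(i, j). a i j))"
    by (rule eq_matI) auto
  then show ?thesis by (simp add: det_transpose[of _ n])
qed

lemma jdet_permute_rows:
  assumes "p permutes {..<n}"
  shows "jdet n (%i j. a (p i) j) = of_int (sign p) * jdet n a"
proof -
  have "Matrix.mat n n (%(i, j). a (p i) j) = 
      Matrix.mat n n (%(i, j). Matrix.mat n n (%(i, j). a i j) $$ (p i, j))"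
    using assms by (intro eq_matI) (auto, metis index_mat(1) lessThan_iff old.prod.case permutes_in_image)
  then show ?thesis
    using det_permute_rows[of "Matrix.mat n n (%(i, j). a i j)" n p] assms
    by (auto simp: atLeast0LessThan)
qed

lemma jdet_permute_rows_cols:
  assumes "p permutes {..<n}"
  shows "jdet n (%i j. a (p i) (p j)) = jdet n a"
proof -
  have "jdet n (%i j. a (p i) (p j)) = of_int (sign p) * jdet n (%i j. a i (p j))"
    using jdet_permute_rows[OF assms, of "%i j. a i (p j)"] .
  also have "jdet n (%i j. a i (p j)) = jdet n (%i j. a j (p i))"
    by (rule jdet_transpose[symmetric])
  also have "... = of_int (sign p) * jdet n (%i j. a j i)"
    using jdet_permute_rows[OF assms, of "%i j. a j i"] .
  also have "jdet n (%i j. a j i) = jdet n a" by (rule jdet_transpose)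
  finally show ?thesis
    by (simp add: sign_idempotent flip: of_int_mult mult.assoc)
qed

lemma jdet_scale_cols: "jdet n (%i j. c j * a i j) = (\<Prod>j<n. c j) * jdet n a"
  unfolding jdet_leibniz
  by (auto simp: prod.distrib sum_distrib_left ac_simps prod.permute[symmetric] comp_def
      intro!: sum.cong prod.permute arg_cong2[where f = "(*)"])
    (metis (mono_tags) comp_apply prod.cong prod.permute)

lemma jdet_scale_rows: "jdet n (%i j. c i * a i j) = (\<Prod>i<n. c i) * jdet n a"
  unfolding jdet_leibniz by (simp add: prod.distrib sum_distrib_left ac_simps)

text \<open>The matrix of values is the matrix of powers times the upper unitriangular matrix of
  coefficients.\<close>
lemma jdet_monic_polys_power:
  fixes P :: "nat => 'a::comm_ring_1 poly"
  assumes "\<And>j. j < n ==> degree (P j) = j" "\<And>j. j < n ==> lead_coeff (P j) = 1"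
  shows "jdet n (%k j. poly (P j) (y k)) = jdet n (%k j. y k ^ j)"
proof -
  have "poly (P j) x = (\<Sum>i<n. x ^ i * coeff (P j) i)" if "j < n" for x j
  proof -
    have "poly (P j) x = (\<Sum>i\<le>j. x ^ i * coeff (P j) i)"
      using assms(1)[OF that] by (simp add: poly_altdef mult.commute)
    also have "... = (\<Sum>i<n. x ^ i * coeff (P j) i)"
      using that assms(1)[OF that] by (intro sum.mono_neutral_left) (auto, metis le_degree mult_zero_right)
    finally show ?thesis .
  qed
  then have "jdet n (%k j. poly (P j) (y k)) = jdet n (%k j. \<Sum>i<n. y k ^ i * coeff (P j) i)"
    by (intro jdet_cong) auto
  also have "... = jdet n (%k j. y k ^ j) * jdet n (%i j. coeff (P j) i)"
    by (rule jdet_mult)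
  also have "jdet n (%i j. coeff (P j) i) = 1"
  proof (subst det_upper_triangular[of _ n])
    show "upper_triangular (Matrix.mat n n (%(i, j). coeff (P j) i))"
      using assms(1) by (intro upper_triangularI) (auto intro!: coeff_eq_0)
    have "diag_mat (Matrix.mat n n (%(i, j). coeff (P j) i)) = map (%i. 1) [0..<n]"
      using assms by (auto simp: diag_mat_def)
    then show "prod_list (diag_mat (Matrix.mat n n (%(i, j). coeff (P j) i))) = 1"
      by (simp add: map_replicate_const)
  qed auto
  finally show ?thesis by simp
qed

lemma newton_poly_props:
  fixes y :: "nat => 'a::idom"
  shows "degree (\<Prod>i<k. [:- y i, 1:]) = k" "lead_coeff (\<Prod>i<k. [:- y i, 1:]) = 1"
proof -
  show "lead_coeff (\<Prod>i<k. [:- y i, 1:]) = 1" by (subst lead_coeff_prod) simp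
qed (simp add: degree_prod_eq_sum_degree)

text \<open>The determinant does not depend on the monic polynomials; Newton's polynomials
  \<open>\<Prod>i<j. x - y i\<close> vanish at the earlier nodes, so for them the matrix is triangular.\<close>
theorem jdet_monic_polys:
  fixes P :: "nat => 'a::idom poly"
  assumes "\<And>j. j < n ==> degree (P j) = j" "\<And>j. j < n ==> lead_coeff (P j) = 1"
  shows "jdet n (%k j. poly (P j) (y k)) = (\<Prod>k<n. \<Prod>i<k. y k - y i)"
proof -
  have "jdet n (%k j. poly (P j) (y k)) = jdet n (%k j. y k ^ j)"
    using assms by (rule jdet_monic_polys_power)
  also have "... = jdet n (%k j. poly (\<Prod>i<j. [:- y i, 1:]) (y k))"
    by (rule jdet_monic_polys_power[symmetric]) (use newton_poly_props in auto)
  also have "... = jdet n (%k j. \<Prod>i<j. y k - y i)"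
    by (simp add: poly_prod)
  also have "... = (\<Prod>k<n. \<Prod>i<k. y k - y i)"
  proof (subst det_lower_triangular[of n])
    show "Matrix.mat n n (%(k, j). \<Prod>i<j. y k - y i) $$ (i, j) = 0" if "i < j" "j < n" for i j
      using that by (auto intro!: prod_zero)
    show "prod_list (diag_mat (Matrix.mat n n (%(k, j). \<Prod>i<j. y k - y i))) = (\<Prod>k<n. \<Prod>i<k. y k - y i)"
      by (simp add: diag_mat_def prod.list_conv_set_nth atLeast0LessThan)
  qed auto
  finally show ?thesis .
qed

corollary jdet_monic_polys_rev:
  fixes P :: "nat => 'a::idom poly"
  assumes "\<And>j. j < n ==> degree (P j) = j" "\<And>j. j < n ==> lead_coeff (P j) = 1"
  shows "jdet n (%k j. poly (P (n - 1 - j)) (y k)) = (\<Prod>b<n. \<Prod>a<b. y a - y b)"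
proof -
  define p where "p i = (if i < n then n - 1 - i else i)" for i
  have p: "p permutes {..<n}"
  proof (rule bij_imp_permutes)
    show "bij_betw p {..<n} {..<n}"
      by (rule bij_betw_byWitness[of _ p]) (auto simp: p_def)
  qed (auto simp: p_def)
  have "jdet n (%k j. poly (P (n - 1 - j)) (y k)) = jdet n (%k j. poly (P (p j)) (y (p (p k))))"
    by (rule jdet_cong) (auto simp: p_def)
  also have "... = jdet n (%k j. poly (P j) (y (p k)))"
    using jdet_permute_rows_cols[OF p, of "%k j. poly (P j) (y (p k))"] .
  also have "... = (\<Prod>k<n. \<Prod>i<k. y (p k) - y (p i))"
    using assms by (rule jdet_monic_polys)
  also have "... = (\<Prod>(k, i)\<in>(SIGMA k:{..<n}. {..<k}). y (p k) - y (p i))"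
    by (simp add: prod.Sigma)
  also have "... = (\<Prod>(b, a)\<in>(SIGMA b:{..<n}. {..<b}). y a - y b)"
    by (rule prod.reindex_bij_witness[of _ "%(b, a). (p a, p b)" "%(k, i). (p i, p k)"])
      (auto simp: p_def)
  also have "... = (\<Prod>b<n. \<Prod>a<b. y a - y b)"
    by (simp add: prod.Sigma)
  finally show ?thesis .
qed

section \<open>Smooth functions\<close>

definition smooth_on :: "('a::real_normed_vector) set => ('a => 'b::real_normed_vector) => bool" where
  "smooth_on S f \<longleftrightarrow> (\<forall>k. times_cont_diff_on k S f)"

lemma times_cont_diff_on_SucD: "times_cont_diff_on (Suc k) S f ==> times_cont_diff_on k S f"
proof (induction k arbitrary: f)
  case 0
  then show ?case
    by (auto intro!: continuous_at_imp_continuous_on differentiable_imp_continuous_within)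
next
  case (Suc k)
  then show ?case
    by (metis times_cont_diff_on.simps(2))
qed

lemma times_cont_diff_on_subset:
  "times_cont_diff_on k S f ==> T \<subseteq> S ==> times_cont_diff_on k T f"
  by (induction k arbitrary: f) (auto intro: continuous_on_subset)

lemma times_cont_diff_on_cong:
  assumes "open S" "\<And>x. x \<in> S ==> f x = g x"
  shows "times_cont_diff_on k S f ==> times_cont_diff_on k S g"
  using assms(2)
proof (induction k arbitrary: f g)
  case 0
  then show ?case by (metis continuous_on_cong times_cont_diff_on.simps(1))
next
  case (Suc k)
  have der: "(g has_derivative frechet_derivative f (at x)) (at x)" if "x \<in> S" for x
  proof (rule has_derivative_transform_within_open[OF _ assms(1) that])
    show "(f has_derivative frechet_derivative f (at x)) (at x)"
      using Suc.prems(1) that by (simp add: frechet_derivative_works[symmetric])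
    show "f y = g y" if "y \<in> S" for y using Suc.prems(2) that by blast
  qed
  have eq: "frechet_derivative f (at x) = frechet_derivative g (at x)" if "x \<in> S" for x
    using frechet_derivative_at[OF der[OF that]] .
  have "times_cont_diff_on k S (%x. frechet_derivative g (at x) v)" for v
  proof (rule Suc.IH)
    show "times_cont_diff_on k S (%x. frechet_derivative f (at x) v)" using Suc.prems(1) by simp
    show "frechet_derivative f (at x) v = frechet_derivative g (at x) v" if "x \<in> S" for x
      using eq[OF that] by simp
  qed
  then show ?case using der by (auto simp: differentiable_def)
qed

lemma times_cont_diff_on_const: "times_cont_diff_on k S (%x. c)"
  by (induction k arbitrary: c) (auto simp: frechet_derivative_const)

lemma times_cont_diff_on_linear:
  assumes "bounded_linear L"
  shows "times_cont_diff_on k S L"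
proof (cases k)
  case 0
  then show ?thesis using assms by (simp add: linear_continuous_on)
next
  case (Suc m)
  have "frechet_derivative L (at x) = L" for x
    using frechet_derivative_at[OF bounded_linear_imp_has_derivative[OF assms]] by simp
  then show ?thesis using Suc assms
    by (auto simp: times_cont_diff_on_const intro: bounded_linear_imp_differentiable)
qed

lemma frechet_derivative_add:
  assumes "f differentiable at x" "g differentiable at x"
  shows "frechet_derivative (%x. f x + g x) (at x) v =
    frechet_derivative f (at x) v + frechet_derivative g (at x) v"
  using frechet_derivative_at[OF has_derivative_add[OF assms[unfolded frechet_derivative_works]]]
  by (simp add: fun_eq_iff)

lemma times_cont_diff_on_add:
  assumes "open S"
  shows "times_cont_diff_on k S f ==> times_cont_diff_on k S g ==>
    times_cont_diff_on k S (%x. f x + g x)"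
proof (induction k arbitrary: f g)
  case (Suc k)
  have "times_cont_diff_on k S (%x. frechet_derivative (%x. f x + g x) (at x) v)" for v
  proof (rule times_cont_diff_on_cong[OF assms])
    show "times_cont_diff_on k S (%x. frechet_derivative f (at x) v + frechet_derivative g (at x) v)"
      using Suc.prems by (intro Suc.IH) simp_all
  qed (use Suc.prems in \<open>simp add: frechet_derivative_add\<close>)
  then show ?case using Suc.prems by auto
qed (auto intro: continuous_intros)

lemma frechet_derivative_mult:
  fixes f g :: "'a::real_normed_vector => 'b::real_normed_algebra"
  assumes "f differentiable at x" "g differentiable at x"
  shows "frechet_derivative (%x. f x * g x) (at x) v =
    f x * frechet_derivative g (at x) v + frechet_derivative f (at x) v * g x"
  using frechet_derivative_at[OF has_derivative_mult[OF assms[unfolded frechet_derivative_works]]]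
  by (simp add: fun_eq_iff)

lemma times_cont_diff_on_mult:
  fixes f g :: "'a::real_normed_vector => 'b::real_normed_algebra"
  assumes "open S"
  shows "times_cont_diff_on k S f ==> times_cont_diff_on k S g ==>
    times_cont_diff_on k S (%x. f x * g x)"
proof (induction k arbitrary: f g)
  case (Suc k)
  have "times_cont_diff_on k S (%x. frechet_derivative (%x. f x * g x) (at x) v)" for v
  proof (rule times_cont_diff_on_cong[OF assms])
    show "times_cont_diff_on k S (%x. f x * frechet_derivative g (at x) v + frechet_derivative f (at x) v * g x)"
      using Suc.prems Suc.prems[THEN times_cont_diff_on_SucD]
      by (intro times_cont_diff_on_add[OF assms] Suc.IH) auto
  qed (use Suc.prems in \<open>auto simp: frechet_derivative_mult\<close>)
  then show ?case using Suc.prems by auto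
qed (auto intro: continuous_intros)

lemma smooth_onD:
  assumes "smooth_on S f"
  shows "x \<in> S ==> f differentiable at x" "continuous_on S f"
    "smooth_on S (%x. frechet_derivative f (at x) v)"
  using assms unfolding smooth_on_def
  by (metis times_cont_diff_on.simps(2), metis times_cont_diff_on.simps(1), metis times_cont_diff_on.simps(2))

lemma smooth_on_cong: "open S ==> smooth_on S f ==> (\<And>x. x \<in> S ==> f x = g x) ==> smooth_on S g"
  unfolding smooth_on_def by (metis times_cont_diff_on_cong)

lemma smooth_on_subset: "smooth_on S f ==> T \<subseteq> S ==> smooth_on T f"
  unfolding smooth_on_def by (metis times_cont_diff_on_subset)

lemma smooth_on_const: "smooth_on S (%x. c)"
  by (simp add: smooth_on_def times_cont_diff_on_const)

lemma smooth_on_linear: "bounded_linear L ==> smooth_on S L"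
  by (simp add: smooth_on_def times_cont_diff_on_linear)

lemma smooth_on_add: "open S ==> smooth_on S f ==> smooth_on S g ==> smooth_on S (%x. f x + g x)"
  by (simp add: smooth_on_def times_cont_diff_on_add)

lemma smooth_on_mult:
  fixes f g :: "'a::real_normed_vector => 'b::real_normed_algebra"
  shows "open S ==> smooth_on S f ==> smooth_on S g ==> smooth_on S (%x. f x * g x)"
  by (simp add: smooth_on_def times_cont_diff_on_mult)

lemma smooth_on_cmult:
  fixes f :: "'a::real_normed_vector => 'b::real_normed_algebra"
  shows "open S ==> smooth_on S f ==> smooth_on S (%x. c * f x)"
  by (simp add: smooth_on_mult smooth_on_const)

lemma smooth_on_sum:
  "open S ==> (\<And>i. i \<in> I ==> smooth_on S (f i)) ==> smooth_on S (%x. \<Sum>i\<in>I. f i x)"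
proof (induction I rule: infinite_finite_induct)
  case (insert i I)
  then show ?case using smooth_on_add[of S "f i" "%x. \<Sum>i\<in>I. f i x"] by simp
qed (simp_all add: smooth_on_const)

lemma smooth_on_prod:
  fixes f :: "'i => 'a::real_normed_vector => 'b::real_normed_field"
  shows "open S ==> (\<And>i. i \<in> I ==> smooth_on S (f i)) ==> smooth_on S (%x. \<Prod>i\<in>I. f i x)"
proof (induction I rule: infinite_finite_induct)
  case (insert i I)
  then show ?case using smooth_on_mult[where f = "f i" and g = "%x. \<Prod>i\<in>I. f i x"] by simp
qed (simp_all add: smooth_on_const)

text \<open>Expand the field in a basis: the derivatives along constant vectors are smooth by definition.\<close>
lemma smooth_on_linear_field:
  fixes f :: "'a::euclidean_space => complex"
  assumes "open S" "smooth_on S f" "bounded_linear L"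
  shows "smooth_on S (%x. frechet_derivative f (at x) (L x))"
proof (rule smooth_on_cong[OF assms(1)])
  show "smooth_on S (%x. \<Sum>b\<in>Basis. complex_of_real (L x \<bullet> b) * frechet_derivative f (at x) b)"
    by (intro smooth_on_sum smooth_on_mult smooth_onD assms(1,2) smooth_on_linear
        bounded_linear_compose[OF bounded_linear_of_real] bounded_linear_compose[OF bounded_linear_inner_left assms(3)])
  fix x assume "x \<in> S"
  then have "linear (frechet_derivative f (at x))"
    using smooth_onD(1)[OF assms(2)] by (simp add: linear_frechet_derivative)
  then show "(\<Sum>b\<in>Basis. complex_of_real (L x \<bullet> b) * frechet_derivative f (at x) b) =
      frechet_derivative f (at x) (L x)"
    by (subst (2) euclidean_representation[of "L x", symmetric])
       (simp add: linear_sum linear_scale scaleR_conv_of_real)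
qed

section \<open>The roots of the characteristic polynomial\<close>

lemma det_char_matrix_poly:
  fixes z :: "complex^'n^'n"
  obtains p where "degree p = CARD('n)" "lead_coeff p = 1" "\<And>x. poly p x = det (mat x - z)"
proof -
  define M :: "complex poly^'n^'n" where "M = (\<chi> i j. if i = j then [:- (z$i$j), 1:] else [:- (z$i$j):])"
  define T where "T p = of_int (sign p) * (\<Prod>i\<in>UNIV. M $ i $ p i)" for p
  have det: "det M = (\<Sum>p | p permutes UNIV. T p)"
    unfolding cart_det_def T_def ..
  have deg: "degree (T p) < CARD('n)" if p: "p permutes UNIV" "p \<noteq> id" for p
  proof -
    obtain i0 where i0: "p i0 \<noteq> i0" using p(2) by (auto simp: fun_eq_iff)
    have "degree (T p) \<le> degree (\<Prod>i\<in>UNIV. M $ i $ p i)"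
      unfolding T_def by (rule order.trans[OF degree_mult_le]) simp
    also have "... \<le> (\<Sum>i\<in>UNIV. degree (M $ i $ p i))"
      by (rule order.trans[OF degree_prod_sum_le]) (auto simp: comp_def)
    also have "... < (\<Sum>i::'n\<in>UNIV. 1)"
      using i0 by (intro sum_strict_mono_ex1) (auto simp: M_def intro!: exI[of _ i0])
    finally show ?thesis by simp
  qed
  have T_id: "T id = (\<Prod>i\<in>UNIV. [:- (z$i$i), 1:])"
    by (simp add: T_def M_def)
  have deg_id: "degree (T id) = CARD('n)" "lead_coeff (T id) = 1"
  proof -
    show "lead_coeff (T id) = 1" unfolding T_id by (subst lead_coeff_prod) simp
  qed (simp add: T_id degree_prod_eq_sum_degree)
  have split: "det M = T id + (\<Sum>p | p permutes UNIV \<and> p \<noteq> id. T p)"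
  proof -
    have "{p. p permutes (UNIV::'n set)} = insert id {p. p permutes UNIV \<and> p \<noteq> id}"
      by (auto simp: permutes_id)
    then show ?thesis unfolding det by (simp add: finite_permutations)
  qed
  have less: "degree (\<Sum>p | p permutes UNIV \<and> p \<noteq> id. T p) < degree (T id)"
    unfolding deg_id using deg by (intro degree_sum_less) auto
  have "degree (det M) = CARD('n)" "lead_coeff (det M) = 1"
    using less deg_id unfolding split by (simp_all add: degree_add_eq_left lead_coeff_add_le coeff_eq_0)
  moreover have "poly (det M) x = det (mat x - z)" for x
    unfolding cart_det_def poly_sum
    by (intro sum.cong) (auto simp: poly_prod M_def Finite_Cartesian_Product.mat_def of_int_poly intro!: prod.cong)
  ultimately show ?thesis using that by blast
qed

lemma complex_poly_monic_roots:
  fixes p :: "complex poly"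
  assumes "degree p = n" "lead_coeff p = 1"
  obtains z where "p = (\<Prod>k<n. [:- z k, 1:])"
  using assms
proof (induction n arbitrary: p thesis)
  case 0
  then have "p = 1" by (metis degree_eq_zeroE lead_coeff_pCons(2) one_pCons)
  then show ?case using 0 by simp
next
  case (Suc n)
  then obtain a where a: "poly p a = 0"
    by (metis constant_degree fundamental_theorem_of_algebra nat.distinct(1))
  then obtain q where q: "p = [:- a, 1:] * q" by (auto simp: poly_eq_0_iff_dvd)
  then have q0: "q \<noteq> 0" using Suc.prems by auto
  have "degree p = Suc (degree q)"
    unfolding q using q0 by (subst degree_mult_eq) auto
  moreover have "lead_coeff p = lead_coeff q"
    unfolding q by (subst lead_coeff_mult) simp
  ultimately have "degree q = n" "lead_coeff q = 1"
    using Suc.prems by simp_all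
  then obtain z where z: "q = (\<Prod>k<n. [:- z k, 1:])" using Suc.IH by blast
  show ?case
    by (rule Suc.prems(1)[of "z(n := a)"]) (simp add: q z mult.commute)
qed

text \<open>The eigenvalues with multiplicities, in an arbitrary order.  In contrast to the arguments
  in the definition of the characters this notion makes sense for all matrices.\<close>
definition char_roots :: "complex^'n^'n => (nat => complex) => bool" where
  "char_roots A z \<longleftrightarrow> (\<forall>x. det (mat x - A) = (\<Prod>k<CARD('n). x - z k))"

lemma char_roots_exist:
  fixes A :: "complex^'n^'n"
  shows "\<exists>z. char_roots A z"
proof -
  obtain p where p: "degree p = CARD('n)" "lead_coeff p = 1" "\<And>x. poly p x = det (mat x - A)"
    using det_char_matrix_poly[of A] by blast
  obtain z where "p = (\<Prod>k<CARD('n). [:- z k, 1:])"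
    by (rule complex_poly_monic_roots[OF p(1,2)])
  then have "poly p x = (\<Prod>k<CARD('n). x - z k)" for x by (simp add: poly_prod)
  then show ?thesis using p(3) by (auto simp: char_roots_def)
qed

text \<open>Both are lists of the roots of the same polynomial, with multiplicities.\<close>
lemma char_roots_unique:
  fixes A :: "complex^'n^'n"
  assumes "char_roots A z" "char_roots A w"
  obtains p where "p permutes {..<CARD('n)}" "\<And>k. k < CARD('n) ==> w k = z (p k)"
proof -
  let ?I = "{..<CARD('n)}"
  have "poly (\<Prod>k\<in>?I. [:- z k, 1:]) x = poly (\<Prod>k\<in>?I. [:- w k, 1:]) x" for x
    using assms by (simp add: char_roots_def poly_prod)
  then have eq: "(\<Prod>k\<in>?I. [:- z k, 1:]) = (\<Prod>k\<in>?I. [:- w k, 1:])"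
    by (simp add: poly_eq_poly_eq_iff[symmetric] fun_eq_iff)
  have roots: "proots (\<Prod>k<m. [:- z k, 1:]) = image_mset z (mset_set {..<m})" for m and z :: "nat => complex"
    by (induction m) (auto simp: lessThan_Suc proots_mult simp del: mult_pCons_left mult_pCons_right)
  have "image_mset z (mset_set ?I) = image_mset w (mset_set ?I)"
    using eq roots by metis
  then obtain p where "p permutes ?I" "\<forall>x\<in>?I. w x = z (p x)"
    using image_mset_eq_implies_permutes[of ?I w z] by (metis finite_lessThan)
  then show ?thesis using that by auto
qed

subsection \<open>Polynomials of a matrix\<close>

definition mpoly :: "complex poly => complex^'n^'n => complex^'n^'n" where
  "mpoly p A = fold_coeffs (%a M. mat a + A ** M) p 0"

lemma mat_times_nth: "(mat a ** (M :: complex^'n^'n)) $ i $ j = a * M $ i $ j"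
  by (simp add: matrix_matrix_mult_def Finite_Cartesian_Product.mat_def if_distrib if_distribR cong: if_cong)

lemma times_mat_nth: "((M :: complex^'n^'n) ** mat a) $ i $ j = M $ i $ j * a"
  by (simp add: matrix_matrix_mult_def Finite_Cartesian_Product.mat_def if_distrib if_distribR cong: if_cong)

lemma mat_nth: "(mat a :: complex^'n^'n) $ i $ j = (if i = j then a else 0)"
  by (simp add: Finite_Cartesian_Product.mat_def)

lemma matrix_diff_rdistrib: "(A - B) ** (C :: complex^'n^'n) = A ** C - B ** C"
  by (simp add: matrix_matrix_mult_def cart_eq_iff algebra_simps sum_subtractf)

lemma mat_0_eq [simp]: "mat 0 = (0 :: complex^'n^'n)"
  by (simp add: Finite_Cartesian_Product.mat_def cart_eq_iff)

lemma mpoly_0 [simp]: "mpoly 0 A = 0"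
  by (simp add: mpoly_def)

lemma mpoly_pCons: "mpoly (pCons a p) A = mat a + A ** mpoly p A"
  by (cases "p = 0 \<and> a = 0") (auto simp: mpoly_def)

lemma mpoly_add: "mpoly (p + q) A = mpoly p A + mpoly q A"
proof (induction p q rule: poly_induct2)
  case (pCons a p b q)
  have "mat (a + b) = mat a + (mat b :: complex^'n^'n)" by (simp add: Finite_Cartesian_Product.mat_def cart_eq_iff)
  then show ?case using pCons by (simp add: mpoly_pCons matrix_add_ldistrib)
qed simp

lemma mpoly_smult: "mpoly (Polynomial.smult c p) A = mat c ** mpoly p A"
proof (induction p)
  case (pCons a p)
  have "mat (c * a) = mat c ** (mat a :: complex^'n^'n)"
    by (simp add: cart_eq_iff mat_times_nth mat_nth)
  moreover have "A ** mat c = mat c ** A"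
    by (simp add: cart_eq_iff mat_times_nth times_mat_nth)
  ultimately show ?case using pCons
    by (simp add: mpoly_pCons matrix_add_ldistrib matrix_mul_assoc)
qed simp

lemma mpoly_linear_mult: "mpoly ([:- b, 1:] * q) A = (A - mat b) ** mpoly q A"
proof -
  have "mat (- b) ** M = - (mat b ** M)" for M :: "complex^'n^'n"
    by (simp add: cart_eq_iff mat_times_nth)
  then show ?thesis
    by (simp only: mult_pCons_left mpoly_add mpoly_smult mpoly_pCons) 
       (simp add: mpoly_add mpoly_smult mpoly_pCons matrix_diff_rdistrib)
qed

lemma mpoly_sum: "mpoly (\<Sum>i\<in>I. f i) A = (\<Sum>i\<in>I. mpoly (f i) A)"
  by (induction I rule: infinite_finite_induct) (auto simp: mpoly_add)

lemma mpoly_monom: "mpoly (monom c k) A = mat c ** matrix_power A k"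
proof (induction k)
  case 0
  then show ?case by (simp add: monom_0 mpoly_pCons matrix_power_def)
next
  case (Suc k)
  have "A ** mat c = mat c ** A"
    by (simp add: cart_eq_iff mat_times_nth times_mat_nth)
  then show ?case using Suc
    by (simp add: monom_Suc mpoly_pCons matrix_power_def) (metis matrix_mul_assoc)
qed

lemma det_uminus_complex: "det (- A) = (-1) ^ CARD('n) * det (A :: complex^'n^'n)"
proof -
  have "- A = (\<chi> i. (-1) *s (A $ i))" by (simp add: cart_eq_iff)
  then show ?thesis using Determinants.det_rows_mul[of "%i. -1" "%i. A $ i"] by simp
qed

lemma char_roots_det_minus:
  fixes A :: "complex^'n^'n"
  assumes "char_roots A z"
  shows "det (A - mat b) = (\<Prod>k<CARD('n). z k - b)"
proof -
  have "det (A - mat b) = (-1) ^ CARD('n) * (\<Prod>k<CARD('n). b - z k)"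
    using det_uminus_complex[of "mat b - A"] assms by (simp add: char_roots_def)
  also have "... = (\<Prod>k<CARD('n). - 1 * (b - z k))" by (subst prod.distrib) simp
  finally show ?thesis by simp
qed

text \<open>Spectral mapping for determinants.  It needs no triangular form: the polynomial is split
  into linear factors, for which the claim is the definition of the characteristic roots.\<close>
text \<open>Spectral mapping for determinants.  It needs no triangular form: the polynomial is split
  into linear factors, for which the claim is the definition of the characteristic roots.\<close>
theorem det_mpoly:
  fixes A :: "complex^'n^'n"
  assumes "char_roots A z"
  shows "det (mpoly p A) = (\<Prod>k<CARD('n). poly p (z k))"
proof (induction "degree p" arbitrary: p rule: less_induct)
  case less
  show ?case
  proof (cases "degree p = 0")
    case True
    then obtain c where "p = [:c:]" by (metis degree_eq_zeroE)
    then show ?thesis by (simp add: mpoly_pCons Finite_Cartesian_Product.mat_def Determinants.det_diagonal)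
  next
    case False
    then obtain a where a: "poly p a = 0"
      by (metis constant_degree fundamental_theorem_of_algebra)
    then obtain q where q: "p = [:- a, 1:] * q" by (auto simp: poly_eq_0_iff_dvd)
    have "q \<noteq> 0" using q False by auto
    then have "degree p = Suc (degree q)" unfolding q by (subst degree_mult_eq) auto
    then have "degree q < degree p" by simp
    from less[OF this] show ?thesis
      unfolding q mpoly_linear_mult det_mul char_roots_det_minus[OF assms]
      by (simp add: prod.distrib[symmetric] algebra_simps)
  qed
qed

section \<open>Functions of two complex variables\<close>

lemma holomorphic2_on_subset: "holomorphic2_on f S ==> T \<subseteq> S ==> holomorphic2_on f T"
  unfolding holomorphic2_on_def by blast

lemma holomorphic2_on_continuous: "holomorphic2_on f S ==> p \<in> S ==> isCont f p"
  unfolding holomorphic2_on_def using has_derivative_continuous by blast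

lemma holomorphic2_on_const: "holomorphic2_on (%_. c) S"
  unfolding holomorphic2_on_def
  by (intro ballI exI[of _ 0]) (auto intro!: derivative_eq_intros simp: case_prod_beta)

lemma holomorphic2_on_mult:
  assumes "holomorphic2_on f S" "holomorphic2_on g S"
  shows "holomorphic2_on (%p. f p * g p) S"
  unfolding holomorphic2_on_def
proof
  fix p assume "p \<in> S"
  then obtain a b c d where
    "(f has_derivative (%(u, v). a * u + b * v)) (at p)" "(g has_derivative (%(u, v). c * u + d * v)) (at p)"
    using assms unfolding holomorphic2_on_def by meson
  from has_derivative_mult[OF this]
  have "((%p. f p * g p) has_derivative (%(u, v). (f p * c + a * g p) * u + (f p * d + b * g p) * v)) (at p)"
    by (rule has_derivative_eq_rhs) (auto simp: algebra_simps)
  then show "\<exists>a b. ((%p. f p * g p) has_derivative (%(u, v). a * u + b * v)) (at p)" by blast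
qed

lemma holomorphic2_on_diff:
  assumes "holomorphic2_on f S" "holomorphic2_on g S"
  shows "holomorphic2_on (%p. f p - g p) S"
  unfolding holomorphic2_on_def
proof
  fix p assume "p \<in> S"
  then obtain a b c d where
    "(f has_derivative (%(u, v). a * u + b * v)) (at p)" "(g has_derivative (%(u, v). c * u + d * v)) (at p)"
    using assms unfolding holomorphic2_on_def by meson
  from has_derivative_diff[OF this]
  have "((%p. f p - g p) has_derivative (%(u, v). (a - c) * u + (b - d) * v)) (at p)"
    by (rule has_derivative_eq_rhs) (auto simp: algebra_simps)
  then show "\<exists>a b. ((%p. f p - g p) has_derivative (%(u, v). a * u + b * v)) (at p)" by blast
qed

lemma holomorphic2_on_compose_add:
  assumes "f holomorphic_on T" "open T" "\<And>s t. (s, t) \<in> S ==> s + t \<in> T"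
  shows "holomorphic2_on (%(s, t). f (s + t)) S"
  unfolding holomorphic2_on_def
proof
  fix p assume p: "p \<in> S"
  obtain s t where st: "p = (s, t)" by (cases p)
  have "(f has_field_derivative deriv f (s + t)) (at (s + t))"
    using assms p st holomorphic_derivI by blast
  then have f: "(f has_derivative (%h. deriv f (s + t) * h)) (at (fst p + snd p))"
    by (simp add: has_field_derivative_def st)
  have "((%q. fst q + snd q) has_derivative (%q. fst q + snd q)) (at p)"
    by (auto intro!: derivative_eq_intros)
  from has_derivative_compose[OF this f]
  have "((%(s, t). f (s + t)) has_derivative (%(u, v). deriv f (s + t) * u + deriv f (s + t) * v)) (at p)"
    by (simp add: case_prod_unfold algebra_simps)
  then show "\<exists>a b. ((%(s, t). f (s + t)) has_derivative (%(u, v). a * u + b * v)) (at p)" by blast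
qed

text \<open>Identity theorem on a ball: restrict to the complex line through a given point and a point
  near which the function vanishes.\<close>
lemma holomorphic2_on_line:
  assumes "holomorphic2_on f S" "open S" "\<And>x. x \<in> T ==> (s + x * u, t + x * v) \<in> S" "open T"
  shows "(%x. f (s + x * u, t + x * v)) holomorphic_on T"
proof (rule holomorphic_onI)
  fix x assume x: "x \<in> T"
  obtain a b where "(f has_derivative (%(u, v). a * u + b * v)) (at (s + x * u, t + x * v))"
    using assms(1) assms(3)[OF x] unfolding holomorphic2_on_def by blast
  moreover have "((%x. (s + x * u, t + x * v)) has_derivative (%h. (h * u, h * v))) (at x)"
    by (auto intro!: derivative_eq_intros)
  ultimately have "((%x. f (s + x * u, t + x * v)) has_derivative (%h. a * (h * u) + b * (h * v))) (at x)"
    using has_derivative_compose by fastforce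
  then have "((%x. f (s + x * u, t + x * v)) has_field_derivative (a * u + b * v)) (at x)"
    unfolding has_field_derivative_def by (rule has_derivative_eq_rhs) (auto simp: algebra_simps)
  then show "(%x. f (s + x * u, t + x * v)) field_differentiable at x within T"
    using field_differentiable_at_within field_differentiable_def by blast
qed

text \<open>Identity theorem on a ball: restrict to the complex line through a given point and a
  point near which the function vanishes.\<close>
lemma holomorphic2_on_ball_zero:
  assumes f: "holomorphic2_on f (ball p r)" and U: "open U" "U \<subseteq> ball p r" "U \<noteq> {}"
    and zero: "\<And>q. q \<in> U ==> f q = 0" and q: "q \<in> ball p r"
  shows "f q = 0"
proof -
  obtain q0 where q0: "q0 \<in> U" using U by blast
  obtain s t where st: "q0 = (s, t)" by (cases q0)
  obtain s1 t1 where st1: "q = (s1, t1)" by (cases q)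
  define l where "l x = (s + x * (s1 - s), t + x * (t1 - t))" for x :: complex
  define T where "T = l -` ball p r"
  have contl: "continuous_on A l" for A unfolding l_def by (intro continuous_intros)
  have openT: "open T" unfolding T_def
    using contl by (intro open_vimage) auto
  have lin: "l ((1 - u) *\<^sub>R x + u *\<^sub>R y) = (1 - u) *\<^sub>R l x + u *\<^sub>R l y" for x y u
    by (simp add: l_def scaleR_conv_of_real algebra_simps)
  have "convex T" unfolding convex_alt T_def
    using convex_ball[of p r] lin by (auto simp: convex_alt)
  then have conn: "connected T" by (rule convex_connected)
  have holo: "(%x. f (l x)) holomorphic_on T"
    unfolding l_def by (rule holomorphic2_on_line[OF f]) (use openT in \<open>auto simp: T_def l_def\<close>)
  have l0: "l 0 = q0" "l 1 = q" by (auto simp: l_def st st1)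
  have "open (l -` U)" using contl U(1) by (intro open_vimage) auto
  moreover have "0 \<in> l -` U" using l0 q0 by simp
  moreover have "l -` U \<subseteq> T" using U(2) by (auto simp: T_def)
  moreover have "1 \<in> T" using l0 q by (simp add: T_def)
  moreover have "f (l x) = 0" if "x \<in> l -` U" for x using zero that by auto
  ultimately have "f (l 1) = 0"
    using analytic_continuation_open[of "l -` U" T "%x. f (l x)" "%_. 0" 1] openT conn holo
    by (metis empty_iff holomorphic_on_const)
  then show ?thesis by (simp add: l0)
qed

lemma holomorphic2_on_nonzero_open:
  assumes "holomorphic2_on k (ball p r)" "q \<in> ball p r" "k q \<noteq> 0"
  obtains U where "open U" "q \<in> U" "U \<subseteq> ball p r" "\<And>x. x \<in> U ==> k x \<noteq> 0"
proof -
  have "continuous_on (ball p r) k"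
    using holomorphic2_on_continuous[OF assms(1)] by (simp add: continuous_at_imp_continuous_on)
  then have "open (ball p r \<inter> k -` (- {0}))"
    by (intro continuous_open_preimage) auto
  then show ?thesis using assms(2,3) by (intro that[of "ball p r \<inter> k -` (- {0})"]) auto
qed

text \<open>Two meromorphic functions that agree on a nonempty open set agree near every point off a
  thin set; the set of points where they agree locally is open and closed.\<close>
theorem meromorphic2_unique:
  assumes F: "meromorphic2 F" and G: "meromorphic2 G"
    and D: "open D" "D \<noteq> {}" "\<And>q. q \<in> D ==> F q = G q"
    and p: "isCont F p" "isCont G p"
  shows "F p = G p"
proof -
  define loc where "loc x = (\<exists>r>0. \<exists>k. holomorphic2_on k (ball x r) \<and> (\<exists>q\<in>ball x r. k q \<noteq> 0) \<and>
      (\<forall>q\<in>ball x r. k q \<noteq> 0 \<longrightarrow> F q = G q))" for x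
  \<comment> \<open>on a ball where both are quotients, agreement on an open part spreads to the whole ball\<close>
  have spread: "\<exists>r>0. \<exists>k. holomorphic2_on k (ball x r) \<and> (\<exists>q\<in>ball x r. k q \<noteq> 0) \<and>
      ((\<exists>V. open V \<and> V \<noteq> {} \<and> V \<subseteq> ball x r \<and> (\<forall>q\<in>V. F q = G q)) \<longrightarrow> 
        (\<forall>q\<in>ball x r. k q \<noteq> 0 \<longrightarrow> F q = G q))" for x
  proof -
    obtain r1 h1 k1 where 1: "r1 > 0" "holomorphic2_on h1 (ball x r1)" "holomorphic2_on k1 (ball x r1)"
      "\<exists>q\<in>ball x r1. k1 q \<noteq> 0" "\<forall>q\<in>ball x r1. k1 q \<noteq> 0 \<longrightarrow> F q = h1 q / k1 q"
      using F unfolding meromorphic2_def by metis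
    obtain r2 h2 k2 where 2: "r2 > 0" "holomorphic2_on h2 (ball x r2)" "holomorphic2_on k2 (ball x r2)"
      "\<exists>q\<in>ball x r2. k2 q \<noteq> 0" "\<forall>q\<in>ball x r2. k2 q \<noteq> 0 \<longrightarrow> G q = h2 q / k2 q"
      using G unfolding meromorphic2_def by metis
    define r where "r = min r1 r2"
    have r: "r > 0" "ball x r \<subseteq> ball x r1" "ball x r \<subseteq> ball x r2" using 1 2 by (auto simp: r_def)
    have nz: "\<exists>q\<in>U. k q \<noteq> 0" if "holomorphic2_on k (ball x R)" "\<exists>q\<in>ball x R. k q \<noteq> 0"
      "open U" "U \<noteq> {}" "U \<subseteq> ball x R" for k R U
      using holomorphic2_on_ball_zero[OF that(1,3,5,4)] that(2) by blast
    have hol: "holomorphic2_on h1 (ball x r)" "holomorphic2_on k1 (ball x r)"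
      "holomorphic2_on h2 (ball x r)" "holomorphic2_on k2 (ball x r)"
      using 1 2 r holomorphic2_on_subset by blast+
    have nzprod: "\<exists>q\<in>V. k1 q * k2 q \<noteq> 0" if V: "open V" "V \<noteq> {}" "V \<subseteq> ball x r" for V
    proof -
      obtain q where q: "q \<in> V" "k1 q \<noteq> 0" using nz[OF 1(3,4) V(1,2)] V(3) r by blast
      then obtain U where U: "open U" "q \<in> U" "U \<subseteq> ball x r" "\<And>x. x \<in> U ==> k1 x \<noteq> 0"
        using holomorphic2_on_nonzero_open[OF hol(2), of q] V(3) by blast
      have "\<exists>q\<in>U \<inter> V. k2 q \<noteq> 0" using U V q r by (intro nz[OF 2(3,4)]) auto
      with U show ?thesis by auto
    qed
    let ?k = "%q. k1 q * k2 q"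
    have "F q = G q" if V: "open V" "V \<noteq> {}" "V \<subseteq> ball x r" "\<forall>q\<in>V. F q = G q"
      and q: "q \<in> ball x r" "?k q \<noteq> 0" for V q
    proof -
      obtain q1 where q1: "q1 \<in> V" "?k q1 \<noteq> 0" using nzprod[OF V(1-3)] by blast
      have holk: "holomorphic2_on ?k (ball x r)" using hol by (intro holomorphic2_on_mult)
      obtain U where U: "open U" "q1 \<in> U" "U \<subseteq> ball x r" "\<And>x. x \<in> U ==> ?k x \<noteq> 0"
        using holomorphic2_on_nonzero_open[OF holk, of q1] V(3) q1 by blast
      have "h1 q * k2 q - h2 q * k1 q = 0"
      proof (rule holomorphic2_on_ball_zero[of "%q. h1 q * k2 q - h2 q * k1 q" x r "U \<inter> V"])
        show "holomorphic2_on (%q. h1 q * k2 q - h2 q * k1 q) (ball x r)"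
          using hol by (intro holomorphic2_on_mult holomorphic2_on_diff)
        fix q assume "q \<in> U \<inter> V"
        then have "h1 q / k1 q = h2 q / k2 q" "k1 q \<noteq> 0" "k2 q \<noteq> 0"
          using U V 1(5) 2(5) r by (metis IntD1 IntD2 mult_eq_0_iff subsetD)+
        then show "h1 q * k2 q - h2 q * k1 q = 0" by (simp add: field_simps)
      qed (use U V q1 q in auto)
      moreover have "F q = h1 q / k1 q" "G q = h2 q / k2 q" using q 1(5) 2(5) r by auto
      ultimately show ?thesis using q by (simp add: frac_eq_eq)
    qed
    then have "\<forall>q\<in>ball x r. ?k q \<noteq> 0 \<longrightarrow> F q = G q"
      if "\<exists>V. open V \<and> V \<noteq> {} \<and> V \<subseteq> ball x r \<and> (\<forall>q\<in>V. F q = G q)" using that by blast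
    moreover have "\<exists>q\<in>ball x r. ?k q \<noteq> 0" using nzprod[of "ball x r"] r(1) by simp
    ultimately show ?thesis
      using r(1) holomorphic2_on_mult[OF hol(2,4)]
      by (intro exI[of _ r] conjI exI[of _ ?k]) blast+
  qed
  have D_loc: "loc x" if "x \<in> D" for x
  proof -
    obtain r where "r > 0" "ball x r \<subseteq> D" using D(1) \<open>x \<in> D\<close> open_contains_ball by blast
    moreover have "x \<in> ball x r" using \<open>r > 0\<close> by simp
    ultimately show ?thesis unfolding loc_def using D(3)
      by (intro exI[of _ r] conjI exI[of _ "%_. 1"] bexI[of _ x] ballI impI)
         (auto intro: holomorphic2_on_const simp del: mem_ball)
  qed
  have agree_open: "\<exists>V. open V \<and> V \<noteq> {} \<and> V \<subseteq> ball y e \<and> (\<forall>q\<in>V. F q = G q)"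
    if loc: "loc x" and y: "\<And>d. d > 0 ==> ball y e \<inter> ball x d \<noteq> {}" for x y e
  proof -
    obtain r k where k: "r > 0" "holomorphic2_on k (ball x r)" "\<exists>q\<in>ball x r. k q \<noteq> 0"
      "\<forall>q\<in>ball x r. k q \<noteq> 0 \<longrightarrow> F q = G q" using loc unfolding loc_def by metis
    let ?U = "ball y e \<inter> ball x r"
    have "\<exists>q\<in>?U. k q \<noteq> 0"
      using holomorphic2_on_ball_zero[OF k(2), of ?U] k(1,3) y[OF k(1)] by (meson inf.cobounded2 open_Int open_ball)
    then obtain q where q: "q \<in> ?U" "k q \<noteq> 0" by blast
    then obtain U where U: "open U" "q \<in> U" "U \<subseteq> ball x r" "\<And>x. x \<in> U ==> k x \<noteq> 0"
      using holomorphic2_on_nonzero_open[OF k(2), of q] by blast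
    show ?thesis using U q k(4) by (intro exI[of _ "U \<inter> ball y e"]) auto
  qed
  have "open {x. loc x}"
    unfolding open_dist
  proof (intro ballI)
    fix x assume "x \<in> {x. loc x}"
    then have x: "loc x" by simp
    obtain r k where k: "r > 0" "holomorphic2_on k (ball x r)" "\<exists>q\<in>ball x r. k q \<noteq> 0"
      "\<forall>q\<in>ball x r. k q \<noteq> 0 \<longrightarrow> F q = G q" using x unfolding loc_def by metis
    have "loc y" if y: "dist y x < r" for y
    proof -
      define d where "d = r - dist y x"
      have d: "d > 0" "ball y d \<subseteq> ball x r"
        using y by (simp_all add: d_def dist_commute ball_subset_ball_iff)
      have "\<exists>q\<in>ball y d. k q \<noteq> 0"
        using holomorphic2_on_ball_zero[OF k(2), of "ball y d"] k(3) d by fastforce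
      then show ?thesis unfolding loc_def using d k holomorphic2_on_subset[OF k(2) d(2)]
        by (intro exI[of _ d] conjI exI[of _ k]) auto
    qed
    then show "\<exists>e>0. \<forall>y. dist y x < e \<longrightarrow> y \<in> {x. loc x}" using k(1) by auto
  qed
  moreover have "closed {x. loc x}"
    unfolding closed_limpt
  proof (intro allI impI)
    fix x assume lim: "x islimpt {x. loc x}"
    obtain r k where k: "r > 0" "holomorphic2_on k (ball x r)" "\<exists>q\<in>ball x r. k q \<noteq> 0"
      "(\<exists>V. open V \<and> V \<noteq> {} \<and> V \<subseteq> ball x r \<and> (\<forall>q\<in>V. F q = G q)) \<longrightarrow> 
        (\<forall>q\<in>ball x r. k q \<noteq> 0 \<longrightarrow> F q = G q)" using spread[of x] by metis
    obtain y where y: "loc y" "dist y x < r"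
      using lim k(1) unfolding islimpt_approachable by (metis mem_Collect_eq)
    have "ball x r \<inter> ball y d \<noteq> {}" if "d > 0" for d
      using y that by (auto simp: dist_commute intro!: exI[of _ y])
    from agree_open[OF y(1) this] k(4) have "\<forall>q\<in>ball x r. k q \<noteq> 0 \<longrightarrow> F q = G q" by blast
    then show "x \<in> {x. loc x}" unfolding loc_def using k by auto
  qed
  ultimately have "{x. loc x} = UNIV"
    using D_loc D(2) by (metis UNIV_I clopen empty_iff equals0I mem_Collect_eq)
  then have "loc p" by blast
  have "dist (F p) (G p) < e" if e: "e > 0" for e
  proof -
    obtain d1 where d1: "d1 > 0" "\<forall>x. dist x p < d1 \<longrightarrow> dist (F x) (F p) < e / 2"
      using p(1) e unfolding continuous_at_eps_delta by (meson half_gt_zero)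
    obtain d2 where d2: "d2 > 0" "\<forall>x. dist x p < d2 \<longrightarrow> dist (G x) (G p) < e / 2"
      using p(2) e unfolding continuous_at_eps_delta by (meson half_gt_zero)
    have "ball p (min d1 d2) \<inter> ball p d \<noteq> {}" if "d > 0" for d
      using that d1 d2 by (metis Int_iff centre_in_ball empty_iff min_less_iff_conj)
    from agree_open[OF \<open>loc p\<close> this] obtain x where x: "x \<in> ball p (min d1 d2)" "F x = G x" by blast
    then have "dist (F x) (F p) < e / 2" "dist (F x) (G p) < e / 2"
      using d1(2)[rule_format, of x] d2(2)[rule_format, of x] by (simp_all add: dist_commute)
    then show ?thesis by (metis dist_commute dist_triangle_half_r)
  qed
  from this[of "dist (F p) (G p)"] show ?thesis by (cases "F p = G p") auto
qed

text \<open>By uniqueness the description of the value of the continuation is satisfied by at most one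
  number, so any explicit continuation gives it.\<close>
lemma continuation_value_eq:
  assumes "meromorphic2 F" "open D" "D \<noteq> {}" "\<And>q. q \<in> D ==> F q = f q"
    and "r > 0" "holomorphic2_on F (ball p r)"
  shows "continuation_value D f p = F p"
  unfolding continuation_value_def
proof (rule the_equality)
  show "\<exists>F'. meromorphic2 F' \<and> (\<forall>q\<in>D. F' q = f q) \<and> (\<exists>r>0. holomorphic2_on F' (ball p r)) \<and> F p = F' p"
    using assms by blast
  fix c assume "\<exists>F. meromorphic2 F \<and> (\<forall>q\<in>D. F q = f q) \<and> (\<exists>r>0. holomorphic2_on F (ball p r)) \<and> c = F p"
  then obtain G r' where G: "meromorphic2 G" "\<forall>q\<in>D. G q = f q" "r' > 0" "holomorphic2_on G (ball p r')" "c = G p"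
    by blast
  have "F p = G p"
  proof (rule meromorphic2_unique[OF assms(1) G(1) assms(2,3)])
    show "F q = G q" if "q \<in> D" for q using assms(4) G(2) that by simp
    show "isCont F p" "isCont G p"
      using holomorphic2_on_continuous[OF assms(6)] holomorphic2_on_continuous[OF G(4)] assms(5) G(3) by auto
  qed
  then show "c = F p" using G by simp
qed

text \<open>Osgood's lemma.  By Cauchy's estimate the derivative in the second variable depends
  continuously on the first one.\<close>
theorem osgood:
  fixes f :: "complex \<times> complex => complex"
  assumes cont: "continuous_on UNIV f"
    and hol1: "\<And>t. (%s. f (s, t)) holomorphic_on UNIV"
    and hol2: "\<And>s. (%t. f (s, t)) holomorphic_on UNIV"
  shows "holomorphic2_on f UNIV"
  unfolding holomorphic2_on_def
proof
  fix p :: "complex \<times> complex"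
  obtain s0 t0 where p: "p = (s0, t0)" by (cases p)
  define g where "g s = deriv (%t. f (s, t))" for s
  have g: "((%t. f (s, t)) has_field_derivative g s t) (at t)" for s t
    unfolding g_def using holomorphic_derivI[OF hol2, of t] by simp
  have contg: "continuous_on UNIV (%(s, t). g s t)"
  proof -
    have "isCont (%(s, t). g s t) (s0, t0)" for s0 t0
      unfolding continuous_at_eps_delta
    proof (intro allI impI)
      fix e :: real assume e: "e > 0"
      have "uniformly_continuous_on (cball (s0, t0) 3) f"
        using cont by (intro compact_uniformly_continuous) (auto intro: continuous_on_subset)
      then obtain d where d: "d > 0" "\<And>x y. x \<in> cball (s0, t0) 3 ==> y \<in> cball (s0, t0) 3 ==> dist y x < d ==> dist (f y) (f x) < e / 3"
        using e unfolding uniformly_continuous_on_def by (metis divide_pos_pos zero_less_numeral)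
      have "isCont (g s0) t0"
        unfolding g_def using holomorphic_deriv[OF hol2, of s0] holomorphic_on_imp_continuous_on continuous_on_eq_continuous_at
        by (metis UNIV_I open_UNIV)
      then obtain d' where d': "d' > 0" "\<And>t. dist t t0 < d' ==> dist (g s0 t) (g s0 t0) < e / 3"
        using e unfolding continuous_at_eps_delta by (metis divide_pos_pos zero_less_numeral)
      have est: "dist (g s t) (g s0 t) \<le> e / 3" if s: "dist s s0 < min d 1" and t: "dist t t0 < 1" for s t
      proof -
        let ?h = "%t. f (s, t) - f (s0, t)"
        have hd: "deriv ?h t = g s t - g s0 t"
          by (rule DERIV_imp_deriv) (intro derivative_intros g)
        have "norm ((deriv ^^ 1) ?h t) \<le> fact 1 * (e / 3) / 1 ^ 1"
        proof (rule Cauchy_inequality)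
          show "?h holomorphic_on ball t 1"
            by (intro holomorphic_intros holomorphic_on_subset[OF hol2]) auto
          show "continuous_on (cball t 1) ?h"
            by (intro holomorphic_on_imp_continuous_on holomorphic_intros holomorphic_on_subset[OF hol2]) auto
          fix x assume x: "cmod (t - x) = 1"
          have "dist (s0, t0) (s, x) \<le> 3" "dist (s0, t0) (s0, x) \<le> 3"
          proof -
            have "dist t0 x \<le> 2" using t x dist_triangle[of t0 x t] by (simp add: dist_commute dist_norm)
            then show "dist (s0, t0) (s0, x) \<le> 3" by (simp add: dist_Pair_Pair)
            have "dist (s0, t0) (s, x) \<le> dist s0 s + dist t0 x"
              by (simp add: dist_Pair_Pair sqrt_sum_squares_le_sum)
            then show "dist (s0, t0) (s, x) \<le> 3" using \<open>dist t0 x \<le> 2\<close> s by (simp add: dist_commute)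
          qed
          moreover have "dist (s, x) (s0, x) < d" using s by (simp add: dist_Pair_Pair)
          ultimately have "dist (f (s, x)) (f (s0, x)) < e / 3" by (intro d) auto
          then show "cmod (?h x) \<le> e / 3" by (simp add: dist_norm)
        qed auto
        then show ?thesis by (simp add: hd dist_norm)
      qed
      show "\<exists>d>0. \<forall>x. dist x (s0, t0) < d \<longrightarrow> dist (case x of (s, t) => g s t) (case (s0, t0) of (s, t) => g s t) < e"
      proof (intro exI[of _ "min (min d 1) d'"] conjI allI impI)
        fix x assume x: "dist x (s0, t0) < min (min d 1) d'"
        obtain s t where st: "x = (s, t)" by (cases x)
        have "dist s s0 \<le> dist x (s0, t0)" "dist t t0 \<le> dist x (s0, t0)"
          by (simp_all add: st dist_Pair_Pair)
        then have "dist (g s t) (g s0 t) \<le> e / 3" "dist (g s0 t) (g s0 t0) < e / 3"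
          using x est[of s t] d'(2)[of t] by linarith+
        then have "dist (g s t) (g s0 t0) < e" using e dist_triangle[of "g s t" "g s0 t0" "g s0 t"] by linarith
        then show "dist (case x of (s, t) => g s t) (case (s0, t0) of (s, t) => g s t) < e" by (simp add: st)
      qed (use d d' in auto)
    qed
    then show ?thesis by (auto simp: continuous_on_eq_continuous_at)
  qed
  have "((%(s, t). f (s, t)) has_derivative (%(u, v). deriv (%s. f (s, t0)) s0 * u + blinfun_mult_right (g s0 t0) v)) (at (s0, t0) within UNIV \<times> UNIV)"
  proof (rule has_derivative_partialsI[where f = "%s t. f (s, t)" and fy = "%s t. blinfun_mult_right (g s t)"])
    show "((%s. f (s, t0)) has_derivative (*) (deriv (%s. f (s, t0)) s0)) (at s0 within UNIV)"
      using holomorphic_derivI[OF hol1, of s0] by (simp add: has_field_derivative_def)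
    show "((%t. f (s, t)) has_derivative blinfun_apply (blinfun_mult_right (g s t))) (at t within UNIV)" for s t
      using g[of s t] by (simp add: has_field_derivative_def)
    show "continuous (at (s0, t0) within UNIV \<times> UNIV) (%(s, t). blinfun_mult_right (g s t))"
    proof -
      have "((%x. blinfun_mult_right ((%(s, t). g s t) x)) \<longlongrightarrow> blinfun_mult_right ((%(s, t). g s t) (s0, t0))) (at (s0, t0))"
        using contg by (intro bounded_linear.tendsto[OF bounded_linear_blinfun_mult_right])
          (auto simp: continuous_on_eq_continuous_at isCont_def)
      then show ?thesis by (simp add: case_prod_unfold continuous_within)
    qed
  qed auto
  then show "\<exists>a b. (f has_derivative (%(u, v). a * u + b * v)) (at p)"
    by (auto simp: p case_prod_beta')
qed

section \<open>Landau's theorem for Laplace integrals\<close>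

text \<open>Expand \<open>exp (y * W x)\<close>; the terms are dominated, since \<open>exp (norm y * W x)\<close> moves the
  exponent \<open>u\<close> only to \<open>u - norm y\<close>.\<close>
lemma laplace_expansion:
  fixes h :: "'a => complex" and W :: "'a => real" and y :: complex
  assumes [measurable]: "h \<in> borel_measurable M" "W \<in> borel_measurable M"
    and nonneg: "\<And>x. x \<in> space M ==> W x \<ge> 0"
    and int: "integrable M (%x. h x * exp (- of_real ((u - norm y) * W x)))"
  defines "f \<equiv> %k x. h x * exp (- of_real (u * W x)) * (y * of_real (W x)) ^ k / fact k"
  shows "integrable M (f k)"
    and "(%k. integral\<^sup>L M (f k)) sums (\<integral>x. h x * exp (- of_real (u * W x)) * exp (y * of_real (W x)) \<partial>M)"
proof -
  have [measurable]: "f k \<in> borel_measurable M" for k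
    unfolding f_def by measurable
  define H where "H x = norm (h x) * exp (- (u - norm y) * W x)" for x
  have intH: "integrable M H"
  proof -
    have "H x = norm (h x * exp (- of_real ((u - norm y) * W x)))" for x
      by (simp add: H_def norm_mult algebra_simps)
    then show ?thesis using integrable_norm[OF int] by presburger
  qed
  have norm_f: "norm (f k x) = norm (h x) * exp (- u * W x) * ((norm y * W x) ^ k / fact k)"
    if "x \<in> space M" for k x
    using nonneg[OF that] by (simp add: f_def norm_mult norm_divide norm_power)
  have exp_sums: "(%k. norm (f k x)) sums H x" if x: "x \<in> space M" for x
  proof -
    have "(%k. norm (h x) * exp (- u * W x) * ((norm y * W x) ^ k / fact k)) sums
        (norm (h x) * exp (- u * W x) * exp (norm y * W x))"
      using exp_converges[of "norm y * W x"] by (intro sums_mult) (simp add: divide_inverse mult.commute)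
    also have "norm (h x) * exp (- u * W x) * exp (norm y * W x) = H x"
      by (simp add: H_def mult_exp_exp algebra_simps)
    finally show ?thesis using norm_f[OF x] by simp
  qed
  have le: "(\<Sum>k<N. norm (f k x)) \<le> H x" if "x \<in> space M" for x N
    using sum_le_suminf[OF sums_summable[OF exp_sums[OF that]], of "{..<N}"] sums_unique[OF exp_sums[OF that]]
    by simp
  have le1: "norm (f k x) \<le> H x" if "x \<in> space M" for x k
  proof -
    have "norm (f k x) \<le> (\<Sum>i<Suc k. norm (f i x))" by (simp add: sum_nonneg)
    then show ?thesis using le[OF that, of "Suc k"] by linarith
  qed
  have intf: "integrable M (f k)" for k
  proof (rule Bochner_Integration.integrable_bound[OF intH])
    show "AE x in M. norm (f k x) \<le> norm (H x)"
      using le1 by (intro AE_I2) (metis abs_ge_self order.trans real_norm_def)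
  qed simp
  then show "integrable M (f k)" .
  have "(%k. integral\<^sup>L M (f k)) sums (\<integral>x. (\<Sum>k. f k x) \<partial>M)"
  proof (rule sums_integral[OF intf])
    show "AE x in M. summable (%i. norm (f i x))"
      using exp_sums by (intro AE_I2) (metis sums_summable)
    show "summable (%i. \<integral>x. norm (f i x) \<partial>M)"
    proof (rule summableI_nonneg_bounded)
      fix N
      have "(\<Sum>i<N. \<integral>x. norm (f i x) \<partial>M) = (\<integral>x. (\<Sum>i<N. norm (f i x)) \<partial>M)"
        using intf by (intro integral_of_sum[symmetric] integrable_norm)
      also have "... \<le> integral\<^sup>L M H"
        using intf by (intro integral_mono Bochner_Integration.integrable_sum integrable_norm intH le)
      finally show "(\<Sum>i<N. \<integral>x. norm (f i x) \<partial>M) \<le> integral\<^sup>L M H" .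
    qed (simp add: integral_nonneg_AE)
  qed
  also have "(\<integral>x. (\<Sum>k. f k x) \<partial>M) = (\<integral>x. h x * exp (- of_real (u * W x)) * exp (y * of_real (W x)) \<partial>M)"
  proof (rule integral_cong_on[OF refl])
    fix x
    have "(%k. h x * exp (- of_real (u * W x)) * ((y * of_real (W x)) ^ k / fact k)) sums
        (h x * exp (- of_real (u * W x)) * exp (y * of_real (W x)))"
      using exp_converges[of "y * of_real (W x)"]
      by (intro sums_mult) (simp add: scaleR_conv_of_real divide_inverse mult.commute)
    then show "(\<Sum>k. f k x) = h x * exp (- of_real (u * W x)) * exp (y * of_real (W x))"
      by (simp add: f_def sums_iff)
  qed
  finally show "(%k. integral\<^sup>L M (f k)) sums (\<integral>x. h x * exp (- of_real (u * W x)) * exp (y * of_real (W x)) \<partial>M)" .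
qed

text \<open>The coefficients of the expansion at a point far to the right are Taylor coefficients of
  the continuation, whose Taylor series converges up to the boundary of its half-plane.\<close>
lemma laplace_taylor:
  fixes h :: "'a => complex" and W :: "'a => real" and F :: "complex => complex"
  assumes [measurable]: "h \<in> borel_measurable M" "W \<in> borel_measurable M"
    and nonneg: "\<And>x. x \<in> space M ==> W x \<ge> 0"
    and int: "\<And>u. u > K ==> integrable M (%x. h x * exp (- of_real (u * W x)))"
    and hol: "F holomorphic_on {w. Re w > x0}"
    and eq: "\<And>u. u > K ==> (\<integral>x. h x * exp (- of_real (u * W x)) \<partial>M) = F (of_real u)"
    and u0: "u0 > K" "u0 > x0"
  defines "a \<equiv> %k. (\<integral>x. h x * exp (- of_real (u0 * W x)) * of_real (W x) ^ k / fact k \<partial>M)"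
  shows "integrable M (%x. h x * exp (- of_real (u0 * W x)) * of_real (W x) ^ k / fact k)"
    and "norm y < u0 - x0 ==> (%k. a k * y ^ k) sums F (of_real u0 - y)"
proof -
  define \<rho> where "\<rho> = min (u0 - K) (u0 - x0)"
  have \<rho>: "\<rho> > 0" using u0 by (simp add: \<rho>_def)
  have sums: "(%k. a k * y ^ k) sums (\<integral>x. h x * exp (- of_real (u0 * W x)) * exp (y * of_real (W x)) \<partial>M)"
    and intk: "y \<noteq> 0 ==> integrable M (%x. h x * exp (- of_real (u0 * W x)) * of_real (W x) ^ k / fact k)"
    if y: "norm y < \<rho>" for y k
  proof -
    have "integrable M (%x. h x * exp (- of_real ((u0 - norm y) * W x)))"
      using y by (intro int) (simp add: \<rho>_def)
    note exp = laplace_expansion[OF assms(1-3) this]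
    have *: "h x * exp (- of_real (u0 * W x)) * (y * of_real (W x)) ^ k / fact k =
        y ^ k * (h x * exp (- of_real (u0 * W x)) * of_real (W x) ^ k / fact k)" for x k
      by (simp add: power_mult_distrib)
    show "(%k. a k * y ^ k) sums (\<integral>x. h x * exp (- of_real (u0 * W x)) * exp (y * of_real (W x)) \<partial>M)"
      using exp(2) unfolding * integral_mult_right_zero a_def by (simp add: mult.commute)
    assume "y \<noteq> 0"
    then show "integrable M (%x. h x * exp (- of_real (u0 * W x)) * of_real (W x) ^ k / fact k)"
      using integrable_mult_right[of "1 / y ^ k", OF exp(1)[of k]] unfolding * by simp
  qed
  show "integrable M (%x. h x * exp (- of_real (u0 * W x)) * of_real (W x) ^ k / fact k)"
    using \<rho> by (intro intk[of "of_real (\<rho> / 2)"]) auto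
  define p where "p y = F (of_real u0 - y)" for y
  define b where "b k = (deriv ^^ k) p 0 / fact k" for k
  have holp: "p holomorphic_on ball 0 (u0 - x0)"
    unfolding p_def
  proof (rule holomorphic_on_compose_gen[OF _ hol, unfolded o_def])
    show "(%y. of_real u0 - y) ` ball 0 (u0 - x0) \<subseteq> {w. Re w > x0}"
    proof safe
      fix y :: complex assume "y \<in> ball 0 (u0 - x0)"
      then have "Re y < u0 - x0" using complex_Re_le_cmod[of y] by auto
      then show "Re (of_real u0 - y) > x0" by simp
    qed
  qed (intro holomorphic_intros)
  have p_sums: "(%k. b k * y ^ k) sums p y" if "norm y < u0 - x0" for y
    using holomorphic_power_series[OF holp, of y] that by (simp add: b_def)
  have eq_real: "(\<integral>x. h x * exp (- of_real (u0 * W x)) * exp (y * of_real (W x)) \<partial>M) = p y"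
    if y: "y = of_real r" "\<bar>r\<bar> < \<rho>" for y r
  proof -
    have "(\<integral>x. h x * exp (- of_real (u0 * W x)) * exp (y * of_real (W x)) \<partial>M) =
        (\<integral>x. h x * exp (- of_real ((u0 - r) * W x)) \<partial>M)"
      by (rule integral_cong_on) (simp_all add: y mult.assoc mult_exp_exp algebra_simps)
    also have "... = F (of_real (u0 - r))" using y by (intro eq) (auto simp: \<rho>_def)
    finally show ?thesis by (simp add: p_def y)
  qed
  define c where "c k = a k - b k" for k
  define f where "f y = (\<integral>x. h x * exp (- of_real (u0 * W x)) * exp (y * of_real (W x)) \<partial>M) - p y" for y
  have c_sums: "(%k. c k * (y - 0) ^ k) sums f y" if "norm (y - 0) < \<rho>" for y
    using sums_diff[OF sums[of y] p_sums[of y]] that by (simp add: c_def f_def algebra_simps \<rho>_def)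
  have f0: "f 0 = 0" using eq_real[of 0 0] \<rho> by (simp add: f_def)
  have "c k = 0" for k
  proof (cases "k = 0")
    case True
    have "(%k. c k * 0 ^ k) sums 0" using c_sums[of 0] \<rho> f0 by simp
    then show ?thesis using True by (simp add: powser_sums_zero_iff)
  next
    case False
    show ?thesis
    proof (rule ccontr)
      assume "c k \<noteq> 0"
      then obtain s where s: "s > 0" "\<And>z. z \<in> cball 0 s - {0} ==> f z \<noteq> 0"
        using powser_0_nonzero[OF \<rho> c_sums f0 _ ] False by (metis neq0_conv)
      define r where "r = min s (\<rho> / 2)"
      have "f (of_real r) = 0" using eq_real[of "of_real r" r] \<rho> s(1) by (simp add: f_def r_def)
      moreover have "of_real r \<in> cball (0::complex) s - {0}" using \<rho> s(1) by (auto simp: r_def)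
      ultimately show False using s(2) by blast
    qed
  qed
  then have "a = b" by (auto simp: c_def fun_eq_iff)
  then show "norm y < u0 - x0 ==> (%k. a k * y ^ k) sums F (of_real u0 - y)"
    using p_sums by (simp add: p_def)
qed

text \<open>Landau's theorem: a Laplace integral with non-negative integrand converges as far as its
  continuation is holomorphic.  The Taylor series of the continuation at a point far to the right
  converges at \<open>u\<close>.  There all terms of the expanded integral are non-negative, and so the sum may
  be moved into the integral.\<close>
theorem landau_integrable:
  fixes h W :: "'a => real" and F :: "complex => complex"
  assumes [measurable]: "h \<in> borel_measurable M" "W \<in> borel_measurable M"
    and nonneg: "\<And>x. x \<in> space M ==> W x \<ge> 0" "\<And>x. x \<in> space M ==> h x \<ge> 0"
    and int: "\<And>u. u > K ==> integrable M (%x. h x * exp (- u * W x))"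
    and hol: "F holomorphic_on {w. Re w > x0}"
    and eq: "\<And>u. u > K ==> of_real (\<integral>x. h x * exp (- u * W x) \<partial>M) = F (of_real u)"
    and u: "u > x0"
  shows "integrable M (%x. h x * exp (- u * W x))"
proof -
  define u0 where "u0 = max (max K x0) u + 1"
  define r where "r = u0 - u"
  have "u0 > K" "u0 > x0" and r: "r > 0" "r < u0 - x0"
    using u by (auto simp: u0_def r_def)
  then have u0: "u0 > K" "u0 > x0" "r > 0" "norm (complex_of_real r) < u0 - x0" by auto
  have conv: "complex_of_real (h x) * exp (- of_real (v * W x)) = of_real (h x * exp (- v * W x))" for v x
    by (simp flip: exp_of_real)
  have inth: "integrable M (%x. complex_of_real (h x) * exp (- of_real (v * W x)))" if "v > K" for v
    unfolding conv using int[OF that] by (rule integrable_of_real)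
  have eqh: "(\<integral>x. complex_of_real (h x) * exp (- of_real (v * W x)) \<partial>M) = F (of_real v)" if "v > K" for v
    unfolding conv using eq[OF that] by (simp only: integral_complex_of_real)
  have hm: "(%x. complex_of_real (h x)) \<in> borel_measurable M" by measurable
  note tay = laplace_taylor[OF hm assms(2) nonneg(1) inth hol eqh u0(1,2)]
  define f where "f k x = h x * exp (- u0 * W x) * (r * W x) ^ k / fact k" for k x
  have f_complex: "complex_of_real (f k x) = of_real (h x) * exp (- of_real (u0 * W x)) * of_real (W x) ^ k / fact k * of_real r ^ k"
    for k x
    by (simp add: f_def power_mult_distrib flip: exp_of_real)
  have f_nonneg: "f k x \<ge> 0" if "x \<in> space M" for k x
    using nonneg[OF that] u0 by (simp add: f_def)
  have intf: "integrable M (f k)" for k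
  proof -
    have "integrable M (%x. complex_of_real (f k x))"
      unfolding f_complex by (rule integrable_mult_left) (rule tay(1))
    then show ?thesis by (simp add: complex_of_real_integrable_eq)
  qed
  have "(%k. (\<integral>x. complex_of_real (h x) * exp (- of_real (u0 * W x)) * of_real (W x) ^ k / fact k \<partial>M) * of_real r ^ k)
      sums F (of_real u0 - of_real r)"
    using tay(2) u0(4) by blast
  also have "(%k. (\<integral>x. complex_of_real (h x) * exp (- of_real (u0 * W x)) * of_real (W x) ^ k / fact k \<partial>M) * of_real r ^ k)
      = (%k. of_real (integral\<^sup>L M (f k)))"
    using f_complex by (simp flip: integral_mult_left_zero integral_complex_of_real)
  finally have "summable (%k. complex_of_real (integral\<^sup>L M (f k)))" by (rule sums_summable)
  then have summ: "summable (%k. integral\<^sup>L M (f k))" by (simp add: summable_complex_of_real)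
  have f_sums: "(%k. f k x) sums (h x * exp (- u * W x))" for x
  proof -
    have "(%k. h x * exp (- u0 * W x) * ((r * W x) ^ k / fact k)) sums (h x * exp (- u0 * W x) * exp (r * W x))"
      using exp_converges[of "r * W x"] by (intro sums_mult) (simp add: divide_inverse mult.commute)
    also have "h x * exp (- u0 * W x) * exp (r * W x) = h x * exp (- u * W x)"
      by (simp add: r_def mult.assoc mult_exp_exp algebra_simps)
    finally show ?thesis by (simp add: f_def)
  qed
  have "integrable M (%x. \<Sum>k. f k x)"
  proof (rule integrable_suminf[OF intf])
    show "AE x in M. summable (%i. norm (f i x))"
    proof (rule AE_I2)
      fix x assume "x \<in> space M"
      then have "(%i. norm (f i x)) = (%i. f i x)" using f_nonneg by auto
      then show "summable (%i. norm (f i x))" using f_sums by (metis sums_summable)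
    qed
    have "(\<integral>x. norm (f i x) \<partial>M) = integral\<^sup>L M (f i)" for i
      using f_nonneg by (intro integral_cong_on) auto
    then show "summable (%i. \<integral>x. norm (f i x) \<partial>M)" using summ by simp
  qed
  then show ?thesis using f_sums by (simp add: sums_iff)
qed

text \<open>Once the integral is known to converge absolutely on the whole half-plane, it is given by
  the same Taylor series as its continuation.\<close>
theorem laplace_continuation:
  fixes h :: "'a => complex" and W :: "'a => real" and F :: "complex => complex"
  assumes [measurable]: "h \<in> borel_measurable M" "W \<in> borel_measurable M"
    and nonneg: "\<And>x. x \<in> space M ==> W x \<ge> 0"
    and int: "\<And>u. u > x0 ==> integrable M (%x. h x * exp (- of_real (u * W x)))"
    and hol: "F holomorphic_on {w. Re w > x0}"
    and eq: "\<And>u. u > K ==> (\<integral>x. h x * exp (- of_real (u * W x)) \<partial>M) = F (of_real u)"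
    and u: "u > x0"
  shows "(\<integral>x. h x * exp (- of_real (u * W x)) \<partial>M) = F (of_real u)"
proof -
  define K' where "K' = max K x0"
  define u0 where "u0 = max K' u + 1"
  define r where "r = u0 - u"
  have "u0 > K'" "u0 > x0" and r: "r > 0" "r < u0 - x0"
    using u by (auto simp: u0_def r_def K'_def)
  then have u0: "u0 > K'" "u0 > x0" "r > 0" "norm (complex_of_real r) < u0 - x0" by auto
  have K': "K' \<ge> K" "K' \<ge> x0" by (auto simp: K'_def)
  have int': "integrable M (%x. h x * exp (- of_real (v * W x)))" if "v > K'" for v
    using int that K' by simp
  have eq': "(\<integral>x. h x * exp (- of_real (v * W x)) \<partial>M) = F (of_real v)" if "v > K'" for v
    using eq that K' by simp
  note tay = laplace_taylor(2)[OF assms(1-3) int' hol eq' u0(1,2), of "of_real r"]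
  have "integrable M (%x. h x * exp (- of_real ((u0 - norm (complex_of_real r)) * W x)))"
    using u u0 by (intro int) (simp add: r_def)
  note exp = laplace_expansion(2)[OF assms(1-3) this]
  have "(\<integral>x. h x * exp (- of_real (u0 * W x)) * (of_real r * of_real (W x)) ^ k / fact k \<partial>M) =
      (\<integral>x. h x * exp (- of_real (u0 * W x)) * of_real (W x) ^ k / fact k \<partial>M) * of_real r ^ k" for k
    by (subst integral_mult_left_zero[symmetric], rule integral_cong_on)
       (simp_all add: power_mult_distrib)
  with exp have "(%k. (\<integral>x. h x * exp (- of_real (u0 * W x)) * of_real (W x) ^ k / fact k \<partial>M) * of_real r ^ k) sums
      (\<integral>x. h x * exp (- of_real (u0 * W x)) * exp (of_real r * of_real (W x)) \<partial>M)"
    by (simp only:)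
  from sums_unique2[OF this] tay u0(4)
  have "(\<integral>x. h x * exp (- of_real (u0 * W x)) * exp (of_real r * of_real (W x)) \<partial>M) = F (of_real u0 - of_real r)" by blast
  also have "(%x. h x * exp (- of_real (u0 * W x)) * exp (of_real r * of_real (W x))) =
      (%x. h x * exp (- of_real (u * W x)))"
    by (simp add: r_def mult.assoc mult_exp_exp algebra_simps)
  finally show ?thesis by (simp add: r_def)
qed

section \<open>The Cauchy--Binet formula for series\<close>

abbreviation entries :: "nat => (nat => int) set" where
  "entries n \<equiv> {1..n} \<rightarrow>\<^sub>E UNIV"

lemma summable_on_prod_entries:
  fixes f :: "nat => int => real"
  assumes "\<And>k p. k < n ==> f k p \<ge> 0" "\<And>k. k < n ==> f k summable_on UNIV"
  shows "(%m. \<Prod>k<n. f k (m (Suc k))) summable_on entries n"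
proof (rule nonneg_bdd_above_summable_on)
  show "bdd_above (sum (%m. \<Prod>k<n. f k (m (Suc k))) ` {F. F \<subseteq> entries n \<and> finite F})"
  proof (rule bdd_aboveI)
    fix x assume "x \<in> sum (%m. \<Prod>k<n. f k (m (Suc k))) ` {F. F \<subseteq> entries n \<and> finite F}"
    then obtain F where F: "F \<subseteq> entries n" "finite F" "x = (\<Sum>m\<in>F. \<Prod>k<n. f k (m (Suc k)))" by auto
    define B where "B = (\<Union>m\<in>F. m ` {1..n})"
    have B: "finite B" "F \<subseteq> {1..n} \<rightarrow>\<^sub>E B" using F by (auto simp: B_def PiE_def)
    have "x \<le> (\<Sum>m\<in>{1..n} \<rightarrow>\<^sub>E B. \<Prod>k<n. f k (m (Suc k)))"
      unfolding F using B assms(1) by (intro sum_mono2 finite_PiE prod_nonneg) auto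
    also have "... = (\<Sum>m\<in>{1..n} \<rightarrow>\<^sub>E B. \<Prod>j=1..n. f (j - 1) (m j))"
      by (intro sum.cong refl) (simp add: prod.atLeast1_atMost_eq)
    also have "... = (\<Prod>j=1..n. \<Sum>p\<in>B. f (j - 1) p)"
      using B by (subst prod_sum_PiE) auto
    also have "... \<le> (\<Prod>j=1..n. infsum (f (j - 1)) UNIV)"
      using assms B by (intro prod_mono conjI sum_nonneg finite_sum_le_infsum) auto
    finally show "x \<le> (\<Prod>j=1..n. infsum (f (j - 1)) UNIV)" .
  qed
qed (use assms in \<open>auto intro!: prod_nonneg\<close>)

lemma signatures_subset: "signatures n \<subseteq> entries n"
  by (auto simp: signatures_def)

text \<open>Every injective tuple is a unique rearrangement of a signature; the bijection turns sums over
  injective tuples into sums over signatures and permutations.\<close>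
lemma signature_permutations:
  fixes n :: nat
  defines "\<Phi> \<equiv> %(m :: nat => int, p). \<lambda>j\<in>{1..n}. m (Suc (p (j - 1)))"
  shows "bij_betw \<Phi> (signatures n \<times> {p. p permutes {..<n}}) {m \<in> entries n. inj_on m {1..n}}"
proof -
  have Phi_nth: "\<Phi> (m, p) (Suc k) = m (Suc (p k))" if "k < n" for m p k
    using that by (simp add: \<Phi>_def)
  have sig_inj: "inj_on m {1..n}" if "m \<in> signatures n" for m
  proof (rule linorder_inj_onI)
    fix i j assume "i < j" "i \<in> {1..n}" "j \<in> {1..n}"
    then have "m i > m j" using that by (auto simp: signatures_def)
    then show "m i \<noteq> m j" by simp
  qed auto
  have decr: "sorted_wrt (>) (map m [1..<Suc n])" if "m \<in> signatures n" for m
    using that by (auto simp: signatures_def sorted_wrt_iff_nth_less simp del: upt_Suc)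
  have sig_unique: "m = m'" if m: "m \<in> signatures n" "m' \<in> signatures n" "m ` {1..n} = m' ` {1..n}" for m m'
  proof -
    have "rev (map m' [1..<Suc n]) = rev (map m [1..<Suc n])"
    proof (rule strict_sorted_equal)
      show "sorted_wrt (<) (rev (map m [1..<Suc n]))" "sorted_wrt (<) (rev (map m' [1..<Suc n]))"
        using decr m by (simp_all add: sorted_wrt_rev)
      show "set (rev (map m' [1..<Suc n])) = set (rev (map m [1..<Suc n]))"
        using m(3) by (simp add: atLeastLessThanSuc_atLeastAtMost del: upt_Suc)
    qed
    then have "m j = m' j" if "j \<in> {1..n}" for j
      using that by (simp add: atLeastLessThanSuc_atLeastAtMost del: upt_Suc)
    then show ?thesis using m(1,2) unfolding signatures_def
      by (auto simp: PiE_def extensional_def fun_eq_iff) metis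
  qed
  show ?thesis
    unfolding bij_betw_def
  proof (intro conjI)
    show "inj_on \<Phi> (signatures n \<times> {p. p permutes {..<n}})"
    proof (rule inj_onI, clarify)
      fix m p m' p'
      assume m: "m \<in> signatures n" "m' \<in> signatures n" and p: "p permutes {..<n}" "p' permutes {..<n}"
        and eq: "\<Phi> (m, p) = \<Phi> (m', p')"
      have "\<Phi> (m, p) ` Suc ` {..<n} = m ` {1..n}" if "p permutes {..<n}" for m p
      proof -
        have "\<Phi> (m, p) ` Suc ` {..<n} = (%k. m (Suc (p k))) ` {..<n}"
          using Phi_nth by (auto simp: image_image)
        also have "... = m ` Suc ` p ` {..<n}" by (simp add: image_image)
        also have "p ` {..<n} = {..<n}" using that by (rule permutes_image)
        finally show ?thesis by (simp add: image_Suc_lessThan)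
      qed
      then have "m ` {1..n} = m' ` {1..n}" using eq p by metis
      then have mm: "m = m'" using sig_unique m by blast
      have "p k = p' k" for k
      proof (cases "k < n")
        case True
        then have "m (Suc (p k)) = m (Suc (p' k))" using Phi_nth eq mm by metis
        moreover have "p k < n" "p' k < n" using True p permutes_in_image by (metis lessThan_iff)+
        ultimately show ?thesis using sig_inj[OF m(1)] by (auto dest: inj_onD)
      next
        case False
        then show ?thesis using p by (auto simp: permutes_def)
      qed
      then show "m = m' \<and> p = p'" using mm by auto
    qed
    show "\<Phi> ` (signatures n \<times> {p. p permutes {..<n}}) = {m \<in> entries n. inj_on m {1..n}}"
    proof (intro equalityI subsetI)
      fix w assume "w \<in> \<Phi> ` (signatures n \<times> {p. p permutes {..<n}})"
      then obtain m p where mp: "m \<in> signatures n" "p permutes {..<n}" "w = \<Phi> (m, p)" by auto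
      have "inj_on w {1..n}"
      proof (rule inj_onI)
        fix i j assume ij: "i \<in> {1..n}" "j \<in> {1..n}" "w i = w j"
        then have "m (Suc (p (i - 1))) = m (Suc (p (j - 1)))" by (simp add: mp \<Phi>_def)
        moreover have "p (i - 1) < n" "p (j - 1) < n"
          using ij permutes_in_image[OF mp(2)] by (metis One_nat_def Suc_le_lessD Suc_pred atLeastAtMost_iff lessThan_iff less_le_trans zero_less_one)+
        ultimately have "p (i - 1) = p (j - 1)" using sig_inj[OF mp(1)] by (auto dest: inj_onD)
        then have "i - 1 = j - 1" using permutes_inj[OF mp(2)] by (auto dest: injD)
        then show "i = j" using ij by auto
      qed
      then show "w \<in> {m \<in> entries n. inj_on m {1..n}}" by (auto simp: mp \<Phi>_def)
    next
      fix w assume "w \<in> {m \<in> entries n. inj_on m {1..n}}"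
      then have w: "w \<in> entries n" "inj_on w {1..n}" by auto
      define L where "L = rev (sorted_list_of_set (w ` {1..n}))"
      have L: "length L = n" "sorted_wrt (>) L" "set L = w ` {1..n}"
        using w by (auto simp: L_def card_image sorted_wrt_rev)
      define m where "m = (\<lambda>j\<in>{1..n}. L ! (j - 1))"
      have m: "m \<in> signatures n"
        using L(1,2) by (auto simp: m_def signatures_def sorted_wrt_iff_nth_less)
      have "m ` {1..n} = (%k. L ! k) ` {..<n}"
        unfolding image_Suc_lessThan[symmetric] image_image by (auto simp: m_def)
      then have img: "m ` {1..n} = w ` {1..n}" using L nth_image[of n L] by (simp add: lessThan_atLeast0)
      have "image_mset (%k. m (Suc k)) (mset_set {..<n}) = mset_set (m ` {1..n})"
        if "inj_on m {1..n}" for m :: "nat => int"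
      proof -
        have "inj_on (%k. m (Suc k)) {..<n}"
          using comp_inj_on[of Suc "{..<n}" m] that by (simp add: image_Suc_lessThan comp_def)
        moreover have "(%k. m (Suc k)) ` {..<n} = m ` {1..n}"
          unfolding image_Suc_lessThan[symmetric] image_image ..
        ultimately show ?thesis by (simp add: image_mset_mset_set)
      qed
      then have "image_mset (%k. w (Suc k)) (mset_set {..<n}) = image_mset (%k. m (Suc k)) (mset_set {..<n})"
        using img w(2) sig_inj[OF m] by simp
      then obtain p where p: "p permutes {..<n}" "\<forall>k\<in>{..<n}. w (Suc k) = m (Suc (p k))"
        using image_mset_eq_implies_permutes[of "{..<n}" "%k. w (Suc k)" "%k. m (Suc k)"]
        by (metis finite_lessThan)
      have "w = \<Phi> (m, p)"
      proof
        fix j show "w j = \<Phi> (m, p) j"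
          using w(1) p(2)[rule_format, of "j - 1"] by (cases "j \<in> {1..n}") (auto simp: \<Phi>_def PiE_def extensional_def)
      qed
      then show "w \<in> \<Phi> ` (signatures n \<times> {p. p permutes {..<n}})" using m p(1) by blast
    qed
  qed
qed

lemma norm_jdet_le:
  fixes a :: "nat => nat => complex"
  assumes "\<And>i j. i < n ==> j < n ==> norm (a i j) \<le> c j"
  shows "norm (jdet n a) \<le> fact n * (\<Prod>j<n. c j)"
proof -
  have c: "c j \<ge> 0" if "j < n" for j
    using assms[OF that that] norm_ge_zero order_trans by blast
  have "norm (jdet n a) \<le> (\<Sum>p | p permutes {..<n}. norm (of_int (sign p) * (\<Prod>i<n. a i (p i))))"
    unfolding jdet_leibniz by (rule norm_sum)
  also have "... \<le> (\<Sum>p | p permutes {..<n}. \<Prod>j<n. c j)"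
  proof (rule sum_mono)
    fix p assume p: "p \<in> {p. p permutes {..<n}}"
    have "norm (of_int (sign p) * (\<Prod>i<n. a i (p i))) = (\<Prod>i<n. norm (a i (p i)))"
      by (simp add: norm_mult prod_norm sign_def)
    also have "... \<le> (\<Prod>i<n. c (p i))"
      using p assms permutes_in_image[of p "{..<n}"] by (intro prod_mono) auto
    also have "... = (\<Prod>i<n. c i)" using p prod.permute[of p "{..<n}" c] by (simp add: comp_def)
    finally show "norm (of_int (sign p) * (\<Prod>i<n. a i (p i))) \<le> (\<Prod>j<n. c j)" .
  qed
  also have "... = fact n * (\<Prod>j<n. c j)"
    using card_permutations[of "{..<n}" n] by simp
  finally show ?thesis .
qed

lemma has_sum_finite_sum:
  fixes f :: "'i => 'a => 'b::topological_comm_monoid_add"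
  shows "finite I ==> (\<And>i. i \<in> I ==> (f i has_sum s i) A) ==>
    ((%x. \<Sum>i\<in>I. f i x) has_sum (\<Sum>i\<in>I. s i)) A"
  by (induction I rule: finite_induct) (auto intro!: has_sum_add)

text \<open>Expanding each row of the determinant of series gives a sum over all tuples.  The tuples
  with a repeated entry contribute 0, and the others are grouped into rearrangements of signatures;
  the sum over a group is the Leibniz formula for the first determinant.\<close>
theorem cauchy_binet_infinite:
  fixes b c :: "nat => int => complex"
  assumes b: "\<And>k. k < n ==> b k abs_summable_on UNIV"
    and c: "\<And>l p. l < n ==> norm (c l p) \<le> 1"
  shows "((%m. jdet n (%j k. b k (m (Suc j))) * jdet n (%l j. c l (m (Suc j)))) has_sum
      jdet n (%l k. \<Sum>\<^sub>\<infinity>p. b k p * c l p)) (signatures n)"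
proof -
  define G where "G m = (\<Prod>k<n. b k (m (Suc k)))" for m
  define T where "T m = jdet n (%l j. c l (m (Suc j)))" for m :: "nat => int"
  have T_leibniz: "T m = (\<Sum>p | p permutes {..<n}. of_int (sign p) * (\<Prod>k<n. c (p k) (m (Suc k))))" for m
    unfolding T_def by (subst jdet_transpose[symmetric]) (simp add: jdet_leibniz)
  have absG: "G abs_summable_on entries n"
    unfolding G_def prod_norm[symmetric]
    using b by (intro summable_on_prod_entries) auto
  have one_perm: "((%m. \<Prod>k<n. b k (m (Suc k)) * c (p k) (m (Suc k))) has_sum
      (\<Prod>k<n. \<Sum>\<^sub>\<infinity>q. b k q * c (p k) q)) (entries n)" if p: "p permutes {..<n}" for p
  proof -
    have pk: "p k < n" if "k < n" for k using p that permutes_in_image by (metis lessThan_iff)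
    have le: "norm (b k q * c (p k) q) \<le> norm (b k q)" if "k < n" for k q
      using c[OF pk[OF that], of q] by (simp add: norm_mult mult_left_le)
    have abs1: "(%q. b k q * c (p k) q) abs_summable_on UNIV" if "k < n" for k
      by (rule Infinite_Sum.abs_summable_on_comparison_test[OF b[OF that]]) (use le[OF that] in auto)
    have summ: "(%m. \<Prod>j\<in>{1..n}. b (j - 1) (m j) * c (p (j - 1)) (m j)) abs_summable_on entries n"
    proof (rule Infinite_Sum.abs_summable_on_comparison_test[OF absG])
      fix m
      have "norm (\<Prod>j\<in>{1..n}. b (j - 1) (m j) * c (p (j - 1)) (m j)) = (\<Prod>k<n. norm (b k (m (Suc k)) * c (p k) (m (Suc k))))"
        by (simp add: prod.atLeast1_atMost_eq prod_norm)
      also have "... \<le> (\<Prod>k<n. norm (b k (m (Suc k))))"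
        using le by (intro prod_mono) auto
      finally show "norm (\<Prod>j\<in>{1..n}. b (j - 1) (m j) * c (p (j - 1)) (m j)) \<le> norm (G m)"
        by (simp add: G_def prod_norm)
    qed
    have "(\<Sum>\<^sub>\<infinity>m\<in>entries n. \<Prod>j\<in>{1..n}. b (j - 1) (m j) * c (p (j - 1)) (m j)) =
        (\<Prod>j\<in>{1..n}. \<Sum>\<^sub>\<infinity>q. b (j - 1) q * c (p (j - 1)) q)"
      using abs1 by (intro infsum_prod_PiE_abs) auto
    with summ have "((%m. \<Prod>j\<in>{1..n}. b (j - 1) (m j) * c (p (j - 1)) (m j)) has_sum
        (\<Prod>j\<in>{1..n}. \<Sum>\<^sub>\<infinity>q. b (j - 1) q * c (p (j - 1)) q)) (entries n)"
      using has_sum_infsum[OF Infinite_Sum.abs_summable_summable[OF summ]] by simp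
    then show ?thesis by (simp add: prod.atLeast1_atMost_eq)
  qed
  have sum_eq: "(\<Sum>p | p permutes {..<n}. of_int (sign p) * (\<Prod>k<n. \<Sum>\<^sub>\<infinity>q. b k q * c (p k) q)) =
      jdet n (%l k. \<Sum>\<^sub>\<infinity>q. b k q * c l q)"
    by (subst jdet_transpose[symmetric]) (simp add: jdet_leibniz)
  have GT: "(\<Sum>p | p permutes {..<n}. of_int (sign p) * (\<Prod>k<n. b k (m (Suc k)) * c (p k) (m (Suc k)))) =
      G m * T m" for m
    by (simp add: T_leibniz G_def prod.distrib sum_distrib_left mult_ac)
  have "((%m. \<Sum>p | p permutes {..<n}. of_int (sign p) * (\<Prod>k<n. b k (m (Suc k)) * c (p k) (m (Suc k)))) has_sum
      (\<Sum>p | p permutes {..<n}. of_int (sign p) * (\<Prod>k<n. \<Sum>\<^sub>\<infinity>q. b k q * c (p k) q))) (entries n)"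
    by (rule has_sum_finite_sum, simp add: finite_permutations, rule has_sum_cmult_right, rule one_perm, simp)
  then have total: "((%m. G m * T m) has_sum jdet n (%l k. \<Sum>\<^sub>\<infinity>q. b k q * c l q)) (entries n)"
    unfolding sum_eq GT .
  \<comment> \<open>an alternant with two equal columns vanishes\<close>
  have T0: "T m = 0" if m: "m \<in> entries n" "\<not> inj_on m {1..n}" for m
  proof -
    obtain i j where ij: "i < n" "j < n" "i \<noteq> j" "m (Suc i) = m (Suc j)"
      using m(2) unfolding inj_on_def image_Suc_lessThan[symmetric] by auto
    have "T m = jdet n (%j l. c l (m (Suc j)))" unfolding T_def by (rule jdet_transpose[symmetric])
    also have "... = 0"
      by (rule det_identical_rows[of _ n i j]) (use ij in \<open>auto intro!: eq_vecI\<close>)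
    finally show ?thesis .
  qed
  define I where "I = {m \<in> entries n. inj_on m {1..n}}"
  have "((%m. G m * T m) has_sum jdet n (%l k. \<Sum>\<^sub>\<infinity>q. b k q * c l q)) I"
    using total by (subst has_sum_cong_neutral[where T = "entries n" and g = "%m. G m * T m"]) (auto simp: I_def T0)
  then have "((%mp. G ((%(m, p). \<lambda>j\<in>{1..n}. m (Suc (p (j - 1)))) mp) * T ((%(m, p). \<lambda>j\<in>{1..n}. m (Suc (p (j - 1)))) mp)) has_sum
      jdet n (%l k. \<Sum>\<^sub>\<infinity>q. b k q * c l q)) (signatures n \<times> {p. p permutes {..<n}})"
    unfolding I_def using has_sum_reindex_bij_betw[OF signature_permutations, of "%m. G m * T m"] by blast
  then show ?thesis
  proof (rule has_sum_SigmaD)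
    fix m assume m: "m \<in> signatures n"
    have *: "G (\<lambda>j\<in>{1..n}. m (Suc (p (j - 1)))) * T (\<lambda>j\<in>{1..n}. m (Suc (p (j - 1)))) =
        T m * (of_int (sign p) * (\<Prod>k<n. b k (m (Suc (p k)))))" if p: "p permutes {..<n}" for p
    proof -
      have "T (\<lambda>j\<in>{1..n}. m (Suc (p (j - 1)))) = jdet n (%l j. c l (m (Suc (p j))))"
        unfolding T_def by (rule jdet_cong) auto
      also have "... = jdet n (%j l. c l (m (Suc (p j))))" by (rule jdet_transpose[symmetric])
      also have "... = of_int (sign p) * jdet n (%j l. c l (m (Suc j)))"
        using jdet_permute_rows[OF p, of "%j l. c l (m (Suc j))"] .
      also have "jdet n (%j l. c l (m (Suc j))) = T m" unfolding T_def by (rule jdet_transpose)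
      finally have TT: "T (\<lambda>j\<in>{1..n}. m (Suc (p (j - 1)))) = of_int (sign p) * T m" .
      show ?thesis unfolding TT by (simp add: G_def)
    qed
    have "((%p. T m * (of_int (sign p) * (\<Prod>k<n. b k (m (Suc (p k)))))) has_sum
      (\<Sum>p | p permutes {..<n}. T m * (of_int (sign p) * (\<Prod>k<n. b k (m (Suc (p k))))))) {p. p permutes {..<n}}"
      by (rule has_sum_finite) (simp add: finite_permutations)
    moreover have "(\<Sum>p | p permutes {..<n}. T m * (of_int (sign p) * (\<Prod>k<n. b k (m (Suc (p k)))))) =
        jdet n (%j k. b k (m (Suc j))) * T m"
      by (subst jdet_transpose[symmetric]) (simp add: jdet_leibniz sum_distrib_left mult.commute)
    ultimately show "((%p. G (case (m, p) of (m, p) => \<lambda>j\<in>{1..n}. m (Suc (p (j - 1)))) *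
          T (case (m, p) of (m, p) => \<lambda>j\<in>{1..n}. m (Suc (p (j - 1))))) has_sum
        jdet n (%j k. b k (m (Suc j))) * jdet n (%l j. c l (m (Suc j)))) {p. p permutes {..<n}}"
      using * by (subst has_sum_cong[where g = "%p. T m * (of_int (sign p) * (\<Prod>k<n. b k (m (Suc (p k)))))"])
        (auto simp: T_def)
  qed
qed

section \<open>Fourier series on the circle\<close>

text \<open>Divided by this power of \<open>k\<close>, the absolute values converge to that of \<open>1 / Gamma (- s)\<close>.\<close>
lemma gbinomial_bound:
  obtains C where "C \<ge> 0" "\<And>k. norm (s gchoose k) \<le> C * (real k + 1) powr - (Re s + 1)"
proof -
  define a where "a = Re s + 1"
  have "(%k. norm (s gchoose k) * real k powr a) \<longlonglongrightarrow> norm (inverse (Gamma (- s)))"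
  proof (rule Lim_transform_eventually[OF tendsto_norm[OF gbinomial_asymptotic]])
    show "\<forall>\<^sub>F k in sequentially. norm ((s gchoose k) / ((- 1) ^ k / exp ((s + 1) * complex_of_real (ln (real k))))) =
        norm (s gchoose k) * real k powr a"
      using eventually_gt_at_top[of 0]
    proof eventually_elim
      case (elim k)
      have "norm (exp ((s + 1) * complex_of_real (ln (real k)))) = real k powr a"
        using elim by (simp add: a_def powr_def)
      then show ?case by (simp add: norm_divide norm_power norm_mult)
    qed
  qed
  moreover have "(%k. ((real k + 1) / real k) powr a) \<longlonglongrightarrow> 1" by real_asymp
  ultimately have "(%k. norm (s gchoose k) * real k powr a * ((real k + 1) / real k) powr a) \<longlonglongrightarrow>
      norm (inverse (Gamma (- s))) * 1"
    by (rule tendsto_mult)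
  then have "(%k. norm (s gchoose k) * (real k + 1) powr a) \<longlonglongrightarrow> norm (inverse (Gamma (- s))) * 1"
  proof (rule Lim_transform_eventually)
    show "\<forall>\<^sub>F k in sequentially. norm (s gchoose k) * real k powr a * ((real k + 1) / real k) powr a =
        norm (s gchoose k) * (real k + 1) powr a"
      using eventually_gt_at_top[of 0] by eventually_elim (simp add: powr_divide)
  qed
  then have "Bseq (%k. norm (s gchoose k) * (real k + 1) powr a)"
    by (intro convergent_imp_Bseq convergentI)
  then obtain C where C: "C > 0" "\<And>k. norm (norm (s gchoose k) * (real k + 1) powr a) \<le> C"
    unfolding Bseq_def by auto
  show ?thesis
  proof (rule that[of C])
    show "norm (s gchoose k) \<le> C * (real k + 1) powr - (Re s + 1)" for k
      unfolding a_def[symmetric] powr_minus_divide using C(2)[of k] by (simp add: pos_le_divide_eq)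
  qed (use C in simp)
qed

lemma summable_gbinomial:
  assumes "Re s > 0"
  shows "summable (%k. norm (s gchoose k))"
proof -
  obtain C where C: "C \<ge> 0" "\<And>k. norm (s gchoose k) \<le> C * (real k + 1) powr - (Re s + 1)"
    using gbinomial_bound by blast
  have "summable (%k. real (Suc k) powr - (Re s + 1))"
    using assms by (subst summable_Suc_iff) (simp add: summable_real_powr_iff)
  then have summ: "summable (%k. C * (real k + 1) powr - (Re s + 1))"
    by (intro summable_mult) (simp add: add.commute)
  show ?thesis using C by (intro summable_comparison_test[OF _ summ]) auto
qed

text \<open>The coefficient of \<open>z ^ p\<close> in the product of two binomial series on the circle, up to a sign.
  Gauss's summation of the hypergeometric series at 1 evaluates it.\<close>
definition gauss_sum :: "complex => complex => nat => complex" where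
  "gauss_sum s t p = (\<Sum>l. (s gchoose (p + l)) * (t gchoose l))"

lemma norm_gbinomial_bounded:
  assumes "Re s > 0"
  obtains B where "\<And>k. norm (s gchoose k) \<le> B"
proof -
  have "(%k. norm (s gchoose k)) \<longlonglongrightarrow> 0"
    using summable_gbinomial[OF assms] by (rule summable_LIMSEQ_zero)
  then have "Bseq (%k. norm (s gchoose k))" by (intro convergent_imp_Bseq convergentI)
  then obtain B where "\<And>k. norm (norm (s gchoose k)) \<le> B" unfolding Bseq_def by auto
  then show ?thesis using that by auto
qed

lemma summable_gauss:
  assumes "Re s > 0" "Re t > 0"
  shows "summable (%l. norm ((s gchoose (p + l)) * (t gchoose l)))"
proof -
  obtain B where B: "\<And>k. norm (s gchoose k) \<le> B" using norm_gbinomial_bounded[OF assms(1)] by blast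
  show ?thesis
  proof (rule summable_comparison_test)
    show "\<exists>N. \<forall>l\<ge>N. norm (norm ((s gchoose (p + l)) * (t gchoose l))) \<le> B * norm (t gchoose l)"
      using B by (auto simp: norm_mult intro!: mult_right_mono)
    show "summable (%l. B * norm (t gchoose l))" by (intro summable_mult summable_gbinomial assms)
  qed
qed

lemma gauss_sums:
  assumes "Re s > 0" "Re t > 0"
  shows "(%l. (s gchoose (p + l)) * (t gchoose l)) sums gauss_sum s t p"
  unfolding gauss_sum_def by (rule summable_sums[OF summable_norm_cancel[OF summable_gauss[OF assms]]])

lemma gbinomial_absorb: "of_nat (Suc k) * ((s::complex) gchoose Suc k) = (s - of_nat k) * (s gchoose k)"
  unfolding left_diff_distrib gbinomial_mult_1[of s k] by simp

text \<open>The recurrence behind the differential equation of \<open>(1 - z) powr s * (1 - cnj z) powr t\<close>;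
  the difference of the two sides telescopes.\<close>
lemma gauss_sum_Suc:
  assumes "Re s > 0" "Re t > 0"
  shows "(of_nat (Suc p) + t) * gauss_sum s t (Suc p) = (s - of_nat p) * gauss_sum s t p"
proof -
  define G where "G l = of_nat l * (t gchoose l) * (s gchoose (p + l))" for l
  have step: "(of_nat (Suc p) + t) * ((s gchoose (Suc p + l)) * (t gchoose l)) -
      (s - of_nat p) * ((s gchoose (p + l)) * (t gchoose l)) = G (Suc l) - G l" for l
  proof -
    have a: "of_nat (Suc l) * (t gchoose Suc l) = (t - of_nat l) * (t gchoose l)"
      by (rule gbinomial_absorb)
    have b: "of_nat (Suc (p + l)) * (s gchoose Suc (p + l)) = (s - of_nat (p + l)) * (s gchoose (p + l))"
      by (rule gbinomial_absorb)
    have "G (Suc l) = (t - of_nat l) * (t gchoose l) * (s gchoose Suc (p + l))"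
      unfolding G_def a by simp
    moreover have "(s - of_nat p) * (s gchoose (p + l)) =
        of_nat (Suc (p + l)) * (s gchoose Suc (p + l)) + of_nat l * (s gchoose (p + l))"
      unfolding b by (simp add: algebra_simps)
    ultimately show ?thesis by (simp add: G_def algebra_simps)
  qed
  have "G \<longlonglongrightarrow> 0"
  proof -
    obtain C where C: "C \<ge> 0" "\<And>k. norm (t gchoose k) \<le> C * (real k + 1) powr - (Re t + 1)"
      using gbinomial_bound by blast
    have "norm (of_nat l * (t gchoose l)) \<le> C" for l
    proof -
      have "norm (of_nat l * (t gchoose l)) \<le> (real l + 1) * (C * (real l + 1) powr - (Re t + 1))"
        unfolding norm_mult using C(2)[of l] by (intro mult_mono) auto
      also have "... = C * ((real l + 1) powr 1 * (real l + 1) powr - (Re t + 1))" by simp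
      also have "... = C * (real l + 1) powr - Re t" unfolding powr_add[symmetric] by simp
      also have "... \<le> C * 1"
        using C(1) assms(2) by (intro mult_left_mono) (use powr_mono[of "- Re t" 0 "real l + 1"] in auto)
      finally show ?thesis by simp
    qed
    then have bd: "norm (G l) \<le> C * norm (s gchoose (p + l))" for l
      unfolding G_def norm_mult[of _ "s gchoose (p + l)"] by (intro mult_right_mono) auto
    have "(%l. C * norm (s gchoose (p + l))) \<longlonglongrightarrow> C * 0"
      using LIMSEQ_ignore_initial_segment[OF summable_LIMSEQ_zero[OF summable_gbinomial[OF assms(1)]], of p]
      by (intro tendsto_mult_left) (simp add: add.commute)
    then show ?thesis using bd by (intro Lim_null_comparison[of G]) auto
  qed
  then have "(%l. G (Suc l) - G l) sums (0 - G 0)" by (rule telescope_sums)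
  moreover have "G 0 = 0" by (simp add: G_def)
  moreover have "(%l. (of_nat (Suc p) + t) * ((s gchoose (Suc p + l)) * (t gchoose l)) -
      (s - of_nat p) * ((s gchoose (p + l)) * (t gchoose l))) sums
      ((of_nat (Suc p) + t) * gauss_sum s t (Suc p) - (s - of_nat p) * gauss_sum s t p)"
    by (intro sums_diff sums_mult gauss_sums assms)
  ultimately have "(of_nat (Suc p) + t) * gauss_sum s t (Suc p) - (s - of_nat p) * gauss_sum s t p = 0"
    unfolding step using sums_unique2 by fastforce
  then show ?thesis by simp
qed

lemma gauss_sum_shift:
  assumes "Re s > 0" "Re t > 0"
  shows "(of_nat (Suc p) + t) * gauss_sum (s + 1) t (Suc p) = (s + t + 1) * gauss_sum s t p"
proof -
  have "(s + 1 gchoose (Suc p + l)) * (t gchoose l) =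
      (s gchoose (p + l)) * (t gchoose l) + (s gchoose (Suc p + l)) * (t gchoose l)" for l
    using gbinomial_Suc_Suc[of s "p + l"] by (simp add: algebra_simps)
  then have "gauss_sum (s + 1) t (Suc p) = gauss_sum s t p + gauss_sum s t (Suc p)"
    using sums_unique2[OF gauss_sums[of "s + 1" t "Suc p"]] assms
      sums_add[OF gauss_sums[OF assms, of p] gauss_sums[OF assms, of "Suc p"]] by simp
  then show ?thesis using gauss_sum_Suc[OF assms, of p] by (simp add: algebra_simps)
qed

lemma gauss_sum_iterate:
  assumes "Re s > 0" "Re t > 0"
  shows "pochhammer (t + 1) N * gauss_sum (s + of_nat N) t N = pochhammer (s + t + 1) N * gauss_sum s t 0"
proof (induction N)
  case (Suc N)
  have "(of_nat (Suc N) + t) * gauss_sum (s + of_nat N + 1) t (Suc N) =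
      (s + of_nat N + t + 1) * gauss_sum (s + of_nat N) t N"
    using assms by (intro gauss_sum_shift) auto
  moreover have "s + of_nat (Suc N) = s + of_nat N + 1" "t + 1 + of_nat N = of_nat (Suc N) + t" by simp_all
  ultimately have "pochhammer (t + 1) (Suc N) * gauss_sum (s + of_nat (Suc N)) t (Suc N) =
      pochhammer (t + 1) N * ((s + of_nat N + t + 1) * gauss_sum (s + of_nat N) t N)"
    by (simp only: pochhammer_Suc mult.assoc)
  then have "pochhammer (t + 1) (Suc N) * gauss_sum (s + of_nat (Suc N)) t (Suc N) =
      (s + t + 1 + of_nat N) * (pochhammer (t + 1) N * gauss_sum (s + of_nat N) t N)"
    by (simp add: algebra_simps)
  then show ?case unfolding Suc by (simp add: pochhammer_Suc algebra_simps)
qed simp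

text \<open>Dividing by the leading term and shifting \<open>s\<close> and \<open>p\<close> leaves only that term in the limit.\<close>
lemma gauss_sum_limit:
  assumes "Re s > 0" "Re t > 0"
  shows "(%N. gauss_sum (s + of_nat N) t N / (s + of_nat N gchoose N)) \<longlonglongrightarrow> 1"
proof -
  define q where "q l N = (\<Prod>i<l. (s - of_nat i) / (of_nat N + 1 + of_nat i))" for l N
  have nz: "(s + of_nat N gchoose N) \<noteq> 0" for N
  proof -
    have "s + of_nat N - of_nat i \<noteq> 0" if "i < N" for i
    proof
      assume "s + of_nat N - of_nat i = 0"
      then have "Re (s + of_nat N - of_nat i) = 0" by (simp only: zero_complex.sel)
      then show False using assms(1) that by simp
    qed
    then show ?thesis by (simp add: gbinomial_prod_rev atLeast0LessThan)
  qed
  have ratio: "(s + of_nat N gchoose (N + l)) = (s + of_nat N gchoose N) * q l N" for N l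
  proof (induction l)
    case (Suc l)
    have "of_nat (Suc (N + l)) * (s + of_nat N gchoose Suc (N + l)) = (s - of_nat l) * (s + of_nat N gchoose (N + l))"
      using gbinomial_absorb[of "N + l" "s + of_nat N"] by (simp add: algebra_simps)
    moreover have "of_nat (Suc (N + l)) \<noteq> (0::complex)" using of_nat_neq_0 by blast
    ultimately have "(s + of_nat N gchoose Suc (N + l)) =
        (s + of_nat N gchoose (N + l)) * ((s - of_nat l) / of_nat (Suc (N + l)))"
      by (simp add: divide_simps mult.commute)
    also have "of_nat (Suc (N + l)) = of_nat N + 1 + (of_nat l :: complex)" by simp
    finally show ?case by (simp add: Suc q_def mult.assoc)
  qed (simp add: q_def)
  have tann: "(%N. \<Sum>l. q l N * (t gchoose l)) \<longlonglongrightarrow> (\<Sum>l. if l = 0 then 1 else 0)"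
  proof -
    obtain B where B: "\<And>k. norm (s gchoose k) \<le> B" using norm_gbinomial_bounded[OF assms(1)] by blast
    have q_le: "norm (q l N) \<le> B" for l N
    proof -
      have "norm (q l N) = (\<Prod>i<l. norm (s - of_nat i) / (real N + 1 + real i))"
        unfolding q_def prod_norm[symmetric]
      proof (intro prod.cong refl)
        fix i
        have "norm (of_nat N + 1 + of_nat i :: complex) = norm (complex_of_real (real N + 1 + real i))" by simp
        also have "... = real N + 1 + real i" by (subst norm_of_real) simp
        finally show "norm ((s - of_nat i) / (of_nat N + 1 + of_nat i)) = norm (s - of_nat i) / (real N + 1 + real i)"
          by (simp add: norm_divide)
      qed
      also have "... \<le> (\<Prod>i<l. norm (s - of_nat i) / (1 + real i))"
        by (intro prod_mono conjI divide_left_mono) auto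
      also have "... = norm (s gchoose l)"
      proof -
        have "(\<Prod>i<l. 1 + real i) = fact l" 
          by (simp add: fact_prod_Suc atLeast0LessThan add.commute)
        then show ?thesis
          by (simp add: gbinomial_prod_rev norm_divide prod_norm[symmetric] prod_dividef atLeast0LessThan)
      qed
      finally show ?thesis using B order_trans by blast
    qed
    have "(%N. \<Sum>l. q l N * (t gchoose l)) \<longlonglongrightarrow> (\<Sum>l. if l = 0 then 1 else 0 :: complex)"
    proof (rule tannerys_theorem[THEN conjunct2, THEN conjunct2])
      show "(%N. q l N * (t gchoose l)) \<longlonglongrightarrow> (if l = 0 then 1 else 0)" for l
      proof (cases l)
        case (Suc l')
        have "(%N. \<Prod>i<l'. (s - of_nat i) / (of_nat N + 1 + of_nat i) :: complex) \<longlonglongrightarrow> (\<Prod>i<l'. 0)"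
        proof (intro tendsto_prod)
          fix i
          have "filterlim (%N. of_nat N + 1 + of_nat i :: complex) at_infinity sequentially"
          proof -
            have "filterlim (%N. of_nat (N + (1 + i)) :: complex) at_infinity sequentially"
              by (rule filterlim_compose[OF tendsto_of_nat]) (rule filterlim_add_const_nat_at_top)
            then show ?thesis by (simp add: add_ac)
          qed
          then show "(%N. (s - of_nat i) / (of_nat N + 1 + of_nat i)) \<longlonglongrightarrow> 0"
            by (intro tendsto_divide_0[OF tendsto_const])
        qed
        moreover have "(%N. (s - of_nat l') / (of_nat N + 1 + of_nat l') :: complex) \<longlonglongrightarrow> 0"
        proof -
          have "filterlim (%N. of_nat (N + (1 + l')) :: complex) at_infinity sequentially"
            by (rule filterlim_compose[OF tendsto_of_nat]) (rule filterlim_add_const_nat_at_top)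
          then have "filterlim (%N. of_nat N + 1 + of_nat l' :: complex) at_infinity sequentially"
            by (simp add: add_ac)
          then show ?thesis by (intro tendsto_divide_0[OF tendsto_const])
        qed
        ultimately have "(%N. q l N) \<longlonglongrightarrow> (\<Prod>i<l'. 0) * 0"
          unfolding q_def Suc prod.lessThan_Suc by (rule tendsto_mult)
        then have "(%N. q l N * (t gchoose l)) \<longlonglongrightarrow> 0 * (t gchoose l)"
          by (intro tendsto_mult_right) simp
        then show ?thesis using Suc by simp
      qed (simp add: q_def)
      show "\<forall>\<^sub>F (l, N) in at_top \<times>\<^sub>F sequentially. norm (q l N * (t gchoose l)) \<le> B * norm (t gchoose l)"
        using q_le by (intro always_eventually) (auto simp: norm_mult intro!: mult_right_mono)
      show "summable (%l. B * norm (t gchoose l))" by (intro summable_mult summable_gbinomial assms)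
    qed auto
    then show ?thesis .
  qed
  have "gauss_sum (s + of_nat N) t N / (s + of_nat N gchoose N) = (\<Sum>l. q l N * (t gchoose l))" for N
  proof -
    have "(%l. (s + of_nat N gchoose N) * (q l N * (t gchoose l))) sums gauss_sum (s + of_nat N) t N"
      using gauss_sums[of "s + of_nat N" t N] assms unfolding ratio by (simp add: mult.assoc)
    from sums_divide[OF this, of "s + of_nat N gchoose N"] nz
    have "(%l. q l N * (t gchoose l)) sums (gauss_sum (s + of_nat N) t N / (s + of_nat N gchoose N))" by simp
    then show ?thesis by (simp add: sums_iff)
  qed
  moreover have "(\<Sum>l. if l = 0 then 1 else 0 :: complex) = 1"
    using sums_single[of 0 "%_. 1 :: complex"] by (simp add: sums_iff)
  ultimately show ?thesis using tann by simp
qed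

text \<open>Iterating the recurrence shifts the arguments to infinity, where the sum is asymptotic to its
  leading term; the accumulated factors form Gauss's product for the Gamma function.\<close>
lemma gauss_sum_0:
  assumes "Re s > 0" "Re t > 0"
  shows "gauss_sum s t 0 = Gamma (1 + s + t) * rGamma (1 + s) * rGamma (1 + t)"
proof -
  have nonpos: "z \<notin> \<int>\<^sub>\<le>\<^sub>0" if "Re z > 0" for z :: complex
    using that by (auto elim!: nonpos_Ints_cases)
  have poch: "pochhammer z N \<noteq> 0" if "Re z > 0" for z :: complex and N
    using nonpos[OF that] pochhammer_eq_0_imp_nonpos_Int by blast
  have eq: "gauss_sum s t 0 = rGamma_series (1 + s) N * rGamma_series (1 + t) N / rGamma_series (1 + s + t) N *
      (of_nat N / of_nat (Suc N)) * (gauss_sum (s + of_nat (Suc N)) t (Suc N) / (s + of_nat (Suc N) gchoose Suc N))"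
    if "N > 0" for N
  proof -
    let ?E = "%z. exp (z * complex_of_real (ln (real N)))"
    have bin: "(s + of_nat (Suc N) gchoose Suc N) = pochhammer (s + 1) (Suc N) / fact (Suc N)"
      by (simp add: gbinomial_pochhammer' algebra_simps)
    have it: "gauss_sum s t 0 = pochhammer (t + 1) (Suc N) * gauss_sum (s + of_nat (Suc N)) t (Suc N) / pochhammer (s + t + 1) (Suc N)"
      using gauss_sum_iterate[OF assms, of "Suc N"] poch[of "s + t + 1" "Suc N"] assms by (simp add: field_simps)
    have E: "?E (1 + s) * ?E (1 + t) = ?E (1 + s + t) * of_nat N"
    proof -
      have "of_nat N = ?E 1" using that by (simp add: exp_of_real)
      then show ?thesis by (simp add: mult_exp_exp algebra_simps)
    qed
    have nz: "?E z \<noteq> 0" for z by simp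
    have R: "rGamma_series (1 + s) N * rGamma_series (1 + t) N / rGamma_series (1 + s + t) N =
        pochhammer (s + 1) (Suc N) * pochhammer (t + 1) (Suc N) / (fact N * pochhammer (s + t + 1) (Suc N) * of_nat N)"
    proof -
      have "rGamma_series (1 + s) N * rGamma_series (1 + t) N / rGamma_series (1 + s + t) N =
          pochhammer (s + 1) (Suc N) * pochhammer (t + 1) (Suc N) * ?E (1 + s + t) /
            (fact N * pochhammer (s + t + 1) (Suc N) * (?E (1 + s) * ?E (1 + t)))"
        by (simp add: rGamma_series_def add_ac mult_ac)
      then show ?thesis unfolding E using nz[of "1 + s + t"] by simp
    qed
    show ?thesis
      unfolding it bin R using poch[of "s + 1" "Suc N"] poch[of "s + t + 1" "Suc N"] assms that
      by (simp add: field_simps fact_Suc del: of_nat_Suc)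
  qed
  have "(%N. rGamma_series (1 + s) N * rGamma_series (1 + t) N / rGamma_series (1 + s + t) N *
      (of_nat N / of_nat (Suc N)) * (gauss_sum (s + of_nat (Suc N)) t (Suc N) / (s + of_nat (Suc N) gchoose Suc N)))
      \<longlonglongrightarrow> rGamma (1 + s) * rGamma (1 + t) / rGamma (1 + s + t) * 1 * 1"
  proof (intro tendsto_mult tendsto_divide rGamma_series_LIMSEQ)
    show "rGamma (1 + s + t) \<noteq> 0" using nonpos[of "1 + s + t"] assms by (simp add: rGamma_eq_zero_iff)
    show "(%N. of_nat N / of_nat (Suc N)) \<longlonglongrightarrow> (1 :: complex)" by (rule LIMSEQ_n_over_Suc_n)
    show "(%N. gauss_sum (s + of_nat (Suc N)) t (Suc N) / (s + of_nat (Suc N) gchoose Suc N)) \<longlonglongrightarrow> 1"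
      using LIMSEQ_Suc[OF gauss_sum_limit[OF assms]] .
  qed
  moreover have "\<forall>\<^sub>F N in sequentially. rGamma_series (1 + s) N * rGamma_series (1 + t) N / rGamma_series (1 + s + t) N *
      (of_nat N / of_nat (Suc N)) * (gauss_sum (s + of_nat (Suc N)) t (Suc N) / (s + of_nat (Suc N) gchoose Suc N))
      = gauss_sum s t 0"
    using eventually_gt_at_top[of 0] by eventually_elim (rule eq[symmetric])
  ultimately have "(%N. gauss_sum s t 0) \<longlonglongrightarrow> rGamma (1 + s) * rGamma (1 + t) / rGamma (1 + s + t) * 1 * 1"
    by (rule Lim_transform_eventually)
  from LIMSEQ_unique[OF tendsto_const this]
  have "gauss_sum s t 0 = rGamma (1 + s) * rGamma (1 + t) / rGamma (1 + s + t)" by simp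
  then show ?thesis by (simp add: Gamma_def divide_inverse)
qed

theorem gauss_sum_eq:
  assumes "Re s > 0" "Re t > 0"
  shows "gauss_sum s t p = Gamma (1 + s + t) * rGamma (1 + s - of_nat p) * rGamma (1 + t + of_nat p)"
proof (induction p)
  case 0
  then show ?case using gauss_sum_0[OF assms] by simp
next
  case (Suc p)
  have nz: "of_nat (Suc p) + t \<noteq> 0"
  proof
    assume "of_nat (Suc p) + t = 0"
    then have "Re (of_nat (Suc p) + t) = 0" by (simp only: zero_complex.sel)
    then show False using assms by simp
  qed
  have r1: "rGamma (1 + s - of_nat (Suc p)) = (s - of_nat p) * rGamma (1 + s - of_nat p)"
    using rGamma_plus1[of "s - of_nat p"] by (simp add: algebra_simps)
  have r2: "rGamma (1 + t + of_nat p) = (of_nat (Suc p) + t) * rGamma (1 + t + of_nat (Suc p))"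
    using rGamma_plus1[of "1 + t + of_nat p"] by (simp add: algebra_simps)
  have "(of_nat (Suc p) + t) * gauss_sum s t (Suc p) =
      (of_nat (Suc p) + t) * (Gamma (1 + s + t) * rGamma (1 + s - of_nat (Suc p)) * rGamma (1 + t + of_nat (Suc p)))"
    unfolding gauss_sum_Suc[OF assms] Suc r1 r2 by (simp add: algebra_simps)
  then show ?case using nz by simp
qed

text \<open>The Fourier coefficients of \<open>circle_symbol\<close>, written with the entire function
  \<open>rGamma\<close>, which needs no exceptions at the poles of \<open>Gamma\<close>.\<close>
definition fourier_coeff :: "complex => complex => int => complex" where
  "fourier_coeff s t p =
     (-1) powi p * Gamma (1 + s + t) * rGamma (1 + s - of_int p) * rGamma (1 + t + of_int p)"

definition circle_symbol :: "complex => complex => complex => complex" where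
  "circle_symbol s t z = (1 - z) powr s * (1 - cnj z) powr t"

lemma Re_one_minus_pos:
  assumes "norm z \<le> 1" "z \<noteq> 1"
  shows "Re (1 - z) > 0"
proof -
  have "Re z \<noteq> 1"
  proof
    assume "Re z = 1"
    moreover have "(Re z)\<^sup>2 + (Im z)\<^sup>2 \<le> 1"
      using assms(1) by (metis cmod_power2 norm_ge_zero power_le_one)
    ultimately show False using assms(2) by (simp add: complex_eq_iff)
  qed
  moreover have "Re z \<le> 1" using complex_Re_le_cmod[of z] assms(1) by linarith
  ultimately show ?thesis by simp
qed

lemma one_minus_nonpos_Reals: "norm (z :: complex) \<le> 1 ==> z \<noteq> 1 ==> 1 - z \<notin> \<real>\<^sub>\<le>\<^sub>0"
  using Re_one_minus_pos[of z] by (auto simp: complex_nonpos_Reals_iff)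

text \<open>The binomial series on the closed disc, by dominated convergence along radii.\<close>
lemma binomial_series_disc:
  assumes s: "Re s > 0" and z: "norm z \<le> 1"
  shows "(%k. (s gchoose k) * (- z) ^ k) sums (1 - z) powr s"
proof -
  define r where "r N = 1 - 1 / (real N + 2)" for N
  have r: "0 \<le> r N" "r N < 1" for N by (simp_all add: r_def)
  have r_lim: "(%N. complex_of_real (r N)) \<longlonglongrightarrow> of_real 1"
    unfolding r_def by (intro tendsto_of_real) real_asymp
  define a where "a k N = (s gchoose k) * (- (z * of_real (r N))) ^ k" for k N
  have z_le: "norm z ^ k \<le> 1" for k using z by (simp add: power_le_one)
  have bound: "norm (a k N) \<le> norm (s gchoose k)" for k N
  proof -
    have "norm (z * of_real (r N)) \<le> 1 * 1"
      unfolding norm_mult using z r[of N] by (intro mult_mono) auto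
    then have "norm (z * of_real (r N)) ^ k \<le> 1" by (intro power_le_one) auto
    then show ?thesis by (simp add: a_def norm_mult norm_power mult_left_le)
  qed
  have "(%N. \<Sum>k. a k N) \<longlonglongrightarrow> (\<Sum>k. (s gchoose k) * (- z) ^ k)"
  proof (rule tannerys_theorem[THEN conjunct2, THEN conjunct2])
    fix k
    have "(%N. (s gchoose k) * (- (z * of_real (r N))) ^ k) \<longlonglongrightarrow> (s gchoose k) * (- (z * of_real 1)) ^ k"
      by (intro tendsto_intros r_lim)
    then show "(%N. a k N) \<longlonglongrightarrow> (s gchoose k) * (- z) ^ k" by (simp add: a_def)
  next
    show "\<forall>\<^sub>F (k, N) in at_top \<times>\<^sub>F sequentially. norm (a k N) \<le> norm (s gchoose k)"
      using bound by (intro always_eventually) auto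
  qed (use summable_gbinomial[OF s] in auto)
  moreover have "(\<Sum>k. a k N) = (1 - z * of_real (r N)) powr s" for N
  proof -
    have "norm (- (z * complex_of_real (r N))) < 1"
    proof -
      have "norm (z * complex_of_real (r N)) \<le> 1 * r N"
        unfolding norm_mult using z r[of N] by (intro mult_mono) auto
      then show ?thesis using r(2)[of N] by (simp only: norm_minus_cancel)
    qed
    from gen_binomial_complex[OF this, of s] show ?thesis by (simp add: a_def sums_iff)
  qed
  moreover have "(%N. (1 - z * of_real (r N)) powr s) \<longlonglongrightarrow> (1 - z) powr s"
  proof (rule tendsto_powr_complex'[OF _ _ tendsto_const])
    show "1 - z \<notin> \<real>\<^sub>\<le>\<^sub>0 \<or> 1 - z = 0 \<and> 0 < Re s"
      using one_minus_nonpos_Reals[OF z] s by auto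
    have "(%N. 1 - z * of_real (r N)) \<longlonglongrightarrow> 1 - z * of_real 1" by (intro tendsto_intros r_lim)
    then show "(%N. 1 - z * of_real (r N)) \<longlonglongrightarrow> 1 - z" by simp
  qed
  ultimately have "(\<Sum>k. (s gchoose k) * (- z) ^ k) = (1 - z) powr s"
    using LIMSEQ_unique by simp
  moreover have "summable (%k. (s gchoose k) * (- z) ^ k)"
  proof (rule summable_norm_cancel, rule summable_comparison_test)
    show "\<exists>N. \<forall>k\<ge>N. norm (norm ((s gchoose k) * (- z) ^ k)) \<le> norm (s gchoose k)"
      using z_le by (auto simp: norm_mult norm_power mult_left_le)
  qed (rule summable_gbinomial[OF s])
  ultimately show ?thesis by (simp add: sums_iff)
qed

lemma fourier_coeff_gauss_nonneg:
  assumes "Re s > 0" "Re t > 0"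
  shows "fourier_coeff s t (int p) = (-1) ^ p * gauss_sum s t p"
  by (simp add: fourier_coeff_def gauss_sum_eq[OF assms])

lemma fourier_coeff_gauss_nonpos:
  assumes "Re s > 0" "Re t > 0"
  shows "fourier_coeff s t (- int p) = (-1) ^ p * gauss_sum t s p"
  by (simp add: fourier_coeff_def gauss_sum_eq[OF assms(2,1)] power_int_minus mult_ac add_ac flip: power_inverse)

lemma gauss_sum_bound:
  assumes "Re s \<ge> R" "R > 0" "Re t > 0"
  obtains C where "\<And>p. norm (gauss_sum s t p) \<le> C * (real p + 1) powr - (R + 1)"
proof -
  obtain C where C: "C \<ge> 0" "\<And>k. norm (s gchoose k) \<le> C * (real k + 1) powr - (Re s + 1)"
    using gbinomial_bound by blast
  have s0: "Re s > 0" using assms by simp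
  have "norm (gauss_sum s t p) \<le> (C * (\<Sum>l. norm (t gchoose l))) * (real p + 1) powr - (R + 1)" for p
  proof -
    have le: "norm ((s gchoose (p + l)) * (t gchoose l)) \<le> C * (real p + 1) powr - (R + 1) * norm (t gchoose l)" for l
    proof -
      have "norm (s gchoose (p + l)) \<le> C * (real (p + l) + 1) powr - (Re s + 1)" by (rule C)
      also have "(real (p + l) + 1) powr - (Re s + 1) \<le> (real p + 1) powr - (Re s + 1)"
        using s0 by (intro powr_mono2') auto
      also have "... \<le> (real p + 1) powr - (R + 1)" using assms by (intro powr_mono) auto
      finally have "norm (s gchoose (p + l)) \<le> C * (real p + 1) powr - (R + 1)"
        using C(1) by (simp add: mult_left_mono)
      then show ?thesis by (simp add: norm_mult mult_right_mono)
    qed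
    have "norm (gauss_sum s t p) \<le> (\<Sum>l. norm ((s gchoose (p + l)) * (t gchoose l)))"
      unfolding gauss_sum_def by (rule summable_norm[OF summable_gauss[OF s0 assms(3)]])
    also have "... \<le> (\<Sum>l. C * (real p + 1) powr - (R + 1) * norm (t gchoose l))"
      by (intro suminf_le le summable_gauss[OF s0 assms(3)] summable_mult summable_gbinomial assms)
    also have "... = C * (real p + 1) powr - (R + 1) * (\<Sum>l. norm (t gchoose l))"
      by (rule suminf_mult[OF summable_gbinomial[OF assms(3)]])
    finally show ?thesis by (simp add: mult_ac)
  qed
  then show ?thesis by (rule that)
qed

text \<open>The sum \<open>gauss_sum s t p\<close> inherits the decay of its first factors, which improves with the real
  part of \<open>s\<close>; for negative indices \<open>s\<close> and \<open>t\<close> change roles.  For large exponents this makes all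
  series below converge.\<close>
lemma fourier_coeff_bound:
  assumes "Re s \<ge> R" "Re t \<ge> R" "R > 0"
  obtains C where "C \<ge> 0" "\<And>p. norm (fourier_coeff s t p) \<le> C * (1 + \<bar>real_of_int p\<bar>) powr - (R + 1)"
proof -
  have st: "Re s > 0" "Re t > 0" using assms by auto
  obtain C1 where C1: "\<And>p. norm (gauss_sum s t p) \<le> C1 * (real p + 1) powr - (R + 1)"
    using gauss_sum_bound[OF assms(1,3) st(2)] by blast
  obtain C2 where C2: "\<And>p. norm (gauss_sum t s p) \<le> C2 * (real p + 1) powr - (R + 1)"
    using gauss_sum_bound[OF assms(2,3) st(1)] by blast
  define C where "C = max 0 (max C1 C2)"
  show ?thesis
  proof (rule that[of C])
    fix p :: int
    show "norm (fourier_coeff s t p) \<le> C * (1 + \<bar>real_of_int p\<bar>) powr - (R + 1)"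
    proof (cases p rule: int_cases2)
      case (nonneg q)
      have "norm (fourier_coeff s t p) \<le> C1 * (real q + 1) powr - (R + 1)"
        using C1[of q] by (simp add: nonneg fourier_coeff_gauss_nonneg[OF st] norm_mult norm_power)
      also have "... \<le> C * (real q + 1) powr - (R + 1)" by (intro mult_right_mono) (auto simp: C_def)
      finally show ?thesis by (simp add: nonneg add.commute)
    next
      case (nonpos q)
      have "norm (fourier_coeff s t p) \<le> C2 * (real q + 1) powr - (R + 1)"
        using C2[of q] by (simp add: nonpos fourier_coeff_gauss_nonpos[OF st] norm_mult norm_power)
      also have "... \<le> C * (real q + 1) powr - (R + 1)" by (intro mult_right_mono) (auto simp: C_def)
      finally show ?thesis by (simp add: nonpos add.commute)
    qed
  qed (simp add: C_def)
qed

lemma summable_on_int_powr: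
  assumes "a > 1"
  shows "(%p::int. (1 + \<bar>real_of_int p\<bar>) powr - a) summable_on UNIV"
proof -
  have nat: "(%k::nat. (1 + real k) powr - a) summable_on UNIV"
  proof (rule norm_summable_imp_summable_on)
    have "summable (%k. real (Suc k) powr - a)"
      using assms by (subst summable_Suc_iff) (simp add: summable_real_powr_iff)
    then show "summable (%k. norm ((1 + real k) powr - a))" by (simp add: add.commute)
  qed
  have eq: "(1 + \<bar>real_of_int (int k)\<bar>) powr - a = (1 + real k) powr - a"
    "(1 + \<bar>real_of_int (- int k)\<bar>) powr - a = (1 + real k) powr - a" for k by simp_all
  have "(%p::int. (1 + \<bar>real_of_int p\<bar>) powr - a) summable_on range int"
    by (subst summable_on_reindex) (auto simp: o_def nat inj_on_def)
  moreover have "(%p::int. (1 + \<bar>real_of_int p\<bar>) powr - a) summable_on range (%k. - int k)"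
    by (subst summable_on_reindex) (auto simp: o_def nat inj_on_def)
  ultimately have "(%p::int. (1 + \<bar>real_of_int p\<bar>) powr - a) summable_on (range int \<union> range (%k. - int k))"
    by (rule summable_on_union)
  also have "range int \<union> range (%k. - int k) = UNIV"
    by (auto simp: image_iff) (metis int_cases2)
  finally show ?thesis .
qed

text \<open>Multiply the binomial series of the two factors, which converge absolutely up to the
  boundary, and collect equal powers of \<open>z\<close>, where \<open>cnj z = inverse z\<close>.\<close>
theorem circle_symbol_fourier:
  assumes s: "Re s > 0" and t: "Re t > 0" and z: "norm z = 1"
  shows "((%p. fourier_coeff s t p * z powi p) has_sum circle_symbol s t z) UNIV"
proof -
  have z0: "z \<noteq> 0" using z by auto
  have cnj_z: "cnj z = inverse z"
    using z z0 by (metis complex_cnj_inverse complex_norm_square divide_inverse inverse_inverse_eq mult.commute nonzero_mult_div_cancel_left of_real_1 one_power2 field_class.field_inverse)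
  define a where "a k = (s gchoose k) * (- z) ^ k" for k
  define b where "b l = (t gchoose l) * (- cnj z) ^ l" for l
  have norm_a: "norm (a k) = norm (s gchoose k)" and norm_b: "norm (b k) = norm (t gchoose k)" for k
    using z by (simp_all add: a_def b_def norm_mult norm_power)
  have a: "(a has_sum (1 - z) powr s) UNIV"
    unfolding a_def using z s summable_gbinomial[OF s] norm_a
    by (intro norm_summable_imp_has_sum binomial_series_disc) (auto simp flip: a_def)
  have b: "(b has_sum (1 - cnj z) powr t) UNIV"
    unfolding b_def using z t summable_gbinomial[OF t] norm_b
    by (intro norm_summable_imp_has_sum binomial_series_disc) (auto simp flip: b_def)
  have abs_a: "(%k. norm (a k)) summable_on UNIV" and abs_b: "(%k. norm (b k)) summable_on UNIV"
    using summable_gbinomial[OF s] summable_gbinomial[OF t]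
    by (auto simp: norm_a norm_b intro!: norm_summable_imp_summable_on)
  have "(%(k, l). a k * b l) abs_summable_on (UNIV \<times> UNIV)"
    unfolding Infinite_Sum.abs_summable_on_Sigma_iff
    using abs_a abs_b by (auto simp: norm_mult infsum_cmult_right' abs_mult intro!: summable_on_cmult_right summable_on_cmult_left)
  then have summ: "(%(k, l). a k * b l) summable_on (UNIV \<times> UNIV)"
    by (rule Infinite_Sum.abs_summable_summable)
  have total: "((%(k, l). a k * b l) has_sum circle_symbol s t z) (UNIV \<times> UNIV)"
    unfolding circle_symbol_def
    by (rule has_sum_SigmaI[where g = "%k. a k * (1 - cnj z) powr t"])
      (use a b summ in \<open>auto intro!: has_sum_cmult_right has_sum_cmult_left\<close>)
  define B where "B p = {l::nat. int l + p \<ge> 0}" for p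
  define h where "h = (%(p, l). (nat (int l + p), l))"
  have bij: "bij_betw h (Sigma UNIV B) (UNIV \<times> UNIV)"
    by (rule bij_betw_byWitness[of _ "%(k, l). (int k - int l, l)"]) (auto simp: h_def B_def)
  have "((%x. (%(k, l). a k * b l) (h x)) has_sum circle_symbol s t z) (Sigma UNIV B)"
    using has_sum_reindex_bij_betw[OF bij, of "%(k, l). a k * b l"] total by blast
  then show ?thesis
  proof (rule has_sum_SigmaD)
    fix p :: int
    have pow: "(- z) ^ k * (- cnj z) ^ l = (-1) powi p * z powi p" if "int k = int l + p" for k l
    proof -
      have m1: "(-1 :: complex) powi p = (-1) ^ (k + l)"
      proof -
        have "(-1 :: complex) powi (int k - int l) = (-1) ^ k / (-1) ^ l"
          by (simp add: power_int_diff)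
        also have "... = (-1) ^ (k + l)"
          by (simp add: power_add divide_inverse power_inverse[symmetric])
        finally show ?thesis using that by simp
      qed
      have m2: "z powi p = z ^ k * cnj z ^ l"
      proof -
        have "z powi (int k - int l) = z ^ k / z ^ l" using z0 by (simp add: power_int_diff)
        then show ?thesis using that by (simp add: cnj_z divide_inverse power_inverse)
      qed
      show ?thesis unfolding m1 m2 power_minus[of z] power_minus[of "cnj z"] by (simp add: power_add)
    qed
    show "((%l. (%(k, l). a k * b l) (h (p, l))) has_sum fourier_coeff s t p * z powi p) (B p)"
    proof (cases p rule: int_cases2)
      case (nonneg q)
      have "((%l. (s gchoose (q + l)) * (t gchoose l)) has_sum gauss_sum s t q) UNIV"
        by (intro norm_summable_imp_has_sum summable_gauss gauss_sums s t)
      then have "((%l. (-1) powi p * z powi p * ((s gchoose (q + l)) * (t gchoose l))) has_sum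
          (-1) powi p * z powi p * gauss_sum s t q) UNIV"
        by (rule has_sum_cmult_right)
      also have "(%l. (-1) powi p * z powi p * ((s gchoose (q + l)) * (t gchoose l))) =
          (%l. (%(k, l). a k * b l) (h (p, l)))"
      proof
        fix l
        have k: "nat (int l + p) = q + l" by (simp add: nonneg nat_add_distrib)
        have "(%(k, l). a k * b l) (h (p, l)) =
            (s gchoose (q + l)) * (t gchoose l) * ((- z) ^ (q + l) * (- cnj z) ^ l)"
          by (simp add: h_def k a_def b_def)
        also have "(- z) ^ (q + l) * (- cnj z) ^ l = (-1) powi p * z powi p"
          by (rule pow) (simp add: nonneg)
        finally show "(-1) powi p * z powi p * ((s gchoose (q + l)) * (t gchoose l)) = (%(k, l). a k * b l) (h (p, l))"
          by (simp only: mult_ac)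
      qed
      finally show ?thesis
        by (simp add: nonneg B_def fourier_coeff_gauss_nonneg[OF s t] mult_ac)
    next
      case (nonpos q)
      have B: "B p = range (%k. q + k)" 
        by (auto simp: B_def nonpos image_iff) (metis le_add_diff_inverse)
      have "((%l. (t gchoose (q + l)) * (s gchoose l)) has_sum gauss_sum t s q) UNIV"
        by (intro norm_summable_imp_has_sum summable_gauss gauss_sums s t)
      then have "((%k. (-1) powi p * z powi p * ((t gchoose (q + k)) * (s gchoose k))) has_sum
          (-1) powi p * z powi p * gauss_sum t s q) UNIV"
        by (rule has_sum_cmult_right)
      also have "(%k. (-1) powi p * z powi p * ((t gchoose (q + k)) * (s gchoose k))) =
          (%l. (%(k, l). a k * b l) (h (p, l))) \<circ> (%k. q + k)"
      proof
        fix k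
        have "nat (int (q + k) + p) = k" by (simp add: nonpos)
        then have "((%l. (%(k, l). a k * b l) (h (p, l))) \<circ> (%k. q + k)) k =
            (t gchoose (q + k)) * (s gchoose k) * ((- z) ^ k * (- cnj z) ^ (q + k))"
          by (simp add: h_def a_def b_def)
        also have "(- z) ^ k * (- cnj z) ^ (q + k) = (-1) powi p * z powi p"
          by (rule pow) (simp add: nonpos)
        finally show "(-1) powi p * z powi p * ((t gchoose (q + k)) * (s gchoose k)) =
            ((%l. (%(k, l). a k * b l) (h (p, l))) \<circ> (%k. q + k)) k"
          by (simp only: mult_ac)
      qed
      finally have "((%l. (%(k, l). a k * b l) (h (p, l))) has_sum (-1) powi p * z powi p * gauss_sum t s q) (range (%k. q + k))"
        by (subst has_sum_reindex) (auto simp: inj_on_def o_def)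
      then show ?thesis
        by (simp add: B) (simp add: nonpos fourier_coeff_gauss_nonpos[OF s t] mult_ac power_int_minus flip: power_inverse)
    qed
  qed
qed

section \<open>Spectral decomposition of unitary matrices\<close>

definition hermitian_adjoint :: "complex^'n^'n => complex^'n^'n" where
  "hermitian_adjoint A = transpose (cnj_matrix A)"

definition cinner :: "complex^'n => complex^'n => complex" where
  "cinner x y = (\<Sum>i\<in>UNIV. x $ i * cnj (y $ i))"

lemma cinner_add_left: "cinner (x + y) w = cinner x w + cinner y w"
  and cinner_diff_left: "cinner (x - y) w = cinner x w - cinner y w"
  and cinner_scale_left: "cinner (c *s x) w = c * cinner x w"
  and cinner_scale_right: "cinner x (c *s w) = cnj c * cinner x w"
  and cinner_cnj: "cnj (cinner x w) = cinner w x"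
  and cinner_zero_left [simp]: "cinner 0 w = 0"
  by (simp_all add: cinner_def algebra_simps sum.distrib sum_subtractf sum_distrib_left)

lemma cinner_self: "cinner x x = of_real ((norm x)\<^sup>2)"
proof -
  have "(norm x)\<^sup>2 = (\<Sum>i\<in>UNIV. (norm (x $ i))\<^sup>2)"
    by (simp add: norm_vec_def L2_set_def sum_nonneg)
  then show ?thesis by (simp add: cinner_def complex_norm_square[symmetric])
qed

lemma Re_cinner: "Re (cinner x w) = x \<bullet> w"
  by (simp add: cinner_def inner_vec_def inner_complex_def Re_sum)

lemma cinner_adjoint: "cinner (A *v x) y = cinner x (hermitian_adjoint A *v y)"
proof -
  have "cinner (A *v x) y = (\<Sum>i\<in>UNIV. \<Sum>j\<in>UNIV. A $ i $ j * x $ j * cnj (y $ i))"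
    by (simp add: cinner_def matrix_vector_mult_def sum_distrib_right)
  also have "... = (\<Sum>j\<in>UNIV. \<Sum>i\<in>UNIV. A $ i $ j * x $ j * cnj (y $ i))"
    by (rule sum.swap)
  also have "... = cinner x (hermitian_adjoint A *v y)"
    by (simp add: cinner_def matrix_vector_mult_def hermitian_adjoint_def cnj_matrix_def
        cart_transpose_def sum_distrib_left mult_ac)
  finally show ?thesis .
qed

lemma unitary_cinner:
  assumes "g \<in> unitary_group"
  shows "cinner (g *v x) (g *v y) = cinner x y"
proof -
  have "hermitian_adjoint g ** g = mat 1"
    using assms by (simp add: unitary_group_def hermitian_adjoint_def)
  then show ?thesis by (simp add: cinner_adjoint matrix_vector_mul_assoc)
qed

lemma unitary_norm:
  assumes "g \<in> unitary_group"
  shows "norm (g *v x) = norm x"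
proof -
  have "complex_of_real ((norm (g *v x))\<^sup>2) = of_real ((norm x)\<^sup>2)"
    using unitary_cinner[OF assms, of x x] by (simp only: cinner_self)
  then show ?thesis by (simp only: of_real_eq_iff) simp
qed

lemma matrix_vector_scale: "A *v (c *s x) = c *s (A *v (x :: complex^'n))"
  by (simp add: matrix_vector_mult_def cart_eq_iff sum_distrib_left mult_ac)

text \<open>An eigenvector in an invariant subspace: some polynomial in the matrix kills a given vector;
  peel off its linear factors.\<close>
lemma invariant_subspace_eigenvector:
  fixes A :: "complex^'n^'n"
  assumes W: "\<And>x. x \<in> W ==> A *v x \<in> W" "\<And>x y. x \<in> W ==> y \<in> W ==> x - y \<in> W"
      "\<And>c x. x \<in> W ==> c *s x \<in> W"
    and p: "p \<noteq> 0" and x: "x \<in> W" "x \<noteq> 0" "mpoly p A *v x = 0"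
  shows "\<exists>v\<in>W. v \<noteq> 0 \<and> (\<exists>a. A *v v = a *s v)"
  using p x
proof (induction "degree p" arbitrary: p x)
  case 0
  then obtain c where c: "p = [:c:]" by (metis degree_eq_zeroE)
  have "c *s x = mpoly p A *v x"
    by (simp add: c mpoly_pCons matrix_vector_mult_def cart_eq_iff mat_nth if_distrib if_distribR cong: if_cong)
  then show ?case using 0 c by auto
next
  case (Suc d)
  then obtain a where a: "poly p a = 0"
    by (metis constant_degree fundamental_theorem_of_algebra nat.distinct(1))
  then obtain q where q: "p = [:- a, 1:] * q" by (auto simp: poly_eq_0_iff_dvd)
  have q0: "q \<noteq> 0" using q Suc.prems by auto
  then have dq: "degree q = d" using Suc.hyps(2) unfolding q by (subst (asm) degree_mult_eq) auto
  define y where "y = A *v x - a *s x"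
  have comm: "mpoly q A ** A = A ** mpoly q A" for q
  proof (induction q)
    case (pCons b q)
    have "mat b ** A = A ** mat b" 
      by (simp add: cart_eq_iff mat_times_nth times_mat_nth)
    moreover have "(A ** mpoly q A) ** A = A ** (A ** mpoly q A)"
      using pCons by (metis matrix_mul_assoc)
    ultimately show ?case by (simp add: mpoly_pCons matrix_add_ldistrib) (simp add: matrix_matrix_mult_def cart_eq_iff algebra_simps sum.distrib)
  qed simp
  show ?case
  proof (cases "y = 0")
    case True
    then show ?thesis using Suc.prems by (auto simp: y_def)
  next
    case False
    have yW: "y \<in> W" using W Suc.prems by (simp add: y_def)
    have "mat a *v x = a *s x"
      by (simp add: matrix_vector_mult_def cart_eq_iff mat_nth if_distrib if_distribR cong: if_cong)
    then have "y = (A - mat a) *v x" by (simp add: y_def matrix_vector_mult_diff_rdistrib)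
    then have "mpoly q A *v y = (mpoly q A ** (A - mat a)) *v x" by (simp add: matrix_vector_mul_assoc)
    also have "mpoly q A ** (A - mat a) = mpoly p A"
    proof -
      have "mpoly q A ** mat a = mat a ** mpoly q A"
        by (simp add: cart_eq_iff mat_times_nth times_mat_nth)
      then show ?thesis unfolding q mpoly_linear_mult
        by (simp add: matrix_diff_rdistrib comm[symmetric])
           (simp add: matrix_matrix_mult_def cart_eq_iff algebra_simps sum_subtractf)
    qed
    finally have "mpoly q A *v y = 0" using Suc.prems by simp
    from Suc.hyps(1)[OF dq[symmetric] q0 yW False this] show ?thesis .
  qed
qed

lemma matrix_power_Suc_vec: "matrix_power A (Suc k) *v x = A *v (matrix_power A k *v x)"
  by (simp add: matrix_power_def matrix_vector_mul_assoc)

text \<open>The iterates \<open>A^k x\<close> cannot all be linearly independent.\<close>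
lemma annihilating_poly:
  fixes A :: "complex^'n^'n"
  shows "\<exists>p. p \<noteq> 0 \<and> mpoly p A *v x = 0"
proof -
  define w where "w k = matrix_power A k *v x" for k
  define N where "N = DIM(complex^'n)"
  have "\<exists>c. (\<exists>k\<le>N. c k \<noteq> 0) \<and> (\<Sum>k\<le>N. c k *\<^sub>R w k) = 0"
  proof (cases "inj_on w {..N}")
    case True
    then have "card (w ` {..N}) > DIM(complex^'n)" by (simp add: card_image N_def)
    then have "dependent (w ` {..N})" using dependent_biggerset[of "w ` {..N}"] by simp
    then obtain u where u: "\<exists>v\<in>w ` {..N}. u v \<noteq> 0" "(\<Sum>v\<in>w ` {..N}. u v *\<^sub>R v) = 0"
      using dependent_finite[of "w ` {..N}"] by auto
    show ?thesis using u True by (intro exI[of _ "%k. u (w k)"]) (auto simp: sum.reindex)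
  next
    case False
    then obtain i j where ij: "i \<le> N" "j \<le> N" "i \<noteq> j" "w i = w j" by (auto simp: inj_on_def)
    define c where "c k = (if k = i then 1 else if k = j then -1 else 0 :: real)" for k
    have "(\<Sum>k\<le>N. c k *\<^sub>R w k) = (\<Sum>k\<in>{i, j}. c k *\<^sub>R w k)"
      using ij by (intro sum.mono_neutral_right) (auto simp: c_def)
    also have "... = 0" using ij by (simp add: c_def)
    finally show ?thesis using ij by (intro exI[of _ c]) (auto simp: c_def)
  qed
  then obtain c where c: "\<exists>k\<le>N. c k \<noteq> 0" "(\<Sum>k\<le>N. c k *\<^sub>R w k) = 0" by blast
  define p where "p = (\<Sum>k\<le>N. monom (complex_of_real (c k)) k)"
  have coeff: "coeff p k = of_real (c k)" if "k \<le> N" for k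
    using that by (simp add: p_def coeff_sum coeff_monom)
  have "p \<noteq> 0" using c(1) coeff by (metis coeff_0 of_real_eq_0_iff)
  moreover have "mpoly p A *v x = (\<Sum>k\<le>N. c k *\<^sub>R w k)"
  proof -
    have "(mat (complex_of_real r) ** M) *v x = r *\<^sub>R (M *v x)" for r and M :: "complex^'n^'n"
      by (simp add: matrix_vector_mult_def cart_eq_iff mat_times_nth scaleR_conv_of_real[where ?'a = complex] mult_ac sum_distrib_left)
    moreover have "(\<Sum>k\<le>N. M k) *v x = (\<Sum>k\<le>N. M k *v x)" for M :: "nat => complex^'n^'n"
      by (induction N) (auto simp: matrix_vector_mult_add_rdistrib)
    ultimately show ?thesis by (simp add: p_def mpoly_sum mpoly_monom w_def)
  qed
  ultimately show ?thesis using c(2) by auto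
qed

text \<open>Orthonormal eigenvectors can be added one at a time, because the orthogonal complement of
  the ones found so far is invariant.\<close>
lemma unitary_orthonormal_eigenvectors:
  fixes g :: "complex^'n^'n"
  assumes g: "g \<in> unitary_group" and "k \<le> CARD('n)"
  shows "\<exists>v a. (\<forall>i<k. g *v v i = a i *s v i) \<and> (\<forall>i<k. \<forall>j<k. cinner (v i) (v j) = (if i = j then 1 else 0))"
  using assms(2)
proof (induction k)
  case (Suc k)
  have "k \<le> CARD('n)" using Suc.prems by simp
  from Suc.IH[OF this] obtain v a where v': "\<forall>i<k. g *v v i = a i *s v i"
    "\<forall>i<k. \<forall>j<k. cinner (v i) (v j) = (if i = j then 1 else 0)" by blast
  then have v: "\<And>i. i < k ==> g *v v i = a i *s v i"
    "\<And>i j. i < k ==> j < k ==> cinner (v i) (v j) = (if i = j then 1 else 0)" by blast+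
  define W where "W = {x. \<forall>i<k. cinner x (v i) = 0}"
  have a_nz: "a i \<noteq> 0" if "i < k" for i
  proof
    assume "a i = 0"
    then have "norm (v i) = 0" using v(1)[OF that] unitary_norm[OF g, of "v i"] by simp
    then show False using v(2)[OF that that] by simp
  qed
  have W: "\<And>x. x \<in> W ==> g *v x \<in> W" "\<And>x y. x \<in> W ==> y \<in> W ==> x - y \<in> W"
      "\<And>c x. x \<in> W ==> c *s x \<in> W"
  proof -
    fix x assume x: "x \<in> W"
    have "cinner (g *v x) (v i) = 0" if i: "i < k" for i
    proof -
      have "cnj (a i) * cinner (g *v x) (v i) = cinner (g *v x) (g *v v i)"
        by (simp add: v(1)[OF i] cinner_scale_right)
      also have "... = 0" using x i by (simp add: unitary_cinner[OF g] W_def)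
      finally show ?thesis using a_nz[OF i] by simp
    qed
    then show "g *v x \<in> W" by (simp add: W_def)
  qed (auto simp: W_def cinner_diff_left cinner_scale_left)
  obtain x where x: "x \<in> W" "x \<noteq> 0"
  proof -
    define S where "S = v ` {..<k} \<union> (%i. \<i> *s v i) ` {..<k}"
    have "card S \<le> card (v ` {..<k}) + card ((%i. \<i> *s v i) ` {..<k})"
      unfolding S_def by (rule card_Un_le)
    also have "... \<le> k + k" by (intro add_mono order.trans[OF card_image_le]) auto
    also have "... < DIM(complex^'n)" using Suc.prems by simp
    finally have "dim S < DIM(complex^'n)"
      using dim_le_card'[of S] by (simp add: S_def)
    then obtain x where x: "x \<noteq> 0" "\<And>y. y \<in> span S ==> x \<bullet> y = 0"
      using orthogonal_to_subspace_exists[of S] by (auto simp: Linear_Algebra.orthogonal_def)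
    have "cinner x (v i) = 0" if i: "i < k" for i
    proof (rule complex_eqI)
      have "x \<bullet> v i = 0" "x \<bullet> (\<i> *s v i) = 0"
        using x(2)[OF span_base] i by (auto simp: S_def)
      then show "Re (cinner x (v i)) = Re 0" "Im (cinner x (v i)) = Im 0"
        by (simp_all add: Re_cinner[symmetric] cinner_scale_right)
    qed
    then show ?thesis using x(1) by (intro that[of x]) (auto simp: W_def)
  qed
  obtain p where p: "p \<noteq> 0" "mpoly p g *v x = 0" using annihilating_poly by blast
  obtain y b where y: "y \<in> W" "y \<noteq> 0" "g *v y = b *s y"
    using invariant_subspace_eigenvector[of W g, OF W p(1) x p(2)] by blast
  define u where "u = complex_of_real (1 / norm y) *s y"
  have "cinner u u = of_real (1 / norm y) * (of_real (1 / norm y) * of_real ((norm y)\<^sup>2))"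
    by (simp only: u_def cinner_scale_left cinner_scale_right cinner_self[of y] complex_cnj_complex_of_real)
  also have "... = 1" using y(2) by (simp add: power2_eq_square)
  finally have u: "u \<in> W" "g *v u = b *s u" "cinner u u = 1"
    using y W(3) by (auto simp: u_def matrix_vector_scale vector_smult_assoc mult.commute)
  have orth: "cinner u (v i) = 0" "cinner (v i) u = 0" if "i < k" for i
    using u(1) that cinner_cnj[of u "v i"] by (auto simp: W_def)
  show ?case
    using v u orth
    by (intro exI[of _ "v(k := u)"] exI[of _ "a(k := b)"]) (auto simp: less_Suc_eq)
qed simp

definition orthobasis :: "(nat => complex^'n) => bool" where
  "orthobasis v \<longleftrightarrow> (\<forall>i<CARD('n). \<forall>j<CARD('n). cinner (v i) (v j) = (if i = j then 1 else 0))"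

text \<open>The orthogonal projection onto the line of \<open>v l\<close>.\<close>
definition eproj :: "(nat => complex^'n) => nat => complex^'n^'n" where
  "eproj v l = (\<chi> i j. v l $ i * cnj (v l $ j))"

text \<open>The matrix with orthonormal eigenvectors \<open>v l\<close> and eigenvalues \<open>z l\<close>.\<close>
definition spectral :: "(nat => complex^'n) => (nat => complex) => complex^'n^'n" where
  "spectral v z = (\<chi> i j. \<Sum>l<CARD('n). z l * eproj v l $ i $ j)"

lemma eproj_mult:
  fixes v :: "nat => complex^'n"
  assumes "orthobasis v" "l < CARD('n)" "k < CARD('n)"
  shows "eproj v l ** eproj v k = (if l = k then eproj v l else 0)"
proof -
  have "(eproj v l ** eproj v k) $ i $ j = v l $ i * cnj (v k $ j) * cinner (v k) (v l)" for i j
    by (simp add: matrix_matrix_mult_def eproj_def cinner_def sum_distrib_left mult_ac)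
  then show ?thesis using assms
    by (auto simp: orthobasis_def cart_eq_iff eproj_def)
qed

lemma trace_eproj:
  fixes v :: "nat => complex^'n"
  assumes "orthobasis v" "l < CARD('n)"
  shows "(\<Sum>i\<in>UNIV. eproj v l $ i $ i) = 1"
  using assms by (simp add: orthobasis_def eproj_def cinner_def)

lemma orthobasis_unitary:
  fixes v :: "nat => complex^'n"
  assumes v: "orthobasis v" and f: "bij_betw f UNIV {..<CARD('n)}"
  defines "U \<equiv> (\<chi> i j. v (f j) $ i)"
  shows "hermitian_adjoint U ** U = mat 1" "U ** hermitian_adjoint U = mat 1"
proof -
  have f_less: "f a < CARD('n)" for a using f by (auto simp: bij_betw_def)
  have f_inj: "f a = f b \<longleftrightarrow> a = b" for a b using f by (auto simp: bij_betw_def inj_on_def)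
  have "(hermitian_adjoint U ** U) $ a $ b = cinner (v (f b)) (v (f a))" for a b
    by (simp add: matrix_matrix_mult_def hermitian_adjoint_def cnj_matrix_def
        cart_transpose_def U_def cinner_def mult.commute)
  then show 1: "hermitian_adjoint U ** U = mat 1"
    using v f_less f_inj by (auto simp: orthobasis_def cart_eq_iff mat_nth)
  then show "U ** hermitian_adjoint U = mat 1" by (simp add: matrix_left_right_inverse)
qed

lemma bij_index: obtains f where "bij_betw f (UNIV :: 'n::finite set) {..<CARD('n)}"
  using ex_bij_betw_finite_nat[of "UNIV :: 'n set"] by (auto simp: atLeast0LessThan)

lemma sum_eproj:
  fixes v :: "nat => complex^'n"
  assumes v: "orthobasis v"
  shows "(\<Sum>l<CARD('n). eproj v l $ i $ j) = (if i = j then 1 else 0)"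
proof -
  obtain f :: "'n => nat" where f: "bij_betw f UNIV {..<CARD('n)}" by (rule bij_index)
  define U :: "complex^'n^'n" where "U = (\<chi> i j. v (f j) $ i)"
  have "(U ** hermitian_adjoint U) $ i $ j = (\<Sum>a\<in>UNIV. eproj v (f a) $ i $ j)"
    by (simp add: matrix_matrix_mult_def hermitian_adjoint_def cnj_matrix_def
        cart_transpose_def U_def eproj_def)
  also have "... = (\<Sum>l<CARD('n). eproj v l $ i $ j)"
    by (rule sum.reindex_bij_betw[OF f])
  finally show ?thesis using orthobasis_unitary(2)[OF v f] by (simp add: U_def mat_nth)
qed

lemma spectral_mult:
  fixes v :: "nat => complex^'n"
  assumes v: "orthobasis v"
  shows "spectral v z ** spectral v w = spectral v (%l. z l * w l)"
proof -
  have "(spectral v z ** spectral v w) $ i $ j = spectral v (%l. z l * w l) $ i $ j" for i j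
  proof -
    have "(spectral v z ** spectral v w) $ i $ j =
        (\<Sum>m\<in>UNIV. \<Sum>l<CARD('n). \<Sum>k<CARD('n). z l * w k * (eproj v l $ i $ m * eproj v k $ m $ j))"
      by (simp only: matrix_matrix_mult_def spectral_def vec_lambda_beta sum_product) (simp only: mult_ac)
    also have "... = (\<Sum>l<CARD('n). \<Sum>k<CARD('n). \<Sum>m\<in>UNIV. z l * w k * (eproj v l $ i $ m * eproj v k $ m $ j))"
      by (subst sum.swap, intro sum.cong refl, rule sum.swap)
    also have "... = (\<Sum>l<CARD('n). \<Sum>k<CARD('n). z l * w k * (eproj v l ** eproj v k) $ i $ j)"
      by (simp add: matrix_matrix_mult_def sum_distrib_left)
    also have "... = (\<Sum>l<CARD('n). \<Sum>k<CARD('n). if l = k then z l * w k * eproj v l $ i $ j else 0)"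
      by (intro sum.cong refl) (simp add: eproj_mult[OF v])
    also have "... = spectral v (%l. z l * w l) $ i $ j" by (simp add: spectral_def)
    finally show ?thesis .
  qed
  then show ?thesis by (simp add: cart_eq_iff)
qed

lemma spectral_const: "orthobasis v ==> spectral v (%_. c) = mat c"
  by (simp add: spectral_def cart_eq_iff mat_nth sum_eproj flip: sum_distrib_left)

lemma spectral_adjoint: "hermitian_adjoint (spectral v z) = spectral v (%l. cnj (z l))"
  by (simp add: hermitian_adjoint_def cnj_matrix_def cart_transpose_def
      spectral_def cart_eq_iff eproj_def mult_ac)

lemma spectral_cong:
  fixes v :: "nat => complex^'n"
  shows "(\<And>l. l < CARD('n) ==> z l = w l) ==> spectral v z = spectral v w"
  by (simp add: spectral_def)

lemma spectral_power: "orthobasis v ==> matrix_power (spectral v z) k = spectral v (%l. z l ^ k)"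
proof (induction k)
  case (Suc k)
  then show ?case by (simp add: matrix_power_def spectral_mult)
qed (simp add: matrix_power_def spectral_const)

lemma spectral_unitary:
  fixes v :: "nat => complex^'n"
  assumes v: "orthobasis v" and z: "\<And>l. l < CARD('n) ==> norm (z l) = 1"
  shows "spectral v z \<in> unitary_group"
proof -
  have "z l * cnj (z l) = 1" if "l < CARD('n)" for l
    using z[OF that] by (simp add: complex_norm_square[symmetric])
  then have "spectral v (%l. z l * cnj (z l)) = mat 1" "spectral v (%l. cnj (z l) * z l) = mat 1"
    using spectral_const[OF v, of 1] spectral_cong[of "%l. z l * cnj (z l)" "%_. 1" v] by (simp_all add: mult.commute)
  then show ?thesis
    using spectral_mult[OF v] spectral_adjoint[of v z] by (simp add: unitary_group_def hermitian_adjoint_def)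
qed

lemma det_spectral:
  fixes v :: "nat => complex^'n"
  assumes v: "orthobasis v"
  shows "det (spectral v w) = (\<Prod>l<CARD('n). w l)"
proof -
  obtain f :: "'n => nat" where f: "bij_betw f UNIV {..<CARD('n)}" by (rule bij_index)
  define U :: "complex^'n^'n" where "U = (\<chi> i j. v (f j) $ i)"
  define E :: "complex^'n^'n" where "E = (\<chi> i j. if i = j then w (f i) else 0)"
  have "(U ** E ** hermitian_adjoint U) $ i $ j = spectral v w $ i $ j" for i j
  proof -
    have UE: "(U ** E) $ i $ a = v (f a) $ i * w (f a)" for a
      by (simp add: matrix_matrix_mult_def U_def E_def if_distrib if_distribR cong: if_cong)
    have "(U ** E ** hermitian_adjoint U) $ i $ j = (\<Sum>a\<in>UNIV. (U ** E) $ i $ a * hermitian_adjoint U $ a $ j)"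
      by (simp add: matrix_matrix_mult_def)
    also have "... = (\<Sum>a\<in>UNIV. w (f a) * eproj v (f a) $ i $ j)"
      unfolding UE by (simp add: hermitian_adjoint_def cnj_matrix_def
        cart_transpose_def U_def eproj_def mult_ac)
    also have "... = (\<Sum>l<CARD('n). w l * eproj v l $ i $ j)"
      using sum.reindex_bij_betw[OF f, of "%l. w l * eproj v l $ i $ j"] .
    finally show ?thesis by (simp add: spectral_def)
  qed
  then have "spectral v w = U ** E ** hermitian_adjoint U" by (simp add: cart_eq_iff)
  then have "det (spectral v w) = det E * det (U ** hermitian_adjoint U)"
    by (simp add: det_mul mult_ac)
  also have "U ** hermitian_adjoint U = mat 1" using orthobasis_unitary(2)[OF v f] by (simp add: U_def)
  also have "det E = (\<Prod>a\<in>UNIV. w (f a))" unfolding E_def by (subst Determinants.det_diagonal) auto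
  also have "... = (\<Prod>l<CARD('n). w l)" by (rule prod.reindex_bij_betw[OF f])
  finally show ?thesis by simp
qed

lemma char_roots_spectral:
  fixes v :: "nat => complex^'n"
  assumes v: "orthobasis v"
  shows "char_roots (spectral v z) z"
  unfolding char_roots_def
proof
  fix x
  have "mat x - spectral v z = spectral v (%l. x - z l)"
    by (simp add: spectral_const[OF v, of x, symmetric])
       (simp add: spectral_def cart_eq_iff algebra_simps sum_subtractf)
  then show "det (mat x - spectral v z) = (\<Prod>k<CARD('n). x - z k)" by (simp add: det_spectral[OF v])
qed

theorem unitary_spectral:
  fixes g :: "complex^'n^'n"
  assumes g: "g \<in> unitary_group"
  obtains v z where "orthobasis v" "g = spectral v z" "\<And>l. l < CARD('n) ==> norm (z l) = 1"
proof -
  obtain v z where v: "\<forall>i<CARD('n). g *v v i = z i *s v i"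
    and o: "\<forall>i<CARD('n). \<forall>j<CARD('n). cinner (v i) (v j) = (if i = j then 1 else 0)"
    using unitary_orthonormal_eigenvectors[OF g order.refl] by blast
  have ov: "orthobasis v" using o by (simp add: orthobasis_def)
  have "norm (z l) = 1" if "l < CARD('n)" for l
  proof -
    have "cinner (v l) (v l) = cinner (z l *s v l) (z l *s v l)"
      using unitary_cinner[OF g, of "v l" "v l"] v that by simp
    then have "cnj (z l) * z l = 1" using o that by (simp add: cinner_scale_left cinner_scale_right)
    then have "z l * cnj (z l) = 1" by (simp only: mult.commute)
    then have "complex_of_real ((norm (z l))\<^sup>2) = 1" by (simp only: complex_norm_square)
    then have "(norm (z l))\<^sup>2 = 1" by (simp only: of_real_eq_1_iff)
    then show ?thesis by (simp add: power2_eq_1_iff) (metis norm_ge_zero not_one_le_zero neg_0_le_iff_le)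
  qed
  moreover have "g = spectral v z"
  proof -
    have "g $ i $ j = spectral v z $ i $ j" for i j
    proof -
      have "g $ i $ j = (\<Sum>m\<in>UNIV. g $ i $ m * (\<Sum>l<CARD('n). eproj v l $ m $ j))"
        by (simp add: sum_eproj[OF ov] if_distrib cong: if_cong)
      also have "... = (\<Sum>l<CARD('n). (\<Sum>m\<in>UNIV. g $ i $ m * v l $ m) * cnj (v l $ j))"
        unfolding sum_distrib_left sum_distrib_right by (subst sum.swap) (simp add: eproj_def mult_ac)
      also have "... = (\<Sum>l<CARD('n). (g *v v l) $ i * cnj (v l $ j))"
        by (simp add: matrix_vector_mult_def)
      also have "... = spectral v z $ i $ j" using v by (simp add: spectral_def eproj_def mult_ac)
      finally show ?thesis .
    qed
    then show ?thesis by (simp add: cart_eq_iff)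
  qed
  ultimately show ?thesis using that ov by blast
qed

text \<open>The eigenvalues may be listed in a prescribed order, because the eigenvectors can be
  rearranged accordingly.\<close>
lemma unitary_spectral_roots:
  fixes g :: "complex^'n^'n"
  assumes g: "g \<in> unitary_group" and w: "char_roots g w"
  obtains v where "orthobasis v" "g = spectral v w" "\<And>l. l < CARD('n) ==> norm (w l) = 1"
proof -
  obtain v z where v: "orthobasis v" "g = spectral v z" "\<And>l. l < CARD('n) ==> norm (z l) = 1"
    using unitary_spectral[OF g] by blast
  have "char_roots g z" using char_roots_spectral v by blast
  then obtain p where p: "p permutes {..<CARD('n)}" "\<And>k. k < CARD('n) ==> w k = z (p k)"
    using char_roots_unique[OF _ w] by blast
  have less: "p k < CARD('n)" if "k < CARD('n)" for k using p(1) that permutes_in_image by (metis lessThan_iff)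
  have inj: "p i = p j \<longleftrightarrow> i = j" for i j using permutes_inj[OF p(1)] by (auto dest: injD)
  have "orthobasis (v \<circ> p)" using v(1) less inj by (simp add: orthobasis_def)
  moreover have "g = spectral (v \<circ> p) w"
  proof -
    have "(\<Sum>l<CARD('n). z l * eproj v l $ i $ j) = (\<Sum>l<CARD('n). w l * eproj (v \<circ> p) l $ i $ j)" for i j
      using sum.permute[OF p(1), of "%l. z l * eproj v l $ i $ j"] p(2) by (simp add: comp_def eproj_def)
    then show ?thesis unfolding v(2) spectral_def by simp
  qed
  moreover have "norm (w l) = 1" if "l < CARD('n)" for l using v(3) p(2) less that by simp
  ultimately show ?thesis using that by blast
qed

text \<open>The eigenvalues in the order of the arguments that define the characters, counted from 0.\<close>
definition eigs :: "complex^'n^'n => nat => complex" where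
  "eigs g k = cis (eigen_angles g (Suc k))"

lemma char_roots_eigs:
  fixes g :: "complex^'n^'n"
  assumes g: "g \<in> unitary_group"
  shows "char_roots g (eigs g)"
proof -
  obtain v z where v: "orthobasis v" "g = spectral v z" "\<And>l. l < CARD('n) ==> norm (z l) = 1"
    using unitary_spectral[OF g] by blast
  have "z l = cis (Arg (z l))" if "l < CARD('n)" for l
    using rcis_cmod_Arg[of "z l"] v(3)[OF that] by (simp add: rcis_def)
  then have "det (mat x - g) = (\<Prod>k=1..CARD('n). x - cis (Arg (z (k - 1))))" for x
    using char_roots_spectral[OF v(1), of z] by (simp add: char_roots_def v(2) prod.atLeast1_atMost_eq)
  then have "\<exists>\<psi>. \<forall>x. det (mat x - g) = (\<Prod>k=1..CARD('n). x - cis (\<psi> k))"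
    by (intro exI[of _ "%k. Arg (z (k - 1))"] allI)
  then have "\<forall>x. det (mat x - g) = (\<Prod>k=1..CARD('n). x - cis (eigen_angles g k))"
    unfolding eigen_angles_def by (rule someI_ex)
  then show ?thesis by (simp add: char_roots_def eigs_def prod.atLeast1_atMost_eq)
qed

lemma distinct_eigenvalues_iff:
  fixes g :: "complex^'n^'n"
  shows "distinct_eigenvalues g \<longleftrightarrow> inj_on (eigs g) {..<CARD('n)}"
proof -
  have "inj_on (%k. cis (eigen_angles g k)) {1..CARD('n)} \<longleftrightarrow> inj_on ((%k. cis (eigen_angles g k)) \<circ> Suc) {..<CARD('n)}"
    unfolding image_Suc_lessThan[symmetric] by (rule comp_inj_on_iff) simp
  moreover have "eigs g = (%k. cis (eigen_angles g k)) \<circ> Suc" by (simp add: eigs_def fun_eq_iff)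
  ultimately show ?thesis by (simp add: distinct_eigenvalues_def)
qed

lemma inj_on_char_roots:
  fixes g :: "complex^'n^'n"
  assumes "char_roots g z" "char_roots g w" "inj_on z {..<CARD('n)}"
  shows "inj_on w {..<CARD('n)}"
proof -
  obtain p where p: "p permutes {..<CARD('n)}" "\<And>k. k < CARD('n) ==> w k = z (p k)"
    using char_roots_unique[OF assms(1,2)] by blast
  have less: "p k < CARD('n)" if "k < CARD('n)" for k using p(1) that permutes_in_image by (metis lessThan_iff)
  show ?thesis
  proof (rule inj_onI)
    fix i j assume ij: "i \<in> {..<CARD('n)}" "j \<in> {..<CARD('n)}" "w i = w j"
    then have "z (p i) = z (p j)" using p(2) by simp
    then have "p i = p j" using assms(3) less ij by (meson inj_onD lessThan_iff)
    then show "i = j" using permutes_inj[OF p(1)] by (meson injD)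
  qed
qed

text \<open>Closed, and bounded because the columns are unit vectors.\<close>
lemma compact_unitary_group: "compact (unitary_group :: (complex^'n^'n) set)"
proof -
  have "continuous_on UNIV (%z::complex^'n^'n. \<chi> i j. \<Sum>k\<in>UNIV. z $ i $ k * cnj (z $ j $ k))"
    "continuous_on UNIV (%z::complex^'n^'n. \<chi> i j. \<Sum>k\<in>UNIV. cnj (z $ k $ i) * z $ k $ j)"
    by (intro continuous_on_vec_lambda continuous_intros)+
  then have cont: "continuous_on UNIV (%z::complex^'n^'n. z ** transpose (cnj_matrix z))"
    "continuous_on UNIV (%z::complex^'n^'n. transpose (cnj_matrix z) ** z)"
    by (simp_all add: matrix_matrix_mult_def cart_transpose_def cnj_matrix_def)
  have "closed {z::complex^'n^'n. z ** transpose (cnj_matrix z) = mat 1}"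
    "closed {z::complex^'n^'n. transpose (cnj_matrix z) ** z = mat 1}"
    using cont by (auto intro!: closed_Collect_eq continuous_on_const)
  then have "closed (unitary_group :: (complex^'n^'n) set)"
    unfolding unitary_group_def by (simp add: Collect_conj_eq closed_Int)
  moreover have "bounded (unitary_group :: (complex^'n^'n) set)"
  proof (rule boundedI)
    fix g :: "complex^'n^'n" assume g: "g \<in> unitary_group"
    have "norm (g $ i $ j) \<le> 1" for i j
    proof -
      have "norm (g $ i $ j) \<le> norm ((g *v axis j 1) $ i)"
        by (simp add: matrix_vector_mult_def axis_def if_distrib cong: if_cong)
      also have "... \<le> norm (g *v axis j 1)" by (rule Finite_Cartesian_Product.norm_nth_le)
      also have "... = 1" by (simp add: unitary_norm[OF g])
      finally show ?thesis .
    qed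
    then have "norm (g $ i) \<le> (\<Sum>j::'n\<in>UNIV. 1)" for i
      unfolding norm_vec_def[of "g $ i"] by (intro order.trans[OF L2_set_le_sum] sum_mono) auto
    then have "norm (g $ i) \<le> real CARD('n)" for i by simp
    then have "norm g \<le> (\<Sum>i::'n\<in>UNIV. real CARD('n))"
      unfolding norm_vec_def[of g] by (intro order.trans[OF L2_set_le_sum] sum_mono) auto
    then show "norm g \<le> real CARD('n) * real CARD('n)" by simp
  qed
  ultimately show ?thesis by (simp add: compact_eq_bounded_closed)
qed

text \<open>Turn the eigenvalues in a spectral decomposition apart by different small
  angles.\<close>
lemma distinct_eigenvalues_dense:
  fixes g :: "complex^'n^'n"
  assumes g: "g \<in> unitary_group"
  obtains h where "\<And>i. h i \<in> unitary_group" "\<And>i. distinct_eigenvalues (h i)" "h \<longlonglongrightarrow> g"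
proof -
  obtain v z where v: "orthobasis v" "g = spectral v z" "\<And>l. l < CARD('n) ==> norm (z l) = 1"
    using unitary_spectral[OF g] by blast
  define e where "e N = 1 / (real N + real CARD('n) + 1)" for N
  have e_lim: "e \<longlonglongrightarrow> 0" unfolding e_def by real_asymp
  have e_pos: "e N > 0" "e N * real CARD('n) < 1" for N by (simp_all add: e_def field_simps)
  define w where "w N l = z l * cis (e N * real l)" for N l
  have w_lim: "(%N. w N l) \<longlonglongrightarrow> z l" for l
  proof -
    have "(%N. z l * cis (e N * real l)) \<longlonglongrightarrow> z l * cis (0 * real l)"
      by (intro tendsto_intros e_lim)
    then show ?thesis by (simp add: w_def)
  qed
  have norm_w: "norm (w N l) = 1" if "l < CARD('n)" for N l
    using v(3)[OF that] by (simp add: w_def norm_mult)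
  have ev: "\<forall>\<^sub>F N in sequentially. w N l \<noteq> w N k" if lk: "l < CARD('n)" "k < CARD('n)" "l \<noteq> k" for l k
  proof (cases "z l = z k")
    case True
    have "w N l \<noteq> w N k" for N
    proof
      assume "w N l = w N k"
      then have "cis (e N * real l) = cis (e N * real k)"
        using True v(3)[OF lk(1)] by (auto simp: w_def)
      then have "cos (e N * real l) = cos (e N * real k)" by (metis cis.sel(1))
      moreover have "e N * real l \<le> pi" "e N * real k \<le> pi" "0 \<le> e N * real l" "0 \<le> e N * real k"
      proof -
        have "e N * real j \<le> e N * real CARD('n)" if "j < CARD('n)" for j
          using that e_pos(1)[of N] by (intro mult_left_mono) auto
        then show "e N * real l \<le> pi" "e N * real k \<le> pi"
          using e_pos(2)[of N] lk(1,2) pi_gt3 by fastforce+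
      qed (use e_pos(1)[of N] in auto)
      ultimately have "e N * real l = e N * real k" using cos_inj_pi by blast
      then show False using e_pos(1)[of N] lk by simp
    qed
    then show ?thesis by simp
  next
    case False
    have "(%N. w N l - w N k) \<longlonglongrightarrow> z l - z k" by (intro tendsto_diff w_lim)
    then have "\<forall>\<^sub>F N in sequentially. w N l - w N k \<noteq> 0"
      using False by (intro tendsto_imp_eventually_ne) auto
    then show ?thesis by eventually_elim auto
  qed
  have "\<forall>\<^sub>F N in sequentially. \<forall>(l, k)\<in>{(l, k). l < CARD('n) \<and> k < CARD('n) \<and> l \<noteq> k}. w N l \<noteq> w N k"
  proof (rule eventually_ball_finite)
    show "finite {(l, k). l < CARD('n) \<and> k < CARD('n) \<and> l \<noteq> k}"
      by (rule finite_subset[of _ "{..<CARD('n)} \<times> {..<CARD('n)}"]) auto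
  qed (use ev in auto)
  then obtain N0 where N0: "\<And>N l k. N \<ge> N0 ==> l < CARD('n) ==> k < CARD('n) ==> l \<noteq> k ==> w N l \<noteq> w N k"
    unfolding eventually_sequentially by fast
  show ?thesis
  proof (rule that[of "%N. spectral v (w (N + N0))"])
    fix N
    show "spectral v (w (N + N0)) \<in> unitary_group" by (intro spectral_unitary v norm_w)
    then show "distinct_eigenvalues (spectral v (w (N + N0)))"
      unfolding distinct_eigenvalues_iff
      by (rule inj_on_char_roots[OF char_roots_spectral[OF v(1)] char_roots_eigs])
         (use N0[of "N + N0"] in \<open>auto simp: inj_on_def\<close>)
  next
    have "(%N. spectral v (w N)) \<longlonglongrightarrow> spectral v z"
      unfolding spectral_def by (intro tendsto_vec_lambda tendsto_sum tendsto_mult_right w_lim)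
    then show "(%N. spectral v (w (N + N0))) \<longlonglongrightarrow> g"
      unfolding v(2) by (rule LIMSEQ_ignore_initial_segment)
  qed
qed

lemma tendsto_det: "(A \<longlongrightarrow> B) F ==> ((%i. det (A i :: complex^'n^'n)) \<longlongrightarrow> det B) F"
  unfolding cart_det_def by (intro tendsto_intros tendsto_vec_nth)

text \<open>Continuity of the roots, for multiplicative symmetric functions.  By compactness the root
  tuples have limit points, and each of them is a root tuple of the limit.\<close>
theorem tendsto_prod_char_roots:
  fixes A :: "nat => complex^'n^'n" and f :: "complex => complex"
  assumes lim: "A \<longlonglongrightarrow> B" and roots: "\<And>i. char_roots (A i) (z i)" "char_roots B w"
    and z: "\<And>i k. k < CARD('n) ==> norm (z i k) \<le> 1"
    and f: "\<And>k. k < CARD('n) ==> continuous (at (w k) within cball 0 1) f"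
  shows "(%i. \<Prod>k<CARD('n). f (z i k)) \<longlonglongrightarrow> (\<Prod>k<CARD('n). f (w k))"
proof (rule ccontr)
  assume "\<not> ?thesis"
  then obtain e where e: "e > 0" "\<not> (\<forall>\<^sub>F i in sequentially. dist (\<Prod>k<CARD('n). f (z i k)) (\<Prod>k<CARD('n). f (w k)) < e)"
    unfolding tendsto_iff by blast
  then have "infinite {i. \<not> dist (\<Prod>k<CARD('n). f (z i k)) (\<Prod>k<CARD('n). f (w k)) < e}"
    by (simp add: not_eventually cofinite_eq_sequentially[symmetric] INFM_iff_infinite)
  then obtain r :: "nat => nat" where r: "strict_mono r"
    "\<And>i. \<not> dist (\<Prod>k<CARD('n). f (z (r i) k)) (\<Prod>k<CARD('n). f (w k)) < e"
    by (auto dest: infinite_enumerate)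
  obtain b :: "'n => nat" where b: "bij_betw b UNIV {..<CARD('n)}" by (rule bij_index)
  have b_less: "b a < CARD('n)" for a using b by (auto simp: bij_betw_def)
  define y where "y i = (\<chi> a. z (r i) (b a))" for i
  have "norm (y i) \<le> real CARD('n)" for i
  proof -
    have "norm (y i) \<le> (\<Sum>a\<in>UNIV. norm (y i $ a))" unfolding norm_vec_def by (rule L2_set_le_sum) auto
    also have "... \<le> (\<Sum>a::'n\<in>UNIV. 1)" using z b_less by (intro sum_mono) (auto simp: y_def)
    finally show ?thesis by simp
  qed
  then have "bounded (range y)" by (auto intro: boundedI)
  then obtain l q where q: "strict_mono q" "(y \<circ> q) \<longlonglongrightarrow> l"
    using bounded_imp_convergent_subsequence by blast
  define u where "u k = l $ inv_into UNIV b k" for k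
  have u_lim: "(%i. z (r (q i)) k) \<longlonglongrightarrow> u k" if "k < CARD('n)" for k
  proof -
    have "b (inv_into UNIV b k) = k" using b that by (auto simp: bij_betw_def f_inv_into_f)
    then show ?thesis using tendsto_vec_nth[OF q(2), of "inv_into UNIV b k"] by (simp add: y_def u_def comp_def)
  qed
  have "char_roots B u"
    unfolding char_roots_def
  proof
    fix x
    have rq: "strict_mono (r \<circ> q)" using r q by (simp add: strict_mono_o)
    have "(%i. det (mat x - A (r (q i)))) \<longlonglongrightarrow> det (mat x - B)"
      using LIMSEQ_subseq_LIMSEQ[OF lim rq] by (intro tendsto_det tendsto_intros) (simp add: comp_def)
    moreover have "(%i. det (mat x - A (r (q i)))) \<longlonglongrightarrow> (\<Prod>k<CARD('n). x - u k)"
      using roots(1) unfolding char_roots_def by (simp, intro tendsto_intros u_lim) auto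
    ultimately show "det (mat x - B) = (\<Prod>k<CARD('n). x - u k)" by (rule LIMSEQ_unique)
  qed
  then obtain p where p: "p permutes {..<CARD('n)}" "\<And>k. k < CARD('n) ==> u k = w (p k)"
    using char_roots_unique[OF roots(2)] by blast
  have p_less: "p k < CARD('n)" if "k < CARD('n)" for k using p(1) that permutes_in_image by (metis lessThan_iff)
  have "(%i. \<Prod>k<CARD('n). f (z (r (q i)) k)) \<longlonglongrightarrow> (\<Prod>k<CARD('n). f (u k))"
  proof (rule tendsto_prod)
    fix k assume "k \<in> {..<CARD('n)}"
    then have k: "k < CARD('n)" by simp
    have "continuous (at (u k) within cball 0 1) f" using f[OF p_less[OF k]] p(2)[OF k] by simp
    then show "(%i. f (z (r (q i)) k)) \<longlonglongrightarrow> f (u k)"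
      using u_lim[OF k] z[OF k] unfolding continuous_within_sequentially by (auto simp: comp_def)
  qed
  also have "(\<Prod>k<CARD('n). f (u k)) = (\<Prod>k<CARD('n). f (w k))"
    using prod.permute[OF p(1), of "%k. f (w k)"] p(2) by (simp add: comp_def)
  finally have "\<forall>\<^sub>F i in sequentially. dist (\<Prod>k<CARD('n). f (z (r (q i)) k)) (\<Prod>k<CARD('n). f (w k)) < e"
    using e(1) by (simp add: tendsto_iff)
  then show False using r(2) by (auto simp: eventually_sequentially)
qed

section \<open>The Casimir operator\<close>

text \<open>The matrix units span the complexified Lie algebra of the unitary group.  The skew-hermitian
  matrices \<open>Xmat i j\<close> and \<open>Ymat i j\<close> are their real and imaginary parts:
  \<open>Emat i j = (Xmat i j - \<i> * Ymat i j) / 2\<close>.\<close>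
definition Emat :: "'n => 'n => complex^'n^'n" where
  "Emat i j = (\<chi> a b. if a = i \<and> b = j then 1 else 0)"

definition Xmat :: "'n => 'n => complex^'n^'n" where
  "Xmat i j = Emat i j - Emat j i"

definition Ymat :: "'n => 'n => complex^'n^'n" where
  "Ymat i j = mat \<i> ** (Emat i j + Emat j i)"

text \<open>The left invariant derivative in the direction of \<open>Emat i j\<close>, extended complex linearly from
  the Lie algebra.  The real derivative of a smooth function is not complex linear, so the derivative
  along \<open>g ** Emat i j\<close> itself would be another operator.\<close>
definition lieD :: "'n => 'n => (complex^'n^'n => complex) => complex^'n^'n => complex" where
  "lieD i j F g = (frechet_derivative F (at g) (g ** Xmat i j) -
     \<i> * frechet_derivative F (at g) (g ** Ymat i j)) / 2"

text \<open>The Casimir operator of the Lie algebra of all complex matrices in its standard basis.\<close>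
definition casimir :: "(complex^'n^'n => complex) => complex^'n^'n => complex" where
  "casimir F g = (\<Sum>i\<in>UNIV. \<Sum>j\<in>UNIV. lieD i j (lieD j i F) g)"

lemma bounded_linear_matrix_mult_right: "bounded_linear (%x :: complex^'n^'n. x ** M)"
proof -
  have "linear (%x :: complex^'n^'n. x ** M)"
    by (rule linearI) (simp_all add: matrix_matrix_mult_def cart_eq_iff
        algebra_simps sum.distrib scaleR_sum_right)
  then show ?thesis by (simp add: linear_conv_bounded_linear)
qed

lemma lieD_mult:
  assumes "F differentiable (at g)" "G differentiable (at g)"
  shows "lieD i j (%x. F x * G x) g = F g * lieD i j G g + lieD i j F g * G g"
  unfolding lieD_def frechet_derivative_mult[OF assms] by (simp add: algebra_simps add_divide_distrib diff_divide_distrib)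

lemma lieD_add:
  assumes "F differentiable (at g)" "G differentiable (at g)"
  shows "lieD i j (%x. F x + G x) g = lieD i j F g + lieD i j G g"
  unfolding lieD_def frechet_derivative_add[OF assms] by (simp add: algebra_simps add_divide_distrib diff_divide_distrib)

lemma lieD_const [simp]: "lieD i j (%x. c) g = 0"
  by (simp add: lieD_def frechet_derivative_const)

lemma lieD_cmult:
  assumes "F differentiable (at g)"
  shows "lieD i j (%x. c * F x) g = c * lieD i j F g"
  using lieD_mult[of "%_. c" g F] assms by simp

lemma lieD_sum:
  assumes "\<And>a. a \<in> S ==> F a differentiable (at g)"
  shows "lieD i j (%x. \<Sum>a\<in>S. F a x) g = (\<Sum>a\<in>S. lieD i j (F a) g)"
  using assms
proof (induction S rule: infinite_finite_induct)
  case (insert a S)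
  then show ?case using lieD_add[of "F a" g "%x. \<Sum>a\<in>S. F a x"] by simp
qed simp_all

lemma lieD_prod:
  assumes "finite S" "\<And>a. a \<in> S ==> F a differentiable (at g)"
  shows "lieD i j (%x. \<Prod>a\<in>S. F a x) g = (\<Sum>a\<in>S. lieD i j (F a) g * (\<Prod>b\<in>S - {a}. F b g))
    \<and> (%x. \<Prod>a\<in>S. F a x) differentiable (at g)"
  using assms
proof (induction S rule: finite_induct)
  case (insert a S)
  have IH: "lieD i j (%x. \<Prod>a\<in>S. F a x) g = (\<Sum>a\<in>S. lieD i j (F a) g * (\<Prod>b\<in>S - {a}. F b g))"
    "(%x. \<Prod>a\<in>S. F a x) differentiable (at g)"
    using insert by auto
  have a: "F a differentiable (at g)" using insert by simp
  have "(\<Sum>c\<in>S. lieD i j (F c) g * (\<Prod>b\<in>insert a S - {c}. F b g)) =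
      F a g * (\<Sum>c\<in>S. lieD i j (F c) g * (\<Prod>b\<in>S - {c}. F b g))"
    unfolding sum_distrib_left
  proof (intro sum.cong refl)
    fix c assume c: "c \<in> S"
    then have "insert a S - {c} = insert a (S - {c})" "a \<notin> S - {c}" using insert by auto
    then show "lieD i j (F c) g * (\<Prod>b\<in>insert a S - {c}. F b g) =
        F a g * (lieD i j (F c) g * (\<Prod>b\<in>S - {c}. F b g))"
      using insert by simp
  qed
  moreover have "insert a S - {a} = S" using insert by auto
  ultimately show ?case
    using lieD_mult[OF a IH(2), of i j] IH insert a by (simp add: differentiable_mult)
qed simp

lemma smooth_on_lieD:
  assumes "open V" "smooth_on V F"
  shows "smooth_on V (lieD i j F)"
proof -
  have "smooth_on V (%g. (1 / 2) * (frechet_derivative F (at g) (g ** Xmat i j) +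
      (- \<i>) * frechet_derivative F (at g) (g ** Ymat i j)))"
    by (intro smooth_on_cmult smooth_on_add smooth_on_linear_field assms bounded_linear_matrix_mult_right)
  then show ?thesis by (rule smooth_on_cong[OF assms(1)]) (simp add: lieD_def)
qed

lemma smooth_on_casimir: "open V ==> smooth_on V F ==> smooth_on V (casimir F)"
  unfolding casimir_def[abs_def] by (intro smooth_on_sum smooth_on_lieD)

lemma bounded_linear_entry: "bounded_linear (%g :: complex^'n^'n. g $ a $ b)"
  by (rule bounded_linear_compose[OF bounded_linear_vec_nth bounded_linear_vec_nth])

lemma bounded_linear_cnj_entry: "bounded_linear (%g :: complex^'n^'n. cnj (g $ a $ b))"
  by (rule bounded_linear_compose[OF bounded_linear_cnj bounded_linear_entry])

lemma frechet_derivative_bounded_linear: "bounded_linear L ==> frechet_derivative L (at x) = L"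
  using frechet_derivative_at[OF bounded_linear_imp_has_derivative] by metis

lemma times_Emat_nth: "(g ** Emat i j) $ a $ b = (if b = j then g $ a $ i else 0)"
  by (simp add: matrix_matrix_mult_def Emat_def if_distrib cong: if_cong)

lemma times_Xmat_nth: "(g ** Xmat i j) $ a $ b = (if b = j then g $ a $ i else 0) - (if b = i then g $ a $ j else 0)"
proof -
  have "g ** Xmat i j = g ** Emat i j - g ** Emat j i"
    by (simp add: Xmat_def matrix_matrix_mult_def cart_eq_iff algebra_simps sum_subtractf)
  then show ?thesis by (simp add: times_Emat_nth)
qed

lemma times_Ymat_nth: "(g ** Ymat i j) $ a $ b = \<i> * ((if b = j then g $ a $ i else 0) + (if b = i then g $ a $ j else 0))"
proof -
  have "(g ** Ymat i j) $ a $ b = \<i> * ((g ** Emat i j) $ a $ b + (g ** Emat j i) $ a $ b)"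
    by (simp add: Ymat_def matrix_matrix_mult_def[of g] mat_times_nth algebra_simps sum.distrib sum_distrib_left)
  then show ?thesis by (simp add: times_Emat_nth)
qed

lemma lieD_entry: "lieD i j (%g. g $ a $ b) g = (if b = j then g $ a $ i else 0)"
  unfolding lieD_def frechet_derivative_bounded_linear[OF bounded_linear_entry] times_Xmat_nth times_Ymat_nth
  by (auto simp: algebra_simps)

lemma lieD_cnj_entry: "lieD i j (%g. cnj (g $ a $ b)) g = (if b = i then - cnj (g $ a $ j) else 0)"
  unfolding lieD_def frechet_derivative_bounded_linear[OF bounded_linear_cnj_entry] times_Xmat_nth times_Ymat_nth
  by (auto simp: algebra_simps)

lemma smooth_on_entry: "smooth_on V (%g :: complex^'n^'n. g $ a $ b)"
  by (rule smooth_on_linear[OF bounded_linear_entry])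

lemma matrix_power_Suc_nth: "matrix_power g (Suc k) $ a $ b = (\<Sum>m\<in>UNIV. g $ a $ m * matrix_power g k $ m $ b)"
  by (simp add: matrix_power_def matrix_matrix_mult_def)

lemma smooth_on_matrix_power: "smooth_on UNIV (%g. matrix_power g k $ a $ b)"
proof (induction k arbitrary: a b)
  case 0
  then show ?case by (simp add: matrix_power_def smooth_on_const)
next
  case (Suc k)
  show ?case unfolding matrix_power_Suc_nth
    by (intro smooth_on_sum smooth_on_mult smooth_on_entry Suc open_UNIV)
qed

lemma smooth_differentiable: "smooth_on UNIV f ==> f differentiable (at x)"
  using smooth_onD(1) by blast

text \<open>Leibniz rule for the product of the factors \<open>g\<close>.\<close>
lemma lieD_matrix_power:
  "lieD i j (%g. matrix_power g k $ a $ b) g =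
    (\<Sum>c<k. matrix_power g (Suc c) $ a $ i * matrix_power g (k - 1 - c) $ j $ b)"
proof (induction k arbitrary: a b)
  case 0
  then show ?case by (simp add: matrix_power_def)
next
  case (Suc k)
  have diff: "(%g. g $ a $ m) differentiable (at g)" "(%g. matrix_power g k $ m $ b) differentiable (at g)"
    "(%g. g $ a $ m * matrix_power g k $ m $ b) differentiable (at g)" for m
    by (intro smooth_differentiable smooth_on_entry smooth_on_matrix_power smooth_on_mult open_UNIV)+
  have "lieD i j (%g. matrix_power g (Suc k) $ a $ b) g =
      (\<Sum>m\<in>UNIV. g $ a $ m * lieD i j (%g. matrix_power g k $ m $ b) g + lieD i j (%g. g $ a $ m) g * matrix_power g k $ m $ b)"
    unfolding matrix_power_Suc_nth using diff by (simp add: lieD_sum lieD_mult)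
  also have "... = (\<Sum>m\<in>UNIV. g $ a $ m * (\<Sum>c<k. matrix_power g (Suc c) $ m $ i * matrix_power g (k - 1 - c) $ j $ b)) +
      g $ a $ i * matrix_power g k $ j $ b"
  proof -
    have "(if m = j then g $ a $ i else 0) * matrix_power g k $ m $ b =
        (if m = j then g $ a $ i * matrix_power g k $ j $ b else 0)" for m by simp
    then show ?thesis unfolding Suc lieD_entry sum.distrib by simp
  qed
  also have "(\<Sum>m\<in>UNIV. g $ a $ m * (\<Sum>c<k. matrix_power g (Suc c) $ m $ i * matrix_power g (k - 1 - c) $ j $ b)) =
      (\<Sum>c<k. matrix_power g (Suc (Suc c)) $ a $ i * matrix_power g (k - 1 - c) $ j $ b)"
    unfolding sum_distrib_left matrix_power_Suc_nth[of g "Suc _"] sum_distrib_right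
    by (subst sum.swap) (simp add: mult.assoc)
  also have "g $ a $ i * matrix_power g k $ j $ b = matrix_power g (Suc 0) $ a $ i * matrix_power g k $ j $ b"
    by (simp add: matrix_power_def)
  finally show ?case by (simp add: sum.lessThan_Suc_shift del: sum.lessThan_Suc)
qed

lemma matrix_power_add_nth:
  "(\<Sum>m\<in>UNIV. matrix_power g a $ i $ m * matrix_power g b $ m $ j) = matrix_power g (a + b) $ i $ j"
proof (induction a arbitrary: i)
  case 0
  then show ?case by (simp add: matrix_power_def mat_nth if_distrib if_distribR cong: if_cong)
next
  case (Suc a)
  have "(\<Sum>m\<in>UNIV. matrix_power g (Suc a) $ i $ m * matrix_power g b $ m $ j) =
      (\<Sum>l\<in>UNIV. g $ i $ l * (\<Sum>m\<in>UNIV. matrix_power g a $ l $ m * matrix_power g b $ m $ j))"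
    unfolding matrix_power_Suc_nth sum_distrib_left sum_distrib_right by (subst sum.swap) (simp add: mult.assoc)
  then show ?case unfolding Suc by (simp add: matrix_power_Suc_nth)
qed

subsection \<open>Power sums and the determinant\<close>

definition psum :: "nat => complex^'n^'n => complex" where
  "psum k g = (\<Sum>a\<in>UNIV. matrix_power g k $ a $ a)"

lemma smooth_on_psum: "smooth_on UNIV (psum k)"
  unfolding psum_def[abs_def] by (intro smooth_on_sum smooth_on_matrix_power open_UNIV)

lemma lieD_psum: "lieD i j (psum k) g = of_nat k * matrix_power g k $ j $ i"
proof -
  have "lieD i j (psum k) g = (\<Sum>a\<in>UNIV. \<Sum>c<k. matrix_power g (k - 1 - c) $ j $ a * matrix_power g (Suc c) $ a $ i)"
    unfolding psum_def[abs_def]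
    by (subst lieD_sum) (auto simp: lieD_matrix_power mult.commute intro: smooth_differentiable smooth_on_matrix_power)
  also have "... = (\<Sum>c<k. matrix_power g (k - 1 - c + Suc c) $ j $ i)"
    by (subst sum.swap) (simp only: matrix_power_add_nth)
  also have "... = (\<Sum>c<k. matrix_power g k $ j $ i)" by (intro sum.cong) auto
  finally show ?thesis by simp
qed

text \<open>The matrix entries of \<open>g\<close> satisfy \<open>lieD j i g = g ** Emat j i\<close>; summing over \<open>i\<close> and
  \<open>j\<close> splits the trace of a power into two traces.\<close>
lemma casimir_psum:
  fixes g :: "complex^'n^'n"
  shows "casimir (psum k) g = of_nat k * (\<Sum>c<k. psum (Suc c) g * psum (k - 1 - c) g)"
proof -
  have "lieD j i (psum k) = (%g. of_nat k * matrix_power g k $ i $ j)" for i j :: 'n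
    by (simp add: lieD_psum fun_eq_iff)
  then have "casimir (psum k) g = (\<Sum>i\<in>UNIV. \<Sum>j\<in>UNIV. of_nat k *
      (\<Sum>c<k. matrix_power g (Suc c) $ i $ i * matrix_power g (k - 1 - c) $ j $ j))"
    by (simp add: casimir_def lieD_cmult lieD_matrix_power smooth_differentiable smooth_on_matrix_power)
  also have "... = of_nat k * (\<Sum>i\<in>UNIV. \<Sum>c<k. \<Sum>j\<in>UNIV. matrix_power g (Suc c) $ i $ i * matrix_power g (k - 1 - c) $ j $ j)"
  proof -
    have "(\<Sum>j\<in>UNIV. \<Sum>c<k. matrix_power g (Suc c) $ i $ i * matrix_power g (k - 1 - c) $ j $ j) =
        (\<Sum>c<k. \<Sum>j\<in>UNIV. matrix_power g (Suc c) $ i $ i * matrix_power g (k - 1 - c) $ j $ j)" for i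
      by (rule sum.swap)
    then show ?thesis by (simp only: sum_distrib_left[symmetric])
  qed
  also have "(\<Sum>i\<in>UNIV. \<Sum>c<k. \<Sum>j\<in>UNIV. matrix_power g (Suc c) $ i $ i * matrix_power g (k - 1 - c) $ j $ j) =
      (\<Sum>c<k. \<Sum>i\<in>UNIV. \<Sum>j\<in>UNIV. matrix_power g (Suc c) $ i $ i * matrix_power g (k - 1 - c) $ j $ j)"
    by (rule sum.swap)
  also have "... = (\<Sum>c<k. psum (Suc c) g * psum (k - 1 - c) g)"
    by (simp add: psum_def sum_product)
  finally show ?thesis .
qed

text \<open>On unitary matrices this is the inverse of the determinant.  Being a polynomial in the conjugate
  entries, it is smooth on all matrices.\<close>
definition cnj_det :: "complex^'n^'n => complex" where
  "cnj_det g = cnj (det g)"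

lemma cnj_det_altdef: "cnj_det g = (\<Sum>p | p permutes UNIV. of_int (sign p) * (\<Prod>a\<in>UNIV. cnj (g $ a $ p a)))"
  by (simp add: cnj_det_def cart_det_def)

lemma smooth_on_cnj_entry: "smooth_on V (%g :: complex^'n^'n. cnj (g $ a $ b))"
  by (rule smooth_on_linear[OF bounded_linear_cnj_entry])

lemma smooth_on_cnj_det: "smooth_on UNIV cnj_det"
  unfolding cnj_det_altdef[abs_def]
  by (intro smooth_on_sum smooth_on_mult smooth_on_const smooth_on_prod smooth_on_cnj_entry open_UNIV)

lemma lieD_cnj_det:
  fixes g :: "complex^'n^'n"
  shows "lieD i j cnj_det g = (if i = j then - cnj_det g else 0)"
proof -
  define h where "h = cnj_matrix g"
  define h' :: "complex^'n^'n" where "h' = (\<chi> a b. if b = i then h $ a $ j else h $ a $ b)"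
  have hn: "cnj (g $ a $ b) = h $ a $ b" for a b by (simp add: h_def cnj_matrix_def)
  have diff: "(%g. cnj (g $ a $ b)) differentiable (at g)" for a b
    by (intro smooth_differentiable smooth_on_cnj_entry)
  have diffp: "(%g. \<Prod>a\<in>UNIV. cnj (g $ a $ p a)) differentiable (at g)"
    "(%g. of_int (sign p) * (\<Prod>a\<in>UNIV. cnj (g $ a $ p a))) differentiable (at g)" for p :: "'n => 'n"
    by (intro smooth_differentiable smooth_on_mult smooth_on_const smooth_on_prod smooth_on_cnj_entry open_UNIV)+
  have "lieD i j cnj_det g = (\<Sum>p | p permutes UNIV. of_int (sign p) *
      (\<Sum>a\<in>UNIV. lieD i j (%g. cnj (g $ a $ p a)) g * (\<Prod>b\<in>UNIV - {a}. cnj (g $ b $ p b))))"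
    unfolding cnj_det_altdef[abs_def] using diff diffp
    by (simp add: lieD_sum lieD_cmult lieD_prod)
  also have "... = (\<Sum>p | p permutes UNIV. of_int (sign p) * (- (\<Prod>a\<in>UNIV. h' $ a $ p a)))"
  proof (intro sum.cong refl, clarify)
    fix p :: "'n => 'n" assume p: "p permutes UNIV"
    define a0 where "a0 = inv_into UNIV p i"
    have a0: "p a = i \<longleftrightarrow> a = a0" for a
      using p permutes_inverses[OF p] by (auto simp: a0_def)
    have "(\<Sum>a\<in>UNIV. lieD i j (%g. cnj (g $ a $ p a)) g * (\<Prod>b\<in>UNIV - {a}. cnj (g $ b $ p b))) =
        (\<Sum>a\<in>UNIV. if a = a0 then - h $ a $ j * (\<Prod>b\<in>UNIV - {a}. h $ b $ p b) else 0)"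
      by (intro sum.cong refl) (simp add: lieD_cnj_entry a0 hn)
    also have "... = - (h $ a0 $ j * (\<Prod>b\<in>UNIV - {a0}. h $ b $ p b))" by simp
    also have "h $ a0 $ j * (\<Prod>b\<in>UNIV - {a0}. h $ b $ p b) = (\<Prod>a\<in>UNIV. h' $ a $ p a)"
      by (subst prod.remove[of UNIV a0]) (auto simp: h'_def a0 intro!: arg_cong2[where f = "(*)"] prod.cong)
    finally show "of_int (sign p) * (\<Sum>a\<in>UNIV. lieD i j (%g. cnj (g $ a $ p a)) g * (\<Prod>b\<in>UNIV - {a}. cnj (g $ b $ p b))) =
        complex_of_int (sign p) * (- (\<Prod>a\<in>UNIV. h' $ a $ p a))" by simp
  qed
  also have "... = - det h'"
    by (simp add: cart_det_def sum_negf)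
  also have "det h' = (if i = j then cnj_det g else 0)"
  proof (cases "i = j")
    case True
    then have "h' = h" by (auto simp: h'_def cart_eq_iff)
    then show ?thesis using True by (simp add: cnj_det_altdef cart_det_def hn)
  next
    case False
    then have "Finite_Cartesian_Product.column i h' = Finite_Cartesian_Product.column j h'"
      by (auto simp: h'_def Finite_Cartesian_Product.column_def cart_eq_iff)
    then show ?thesis using False Determinants.det_identical_columns by auto
  qed
  finally show ?thesis by simp
qed

lemma casimir_cnj_det: "casimir cnj_det (g :: complex^'n^'n) = of_nat CARD('n) * cnj_det g"
proof -
  have eq: "lieD j i cnj_det = (%g. (if i = j then - 1 else 0) * cnj_det g)" for i j :: 'n
    by (auto simp: lieD_cnj_det fun_eq_iff)
  have "casimir cnj_det g = (\<Sum>i::'n\<in>UNIV. \<Sum>j\<in>UNIV. if i = j then cnj_det g else 0)"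
    unfolding casimir_def eq
    by (intro sum.cong refl) (auto simp: lieD_cmult smooth_differentiable smooth_on_cnj_det lieD_cnj_det)
  then show ?thesis by simp
qed

text \<open>The Casimir operator has order two, so a mixed term with first derivatives appears.\<close>
lemma casimir_mult:
  fixes g :: "complex^'n^'n"
  assumes F: "smooth_on UNIV F" and G: "smooth_on UNIV G"
  shows "casimir (%x. F x * G x) g = F g * casimir G g + casimir F g * G g +
    2 * (\<Sum>i\<in>UNIV. \<Sum>j\<in>UNIV. lieD i j F g * lieD j i G g)"
proof -
  note diff = smooth_differentiable[OF F] smooth_differentiable[OF G]
    smooth_differentiable[OF smooth_on_lieD[OF open_UNIV F]] smooth_differentiable[OF smooth_on_lieD[OF open_UNIV G]]
  have "lieD j i (%x. F x * G x) = (%x. F x * lieD j i G x + lieD j i F x * G x)" for i j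
    using diff by (simp add: fun_eq_iff lieD_mult)
  then have "lieD i j (lieD j i (%x. F x * G x)) g = F g * lieD i j (lieD j i G) g + lieD i j F g * lieD j i G g +
      (lieD j i F g * lieD i j G g + lieD i j (lieD j i F) g * G g)" for i j
    using diff by (simp add: lieD_add lieD_mult differentiable_mult)
  then have "casimir (%x. F x * G x) g = F g * casimir G g + casimir F g * G g +
      ((\<Sum>i\<in>UNIV. \<Sum>j\<in>UNIV. lieD i j F g * lieD j i G g) + (\<Sum>i\<in>UNIV. \<Sum>j\<in>UNIV. lieD j i F g * lieD i j G g))"
    by (simp add: casimir_def sum.distrib sum_distrib_left sum_distrib_right algebra_simps)
  also have "(\<Sum>i\<in>UNIV. \<Sum>j\<in>UNIV. lieD j i F g * lieD i j G g) = (\<Sum>i\<in>UNIV. \<Sum>j\<in>UNIV. lieD i j F g * lieD j i G g)"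
    by (rule sum.swap)
  finally show ?thesis by simp
qed

lemma casimir_add:
  fixes g :: "complex^'n^'n"
  assumes F: "smooth_on UNIV F" and G: "smooth_on UNIV G"
  shows "casimir (%x. F x + G x) g = casimir F g + casimir G g"
proof -
  note diff = smooth_differentiable[OF F] smooth_differentiable[OF G]
    smooth_differentiable[OF smooth_on_lieD[OF open_UNIV F]] smooth_differentiable[OF smooth_on_lieD[OF open_UNIV G]]
  have "lieD j i (%x. F x + G x) = (%x. lieD j i F x + lieD j i G x)" for i j
    using diff by (simp add: fun_eq_iff lieD_add)
  then show ?thesis using diff by (simp add: casimir_def lieD_add sum.distrib)
qed

lemma casimir_const: "casimir (%_. c) (g :: complex^'n^'n) = 0"
proof -
  have "lieD j i (%_. c) = (%_. 0)" for i j :: 'n by (simp add: fun_eq_iff)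
  then show ?thesis by (simp add: casimir_def)
qed

lemma spectral_nth:
  fixes v :: "nat => complex^'n"
  shows "spectral v z $ i $ j = (\<Sum>l<CARD('n). z l * eproj v l $ i $ j)"
  by (simp add: spectral_def)

section \<open>The radial part of the Casimir operator\<close>

text \<open>The Euler operator \<open>x d/dx\<close>, which is \<open>- \<i> d/d\<psi>\<close> at \<open>x = cis \<psi>\<close>.\<close>
definition euler :: "(complex => complex) => complex => complex" where
  "euler \<phi> x = x * deriv \<phi> x"

abbreviation punctured :: "complex set" where "punctured \<equiv> - {0}"

lemma euler_holomorphic: "\<phi> holomorphic_on punctured ==> euler \<phi> holomorphic_on punctured"
  unfolding euler_def by (intro holomorphic_intros holomorphic_deriv) auto

lemma punctured_differentiable: "\<phi> holomorphic_on punctured ==> x \<noteq> 0 ==> \<phi> field_differentiable at x"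
  by (auto intro: holomorphic_on_imp_differentiable_at)

lemma euler_cong:
  assumes "\<And>y. y \<noteq> 0 ==> \<phi> y = \<psi> y" "x \<noteq> 0"
  shows "euler \<phi> x = euler \<psi> x"
proof -
  have "\<forall>\<^sub>F y in nhds x. \<phi> y = \<psi> y"
    using eventually_nhds_in_open[of punctured x] assms by (auto elim: eventually_mono simp: open_Compl)
  then show ?thesis by (simp add: euler_def deriv_cong_ev)
qed

lemma euler_add:
  assumes "\<phi> holomorphic_on punctured" "\<psi> holomorphic_on punctured" "x \<noteq> 0"
  shows "euler (%y. \<phi> y + \<psi> y) x = euler \<phi> x + euler \<psi> x"
  using assms punctured_differentiable by (simp add: euler_def algebra_simps)

lemma euler_mult:
  assumes "\<phi> holomorphic_on punctured" "\<psi> holomorphic_on punctured" "x \<noteq> 0"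
  shows "euler (%y. \<phi> y * \<psi> y) x = \<phi> x * euler \<psi> x + euler \<phi> x * \<psi> x"
  using assms punctured_differentiable by (simp add: euler_def algebra_simps)

lemma euler2_add:
  assumes "\<phi> holomorphic_on punctured" "\<psi> holomorphic_on punctured" "x \<noteq> 0"
  shows "euler (euler (%y. \<phi> y + \<psi> y)) x = euler (euler \<phi>) x + euler (euler \<psi>) x"
proof -
  have "euler (euler (%y. \<phi> y + \<psi> y)) x = euler (%y. euler \<phi> y + euler \<psi> y) x"
    using assms by (intro euler_cong) (auto simp: euler_add)
  then show ?thesis using assms by (simp add: euler_add euler_holomorphic)
qed

lemma euler2_mult:
  assumes "\<phi> holomorphic_on punctured" "\<psi> holomorphic_on punctured" "x \<noteq> 0"
  shows "euler (euler (%y. \<phi> y * \<psi> y)) x =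
    \<phi> x * euler (euler \<psi>) x + euler (euler \<phi>) x * \<psi> x + 2 * (euler \<phi> x * euler \<psi> x)"
proof -
  have "euler (euler (%y. \<phi> y * \<psi> y)) x = euler (%y. \<phi> y * euler \<psi> y + euler \<phi> y * \<psi> y) x"
    using assms by (intro euler_cong) (auto simp: euler_mult)
  also have "... = euler (%y. \<phi> y * euler \<psi> y) x + euler (%y. euler \<phi> y * \<psi> y) x"
    using assms by (intro euler_add holomorphic_on_mult euler_holomorphic)
  also have "... = \<phi> x * euler (euler \<psi>) x + euler \<phi> x * euler \<psi> x + (euler \<phi> x * euler \<psi> x + euler (euler \<phi>) x * \<psi> x)"
    using assms by (simp add: euler_mult euler_holomorphic)
  finally show ?thesis by simp
qed

lemma euler_const [simp]: "euler (%_. c) x = 0"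
  by (simp add: euler_def)

lemma euler_power: "euler (%y. y ^ k + c) x = of_nat k * x ^ k"
proof -
  have "((%y. y ^ k + c) has_field_derivative of_nat k * x ^ (k - 1)) (at x)"
    by (auto intro!: derivative_eq_intros)
  then have "deriv (%y. y ^ k + c) x = of_nat k * x ^ (k - 1)" by (rule DERIV_imp_deriv)
  then show ?thesis by (cases k) (simp_all add: euler_def)
qed

lemma euler_powi:
  assumes "x \<noteq> 0"
  shows "euler (%y. c * y powi m) x = of_int m * (c * x powi m)"
proof -
  have "((%y. c * y powi m) has_field_derivative c * (of_int m * x powi (m - 1))) (at x)"
    using assms by (auto intro!: derivative_eq_intros)
  then have "deriv (%y. c * y powi m) x = c * (of_int m * x powi (m - 1))" by (rule DERIV_imp_deriv)
  then show ?thesis using assms by (simp add: euler_def power_int_diff)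
qed

text \<open>The Euler operator in the variable \<open>l\<close>, and its square.\<close>
definition theta :: "nat => ((nat => complex) => complex) => (nat => complex) => complex" where
  "theta l F z = euler (%x. F (z(l := x))) (z l)"

definition theta2 :: "nat => ((nat => complex) => complex) => (nat => complex) => complex" where
  "theta2 l F z = euler (euler (%x. F (z(l := x)))) (z l)"

definition separately_holomorphic :: "((nat => complex) => complex) => bool" where
  "separately_holomorphic F \<longleftrightarrow> (\<forall>z l. (%x. F (z(l := x))) holomorphic_on punctured)"

text \<open>Conjugating by the Vandermonde determinant turns this operator into the sum of the squares of
  the Euler operators minus \<open>n - 1\<close> times their sum, up to a constant; see \<open>radial_part_schur\<close>
  below.  The coefficients combine to \<open>(z l + z j) / (z l - z j)\<close>.\<close>
definition radial_part :: "nat => ((nat => complex) => complex) => (nat => complex) => complex" where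
  "radial_part n F z = (\<Sum>l<n. theta2 l F z) +
     2 * (\<Sum>l<n. theta l F z * (\<Sum>j\<in>{..<n} - {l}. z l / (z l - z j))) -
     (of_nat n - 1) * (\<Sum>l<n. theta l F z)"

text \<open>A class function \<open>f\<close> with the symmetric function \<open>F\<close> of the eigenvalues, for which the invariant
  first derivatives and the Casimir operator on unitary matrices are given by derivatives of \<open>F\<close>.
  No change to polar coordinates on the group is needed: the property is checked for power sums and
  the inverse determinant, and it is inherited by sums and products, in particular by characters.\<close>
definition radial :: "(complex^'n^'n => complex) => ((nat => complex) => complex) => bool" where
  "radial f F \<longleftrightarrow> smooth_on UNIV f \<and> separately_holomorphic F \<and>
     (\<forall>v z. orthobasis v \<longrightarrow> (\<forall>l<CARD('n). norm (z l) = 1) \<longrightarrow>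
        f (spectral v z) = F z \<and>
        (\<forall>i j. lieD i j f (spectral v z) = (\<Sum>l<CARD('n). theta l F z * eproj v l $ j $ i)) \<and>
        (inj_on z {..<CARD('n)} \<longrightarrow> casimir f (spectral v z) = radial_part CARD('n) F z))"

lemma theta_add:
  assumes "separately_holomorphic F" "separately_holomorphic G" "z l \<noteq> 0"
  shows "theta l (%z. F z + G z) z = theta l F z + theta l G z"
    "theta2 l (%z. F z + G z) z = theta2 l F z + theta2 l G z"
  using assms by (simp_all add: theta_def theta2_def separately_holomorphic_def euler_add euler2_add)

lemma theta_mult:
  assumes "separately_holomorphic F" "separately_holomorphic G" "z l \<noteq> 0"
  shows "theta l (%z. F z * G z) z = F z * theta l G z + theta l F z * G z"
    "theta2 l (%z. F z * G z) z = F z * theta2 l G z + theta2 l F z * G z + 2 * (theta l F z * theta l G z)"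
  using assms by (simp_all add: theta_def theta2_def separately_holomorphic_def euler_mult euler2_mult)

lemma radial_const: "radial (%_. c) (%_. c)"
  by (simp add: radial_def smooth_on_const separately_holomorphic_def theta_def theta2_def radial_part_def casimir_const euler_const[abs_def])

lemma radial_add:
  fixes f g :: "complex^'n^'n => complex"
  assumes f: "radial f F" and g: "radial g G"
  shows "radial (%x. f x + g x) (%z. F z + G z)"
proof -
  have s: "smooth_on UNIV f" "smooth_on UNIV g" "separately_holomorphic F" "separately_holomorphic G"
    using f g by (auto simp: radial_def)
  show ?thesis
    unfolding radial_def
  proof (intro conjI allI impI)
    show "smooth_on UNIV (%x. f x + g x)" using s by (intro smooth_on_add) auto
    show "separately_holomorphic (%z. F z + G z)"
      using s unfolding separately_holomorphic_def by (auto intro: holomorphic_on_add)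
    fix v :: "nat => complex^'n" and z :: "nat => complex"
    assume v: "orthobasis v" and z: "\<forall>l<CARD('n). norm (z l) = 1"
    have z0: "z l \<noteq> 0" if "l < CARD('n)" for l using z that by force
    have th: "theta l (%z. F z + G z) z = theta l F z + theta l G z"
      "theta2 l (%z. F z + G z) z = theta2 l F z + theta2 l G z" if "l < CARD('n)" for l
      using theta_add[OF s(3,4), of z l] z0[OF that] by auto
    show "f (spectral v z) + g (spectral v z) = F z + G z" using f g v z by (simp add: radial_def)
    show "lieD i j (%x. f x + g x) (spectral v z) =
        (\<Sum>l<CARD('n). theta l (%z. F z + G z) z * eproj v l $ j $ i)" for i j
      using f g v z by (simp add: radial_def lieD_add smooth_differentiable th sum.distrib algebra_simps)
    show "casimir (%x. f x + g x) (spectral v z) = radial_part CARD('n) (%z. F z + G z) z"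
      if inj: "inj_on z {..<CARD('n)}"
    proof -
      have C: "casimir f (spectral v z) = radial_part CARD('n) F z" "casimir g (spectral v z) = radial_part CARD('n) G z"
        using f g v z inj by (auto simp: radial_def)
      show ?thesis using s by (simp add: casimir_add C radial_part_def th sum.distrib algebra_simps)
    qed
  qed
qed

text \<open>In the product rules for the Casimir operator and for the radial part the mixed terms agree,
  because the eigenprojections are orthogonal to each other and have trace 1.\<close>
lemma radial_mult:
  fixes f g :: "complex^'n^'n => complex"
  assumes f: "radial f F" and g: "radial g G"
  shows "radial (%x. f x * g x) (%z. F z * G z)"
proof -
  have s: "smooth_on UNIV f" "smooth_on UNIV g" "separately_holomorphic F" "separately_holomorphic G"
    using f g by (auto simp: radial_def)
  show ?thesis
    unfolding radial_def
  proof (intro conjI allI impI)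
    show "smooth_on UNIV (%x. f x * g x)" using s by (intro smooth_on_mult) auto
    show "separately_holomorphic (%z. F z * G z)"
      using s unfolding separately_holomorphic_def by (auto intro: holomorphic_on_mult)
    fix v :: "nat => complex^'n" and z :: "nat => complex"
    assume v: "orthobasis v" and z: "\<forall>l<CARD('n). norm (z l) = 1"
    have z0: "z l \<noteq> 0" if "l < CARD('n)" for l using z that by force
    have th: "theta l (%z. F z * G z) z = F z * theta l G z + theta l F z * G z"
      "theta2 l (%z. F z * G z) z = F z * theta2 l G z + theta2 l F z * G z + 2 * (theta l F z * theta l G z)"
      if "l < CARD('n)" for l
      using theta_mult[OF s(3,4), of z l] z0[OF that] by auto
    have val: "f (spectral v z) = F z" "g (spectral v z) = G z" using f g v z by (auto simp: radial_def)
    have D: "lieD i j f (spectral v z) = (\<Sum>l<CARD('n). theta l F z * eproj v l $ j $ i)"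
      "lieD i j g (spectral v z) = (\<Sum>l<CARD('n). theta l G z * eproj v l $ j $ i)" for i j
      using f g v z by (auto simp: radial_def)
    show "f (spectral v z) * g (spectral v z) = F z * G z" using val by simp
    show "lieD i j (%x. f x * g x) (spectral v z) =
        (\<Sum>l<CARD('n). theta l (%z. F z * G z) z * eproj v l $ j $ i)" for i j
      using s by (simp add: lieD_mult smooth_differentiable val D th sum.distrib algebra_simps sum_distrib_left sum_distrib_right)
    assume inj: "inj_on z {..<CARD('n)}"
    have C: "casimir f (spectral v z) = radial_part CARD('n) F z" "casimir g (spectral v z) = radial_part CARD('n) G z"
      using f g v z inj by (auto simp: radial_def)
    have "(\<Sum>i\<in>UNIV. \<Sum>j\<in>UNIV. lieD i j f (spectral v z) * lieD j i g (spectral v z)) =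
        (\<Sum>l<CARD('n). theta l F z * theta l G z)"
    proof -
      have "(\<Sum>i\<in>UNIV. \<Sum>j\<in>UNIV. lieD i j f (spectral v z) * lieD j i g (spectral v z)) =
          (\<Sum>j\<in>UNIV. \<Sum>i\<in>UNIV. (spectral v (%l. theta l F z)) $ j $ i * (spectral v (%l. theta l G z)) $ i $ j)"
        by (subst sum.swap) (simp only: D spectral_nth)
      also have "... = (\<Sum>j\<in>UNIV. (spectral v (%l. theta l F z * theta l G z)) $ j $ j)"
        by (simp add: matrix_matrix_mult_def flip: spectral_mult[OF v])
      also have "... = (\<Sum>l<CARD('n). theta l F z * theta l G z * (\<Sum>j\<in>UNIV. eproj v l $ j $ j))"
        unfolding spectral_nth sum_distrib_left by (rule sum.swap)
      also have "... = (\<Sum>l<CARD('n). theta l F z * theta l G z)"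
        by (simp add: trace_eproj[OF v])
      finally show ?thesis .
    qed
    then show "casimir (%x. f x * g x) (spectral v z) = radial_part CARD('n) (%z. F z * G z) z"
      using s by (simp add: casimir_mult C val radial_part_def th sum.distrib algebra_simps sum_distrib_left sum_distrib_right)
  qed
qed

text \<open>Averaging over the exchange of the two indices turns the quotient into a finite geometric
  sum, which has no denominators.\<close>
lemma symmetrize_geometric:
  fixes z :: "nat => complex"
  assumes inj: "inj_on z {..<n}"
  shows "2 * (\<Sum>l<n. \<Sum>j\<in>{..<n} - {l}. z l ^ Suc k / (z l - z j)) =
    (\<Sum>c\<le>k. (\<Sum>l<n. z l ^ c) * (\<Sum>l<n. z l ^ (k - c))) - of_nat (Suc k) * (\<Sum>l<n. z l ^ k)"
proof -
  define S where "S = (\<Sum>l<n. \<Sum>j\<in>{..<n} - {l}. z l ^ Suc k / (z l - z j))"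
  have flip: "(\<Sum>l<n. \<Sum>j\<in>{..<n} - {l}. h l j) = (\<Sum>l<n. \<Sum>j\<in>{..<n} - {l}. h j l)" for h :: "nat => nat => complex"
  proof -
    have "(\<Sum>l<n. \<Sum>j\<in>{..<n} - {l}. h l j) = (\<Sum>l<n. \<Sum>j<n. if j = l then 0 else h l j)" for h :: "nat => nat => complex"
      by (intro sum.cong refl sum.mono_neutral_cong_left) auto
    then show ?thesis by (simp, subst sum.swap) (intro sum.cong refl, auto)
  qed
  have "2 * S = S + (\<Sum>l<n. \<Sum>j\<in>{..<n} - {l}. z j ^ Suc k / (z j - z l))"
    unfolding S_def by (subst (3) flip) simp
  also have "... = (\<Sum>l<n. \<Sum>j\<in>{..<n} - {l}. \<Sum>c\<le>k. z l ^ c * z j ^ (k - c))"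
    unfolding S_def sum.distrib[symmetric]
  proof (intro sum.cong refl)
    fix l j assume lj: "l \<in> {..<n}" "j \<in> {..<n} - {l}"
    then have ne: "z l - z j \<noteq> 0" using inj by (auto dest: inj_onD)
    have "z l ^ Suc k - z j ^ Suc k = (z l - z j) * (\<Sum>c\<le>k. z l ^ c * z j ^ (k - c))"
      using power_diff_sumr2[of "z l" "Suc k" "z j"] by (simp add: lessThan_Suc_atMost mult.commute)
    moreover have "z l ^ Suc k / (z l - z j) + z j ^ Suc k / (z j - z l) = (z l ^ Suc k - z j ^ Suc k) / (z l - z j)"
      using ne minus_divide_right[of "z j ^ Suc k" "z l - z j"] by (simp add: diff_divide_distrib)
    ultimately show "z l ^ Suc k / (z l - z j) + z j ^ Suc k / (z j - z l) = (\<Sum>c\<le>k. z l ^ c * z j ^ (k - c))"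
      using ne by simp
  qed
  also have "... = (\<Sum>l<n. (\<Sum>j<n. \<Sum>c\<le>k. z l ^ c * z j ^ (k - c)) - (\<Sum>c\<le>k. z l ^ c * z l ^ (k - c)))"
    by (intro sum.cong refl) (simp add: sum_diff1)
  also have "... = (\<Sum>l<n. \<Sum>j<n. \<Sum>c\<le>k. z l ^ c * z j ^ (k - c)) - (\<Sum>l<n. of_nat (Suc k) * z l ^ k)"
    unfolding sum_subtractf by (simp flip: power_add)
  also have "(\<Sum>l<n. \<Sum>j<n. \<Sum>c\<le>k. z l ^ c * z j ^ (k - c)) = (\<Sum>c\<le>k. (\<Sum>l<n. z l ^ c) * (\<Sum>j<n. z j ^ (k - c)))"
  proof -
    have "(\<Sum>l<n. \<Sum>j<n. \<Sum>c\<le>k. z l ^ c * z j ^ (k - c)) = (\<Sum>l<n. \<Sum>c\<le>k. \<Sum>j<n. z l ^ c * z j ^ (k - c))"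
      by (intro sum.cong refl sum.swap)
    also have "... = (\<Sum>c\<le>k. \<Sum>l<n. \<Sum>j<n. z l ^ c * z j ^ (k - c))" by (rule sum.swap)
    finally show ?thesis by (simp add: sum_product)
  qed
  finally show ?thesis by (simp add: S_def sum_distrib_left)
qed

text \<open>Both sides of the equation for the Casimir operator are sums of products of two power
  sums; the quotients in the radial part are summed as geometric series.\<close>
lemma radial_psum: "radial (psum k :: complex^'n^'n => complex) (%z. \<Sum>l<CARD('n). z l ^ k)"
proof -
  let ?n = "CARD('n)"
  have line: "(%x. \<Sum>j<?n. (z(l := x)) j ^ k) = (%x. x ^ k + (\<Sum>j\<in>{..<?n} - {l}. z j ^ k))" if "l < ?n" for z l
    using that by (intro ext, subst sum.remove[of _ l]) (auto intro!: sum.cong)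
  have th1: "theta l (%z. \<Sum>l<?n. z l ^ k) z = of_nat k * z l ^ k" if "l < ?n" for z l
    unfolding theta_def line[OF that] by (rule euler_power)
  have th2: "theta2 l (%z. \<Sum>l<?n. z l ^ k) z = of_nat k * (of_nat k * z l ^ k)" if "l < ?n" "z l \<noteq> 0" for z l
  proof -
    have "euler (%x. x ^ k + c) = (%x. of_nat k * x powi int k)" for c
      by (simp add: fun_eq_iff euler_power)
    then have "theta2 l (%z. \<Sum>l<?n. z l ^ k) z = euler (%x. of_nat k * x powi int k) (z l)"
      unfolding theta2_def line[OF that(1)] by simp
    then show ?thesis using euler_powi[OF that(2), of "of_nat k" "int k"] by simp
  qed
  show ?thesis
    unfolding radial_def
  proof (intro conjI allI impI)
    show "smooth_on UNIV (psum k :: complex^'n^'n => complex)" by (rule smooth_on_psum)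
    show "separately_holomorphic (%z. \<Sum>l<?n. z l ^ k)"
      unfolding separately_holomorphic_def
    proof (intro allI)
      fix z l show "(%x. \<Sum>j<?n. (z(l := x)) j ^ k) holomorphic_on punctured"
      proof (intro holomorphic_on_sum holomorphic_on_power)
        fix j show "(%x. (z(l := x)) j) holomorphic_on punctured" by (cases "j = l") (auto intro: holomorphic_intros)
      qed
    qed
    fix v :: "nat => complex^'n" and z :: "nat => complex"
    assume v: "orthobasis v" and z: "\<forall>l<?n. norm (z l) = 1"
    have z0: "z l \<noteq> 0" if "l < ?n" for l using z that by force
    have val: "psum c (spectral v z) = (\<Sum>l<?n. z l ^ c)" for c
    proof -
      have "psum c (spectral v z) = (\<Sum>l<?n. z l ^ c * (\<Sum>a\<in>UNIV. eproj v l $ a $ a))"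
        unfolding psum_def spectral_power[OF v] spectral_nth sum_distrib_left by (rule sum.swap)
      then show ?thesis by (simp add: trace_eproj[OF v])
    qed
    show "psum k (spectral v z) = (\<Sum>l<?n. z l ^ k)" by (rule val)
    show "lieD i j (psum k) (spectral v z) = (\<Sum>l<?n. theta l (%z. \<Sum>l<?n. z l ^ k) z * eproj v l $ j $ i)" for i j
      unfolding lieD_psum spectral_power[OF v] spectral_nth by (simp add: th1 sum_distrib_left mult.assoc)
    assume inj: "inj_on z {..<?n}"
    show "casimir (psum k) (spectral v z) = radial_part ?n (%z. \<Sum>l<?n. z l ^ k) z"
    proof -
      have "radial_part ?n (%z. \<Sum>l<?n. z l ^ k) z = of_nat k * (of_nat k * (\<Sum>l<?n. z l ^ k)) +
          of_nat k * (2 * (\<Sum>l<?n. \<Sum>j\<in>{..<?n} - {l}. z l ^ Suc k / (z l - z j))) -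
          (of_nat ?n - 1) * (of_nat k * (\<Sum>l<?n. z l ^ k))"
        using z0 by (simp add: radial_part_def th1 th2 sum_distrib_left mult_ac)
      also have "... = of_nat k * ((\<Sum>c\<le>k. (\<Sum>l<?n. z l ^ c) * (\<Sum>l<?n. z l ^ (k - c))) - of_nat ?n * (\<Sum>l<?n. z l ^ k))"
        unfolding symmetrize_geometric[OF inj] by (simp add: algebra_simps)
      also have "(\<Sum>c\<le>k. (\<Sum>l<?n. z l ^ c) * (\<Sum>l<?n. z l ^ (k - c))) - of_nat ?n * (\<Sum>l<?n. z l ^ k) =
          (\<Sum>c<k. (\<Sum>l<?n. z l ^ Suc c) * (\<Sum>l<?n. z l ^ (k - 1 - c)))"
        by (subst sum.atMost_shift) simp
      finally show ?thesis by (simp add: casimir_psum val)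
    qed
  qed
qed

lemma radial_cnj_det: "radial (cnj_det :: complex^'n^'n => complex) (%z. \<Prod>l<CARD('n). inverse (z l))"
proof -
  let ?n = "CARD('n)" and ?F = "%z::nat => complex. \<Prod>l<CARD('n). inverse (z l)"
  have line: "(%x. ?F (z(l := x))) = (%x. (\<Prod>j\<in>{..<?n} - {l}. inverse (z j)) * x powi (-1))" if "l < ?n" for z l
    using that by (intro ext, subst prod.remove[of _ l]) (auto intro!: prod.cong simp: power_int_minus)
  have F_line: "?F z = (\<Prod>j\<in>{..<?n} - {l}. inverse (z j)) * z l powi (-1)" if "l < ?n" for z l
    using fun_cong[OF line[OF that, of z], of "z l"] by simp
  have th1: "theta l ?F z = - ?F z" if "l < ?n" "z l \<noteq> 0" for z l
    unfolding theta_def line[OF that(1)] euler_powi[OF that(2)] F_line[OF that(1), of z] by simp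
  have th2: "theta2 l ?F z = ?F z" if "l < ?n" "z l \<noteq> 0" for z l
  proof -
    have "theta2 l ?F z = euler (%x. - (\<Prod>j\<in>{..<?n} - {l}. inverse (z j)) * x powi (-1)) (z l)"
      unfolding theta2_def line[OF that(1)]
    proof (rule euler_cong[OF _ that(2)])
      fix y :: complex assume "y \<noteq> 0"
      from euler_powi[OF this, of "\<Prod>j\<in>{..<?n} - {l}. inverse (z j)" "-1"]
      show "euler (%x. (\<Prod>j\<in>{..<?n} - {l}. inverse (z j)) * x powi (-1)) y =
          - (\<Prod>j\<in>{..<?n} - {l}. inverse (z j)) * y powi (-1)" by simp
    qed
    then show ?thesis unfolding euler_powi[OF that(2)] F_line[OF that(1), of z] by simp
  qed
  show ?thesis
    unfolding radial_def
  proof (intro conjI allI impI)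
    show "smooth_on UNIV (cnj_det :: complex^'n^'n => complex)" by (rule smooth_on_cnj_det)
    show "separately_holomorphic ?F"
      unfolding separately_holomorphic_def
    proof (intro allI)
      fix z l show "(%x. ?F (z(l := x))) holomorphic_on punctured"
      proof (intro holomorphic_on_prod)
        fix j show "(%x. inverse ((z(l := x)) j)) holomorphic_on punctured" by (cases "j = l") (auto intro: holomorphic_intros)
      qed
    qed
    fix v :: "nat => complex^'n" and z :: "nat => complex"
    assume v: "orthobasis v" and z: "\<forall>l<?n. norm (z l) = 1"
    have z0: "z l \<noteq> 0" if "l < ?n" for l using z that by force
    have cnj_inv: "cnj (z l) = inverse (z l)" if "l < ?n" for l
    proof -
      have "z l * cnj (z l) = 1" using z that by (simp add: complex_norm_square[symmetric])
      then show ?thesis by (metis inverse_unique)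
    qed
    show val: "cnj_det (spectral v z) = ?F z"
      by (simp add: cnj_det_def det_spectral[OF v] cnj_inv)
    show "lieD i j cnj_det (spectral v z) = (\<Sum>l<?n. theta l ?F z * eproj v l $ j $ i)" for i j
    proof -
      have "(\<Sum>l<?n. theta l ?F z * eproj v l $ j $ i) = - ?F z * (\<Sum>l<?n. eproj v l $ j $ i)"
        using z0 by (simp add: th1 sum_distrib_left)
      then show ?thesis by (simp add: lieD_cnj_det sum_eproj[OF v] val)
    qed
    assume inj: "inj_on z {..<?n}"
    show "casimir cnj_det (spectral v z) = radial_part ?n ?F z"
    proof -
      have "radial_part ?n ?F z = of_nat ?n * ?F z - ?F z * (2 * (\<Sum>l<?n. \<Sum>j\<in>{..<?n} - {l}. z l ^ Suc 0 / (z l - z j)))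
          + (of_nat ?n - 1) * (of_nat ?n * ?F z)"
        using z0 by (simp add: radial_part_def th1 th2 sum_distrib_left sum_negf mult_ac)
      then show ?thesis
        unfolding symmetrize_geometric[OF inj] casimir_cnj_det val by (simp add: algebra_simps)
    qed
  qed
qed

lemma radial_cmult: "radial f F ==> radial (%x. c * f x) (%z. c * F z)"
  by (rule radial_mult[OF radial_const])

lemma radial_sum: "(\<And>i. i \<in> I ==> radial (f i) (F i)) ==> radial (%x. \<Sum>i\<in>I. f i x) (%z. \<Sum>i\<in>I. F i z)"
proof (induction I rule: infinite_finite_induct)
  case (insert i I)
  then show ?case using radial_add[of "f i" "F i" "%x. \<Sum>i\<in>I. f i x" "%z. \<Sum>i\<in>I. F i z"] by simp
qed (simp_all add: radial_const)

lemma radial_prod: "(\<And>i. i \<in> I ==> radial (f i) (F i)) ==> radial (%x. \<Prod>i\<in>I. f i x) (%z. \<Prod>i\<in>I. F i z)"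
proof (induction I rule: infinite_finite_induct)
  case (insert i I)
  then show ?case using radial_mult[of "f i" "F i" "%x. \<Prod>i\<in>I. f i x" "%z. \<Prod>i\<in>I. F i z"] by simp
qed (simp_all add: radial_const)

section \<open>Characters\<close>

subsection \<open>Newton's identities\<close>

definition char_coeff :: "nat => (nat => complex) => nat => complex" where
  "char_coeff n z k = coeff (\<Prod>l<n. [:- z l, 1:]) k"

lemma char_coeff_top: "char_coeff n z n = 1"
  using newton_poly_props[of z n] by (simp add: char_coeff_def)

lemma char_coeff_0: "char_coeff n z 0 = (\<Prod>l<n. - z l)"
  by (simp add: char_coeff_def poly_0_coeff_0[symmetric] poly_prod)

lemma char_coeff_root:
  assumes "l < n"
  shows "(\<Sum>i\<le>n. char_coeff n z i * z l ^ i) = 0"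
proof -
  have "(\<Sum>i\<le>n. char_coeff n z i * z l ^ i) = poly (\<Prod>l<n. [:- z l, 1:]) (z l)"
    by (simp add: poly_altdef newton_poly_props char_coeff_def)
  also have "... = 0" using assms by (auto simp: poly_prod intro!: prod_zero)
  finally show ?thesis .
qed

text \<open>Dividing the characteristic polynomial by \<open>x - z l\<close> with Horner's scheme and adding over
  \<open>l\<close> gives its derivative.\<close>
lemma newton_identity:
  assumes "k < n"
  shows "of_nat (n - k) * char_coeff n z k =
    - (\<Sum>i\<in>{k<..n}. char_coeff n z i * (\<Sum>l<n. z l ^ (i - k)))"
proof -
  define P where "P = (\<Prod>l<n. [:- z l, 1:])"
  define Q where "Q l = (\<Prod>j\<in>{..<n} - {l}. [:- z j, 1:])" for l
  have PQ: "P = [:- z l, 1:] * Q l" if "l < n" for l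
    unfolding P_def Q_def using that by (subst prod.remove[of _ l]) auto
  have degQ: "coeff (Q l) n = 0" if "l < n" for l
  proof (rule coeff_eq_0)
    have "degree (Q l) = card ({..<n} - {l})"
      unfolding Q_def by (subst degree_prod_eq_sum_degree) auto
    then show "degree (Q l) < n" using that by simp
  qed
  have cP: "char_coeff n z i = coeff P i" for i by (simp add: char_coeff_def P_def)
  \<comment> \<open>synthetic division\<close>
  have Q: "coeff (Q l) j = (\<Sum>i\<in>{j<..n}. coeff P i * z l ^ (i - Suc j))" if l: "l < n" and "j \<le> n" for l j
    using \<open>j \<le> n\<close>
  proof (induction rule: inc_induct)
    case base
    then show ?case using degQ[OF l] by simp
  next
    case (step j)
    have "coeff P (Suc j) = coeff (Q l) j - z l * coeff (Q l) (Suc j)"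
      unfolding PQ[OF l] by (simp add: coeff_pCons)
    then have "coeff (Q l) j = coeff P (Suc j) + z l * (\<Sum>i\<in>{Suc j<..n}. coeff P i * z l ^ (i - Suc (Suc j)))"
      using step by simp
    also have "z l * (\<Sum>i\<in>{Suc j<..n}. coeff P i * z l ^ (i - Suc (Suc j))) =
        (\<Sum>i\<in>{Suc j<..n}. coeff P i * z l ^ (i - Suc j))"
      unfolding sum_distrib_left
    proof (intro sum.cong refl)
      fix i assume "i \<in> {Suc j<..n}"
      then have "i - Suc j = Suc (i - Suc (Suc j))" by auto
      then show "z l * (coeff P i * z l ^ (i - Suc (Suc j))) = coeff P i * z l ^ (i - Suc j)" by simp
    qed
    also have "coeff P (Suc j) + (\<Sum>i\<in>{Suc j<..n}. coeff P i * z l ^ (i - Suc j)) =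
        (\<Sum>i\<in>insert (Suc j) {Suc j<..n}. coeff P i * z l ^ (i - Suc j))" by simp
    also have "insert (Suc j) {Suc j<..n} = {j<..n}" using step by auto
    finally show ?case .
  qed
  show ?thesis
  proof (cases k)
    case 0
    have "0 = (\<Sum>l<n. \<Sum>i\<le>n. char_coeff n z i * z l ^ i)" by (simp add: char_coeff_root)
    also have "... = (\<Sum>i\<le>n. char_coeff n z i * (\<Sum>l<n. z l ^ i))"
      unfolding sum_distrib_left by (rule sum.swap)
    also have "{..n} = insert 0 {0<..n}" by auto
    finally show ?thesis using 0 by (simp add: eq_neg_iff_add_eq_0 mult.commute)
  next
    case (Suc j)
    have "of_nat k * coeff P k = coeff (pderiv P) j" by (simp add: coeff_pderiv Suc)
    also have "pderiv P = (\<Sum>l<n. Q l)"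
      unfolding P_def Q_def by (simp add: pderiv_prod pderiv_pCons)
    also have "coeff (\<Sum>l<n. Q l) j = (\<Sum>l<n. \<Sum>i\<in>{j<..n}. coeff P i * z l ^ (i - k))"
      using assms Suc Q by (simp add: coeff_sum)
    also have "... = (\<Sum>i\<in>{j<..n}. coeff P i * (\<Sum>l<n. z l ^ (i - k)))"
      unfolding sum_distrib_left by (rule sum.swap)
    also have "{j<..n} = insert k {k<..n}" using assms Suc by auto
    finally have "of_nat k * coeff P k = coeff P k * of_nat n + (\<Sum>i\<in>{k<..n}. coeff P i * (\<Sum>l<n. z l ^ (i - k)))"
      by simp
    then show ?thesis using assms by (simp add: cP of_nat_diff algebra_simps)
  qed
qed

text \<open>By Newton's identities the coefficients are polynomials in the power sums.\<close>
lemma radial_char_coeff: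
  assumes "k \<le> CARD('n)"
  shows "\<exists>f :: complex^'n^'n => complex. radial f (%z. char_coeff CARD('n) z k)"
  using assms
proof (induction "CARD('n) - k" arbitrary: k rule: less_induct)
  case less
  let ?n = "CARD('n)"
  show ?case
  proof (cases "k = ?n")
    case True
    then show ?thesis using radial_const[of 1] by (auto simp: char_coeff_top)
  next
    case False
    then have k: "k < ?n" using less by simp
    have "\<forall>i\<in>{k<..?n}. \<exists>f :: complex^'n^'n => complex. radial f (%z. char_coeff ?n z i)"
      using less k by (auto intro!: less.hyps)
    then obtain f :: "nat => complex^'n^'n => complex"
      where f: "\<And>i. i \<in> {k<..?n} ==> radial (f i) (%z. char_coeff ?n z i)" by metis
    have "radial (%g. (- 1 / of_nat (?n - k)) * (\<Sum>i\<in>{k<..?n}. f i g * psum (i - k) g))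
        (%z. (- 1 / of_nat (?n - k)) * (\<Sum>i\<in>{k<..?n}. char_coeff ?n z i * (\<Sum>l<?n. z l ^ (i - k))))"
      by (intro radial_cmult radial_sum radial_mult f radial_psum)
    moreover have "(- 1 / of_nat (?n - k)) * (\<Sum>i\<in>{k<..?n}. char_coeff ?n z i * (\<Sum>l<?n. z l ^ (i - k))) =
        char_coeff ?n z k" for z
      using newton_identity[OF k, of z] k by (simp add: divide_simps) (simp add: algebra_simps)
    ultimately show ?thesis by auto
  qed
qed

subsection \<open>Powers modulo the characteristic polynomial\<close>

text \<open>The coefficients of the remainder of \<open>x^k\<close> modulo a monic polynomial with coefficients \<open>c\<close>
  of degree \<open>n\<close>: a step multiplies by \<open>x\<close> and eliminates the top power.\<close>
fun pos_residue :: "nat => (nat => 'a::comm_ring_1) => nat => nat => 'a" where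
  "pos_residue n c 0 i = (if i = 0 then 1 else 0)"
| "pos_residue n c (Suc k) i = (if i = 0 then 0 else pos_residue n c k (i - 1)) - pos_residue n c k (n - 1) * c i"

text \<open>The same for \<open>x^(-k)\<close>, where the constant term is eliminated; \<open>d\<close> is the inverse of
  \<open>c 0\<close>.\<close>
fun neg_residue :: "nat => (nat => 'a::comm_ring_1) => 'a => nat => nat => 'a" where
  "neg_residue n c d 0 i = (if i = 0 then 1 else 0)"
| "neg_residue n c d (Suc k) i = (if Suc i < n then neg_residue n c d k (Suc i) else 0) -
     neg_residue n c d k 0 * d * c (Suc i)"

lemma pos_residue_eval:
  fixes x :: complex
  assumes n: "n > 0" and c: "(\<Sum>i<n. c i * x ^ i) + x ^ n = 0"
  shows "(\<Sum>i<n. pos_residue n c k i * x ^ i) = x ^ k"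
proof (induction k)
  case 0
  then show ?case using n by (simp add: if_distrib if_distribR sum.delta cong: if_cong)
next
  case (Suc k)
  obtain m where m: "n = Suc m" using n by (cases n) auto
  have "(\<Sum>i<n. pos_residue n c (Suc k) i * x ^ i) =
      (\<Sum>i<n. (if i = 0 then 0 else pos_residue n c k (i - 1)) * x ^ i) - pos_residue n c k (n - 1) * (\<Sum>i<n. c i * x ^ i)"
    by (simp add: algebra_simps sum_subtractf sum_distrib_left)
  also have "(\<Sum>i<n. (if i = 0 then 0 else pos_residue n c k (i - 1)) * x ^ i) = x * (\<Sum>i<m. pos_residue n c k i * x ^ i)"
    unfolding m sum.lessThan_Suc_shift sum_distrib_left by (simp add: mult_ac)
  also have "(\<Sum>i<m. pos_residue n c k i * x ^ i) = x ^ k - pos_residue n c k m * x ^ m"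
    using Suc unfolding m by (simp add: eq_diff_eq)
  also have "(\<Sum>i<n. c i * x ^ i) = - (x ^ n)" using c by (simp add: eq_neg_iff_add_eq_0)
  finally show ?case by (simp add: m algebra_simps)
qed

lemma neg_residue_eval:
  fixes x :: complex
  assumes n: "n > 0" and x: "x \<noteq> 0" and c: "(\<Sum>i<n. c i * x ^ i) + x ^ n = 0" "c n = 1" "d * c 0 = 1"
  shows "(\<Sum>i<n. neg_residue n c d k i * x ^ i) = inverse x ^ k"
proof (induction k)
  case 0
  then show ?case using n by (simp add: if_distrib if_distribR sum.delta cong: if_cong)
next
  case (Suc k)
  obtain m where m: "n = Suc m" using n by (cases n) auto
  have "x * (\<Sum>i<n. neg_residue n c d (Suc k) i * x ^ i) =
      (\<Sum>i<n. (if Suc i < n then neg_residue n c d k (Suc i) else 0) * x ^ Suc i) -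
      neg_residue n c d k 0 * d * (\<Sum>i<n. c (Suc i) * x ^ Suc i)"
    by (simp add: algebra_simps sum_subtractf sum_distrib_left)
  also have "(\<Sum>i<n. (if Suc i < n then neg_residue n c d k (Suc i) else 0) * x ^ Suc i) = inverse x ^ k - neg_residue n c d k 0"
  proof -
    have "(\<Sum>i<n. neg_residue n c d k i * x ^ i) =
        neg_residue n c d k 0 + (\<Sum>i<m. neg_residue n c d k (Suc i) * x ^ Suc i)"
      unfolding m by (subst sum.lessThan_Suc_shift) simp
    moreover have "(\<Sum>i<n. (if Suc i < n then neg_residue n c d k (Suc i) else 0) * x ^ Suc i) =
        (\<Sum>i<m. neg_residue n c d k (Suc i) * x ^ Suc i)" unfolding m by simp
    ultimately show ?thesis using Suc by (simp add: algebra_simps)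
  qed
  also have "(\<Sum>i<n. c (Suc i) * x ^ Suc i) = - c 0"
  proof -
    have "(\<Sum>i<Suc n. c i * x ^ i) = 0" using c by simp
    then show ?thesis by (simp only: sum.lessThan_Suc_shift) (simp add: eq_neg_iff_add_eq_0 add.commute)
  qed
  finally have "x * (\<Sum>i<n. neg_residue n c d (Suc k) i * x ^ i) = inverse x ^ k - neg_residue n c d k 0 * (1 - d * c 0)"
    by (simp add: algebra_simps)
  then have "x * (\<Sum>i<n. neg_residue n c d (Suc k) i * x ^ i) = inverse x ^ k" using c(3) by simp
  then show ?case using x by (simp add: field_simps)
qed

text \<open>The remainder of \<open>x^p\<close> modulo the polynomial with roots \<open>z\<close>.  Its coefficients are polynomials in
  the elementary symmetric functions and the inverse of the last one, so they make sense and are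
  smooth even if some of the roots coincide.\<close>
definition residue_coeff :: "nat => (nat => complex) => int => nat => complex" where
  "residue_coeff n z p i =
     (if p \<ge> 0 then pos_residue n (char_coeff n z) (nat p) i
      else neg_residue n (char_coeff n z) ((- 1) ^ n * (\<Prod>l<n. inverse (z l))) (nat (- p)) i)"

lemma residue_coeff_eval:
  assumes z: "\<And>l. l < n ==> z l \<noteq> 0" and l: "l < n"
  shows "(\<Sum>i<n. residue_coeff n z p i * z l ^ i) = z l powi p"
proof -
  have c: "(\<Sum>i<n. char_coeff n z i * z l ^ i) + z l ^ n = 0"
    using char_coeff_root[OF l, of z] by (simp add: lessThan_Suc_atMost[symmetric] char_coeff_top)
  have d: "(- 1) ^ n * (\<Prod>l<n. inverse (z l)) * char_coeff n z 0 = 1"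
  proof -
    have "(\<Prod>l<n. inverse (z l)) * (\<Prod>l<n. - z l) = (\<Prod>l<n. - 1)"
      unfolding prod.distrib[symmetric] using z by (intro prod.cong) auto
    then show ?thesis by (simp add: char_coeff_0 mult.assoc flip: power_mult_distrib)
  qed
  have n: "n > 0" using l by simp
  show ?thesis
    using pos_residue_eval[OF n c, of "nat p"] neg_residue_eval[OF n z[OF l] c char_coeff_top d, of "nat (- p)"]
    by (auto simp: residue_coeff_def power_int_def)
qed

lemma radial_residue_coeff:
  "\<exists>f :: complex^'n^'n => complex. radial f (%z. residue_coeff CARD('n) z p i)" if "i < CARD('n)"
proof -
  let ?n = "CARD('n)"
  let ?rad = "%F. \<exists>f :: complex^'n^'n => complex. radial f F"
  have const: "?rad (%_. c)" for c using radial_const by blast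
  have mult: "?rad (%z. F z * G z)" if "?rad F" "?rad G" for F G using radial_mult that by blast
  have diff: "?rad (%z. F z - G z)" if FG: "?rad F" "?rad G" for F G
  proof -
    obtain f g :: "complex^'n^'n => complex" where fg: "radial f F" "radial g G" using FG by blast
    have "radial (%x. f x + (- 1) * g x) (%z. F z + (- 1) * G z)"
      by (rule radial_add[OF fg(1) radial_cmult[OF fg(2)]])
    then show ?thesis by auto
  qed
  have coeff: "?rad (%z. char_coeff ?n z k)" if "k \<le> ?n" for k using radial_char_coeff that by blast
  have d: "?rad (%z. (- 1) ^ ?n * (\<Prod>l<?n. inverse (z l)))"
    using radial_cmult[OF radial_cnj_det] by blast
  have pos: "?rad (%z. pos_residue ?n (char_coeff ?n z) k i)" if "i < ?n" for k i
    using that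
  proof (induction k arbitrary: i)
    case (Suc k)
    show ?case
    proof (cases "i = 0")
      case True
      have "?rad (%z. 0 - pos_residue ?n (char_coeff ?n z) k (?n - 1) * char_coeff ?n z i)"
        using Suc by (intro diff mult const coeff Suc.IH) auto
      then show ?thesis using True by simp
    next
      case False
      have "?rad (%z. pos_residue ?n (char_coeff ?n z) k (i - 1) - pos_residue ?n (char_coeff ?n z) k (?n - 1) * char_coeff ?n z i)"
        using Suc by (intro diff mult coeff Suc.IH) auto
      then show ?thesis using False by simp
    qed
  qed (simp add: const)
  have neg: "?rad (%z. neg_residue ?n (char_coeff ?n z) ((- 1) ^ ?n * (\<Prod>l<?n. inverse (z l))) k i)" if "i < ?n" for k i
    using that
  proof (induction k arbitrary: i)
    case (Suc k)
    let ?r = "%z. neg_residue ?n (char_coeff ?n z) ((- 1) ^ ?n * (\<Prod>l<?n. inverse (z l))) k"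
    have tail: "?rad (%z. ?r z 0 * ((- 1) ^ ?n * (\<Prod>l<?n. inverse (z l))) * char_coeff ?n z (Suc i))"
      using Suc by (intro mult d coeff Suc.IH) auto
    have head: "?rad (%z. if Suc i < ?n then ?r z (Suc i) else 0)"
      by (cases "Suc i < ?n") (auto intro: const Suc.IH)
    show ?case using diff[OF head tail] by simp
  qed (simp add: const)
  show ?thesis
    unfolding residue_coeff_def using pos[OF that] neg[OF that] by (cases "p \<ge> 0") auto
qed

subsection \<open>Alternants\<close>

definition alternant :: "nat => (nat => int) => (nat => complex) => complex" where
  "alternant n m z = jdet n (%k j. z k powi m (Suc j))"

definition vandermonde :: "nat => (nat => complex) => complex" where
  "vandermonde n z = jdet n (%k j. z k ^ (n - Suc j))"

lemma vandermonde_eq: "vandermonde n z = (\<Prod>b<n. \<Prod>a<b. z a - z b)"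
proof -
  have "vandermonde n z = jdet n (%k j. poly (monom 1 (n - 1 - j)) (z k))"
    unfolding vandermonde_def by (rule jdet_cong) (simp add: poly_monom)
  also have "... = (\<Prod>b<n. \<Prod>a<b. z a - z b)"
    by (rule jdet_monic_polys_rev) (simp_all add: degree_monom_eq)
  finally show ?thesis .
qed

lemma vandermonde_nonzero:
  assumes "inj_on z {..<n}"
  shows "vandermonde n z \<noteq> 0"
  using assms unfolding vandermonde_eq by (fastforce dest: inj_onD)

lemma vandermonde_alternant: "vandermonde n z = alternant n (%j. int (n - j)) z"
  by (simp add: vandermonde_def alternant_def)

text \<open>The quotient of the alternant by the Vandermonde determinant.  On the roots \<open>z l ^ p\<close> equals
  its remainder, so the matrix of the alternant factors into the matrix of powers and this one; in
  this form the quotient is defined for coinciding roots, too.\<close>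
definition schur_function :: "nat => (nat => int) => (nat => complex) => complex" where
  "schur_function n m z = jdet n (%i j. residue_coeff n z (m (Suc j)) (n - Suc i))"

lemma alternant_schur:
  assumes z: "\<And>l. l < n ==> z l \<noteq> 0"
  shows "alternant n m z = vandermonde n z * schur_function n m z"
proof -
  have "z k powi m (Suc j) = (\<Sum>i<n. z k ^ (n - Suc i) * residue_coeff n z (m (Suc j)) (n - Suc i))" if "k < n" for k j
  proof -
    have "z k powi m (Suc j) = (\<Sum>i<n. residue_coeff n z (m (Suc j)) i * z k ^ i)"
      using residue_coeff_eval[of n z k "m (Suc j)"] z that by simp
    also have "... = (\<Sum>i<n. residue_coeff n z (m (Suc j)) (n - Suc i) * z k ^ (n - Suc i))"
      by (rule sum.nat_diff_reindex[symmetric])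
    finally show ?thesis by (simp add: mult.commute)
  qed
  then have "alternant n m z = jdet n (%k j. \<Sum>i<n. z k ^ (n - Suc i) * residue_coeff n z (m (Suc j)) (n - Suc i))"
    unfolding alternant_def by (intro jdet_cong) auto
  then show ?thesis unfolding jdet_mult by (simp add: vandermonde_def schur_function_def)
qed

text \<open>Apply the closure properties to the Leibniz formula for the determinant.\<close>
lemma radial_schur: "\<exists>f :: complex^'n^'n => complex. radial f (schur_function CARD('n) m)"
proof -
  let ?n = "CARD('n)"
  have "\<forall>i\<in>{..<?n}. \<forall>j. \<exists>f :: complex^'n^'n => complex. radial f (%z. residue_coeff ?n z (m (Suc j)) (?n - Suc i))"
    by (auto intro!: radial_residue_coeff)
  then obtain f :: "nat => nat => complex^'n^'n => complex"
    where f: "\<And>i j. i < ?n ==> radial (f i j) (%z. residue_coeff ?n z (m (Suc j)) (?n - Suc i))"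
    by (metis lessThan_iff)
  have "radial (%g. \<Sum>p | p permutes {..<?n}. of_int (sign p) * (\<Prod>i<?n. f i (p i) g))
      (%z. \<Sum>p | p permutes {..<?n}. of_int (sign p) * (\<Prod>i<?n. residue_coeff ?n z (m (Suc (p i))) (?n - Suc i)))"
    by (intro radial_sum radial_cmult radial_prod f) auto
  then show ?thesis unfolding schur_function_def[abs_def] jdet_leibniz by blast
qed

section \<open>The eigenvalue of the Casimir operator\<close>

lemma euler_prod:
  assumes "finite S" "\<And>p. p \<in> S ==> \<phi> p holomorphic_on punctured" "x \<noteq> 0" "\<And>p. p \<in> S ==> \<phi> p x \<noteq> 0"
  shows "euler (%y. \<Prod>p\<in>S. \<phi> p y) x = (\<Prod>p\<in>S. \<phi> p x) * (\<Sum>p\<in>S. euler (\<phi> p) x / \<phi> p x)"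
  using assms
proof (induction S rule: finite_induct)
  case (insert p S)
  have "(%y. \<Prod>p\<in>S. \<phi> p y) holomorphic_on punctured" using insert by (intro holomorphic_on_prod) auto
  then have "euler (%y. \<phi> p y * (\<Prod>p\<in>S. \<phi> p y)) x = \<phi> p x * euler (%y. \<Prod>p\<in>S. \<phi> p y) x + euler (\<phi> p) x * (\<Prod>p\<in>S. \<phi> p x)"
    using insert by (intro euler_mult) auto
  then show ?case using insert by (simp add: field_simps)
qed simp

lemma euler_sum:
  assumes "\<And>p. p \<in> S ==> \<phi> p holomorphic_on punctured" "x \<noteq> 0"
  shows "euler (%y. \<Sum>p\<in>S. \<phi> p y) x = (\<Sum>p\<in>S. euler (\<phi> p) x)"
  using assms
proof (induction S rule: infinite_finite_induct)
  case (insert p S)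
  have "(%y. \<Sum>p\<in>S. \<phi> p y) holomorphic_on punctured" using insert by (intro holomorphic_on_sum) auto
  then show ?case using insert euler_add[of "\<phi> p" "%y. \<Sum>p\<in>S. \<phi> p y" x] by simp
qed simp_all

lemma holomorphic_on_coordinate: "(%x. (z(l := x)) a) holomorphic_on S"
  by (cases "a = l") (auto intro: holomorphic_intros)

text \<open>Logarithmic derivative of a product of linear factors.\<close>
lemma theta_vandermonde:
  assumes l: "l < n" and inj: "inj_on z {..<n}" and z: "z l \<noteq> 0"
  shows "theta l (vandermonde n) z = vandermonde n z * (\<Sum>j\<in>{..<n} - {l}. z l / (z l - z j))"
proof -
  define S where "S = (SIGMA b:{..<n}. {..<b})"
  define \<phi> where "\<phi> = (%(b, a) x. (z(l := x)) a - (z(l := x)) b)"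
  have V: "vandermonde n (z(l := x)) = (\<Prod>p\<in>S. \<phi> p x)" for x
    by (simp add: vandermonde_eq S_def \<phi>_def prod.Sigma case_prod_unfold)
  have ne: "z a \<noteq> z b" if "a < n" "b < n" "a \<noteq> b" for a b using inj that by (auto dest: inj_onD)
  have hol: "\<phi> p holomorphic_on punctured" for p
    by (cases p) (auto simp: \<phi>_def simp del: fun_upd_apply intro!: holomorphic_on_diff holomorphic_on_coordinate)
  have e: "euler (\<phi> (b, a)) (z l) / \<phi> (b, a) (z l) = 
      (if a = l then z l / (z l - z b) else 0) + (if b = l then z l / (z l - z a) else 0)" if "a < b" "b < n" for a b
  proof -
    have "euler (%x. x - c) (z l) = z l" for c
    proof -
      have "((%x. x - c) has_field_derivative 1) (at (z l))" by (auto intro!: derivative_eq_intros)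
      then show ?thesis by (simp add: euler_def DERIV_imp_deriv)
    qed
    moreover have "euler (%x. c - x) (z l) = - z l" for c
    proof -
      have "((%x. c - x) has_field_derivative - 1) (at (z l))" by (auto intro!: derivative_eq_intros)
      then show ?thesis by (simp add: euler_def DERIV_imp_deriv)
    qed
    ultimately show ?thesis using that ne[of a b]
      by (auto simp: \<phi>_def minus_divide_left[symmetric] divide_simps algebra_simps)
  qed
  have "theta l (vandermonde n) z = vandermonde n z * (\<Sum>p\<in>S. euler (\<phi> p) (z l) / \<phi> p (z l))"
  proof -
    have "euler (%x. \<Prod>p\<in>S. \<phi> p x) (z l) = (\<Prod>p\<in>S. \<phi> p (z l)) * (\<Sum>p\<in>S. euler (\<phi> p) (z l) / \<phi> p (z l))"
    proof (rule euler_prod[OF _ hol z])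
      show "\<phi> p (z l) \<noteq> 0" if p: "p \<in> S" for p
      proof -
        obtain b a where "p = (b, a)" "a < b" "b < n" using p by (auto simp: S_def)
        then show ?thesis using ne[of a b] by (simp add: \<phi>_def fun_upd_triv del: fun_upd_apply)
      qed
    qed (simp add: S_def)
    then show ?thesis using V[of "z l"] by (simp add: theta_def V)
  qed
  also have "(\<Sum>p\<in>S. euler (\<phi> p) (z l) / \<phi> p (z l)) =
      (\<Sum>b<n. \<Sum>a<b. (if a = l then z l / (z l - z b) else 0) + (if b = l then z l / (z l - z a) else 0))"
    unfolding S_def using e by (subst sum.Sigma) (auto intro!: sum.cong)
  also have "... = (\<Sum>b<n. (if l < b then z l / (z l - z b) else 0) + (if b = l then \<Sum>a<b. z l / (z l - z a) else 0))"
    by (intro sum.cong refl) (simp add: sum.distrib sum.delta')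
  also have "... = (\<Sum>b<n. if l < b then z l / (z l - z b) else 0) + (\<Sum>a<l. z l / (z l - z a))"
    using l by (simp add: sum.distrib sum.delta')
  also have "(\<Sum>b<n. if l < b then z l / (z l - z b) else 0) = (\<Sum>b\<in>{l<..<n}. z l / (z l - z b))"
    by (intro sum.mono_neutral_cong_right) auto
  also have "... + (\<Sum>a<l. z l / (z l - z a)) = (\<Sum>j\<in>{l<..<n} \<union> {..<l}. z l / (z l - z j))"
    by (intro sum.union_disjoint[symmetric]) auto
  also have "{l<..<n} \<union> {..<l} = {..<n} - {l}" using l by auto
  finally show ?thesis .
qed

lemma alternant_leibniz:
  "alternant n m z = (\<Sum>p | p permutes {..<n}. of_int (sign p) * (\<Prod>k<n. z k powi m (Suc (p k))))"
  by (simp add: alternant_def jdet_leibniz)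

text \<open>Every term of an alternant is an eigenvector of the Euler operators; summed over the variables
  the eigenvalues do not depend on the term.\<close>
lemma theta_alternant:
  fixes n :: nat and m :: "nat => int"
  assumes z: "\<And>l. l < n ==> z l \<noteq> 0"
  shows "(\<Sum>l<n. theta l (alternant n m) z) = of_int (\<Sum>j=1..n. m j) * alternant n m z"
    and "(\<Sum>l<n. theta2 l (alternant n m) z) = of_int (\<Sum>j=1..n. (m j)\<^sup>2) * alternant n m z"
proof -
  define C where "C l p = of_int (sign p) * (\<Prod>k\<in>{..<n} - {l}. z k powi m (Suc (p k)))" for l and p :: "nat => nat"
  let ?P = "{p. p permutes {..<n}}"
  have line: "(%x. alternant n m (z(l := x))) = (%x. \<Sum>p\<in>?P. C l p * x powi m (Suc (p l)))" if l: "l < n" for l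
  proof
    fix x
    have "(\<Prod>k<n. (z(l := x)) k powi m (Suc (p k))) = x powi m (Suc (p l)) * (\<Prod>k\<in>{..<n} - {l}. z k powi m (Suc (p k)))" for p
      using l by (subst prod.remove[of _ l]) (auto intro!: prod.cong)
    then show "alternant n m (z(l := x)) = (\<Sum>p\<in>?P. C l p * x powi m (Suc (p l)))"
      by (simp add: alternant_leibniz C_def mult_ac)
  qed
  have hol: "(%x. c * x powi q) holomorphic_on punctured" for c q
    by (intro holomorphic_intros) auto
  have term_eq: "C l p * z l powi m (Suc (p l)) = of_int (sign p) * (\<Prod>k<n. z k powi m (Suc (p k)))" if "l < n" for l p
    using that by (simp add: C_def prod.remove[of _ l "%k. z k powi m (Suc (p k))"] mult_ac)
  have th: "theta l (alternant n m) z = (\<Sum>p\<in>?P. of_int (m (Suc (p l))) * (of_int (sign p) * (\<Prod>k<n. z k powi m (Suc (p k)))))"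
    if l: "l < n" for l
    unfolding theta_def line[OF l] using z[OF l] hol term_eq[OF l] by (simp add: euler_sum euler_powi)
  have th2: "theta2 l (alternant n m) z = (\<Sum>p\<in>?P. of_int ((m (Suc (p l)))\<^sup>2) * (of_int (sign p) * (\<Prod>k<n. z k powi m (Suc (p k)))))"
    if l: "l < n" for l
  proof -
    have "theta2 l (alternant n m) z = euler (%x. \<Sum>p\<in>?P. (of_int (m (Suc (p l))) * C l p) * x powi m (Suc (p l))) (z l)"
      unfolding theta2_def line[OF l]
      by (rule euler_cong[OF _ z[OF l]]) (simp add: euler_sum hol euler_powi mult.assoc)
    also have "... = (\<Sum>p\<in>?P. of_int (m (Suc (p l))) * ((of_int (m (Suc (p l))) * C l p) * z l powi m (Suc (p l))))"
      using z[OF l] hol by (simp add: euler_sum euler_powi)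
    also have "... = (\<Sum>p\<in>?P. of_int ((m (Suc (p l)))\<^sup>2) * (C l p * z l powi m (Suc (p l))))"
      by (simp add: power2_eq_square mult_ac)
    finally show ?thesis by (simp only: term_eq[OF l])
  qed
  have perm: "(\<Sum>l<n. h (m (Suc (p l)))) = (\<Sum>j=1..n. h (m j))" if "p permutes {..<n}" for p and h :: "int => int"
    using sum.permute[OF that, of "%l. h (m (Suc l))"] by (simp add: comp_def sum.atLeast1_atMost_eq)
  have swap: "(\<Sum>l<n. \<Sum>p\<in>?P. of_int (h (m (Suc (p l)))) * T p) = of_int (\<Sum>j=1..n. h (m j)) * (\<Sum>p\<in>?P. T p)"
    for h :: "int => int" and T :: "(nat => nat) => complex"
  proof -
    have "(\<Sum>l<n. \<Sum>p\<in>?P. of_int (h (m (Suc (p l)))) * T p) = (\<Sum>p\<in>?P. of_int (\<Sum>l<n. h (m (Suc (p l)))) * T p)"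
      by (subst sum.swap) (simp add: sum_distrib_right)
    then show ?thesis using perm by (simp add: sum_distrib_left)
  qed
  show "(\<Sum>l<n. theta l (alternant n m) z) = of_int (\<Sum>j=1..n. m j) * alternant n m z"
    using th swap[of "%x. x"] by (simp add: alternant_leibniz)
  show "(\<Sum>l<n. theta2 l (alternant n m) z) = of_int (\<Sum>j=1..n. (m j)\<^sup>2) * alternant n m z"
    using th2 swap[of "%x. x\<^sup>2"] by (simp add: alternant_leibniz)
qed

lemma separately_holomorphic_alternant: "separately_holomorphic (alternant n m)"
  unfolding separately_holomorphic_def
proof (intro allI)
  fix z l
  show "(%x. alternant n m (z(l := x))) holomorphic_on punctured"
    unfolding alternant_leibniz
  proof (intro holomorphic_on_sum holomorphic_on_mult holomorphic_on_const holomorphic_on_prod)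
    fix k p show "(%x. (z(l := x)) k powi m (Suc (p k))) holomorphic_on punctured"
      by (cases "k = l") (auto intro!: holomorphic_intros)
  qed
qed

text \<open>The eigenvalue of the Casimir operator on \<open>\<chi>\<^sub>m\<close>; \<open>n - j\<close> are the entries of the trivial signature.\<close>
definition casimir_eigenvalue :: "nat => (nat => int) => complex" where
  "casimir_eigenvalue n m = of_int (\<Sum>j=1..n. (m j)\<^sup>2) - of_int (\<Sum>j=1..n. (int (n - j))\<^sup>2) -
     (of_nat n - 1) * (of_int (\<Sum>j=1..n. m j) - of_int (\<Sum>j=1..n. int (n - j)))"

text \<open>Apply the Euler operators and their squares to \<open>alternant = vandermonde * F\<close>.  Both determinants
  are eigenvectors, and the mixed terms, which contain the logarithmic derivative of the Vandermonde
  determinant, are the first order terms of the radial part.\<close>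
lemma radial_part_schur:
  assumes z: "\<And>l. l < n ==> z l \<noteq> 0" and inj: "inj_on z {..<n}"
    and F: "separately_holomorphic F" "\<And>w. (\<And>l. l < n ==> w l \<noteq> 0) ==> alternant n m w = vandermonde n w * F w"
  shows "radial_part n F z = casimir_eigenvalue n m * F z"
proof -
  let ?V = "vandermonde n" and ?A = "alternant n m"
  have sV: "separately_holomorphic ?V"
    using separately_holomorphic_alternant[of n "%j. int (n - j)"] by (simp add: vandermonde_alternant[abs_def])
  have V0: "?V z \<noteq> 0" using inj by (rule vandermonde_nonzero)
  have line: "?A (z(l := x)) = ?V (z(l := x)) * F (z(l := x))" if "x \<noteq> 0" for l x
    using z that by (intro F) auto
  have A: "theta l ?A z = theta l (%w. ?V w * F w) z" if l: "l < n" for l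
    unfolding theta_def by (rule euler_cong[OF line z[OF l]])
  have A2: "theta2 l ?A z = theta2 l (%w. ?V w * F w) z" if l: "l < n" for l
    unfolding theta2_def by (rule euler_cong[OF euler_cong[OF line] z[OF l]])
  have AF: "?A z = ?V z * F z" by (rule F(2)[OF z])
  have tV: "(\<Sum>l<n. theta l ?V z) = of_int (\<Sum>j=1..n. int (n - j)) * ?V z"
    "(\<Sum>l<n. theta2 l ?V z) = of_int (\<Sum>j=1..n. (int (n - j))\<^sup>2) * ?V z"
    unfolding vandermonde_alternant[abs_def] using theta_alternant[OF z] by simp_all
  have 1: "of_int (\<Sum>j=1..n. m j) * (?V z * F z) = ?V z * (\<Sum>l<n. theta l F z) + of_int (\<Sum>j=1..n. int (n - j)) * ?V z * F z"
  proof -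
    have "of_int (\<Sum>j=1..n. m j) * (?V z * F z) = (\<Sum>l<n. theta l ?A z)"
      using theta_alternant(1)[OF z, where m = m] AF by simp
    also have "... = (\<Sum>l<n. ?V z * theta l F z + theta l ?V z * F z)"
      using A theta_mult(1)[OF sV F(1)] z by (intro sum.cong) auto
    also have "... = ?V z * (\<Sum>l<n. theta l F z) + (\<Sum>l<n. theta l ?V z) * F z"
      by (simp add: sum.distrib sum_distrib_left sum_distrib_right)
    finally show ?thesis unfolding tV .
  qed
  have 2: "of_int (\<Sum>j=1..n. (m j)\<^sup>2) * (?V z * F z) = ?V z * (\<Sum>l<n. theta2 l F z) +
      of_int (\<Sum>j=1..n. (int (n - j))\<^sup>2) * ?V z * F z +
      2 * (?V z * (\<Sum>l<n. theta l F z * (\<Sum>j\<in>{..<n} - {l}. z l / (z l - z j))))"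
  proof -
    have "of_int (\<Sum>j=1..n. (m j)\<^sup>2) * (?V z * F z) = (\<Sum>l<n. theta2 l ?A z)"
      using theta_alternant(2)[OF z, where m = m] AF by simp
    also have "... = (\<Sum>l<n. ?V z * theta2 l F z + theta2 l ?V z * F z +
        2 * (?V z * (theta l F z * (\<Sum>j\<in>{..<n} - {l}. z l / (z l - z j)))))"
    proof (intro sum.cong refl)
      fix l assume "l \<in> {..<n}"
      then have l: "l < n" by simp
      show "theta2 l ?A z = ?V z * theta2 l F z + theta2 l ?V z * F z +
        2 * (?V z * (theta l F z * (\<Sum>j\<in>{..<n} - {l}. z l / (z l - z j))))"
        unfolding A2[OF l] theta_mult(2)[OF sV F(1), of z l, OF z[OF l]] theta_vandermonde[OF l inj z[OF l]]
        by (simp add: mult_ac)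
    qed
    also have "... = ?V z * (\<Sum>l<n. theta2 l F z) + (\<Sum>l<n. theta2 l ?V z) * F z +
        2 * (?V z * (\<Sum>l<n. theta l F z * (\<Sum>j\<in>{..<n} - {l}. z l / (z l - z j))))"
      by (simp only: sum.distrib sum_distrib_left sum_distrib_right)
    finally show ?thesis unfolding tV .
  qed
  have "?V z * radial_part n F z = ?V z * (casimir_eigenvalue n m * F z)"
  proof -
    have "?V z * radial_part n F z = (?V z * (\<Sum>l<n. theta2 l F z) +
      2 * (?V z * (\<Sum>l<n. theta l F z * (\<Sum>j\<in>{..<n} - {l}. z l / (z l - z j))))) - (of_nat n - 1) * (?V z * (\<Sum>l<n. theta l F z))"
      by (simp only: radial_part_def) (simp only: algebra_simps)
    also have "?V z * (\<Sum>l<n. theta l F z) = of_int (\<Sum>j=1..n. m j) * (?V z * F z) - of_int (\<Sum>j=1..n. int (n - j)) * ?V z * F z"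
      unfolding 1 by simp
    also have "?V z * (\<Sum>l<n. theta2 l F z) + 2 * (?V z * (\<Sum>l<n. theta l F z * (\<Sum>j\<in>{..<n} - {l}. z l / (z l - z j)))) =
      of_int (\<Sum>j=1..n. (m j)\<^sup>2) * (?V z * F z) - of_int (\<Sum>j=1..n. (int (n - j))\<^sup>2) * ?V z * F z"
      unfolding 2 by simp
    finally show ?thesis by (simp only: casimir_eigenvalue_def) (simp only: algebra_simps)
  qed
  then show ?thesis using V0 by simp
qed

subsection \<open>The bound for characters\<close>

text \<open>Divided differences of powers at \<open>z 0, z 1, \<dots>\<close>; they stay bounded when nodes collide.\<close>
fun divided_power :: "(nat => complex) => nat => nat => complex" where
  "divided_power z 0 i = (if i = 0 then 1 else 0)"
| "divided_power z (Suc k) i = z i * divided_power z k i + (if i = 0 then 0 else divided_power z k (i - 1))"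

lemma divided_power_newton:
  assumes "l < n"
  shows "(\<Sum>i<n. divided_power z k i * (\<Prod>a<i. z l - z a)) = z l ^ k"
proof (induction k)
  case 0
  then show ?case using assms by (simp add: if_distrib if_distribR sum.delta cong: if_cong)
next
  case (Suc k)
  define N where "N i = (\<Prod>a<i. z l - z a)" for i
  obtain n' where n': "n = Suc n'" using assms by (cases n) auto
  have Nn: "N n = 0" using assms by (auto simp: N_def intro!: prod_zero)
  have "(\<Sum>i<n. divided_power z (Suc k) i * N i) =
      (\<Sum>i<n. z i * divided_power z k i * N i) + (\<Sum>i<n. (if i = 0 then 0 else divided_power z k (i - 1)) * N i)"
    by (simp add: algebra_simps sum.distrib)
  also have "(\<Sum>i<n. (if i = 0 then 0 else divided_power z k (i - 1)) * N i) = (\<Sum>i<n'. divided_power z k i * N (Suc i))"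
    unfolding n' sum.lessThan_Suc_shift by simp
  also have "... = (\<Sum>i<n. divided_power z k i * N (Suc i))" using Nn by (simp add: n')
  also have "... = (\<Sum>i<n. divided_power z k i * (N i * (z l - z i)))" by (simp add: N_def)
  also have "(\<Sum>i<n. z i * divided_power z k i * N i) + \<dots> = (\<Sum>i<n. z l * (divided_power z k i * N i))"
    unfolding sum.distrib[symmetric] by (simp add: algebra_simps)
  finally show ?case using Suc by (simp add: N_def flip: sum_distrib_left)
qed

lemma norm_divided_power_le:
  assumes "\<And>i. norm (z i) \<le> 1"
  shows "norm (divided_power z k i) \<le> (1 + real k) ^ i"
proof (induction k arbitrary: i)
  case (Suc k)
  have "norm (divided_power z (Suc k) i) \<le> norm (z i * divided_power z k i) + norm (if i = 0 then 0 else divided_power z k (i - 1))"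
    by (simp add: norm_triangle_ineq)
  also have "norm (z i * divided_power z k i) \<le> 1 * (1 + real k) ^ i"
    unfolding norm_mult using assms Suc by (intro mult_mono) auto
  also have "norm (if i = 0 then 0 else divided_power z k (i - 1)) \<le> (if i = 0 then 0 else (1 + real k) ^ (i - 1))"
    using Suc by simp
  also have "1 * (1 + real k) ^ i + (if i = 0 then 0 else (1 + real k) ^ (i - 1)) \<le> (1 + real (Suc k)) ^ i"
  proof (cases i)
    case (Suc i')
    have "(1 + real k) ^ i + (1 + real k) ^ i' = (1 + real k) ^ i' * (2 + real k)" by (simp add: Suc algebra_simps)
    also have "... \<le> (2 + real k) ^ i' * (2 + real k)" by (intro mult_right_mono power_mono) auto
    finally show ?thesis by (simp add: Suc mult.commute)
  qed simp
  finally show ?case by simp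
qed simp

text \<open>All bounds are powers of this product, for which sums over signatures factor into sums over
  single entries.\<close>
definition weight :: "nat => (nat => int) => real" where
  "weight n m = (\<Prod>k<n. 1 + \<bar>real_of_int (m (Suc k))\<bar>)"

lemma weight_ge: "weight n m \<ge> 1"
  unfolding weight_def by (rule prod_ge_1) auto

lemma weight_ge_entry:
  assumes "k < n"
  shows "1 + \<bar>real_of_int (m (Suc k))\<bar> \<le> weight n m"
proof -
  have "1 * (1 + \<bar>real_of_int (m (Suc k))\<bar>) \<le> (\<Prod>j\<in>{..<n} - {k}. 1 + \<bar>real_of_int (m (Suc j))\<bar>) * (1 + \<bar>real_of_int (m (Suc k))\<bar>)"
    by (intro mult_right_mono prod_ge_1) auto
  then show ?thesis using assms unfolding weight_def by (subst prod.remove[of _ k]) (auto simp: mult.commute)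
qed

text \<open>After dividing by \<open>z powi m n\<close> all exponents are non-negative.  Newton interpolation of the powers
  splits off the Vandermonde determinant, and the divided differences are polynomially bounded.\<close>
lemma norm_alternant_le:
  fixes z :: "nat => complex"
  assumes z: "\<And>l. norm (z l) = 1" and m: "m \<in> signatures n" and n: "n > 0"
  shows "norm (alternant n m z) \<le> fact n * weight n m ^ (2 * n * n) * norm (vandermonde n z)"
proof -
  define m0 where "m0 = m n"
  have z0: "z l \<noteq> 0" for l using z[of l] by auto
  have ge: "m (Suc j) \<ge> m0" if "j < n" for j
  proof (cases "Suc j = n")
    case False
    then have "Suc j < n" using that by simp
    then show ?thesis using m n unfolding m0_def signatures_def
      by (auto simp: less_imp_le)
  qed (simp add: m0_def)
  define q where "q j = nat (m (Suc j) - m0)" for j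
  have q: "m (Suc j) = m0 + int (q j)" if "j < n" for j using ge[OF that] by (simp add: q_def)
  have "alternant n m z = jdet n (%k j. z k powi m0 * z k ^ q j)"
    unfolding alternant_def using z0 by (intro jdet_cong) (simp add: q power_int_add)
  also have "... = (\<Prod>k<n. z k powi m0) * jdet n (%k j. z k ^ q j)" by (rule jdet_scale_rows)
  also have "jdet n (%k j. z k ^ q j) = jdet n (%k j. \<Sum>i<n. (\<Prod>a<i. z k - z a) * divided_power z (q j) i)"
    by (rule jdet_cong) (simp add: divided_power_newton[symmetric] mult.commute)
  also have "... = jdet n (%k i. \<Prod>a<i. z k - z a) * jdet n (%i j. divided_power z (q j) i)"
    by (rule jdet_mult)
  also have "jdet n (%k i. \<Prod>a<i. z k - z a) = jdet n (%k i. poly (\<Prod>a<i. [:- z a, 1:]) (z k))"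
    by (simp add: poly_prod)
  also have "... = (\<Prod>k<n. \<Prod>i<k. z k - z i)"
    by (rule jdet_monic_polys) (use newton_poly_props in auto)
  finally have "norm (alternant n m z) = norm (\<Prod>k<n. \<Prod>i<k. z k - z i) * norm (jdet n (%i j. divided_power z (q j) i))"
    by (simp add: norm_mult prod_norm[symmetric] norm_power_int z)
  also have "norm (\<Prod>k<n. \<Prod>i<k. z k - z i) = norm (vandermonde n z)"
    unfolding vandermonde_eq by (simp add: prod_norm[symmetric] norm_minus_commute)
  finally have "norm (alternant n m z) = norm (vandermonde n z) * norm (jdet n (%i j. divided_power z (q j) i))" .
  moreover have "norm (jdet n (%i j. divided_power z (q j) i)) \<le> fact n * (\<Prod>j<n. weight n m ^ (2 * n))"
  proof (rule norm_jdet_le)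
    fix i j assume ij: "i < n" "j < n"
    have "norm (divided_power z (q j) i) \<le> (1 + real (q j)) ^ i"
      by (rule norm_divided_power_le) (simp add: z)
    also have "... \<le> (weight n m ^ 2) ^ i"
    proof (rule power_mono)
      have "1 + real (q j) \<le> (1 + \<bar>real_of_int (m (Suc j))\<bar>) * (1 + \<bar>real_of_int m0\<bar>)"
      proof -
        have "0 \<le> \<bar>real_of_int (m (Suc j))\<bar> * \<bar>real_of_int m0\<bar>" by simp
        moreover have "real (q j) = real_of_int (m (Suc j)) - real_of_int m0" using ge[OF ij(2)] by (simp add: q_def)
        ultimately have "real (q j) \<le> \<bar>real_of_int (m (Suc j))\<bar> + \<bar>real_of_int m0\<bar> + \<bar>real_of_int (m (Suc j))\<bar> * \<bar>real_of_int m0\<bar>"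
          by linarith
        then show ?thesis by (simp add: algebra_simps)
      qed
      also have "... \<le> weight n m * weight n m"
        using weight_ge_entry[OF ij(2), of m] weight_ge_entry[of "n - 1" n m] n weight_ge[of n m]
        by (intro mult_mono) (auto simp: m0_def)
      finally show "1 + real (q j) \<le> weight n m ^ 2" by (simp add: power2_eq_square)
    qed simp
    also have "... \<le> (weight n m ^ 2) ^ n"
      using ij weight_ge[of n m] by (intro power_increasing) (auto simp: one_le_power)
    finally show "norm (divided_power z (q j) i) \<le> weight n m ^ (2 * n)" by (simp add: power_mult)
  qed
  moreover have "(\<Prod>j<n. weight n m ^ (2 * n)) = weight n m ^ (2 * n * n)" by (simp add: power_mult)
  ultimately show ?thesis
    using mult_left_mono[of "norm (jdet n (%i j. divided_power z (q j) i))" "fact n * weight n m ^ (2 * n * n)" "norm (vandermonde n z)"]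
    by (simp add: mult.commute)
qed

subsection \<open>Characters as smooth functions\<close>

text \<open>A smooth extension of the character to all matrices, which is what differential operators can be
  applied to.  Only its values near unitary matrices matter, so an arbitrary choice will do.\<close>
definition char_fun :: "(nat => int) => complex^'n^'n => complex" where
  "char_fun m = (SOME f. radial f (schur_function CARD('n) m))"

lemma radial_char_fun: "radial (char_fun m :: complex^'n^'n => complex) (schur_function CARD('n) m)"
  unfolding char_fun_def using someI_ex[OF radial_schur] .

lemma smooth_on_char_fun: "smooth_on V (char_fun m)"
  using radial_char_fun[of m] unfolding radial_def by (meson smooth_on_subset subset_UNIV)

lemma continuous_on_char_fun: "continuous_on V (char_fun m)"
  by (rule smooth_onD(2)[OF smooth_on_char_fun])

lemma unitary_eigs:
  fixes g :: "complex^'n^'n"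
  assumes g: "g \<in> unitary_group"
  obtains v where "orthobasis v" "g = spectral v (eigs g)"
  using unitary_spectral_roots[OF g char_roots_eigs[OF g]] by blast

lemma norm_eigs [simp]: "norm (eigs g k) = 1"
  by (simp add: eigs_def)

lemma eigs_nonzero [simp]: "eigs g k \<noteq> 0"
  by (simp add: eigs_def)

lemma char_fun_eigs:
  fixes g :: "complex^'n^'n"
  assumes g: "g \<in> unitary_group"
  shows "char_fun m g = schur_function CARD('n) m (eigs g)"
proof -
  obtain v where v: "orthobasis v" "g = spectral v (eigs g)" using unitary_eigs[OF g] .
  have "\<forall>l<CARD('n). norm (eigs g l) = 1" by simp
  then have "char_fun m (spectral v (eigs g)) = schur_function CARD('n) m (eigs g)"
    using radial_char_fun[of m] v(1) unfolding radial_def by blast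
  then show ?thesis using v(2) by simp
qed

lemma weyl_quotient_eq:
  fixes g :: "complex^'n^'n"
  shows "weyl_quotient m g = alternant CARD('n) m (eigs g) / vandermonde CARD('n) (eigs g)"
proof -
  have "cis (of_int p * x) = cis x powi p" for p :: int and x
    by (cases p rule: int_cases2) (auto simp: Complex.DeMoivre power_int_minus cis_inverse)
  then show ?thesis
    unfolding weyl_quotient_def alternant_def vandermonde_def Let_def eigs_def
    by (simp add: Complex.DeMoivre)
qed

lemma char_fun_distinct:
  fixes g :: "complex^'n^'n"
  assumes "g \<in> unitary_group" "distinct_eigenvalues g"
  shows "char_fun m g = weyl_quotient m g"
proof -
  have "vandermonde CARD('n) (eigs g) \<noteq> 0"
    using assms(2) unfolding distinct_eigenvalues_iff by (rule vandermonde_nonzero)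
  then show ?thesis
    using alternant_schur[of "CARD('n)" "eigs g" m] by (simp add: char_fun_eigs[OF assms(1)] weyl_quotient_eq)
qed

text \<open>At coinciding eigenvalues the character is defined as a limit; the smooth extension is
  continuous and agrees with the quotient on a dense set.\<close>
theorem weyl_character_eq:
  fixes g :: "complex^'n^'n"
  assumes g: "g \<in> unitary_group"
  shows "weyl_character m g = char_fun m g"
proof (cases "distinct_eigenvalues g")
  case True
  then show ?thesis using char_fun_distinct[OF g] by (simp add: weyl_character_def)
next
  case False
  define S where "S = {w \<in> unitary_group :: (complex^'n^'n) set. distinct_eigenvalues w}"
  obtain h where h: "\<And>i. h i \<in> unitary_group" "\<And>i. distinct_eigenvalues (h i)" "h \<longlonglongrightarrow> g"
    using distinct_eigenvalues_dense[OF g] by blast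
  have "g islimpt S"
    unfolding islimpt_sequential using h False by (intro exI[of _ h]) (auto simp: S_def)
  then have "\<not> trivial_limit (at g within S)" by (simp add: trivial_limit_within)
  moreover have "(weyl_quotient m \<longlongrightarrow> char_fun m g) (at g within S)"
  proof (rule Lim_transform_eventually)
    show "(char_fun m \<longlongrightarrow> char_fun m g) (at g within S)"
      using continuous_on_char_fun[of UNIV m] by (meson UNIV_I continuous_on_def tendsto_within_subset subset_UNIV)
    show "\<forall>\<^sub>F x in at g within S. char_fun m x = weyl_quotient m x"
      unfolding eventually_at_filter by (rule always_eventually) (auto simp: S_def char_fun_distinct)
  qed
  ultimately have "Lim (at g within S) (weyl_quotient m) = char_fun m g" by (rule tendsto_Lim)
  then show ?thesis using False by (simp add: weyl_character_def S_def)
qed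

lemma unitary_dense_extend:
  fixes g :: "complex^'n^'n" and f h :: "complex^'n^'n => 'b::t2_space"
  assumes g: "g \<in> unitary_group" and C: "closed {x. P x}" and P: "\<And>x. x \<in> unitary_group ==> distinct_eigenvalues x ==> P x"
  shows "P g"
proof -
  obtain h where h: "\<And>i. h i \<in> unitary_group" "\<And>i. distinct_eigenvalues (h i)" "h \<longlonglongrightarrow> g"
    using distinct_eigenvalues_dense[OF g] by blast
  have "h i \<in> {x. P x}" for i using P h by simp
  then have "g \<in> {x. P x}" using C h(3) closed_sequentially by blast
  then show ?thesis by simp
qed

text \<open>On matrices with distinct eigenvalues divide the bound for alternants by the Vandermonde determinant.\<close>
lemma norm_char_fun_le:
  fixes g :: "complex^'n^'n"
  assumes g: "g \<in> unitary_group" and m: "m \<in> signatures CARD('n)"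
  shows "norm (char_fun m g) \<le> fact CARD('n) * weight CARD('n) m ^ (2 * CARD('n) * CARD('n))"
  using g
proof (rule unitary_dense_extend)
  show "closed {x :: complex^'n^'n. norm (char_fun m x) \<le> fact CARD('n) * weight CARD('n) m ^ (2 * CARD('n) * CARD('n))}"
    by (intro closed_Collect_le continuous_on_norm continuous_on_char_fun continuous_on_const)
  fix x :: "complex^'n^'n" assume x: "x \<in> unitary_group" "distinct_eigenvalues x"
  have V: "vandermonde CARD('n) (eigs x) \<noteq> 0"
    using x(2) unfolding distinct_eigenvalues_iff by (rule vandermonde_nonzero)
  have "norm (alternant CARD('n) m (eigs x)) \<le>
      fact CARD('n) * weight CARD('n) m ^ (2 * CARD('n) * CARD('n)) * norm (vandermonde CARD('n) (eigs x))"
    by (rule norm_alternant_le[OF _ m]) auto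
  then show "norm (char_fun m x) \<le> fact CARD('n) * weight CARD('n) m ^ (2 * CARD('n) * CARD('n))"
    using V by (simp add: char_fun_distinct[OF x] weyl_quotient_eq norm_divide divide_le_eq)
qed

theorem casimir_char_fun:
  fixes g :: "complex^'n^'n"
  assumes g: "g \<in> unitary_group"
  shows "casimir (char_fun m) g = casimir_eigenvalue CARD('n) m * char_fun m g"
  using g
proof (rule unitary_dense_extend)
  have "continuous_on UNIV (casimir (char_fun m :: complex^'n^'n => complex))"
    by (rule smooth_onD(2)[OF smooth_on_casimir[OF open_UNIV smooth_on_char_fun]])
  then show "closed {x :: complex^'n^'n. casimir (char_fun m) x = casimir_eigenvalue CARD('n) m * char_fun m x}"
    by (intro closed_Collect_eq continuous_on_mult continuous_on_char_fun continuous_on_const)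
  fix x :: "complex^'n^'n" assume x: "x \<in> unitary_group" "distinct_eigenvalues x"
  obtain v where v: "orthobasis v" "x = spectral v (eigs x)" using unitary_eigs[OF x(1)] .
  have inj: "inj_on (eigs x) {..<CARD('n)}" using x(2) by (simp add: distinct_eigenvalues_iff)
  have r: "radial (char_fun m :: complex^'n^'n => complex) (schur_function CARD('n) m)" by (rule radial_char_fun)
  have "\<forall>l<CARD('n). norm (eigs x l) = 1" by simp
  then have "casimir (char_fun m) (spectral v (eigs x)) = radial_part CARD('n) (schur_function CARD('n) m) (eigs x)"
    using r v(1) inj unfolding radial_def by blast
  also have "... = casimir_eigenvalue CARD('n) m * schur_function CARD('n) m (eigs x)"
    by (rule radial_part_schur) (use inj r alternant_schur in \<open>auto simp: radial_def\<close>)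
  finally show "casimir (char_fun m) x = casimir_eigenvalue CARD('n) m * char_fun m x"
    using v(2) by (simp add: char_fun_eigs[OF x(1)])
qed

section \<open>Integration by parts\<close>

lemma unitary_mult: "g \<in> unitary_group ==> u \<in> unitary_group ==> g ** u \<in> unitary_group"
proof -
  assume g: "g \<in> unitary_group" and u: "u \<in> unitary_group"
  have adj: "transpose (cnj_matrix (g ** u)) = transpose (cnj_matrix u) ** transpose (cnj_matrix g)"
    by (simp add: cnj_matrix_def cart_transpose_def matrix_matrix_mult_def
        cart_eq_iff mult.commute)
  have "(g ** u) ** (transpose (cnj_matrix u) ** transpose (cnj_matrix g)) =
      g ** (u ** transpose (cnj_matrix u)) ** transpose (cnj_matrix g)" by (simp add: matrix_mul_assoc)
  moreover have "(transpose (cnj_matrix u) ** transpose (cnj_matrix g)) ** (g ** u) =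
      transpose (cnj_matrix u) ** (transpose (cnj_matrix g) ** g) ** u" by (simp add: matrix_mul_assoc)
  ultimately show "g ** u \<in> unitary_group" using g u by (simp add: unitary_group_def adj)
qed

lemma haar_basics:
  assumes "normalized_haar \<mu>"
  shows "prob_space \<mu>" "space \<mu> = unitary_group" "sets \<mu> = sets (restrict_space borel unitary_group)"
  using assms by (auto simp: normalized_haar_def)

lemma haar_measurable:
  fixes f :: "complex^'n^'n => 'b::{second_countable_topology, t2_space}"
  assumes "normalized_haar \<mu>" "continuous_on unitary_group f"
  shows "f \<in> borel_measurable \<mu>"
proof -
  have "f \<in> borel_measurable (restrict_space borel unitary_group)"
    using assms(2) by (rule borel_measurable_continuous_on_restrict)
  then show ?thesis using haar_basics(3)[OF assms(1)] by (simp cong: measurable_cong_sets)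
qed

lemma unitary_bounded:
  fixes f :: "complex^'n^'n => complex"
  assumes "continuous_on unitary_group f"
  obtains B where "\<And>g. g \<in> unitary_group ==> norm (f g) \<le> B"
  using compact_continuous_image[OF assms compact_unitary_group] compact_imp_bounded bounded_iff by (metis imageI)

lemma haar_integrable:
  fixes f :: "complex^'n^'n => complex"
  assumes haar: "normalized_haar \<mu>" and f: "continuous_on unitary_group f"
  shows "integrable \<mu> f"
proof -
  interpret prob_space \<mu> using haar_basics[OF haar] by simp
  obtain B where B: "\<And>g. g \<in> unitary_group ==> norm (f g) \<le> B" using unitary_bounded[OF f] by blast
  then show ?thesis
    using haar_measurable[OF haar f] haar_basics(2)[OF haar] by (intro integrable_const_bound[of _ B]) auto
qed

lemma haar_translate:
  fixes f :: "complex^'n^'n => complex"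
  assumes haar: "normalized_haar \<mu>" and f: "continuous_on unitary_group f" and u: "u \<in> unitary_group"
  shows "(\<integral>g. f (g ** u) \<partial>\<mu>) = (\<integral>g. f g \<partial>\<mu>)"
proof -
  have "(%g. g ** u) \<in> measurable \<mu> (restrict_space borel unitary_group)"
  proof (rule measurable_restrict_space2)
    show "(%g. g ** u) \<in> space \<mu> \<rightarrow> unitary_group" using u haar_basics(2)[OF haar] unitary_mult by auto
    show "(%g. g ** u) \<in> borel_measurable \<mu>"
      by (rule haar_measurable[OF haar]) (rule linear_continuous_on[OF bounded_linear_matrix_mult_right])
  qed
  then have meas: "(%g. g ** u) \<in> measurable \<mu> \<mu>"
    using haar_basics(3)[OF haar] by (simp cong: measurable_cong_sets)
  have "(\<integral>g. f g \<partial>distr \<mu> \<mu> (%g. g ** u)) = (\<integral>g. f (g ** u) \<partial>\<mu>)"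
    by (rule integral_distr[OF meas haar_measurable[OF haar f]])
  moreover have "distr \<mu> \<mu> (%g. g ** u) = \<mu>" using haar u by (simp add: normalized_haar_def)
  ultimately show ?thesis by simp
qed

lemma hermitian_adjoint_simps:
  "hermitian_adjoint (A + B) = hermitian_adjoint A + hermitian_adjoint B"
  "hermitian_adjoint (c *\<^sub>R A) = c *\<^sub>R hermitian_adjoint A"
  "hermitian_adjoint (A ** B) = hermitian_adjoint B ** hermitian_adjoint A"
  "hermitian_adjoint (mat 1) = mat 1"
  by (simp_all add: hermitian_adjoint_def cnj_matrix_def cart_transpose_def
      cart_eq_iff matrix_matrix_mult_def mat_nth mult.commute)

lemma matrix_scaleR_mult:
  fixes A B :: "complex^'n^'n"
  shows "(c *\<^sub>R A) ** B = c *\<^sub>R (A ** B)" "A ** (c *\<^sub>R B) = c *\<^sub>R (A ** B)"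
    "(- A) ** B = - (A ** B)" "A ** (- B) = - (A ** B)"
  by (simp_all add: cart_eq_iff matrix_matrix_mult_def scaleR_sum_right sum_negf)

lemma matrix_add_rdistrib': "(A + B) ** (C :: complex^'n^'n) = A ** C + B ** C"
  by (simp add: cart_eq_iff matrix_matrix_mult_def algebra_simps sum.distrib)

lemma bounded_linear_matrix_mult_left:
  fixes M :: "complex^'n^'n"
  shows "bounded_linear (%x :: complex^'n^'n. M ** x)"
proof -
  have "linear (%x :: complex^'n^'n. M ** x)"
    by (rule linearI) (simp_all add: matrix_scaleR_mult matrix_add_ldistrib)
  then show ?thesis by (simp add: linear_conv_bounded_linear)
qed

text \<open>If \<open>X\<^sup>3 = -X\<close>, then the exponential series of \<open>t *\<^sub>R X\<close> sums to this.\<close>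
definition rotation :: "complex^'n^'n => real => complex^'n^'n" where
  "rotation X t = mat 1 + sin t *\<^sub>R X + (1 - cos t) *\<^sub>R (X ** X)"

lemma rotation_unitary:
  assumes X: "hermitian_adjoint X = - X" "X ** X ** X = - X"
  shows "rotation X t \<in> unitary_group"
proof -
  have adj: "hermitian_adjoint (rotation X t) = mat 1 - sin t *\<^sub>R X + (1 - cos t) *\<^sub>R (X ** X)"
    by (simp add: rotation_def hermitian_adjoint_simps X matrix_scaleR_mult)
  have X4: "X ** X ** (X ** X) = - (X ** X)"
    using X(2) by (metis matrix_mul_assoc matrix_scaleR_mult(3))
  have X3: "X ** (X ** X) = - X" "X ** X ** X = - X" using X(2) by (simp_all add: matrix_mul_assoc)
  have expand: "(mat 1 + a *\<^sub>R X + b *\<^sub>R (X ** X)) ** (mat 1 + c *\<^sub>R X + b *\<^sub>R (X ** X)) =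
      mat 1 + (a + c - b * c - a * b) *\<^sub>R X + (b + b + a * c - b * b) *\<^sub>R (X ** X)" for a b c
  proof -
    have "(mat 1 + a *\<^sub>R X + b *\<^sub>R (X ** X)) ** (mat 1 + c *\<^sub>R X + b *\<^sub>R (X ** X)) =
        (mat 1 + a *\<^sub>R X + b *\<^sub>R (X ** X)) + c *\<^sub>R (X + a *\<^sub>R (X ** X) + b *\<^sub>R (- X)) +
        b *\<^sub>R (X ** X + a *\<^sub>R (- X) + b *\<^sub>R (- (X ** X)))"
      by (simp only: matrix_add_ldistrib matrix_add_rdistrib' matrix_scaleR_mult(1,2) X3 X4 matrix_mul_lid matrix_mul_rid scaleR_add_right)
    then show ?thesis
      by (simp add: cart_eq_iff scaleR_conv_of_real[where 'a = complex] algebra_simps)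
  qed
  have trig: "(1 - cos t) + (1 - cos t) - sin t * sin t - (1 - cos t) * (1 - cos t) = 0"
    using sin_cos_squared_add[of t] by (simp add: power2_eq_square algebra_simps)
  have "rotation X t ** hermitian_adjoint (rotation X t) = mat 1"
    unfolding adj using expand[of "sin t" "1 - cos t" "- sin t"] trig
    by (simp add: rotation_def algebra_simps)
  moreover from this have "hermitian_adjoint (rotation X t) ** rotation X t = mat 1"
    using matrix_left_right_inverse by blast
  ultimately show ?thesis by (simp add: unitary_group_def hermitian_adjoint_def)
qed

text \<open>By invariance of the Haar measure the integral of the difference quotients of \<open>F\<close> along the
  one-parameter group of \<open>X\<close> is 0, and by compactness they converge boundedly.\<close>
lemma integral_derivative_zero:
  fixes F :: "complex^'n^'n => complex"
  assumes haar: "normalized_haar \<mu>" and V: "open V" "unitary_group \<subseteq> V" and F: "smooth_on V F"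
    and X: "hermitian_adjoint X = - X" "X ** X ** X = - X"
  shows "(\<integral>g. frechet_derivative F (at g) (g ** X) \<partial>\<mu>) = 0"
proof -
  define DF where "DF g = frechet_derivative F (at g) (g ** X)" for g
  have DF: "continuous_on unitary_group DF"
    using smooth_onD(2)[OF smooth_on_linear_field[OF V(1) F bounded_linear_matrix_mult_right]] V(2)
    unfolding DF_def[abs_def] by (rule continuous_on_subset)
  have Fc: "continuous_on unitary_group F" using smooth_onD(2)[OF F] V(2) by (rule continuous_on_subset)
  have rot: "g ** rotation X t \<in> unitary_group" if "g \<in> unitary_group" for g t
    using unitary_mult[OF that rotation_unitary[OF X]] .
  have der: "((%t. F (g ** rotation X t)) has_vector_derivative DF (g ** rotation X t)) (at t)"
    if g: "g \<in> unitary_group" for g t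
  proof -
    have "((%t. rotation X t) has_vector_derivative (cos t *\<^sub>R X + sin t *\<^sub>R (X ** X))) (at t)"
      unfolding rotation_def
      by (auto intro!: derivative_eq_intros simp: has_vector_derivative_def scaleR_left_distrib algebra_simps)
    moreover have "cos t *\<^sub>R X + sin t *\<^sub>R (X ** X) = rotation X t ** X"
    proof -
      have "rotation X t ** X = X + sin t *\<^sub>R (X ** X) + (1 - cos t) *\<^sub>R (- X)"
        by (simp only: rotation_def matrix_add_rdistrib' matrix_scaleR_mult(1) X(2) matrix_mul_lid)
      then show ?thesis by (simp add: scaleR_diff_left)
    qed
    ultimately have "((%t. rotation X t) has_derivative (%h. h *\<^sub>R (rotation X t ** X))) (at t)"
      by (simp add: has_vector_derivative_def)
    moreover have "bounded_linear (%M :: complex^'n^'n. g ** M)" by (rule bounded_linear_matrix_mult_left)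
    ultimately have 1: "((%t. g ** rotation X t) has_derivative (%h. g ** (h *\<^sub>R (rotation X t ** X)))) (at t)"
      by (rule bounded_linear.has_derivative[rotated])
    have 2: "F differentiable at (g ** rotation X t)" using smooth_onD(1)[OF F] rot[OF g] V(2) by blast
    then have 3: "linear (frechet_derivative F (at (g ** rotation X t)))" by (rule linear_frechet_derivative)
    have "((%t. F (g ** rotation X t)) has_derivative
        (%h. frechet_derivative F (at (g ** rotation X t)) (g ** (h *\<^sub>R (rotation X t ** X))))) (at t)"
      using diff_chain_at[OF 1 2[unfolded frechet_derivative_works]] by (simp add: o_def)
    then show ?thesis
      by (simp add: DF_def has_vector_derivative_def matrix_scaleR_mult linear_scale[OF 3] matrix_mul_assoc)
  qed
  obtain B where B: "\<And>g. g \<in> unitary_group ==> norm (DF g) \<le> B"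
    using unitary_bounded[OF DF] by blast
  define q where "q k g = real (Suc k) *\<^sub>R (F (g ** rotation X (1 / real (Suc k))) - F g)" for k g
  have rot0: "g ** rotation X 0 = g" for g by (simp add: rotation_def)
  have q_lim: "(%k. q k g) \<longlonglongrightarrow> DF g" if g: "g \<in> unitary_group" for g
  proof -
    have "((%t. (F (g ** rotation X t) - F g) /\<^sub>R t) \<longlongrightarrow> DF g) (at 0)"
    proof (rule Lim_null[THEN iffD2], rule tendsto_norm_zero_cancel, rule Lim_transform_eventually)
      show "((%t. norm (F (g ** rotation X t) - F g - t *\<^sub>R DF g) / norm t) \<longlongrightarrow> 0) (at 0)"
        using der[OF g, of 0] by (simp add: has_vector_derivative_def has_derivative_iff_norm rot0)
      have "norm (F (g ** rotation X t) - F g - t *\<^sub>R DF g) / norm t = norm ((F (g ** rotation X t) - F g) /\<^sub>R t - DF g)" if "t \<noteq> 0" for t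
      proof -
        have "(F (g ** rotation X t) - F g) /\<^sub>R t - DF g = (F (g ** rotation X t) - F g - t *\<^sub>R DF g) /\<^sub>R t"
          using that by (simp add: scaleR_diff_right)
        then show ?thesis by (simp add: divide_inverse mult.commute)
      qed
      then show "\<forall>\<^sub>F t in at 0. norm (F (g ** rotation X t) - F g - t *\<^sub>R DF g) / norm t = norm ((F (g ** rotation X t) - F g) /\<^sub>R t - DF g)"
        unfolding eventually_at_filter by simp
    qed
    moreover have "filterlim (%k. 1 / real (Suc k)) (at 0) sequentially"
      unfolding filterlim_at using LIMSEQ_Suc[OF lim_1_over_n] by simp
    ultimately have "(%k. (F (g ** rotation X (1 / real (Suc k))) - F g) /\<^sub>R (1 / real (Suc k))) \<longlonglongrightarrow> DF g"
      by (rule filterlim_compose)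
    then show ?thesis unfolding q_def by (simp add: divide_simps)
  qed
  have q_bound: "norm (q k g) \<le> B" if g: "g \<in> unitary_group" for k g
  proof -
    define e where "e = 1 / real (Suc k)"
    have e: "e > 0" by (simp add: e_def)
    have "norm (F (g ** rotation X e) - F (g ** rotation X 0)) \<le> B * norm (e - 0)"
    proof (rule differentiable_bound[of "{0..e}"])
      show "((%t. F (g ** rotation X t)) has_derivative (%h. h *\<^sub>R DF (g ** rotation X t))) (at t within {0..e})" for t
        using der[OF g] has_derivative_at_withinI unfolding has_vector_derivative_def by blast
      show "onorm (%h. h *\<^sub>R DF (g ** rotation X t)) \<le> B" for t
        by (rule onorm_le) (simp add: mult.commute[of B] B[OF rot[OF g]] mult_left_mono)
    qed (use e in auto)
    then have "norm (F (g ** rotation X e) - F g) \<le> B * e" using e by (simp add: rot0)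
    then have "real (Suc k) * norm (F (g ** rotation X e) - F g) \<le> real (Suc k) * (B * e)" by (intro mult_left_mono) auto
    then show ?thesis unfolding q_def e_def[symmetric] by (simp add: e_def del: of_nat_Suc)
  qed
  have cont_rot: "continuous_on unitary_group (%g. F (g ** rotation X t))" for t
    by (rule continuous_on_compose2[OF Fc linear_continuous_on[OF bounded_linear_matrix_mult_right]])
       (use rot in auto)
  have q_int: "integral\<^sup>L \<mu> (q k) = 0" for k
  proof -
    have "integral\<^sup>L \<mu> (q k) = ((\<integral>g. F (g ** rotation X (1 / real (Suc k))) \<partial>\<mu>) - (\<integral>g. F g \<partial>\<mu>)) * real (Suc k)"
      unfolding q_def using haar_integrable[OF haar cont_rot] haar_integrable[OF haar Fc] by (simp add: scaleR_conv_of_real mult.commute del: of_nat_Suc)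
    then show ?thesis using haar_translate[OF haar Fc rotation_unitary[OF X]] by simp
  qed
  have "(%k. integral\<^sup>L \<mu> (q k)) \<longlonglongrightarrow> integral\<^sup>L \<mu> DF"
  proof (rule integral_dominated_convergence[where w = "%_. B"])
    show "DF \<in> borel_measurable \<mu>" by (rule haar_measurable[OF haar DF])
    show "q k \<in> borel_measurable \<mu>" for k
      unfolding q_def using haar_measurable[OF haar cont_rot] haar_measurable[OF haar Fc] by measurable
    interpret prob_space \<mu> using haar_basics[OF haar] by simp
    show "integrable \<mu> (%_. B)" by simp
  qed (use q_lim q_bound haar_basics(2)[OF haar] in auto)
  then have "(%k. 0) \<longlonglongrightarrow> integral\<^sup>L \<mu> DF" by (simp add: q_int)
  from LIMSEQ_unique[OF this tendsto_const] show ?thesis by (simp add: DF_def[abs_def])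
qed

lemma Xmat_props:
  fixes i j :: "'n::finite"
  shows "hermitian_adjoint (Xmat i j) = - Xmat i j" "Xmat i j ** Xmat i j ** Xmat i j = - Xmat i j"
proof -
  have nth: "Xmat i j $ a $ b = (if a = i \<and> b = j then 1 else 0) - (if a = j \<and> b = i then 1 else 0)" for a b
    by (simp add: Xmat_def Emat_def)
  show "hermitian_adjoint (Xmat i j) = - Xmat i j"
    unfolding cart_eq_iff
  proof (intro allI)
    fix a b
    have e: "(hermitian_adjoint (Xmat i j)) $ a $ b = cnj ((Xmat i j) $ b $ a)"
      by (simp only: hermitian_adjoint_def cnj_matrix_def cart_transpose_def vec_lambda_beta)
    show "(hermitian_adjoint (Xmat i j)) $ a $ b = (- (Xmat i j)) $ a $ b"
      unfolding e vector_uminus_component nth by (cases "a = i"; cases "a = j"; cases "b = i"; cases "b = j"; simp add: nth)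
  qed
  show "Xmat i j ** Xmat i j ** Xmat i j = - Xmat i j"
    unfolding cart_eq_iff
  proof (intro allI)
    show "(Xmat i j ** Xmat i j ** Xmat i j) $ a $ b = (- Xmat i j) $ a $ b" for a b
      unfolding times_Xmat_nth nth vector_uminus_component by (cases "a = i"; cases "a = j"; cases "b = i"; cases "b = j"; simp)
  qed
qed

lemma Ymat_nth:
  fixes i j :: "'n::finite"
  shows "Ymat i j $ a $ b = \<i> * ((if a = i \<and> b = j then 1 else 0) + (if a = j \<and> b = i then 1 else 0))"
  by (simp add: Ymat_def mat_times_nth Emat_def)

lemma hermitian_adjoint_Ymat:
  fixes i j :: "'n::finite"
  shows "hermitian_adjoint (Ymat i j) = - Ymat i j"
  unfolding cart_eq_iff
  proof (intro allI)
    fix a b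
    have "(hermitian_adjoint (Ymat i j)) $ a $ b = cnj ((Ymat i j) $ b $ a)"
      by (simp only: hermitian_adjoint_def cnj_matrix_def cart_transpose_def vec_lambda_beta)
    then show "(hermitian_adjoint (Ymat i j)) $ a $ b = (- (Ymat i j)) $ a $ b"
      by (cases "a = i"; cases "a = j"; cases "b = i"; cases "b = j"; simp add: Ymat_nth)
  qed

lemma Ymat_props:
  fixes i j :: "'n::finite"
  assumes "i \<noteq> j"
  shows "hermitian_adjoint (Ymat i j) = - Ymat i j" "Ymat i j ** Ymat i j ** Ymat i j = - Ymat i j"
proof -
  show "hermitian_adjoint (Ymat i j) = - Ymat i j"
    by (rule hermitian_adjoint_Ymat)
  show "Ymat i j ** Ymat i j ** Ymat i j = - Ymat i j"
    unfolding cart_eq_iff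
  proof (intro allI)
    show "(Ymat i j ** Ymat i j ** Ymat i j) $ a $ b = (- Ymat i j) $ a $ b" for a b
      using assms by (cases "a = i"; cases "a = j"; cases "b = i"; cases "b = j"; simp add: times_Ymat_nth Ymat_nth)
  qed
qed

text \<open>On the diagonal \<open>Ymat\<close> is twice a matrix to which the formula for rotations applies.\<close>
lemma Ymat_diag_props:
  fixes i :: "'n::finite"
  defines "Z \<equiv> %i :: 'n. (1 / 2) *\<^sub>R Ymat i i"
  shows "hermitian_adjoint (Z i) = - Z i" "Z i ** Z i ** Z i = - Z i"
proof -
  show "hermitian_adjoint (Z i) = - Z i"
    using hermitian_adjoint_Ymat[of i i] by (simp add: Z_def hermitian_adjoint_simps(2))
  show "Z i ** Z i ** Z i = - Z i"
    unfolding cart_eq_iff Z_def matrix_scaleR_mult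
  proof (intro allI)
    show "((1 / 2) *\<^sub>R (1 / 2) *\<^sub>R (1 / 2) *\<^sub>R (Ymat i i ** Ymat i i ** Ymat i i)) $ a $ b = (- ((1 / 2) *\<^sub>R Ymat i i)) $ a $ b" for a b
      by (cases "a = i"; cases "b = i"; simp add: times_Ymat_nth Ymat_nth scaleR_conv_of_real[where 'a = complex])
  qed
qed

lemma integral_lieD_zero:
  fixes F :: "complex^'n^'n => complex"
  assumes haar: "normalized_haar \<mu>" and V: "open V" "unitary_group \<subseteq> V" and F: "smooth_on V F"
  shows "(\<integral>g. lieD i j F g \<partial>\<mu>) = 0"
proof -
  have cont: "continuous_on unitary_group (%g. frechet_derivative F (at g) (g ** M))" for M
    using smooth_onD(2)[OF smooth_on_linear_field[OF V(1) F bounded_linear_matrix_mult_right]] V(2)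
    by (rule continuous_on_subset)
  note int = haar_integrable[OF haar cont]
  have 1: "(\<integral>g. frechet_derivative F (at g) (g ** Xmat i j) \<partial>\<mu>) = 0"
    by (rule integral_derivative_zero[OF haar V F Xmat_props])
  have 2: "(\<integral>g. frechet_derivative F (at g) (g ** Ymat i j) \<partial>\<mu>) = 0"
  proof (cases "i = j")
    case True
    have lin: "frechet_derivative F (at g) (g ** Ymat i j) = 2 *\<^sub>R frechet_derivative F (at g) (g ** ((1 / 2) *\<^sub>R Ymat i i))"
      if "g \<in> unitary_group" for g
    proof -
      have "linear (frechet_derivative F (at g))"
        using smooth_onD(1)[OF F] V(2) that by (blast intro: linear_frechet_derivative)
      then show ?thesis by (simp add: True matrix_scaleR_mult linear_scale)
    qed
    have "(\<integral>g. frechet_derivative F (at g) (g ** Ymat i j) \<partial>\<mu>) =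
        (\<integral>g. 2 *\<^sub>R frechet_derivative F (at g) (g ** ((1 / 2) *\<^sub>R Ymat i i)) \<partial>\<mu>)"
      using lin haar_basics(2)[OF haar] by (intro integral_cong_on) auto
    also have "... = 0"
      using integral_derivative_zero[OF haar V F Ymat_diag_props] by simp
    finally show ?thesis .
  next
    case False
    show ?thesis by (rule integral_derivative_zero[OF haar V F Ymat_props[OF False]])
  qed
  show ?thesis unfolding lieD_def using int 1 2 by simp
qed

text \<open>Integrate the product rule.\<close>
lemma integral_lieD_parts:
  fixes F G :: "complex^'n^'n => complex"
  assumes haar: "normalized_haar \<mu>" and V: "open V" "unitary_group \<subseteq> V"
    and F: "smooth_on V F" and G: "smooth_on V G"
  shows "(\<integral>g. lieD i j F g * G g \<partial>\<mu>) = - (\<integral>g. F g * lieD i j G g \<partial>\<mu>)"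
proof -
  have cont: "continuous_on unitary_group H" if "smooth_on V H" for H :: "complex^'n^'n => complex"
    using smooth_onD(2)[OF that] V(2) by (rule continuous_on_subset)
  note int = haar_integrable[OF haar cont]
  have "0 = (\<integral>g. lieD i j (%x. F x * G x) g \<partial>\<mu>)"
    using integral_lieD_zero[OF haar V smooth_on_mult[OF V(1) F G]] by simp
  also have "... = (\<integral>g. F g * lieD i j G g + lieD i j F g * G g \<partial>\<mu>)"
    using haar_basics(2)[OF haar] V(2) smooth_onD(1)[OF F] smooth_onD(1)[OF G]
    by (intro integral_cong_on) (auto intro!: lieD_mult)
  also have "... = (\<integral>g. F g * lieD i j G g \<partial>\<mu>) + (\<integral>g. lieD i j F g * G g \<partial>\<mu>)"
    by (intro Bochner_Integration.integral_add int smooth_on_mult smooth_on_lieD V F G)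
  finally show ?thesis by (simp add: eq_neg_iff_add_eq_0 add.commute)
qed

theorem casimir_symmetric:
  fixes F G :: "complex^'n^'n => complex"
  assumes haar: "normalized_haar \<mu>" and V: "open V" "unitary_group \<subseteq> V"
    and F: "smooth_on V F" and G: "smooth_on V G"
  shows "(\<integral>g. casimir F g * G g \<partial>\<mu>) = (\<integral>g. F g * casimir G g \<partial>\<mu>)"
proof -
  have cont: "continuous_on unitary_group H" if "smooth_on V H" for H :: "complex^'n^'n => complex"
    using smooth_onD(2)[OF that] V(2) by (rule continuous_on_subset)
  note int = haar_integrable[OF haar cont]
  have "(\<integral>g. casimir F g * G g \<partial>\<mu>) = (\<Sum>i\<in>UNIV. \<Sum>j\<in>UNIV. \<integral>g. lieD i j (lieD j i F) g * G g \<partial>\<mu>)"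
    unfolding casimir_def sum_distrib_right
    by (subst integral_of_sum, intro Bochner_Integration.integrable_sum int smooth_on_mult smooth_on_lieD V F G,
        subst integral_of_sum, intro int smooth_on_mult smooth_on_lieD V F G, rule refl)
  also have "... = (\<Sum>i\<in>UNIV. \<Sum>j\<in>UNIV. \<integral>g. F g * lieD j i (lieD i j G) g \<partial>\<mu>)"
    by (intro sum.cong refl)
       (simp add: integral_lieD_parts[OF haar V smooth_on_lieD[OF V(1) F] G] integral_lieD_parts[OF haar V F smooth_on_lieD[OF V(1) G]])
  also have "... = (\<Sum>i\<in>UNIV. \<Sum>j\<in>UNIV. \<integral>g. F g * lieD i j (lieD j i G) g \<partial>\<mu>)"
    by (rule sum.swap)
  also have "... = (\<integral>g. F g * casimir G g \<partial>\<mu>)"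
    unfolding casimir_def sum_distrib_left
    by (subst integral_of_sum, intro Bochner_Integration.integrable_sum int smooth_on_mult smooth_on_lieD V F G,
        subst integral_of_sum, intro int smooth_on_mult smooth_on_lieD V F G, rule refl)
  finally show ?thesis .
qed

section \<open>Rapid decay of the Fourier coefficients of test functions\<close>

text \<open>The constant that completes the squares in the eigenvalue and makes it positive.\<close>
definition casimir_shift :: "nat => complex" where
  "casimir_shift n = 1 + of_int (\<Sum>j=1..n. (int (n - j))\<^sup>2) -
     (of_nat n - 1) * of_int (\<Sum>j=1..n. int (n - j)) + of_nat n * ((of_nat n - 1) / 2)\<^sup>2"

definition shifted_casimir :: "(complex^'n^'n => complex) => complex^'n^'n => complex" where
  "shifted_casimir F g = casimir F g + casimir_shift CARD('n) * F g"

definition shifted_eigenvalue :: "nat => (nat => int) => real" where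
  "shifted_eigenvalue n m = 1 + (\<Sum>j=1..n. (real_of_int (m j) - (real n - 1) / 2)\<^sup>2)"

lemma shifted_eigenvalue_eq:
  "casimir_eigenvalue n m + casimir_shift n =
   of_real (shifted_eigenvalue n m)"
proof -
  have "complex_of_real (shifted_eigenvalue n m) = 1 + (\<Sum>j=1..n. (of_int (m j) - (of_nat n - 1) / 2)\<^sup>2)"
    by (simp add: shifted_eigenvalue_def)
  also have sq: "(\<Sum>j=1..n. (of_int (m j) - (of_nat n - 1) / 2)\<^sup>2) =
      (\<Sum>j=1..n. complex_of_int ((m j)\<^sup>2) - (of_nat n - 1) * complex_of_int (m j) + ((of_nat n - 1) / 2)\<^sup>2)"
    by (intro sum.cong refl) (simp add: power2_eq_square field_simps)
  also have "... = complex_of_int (\<Sum>j=1..n. (m j)\<^sup>2) - (of_nat n - 1) * complex_of_int (\<Sum>j=1..n. m j) + of_nat n * ((of_nat n - 1) / 2)\<^sup>2"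
    by (simp add: sum.distrib sum_subtractf sum_distrib_left)
  finally have eq: "complex_of_real (shifted_eigenvalue n m) = 1 + (complex_of_int (\<Sum>j=1..n. (m j)\<^sup>2) -
      (of_nat n - 1) * complex_of_int (\<Sum>j=1..n. m j) + of_nat n * ((of_nat n - 1) / 2)\<^sup>2)" .
  show ?thesis unfolding casimir_eigenvalue_def casimir_shift_def eq by (simp only: algebra_simps)
qed

text \<open>The eigenvalue bounds every entry of the signature, and so its power bounds their product.\<close>
lemma weight_le_eigenvalue: "weight n m \<le> ((real n + 2) * shifted_eigenvalue n m) ^ n"
proof -
  have "1 + \<bar>real_of_int (m (Suc k))\<bar> \<le> (real n + 2) * shifted_eigenvalue n m" if k: "k < n" for k
  proof -
    define c where "c = (real n - 1) / 2"
    define x where "x = real_of_int (m (Suc k)) - c"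
    have c: "0 \<le> c" "c \<le> real n" using k by (auto simp: c_def)
    have Q1: "1 \<le> shifted_eigenvalue n m" by (simp add: shifted_eigenvalue_def sum_nonneg)
    have "x\<^sup>2 \<le> (\<Sum>j=1..n. (real_of_int (m j) - c)\<^sup>2)"
      unfolding x_def using k by (intro member_le_sum[where i = "Suc k"]) auto
    then have Q: "1 + x\<^sup>2 \<le> shifted_eigenvalue n m" by (simp add: shifted_eigenvalue_def c_def)
    have "0 \<le> (\<bar>x\<bar> - 1)\<^sup>2" by simp
    then have "\<bar>x\<bar> \<le> 1 + x\<^sup>2" by (simp add: power2_eq_square algebra_simps)
    then have "1 + \<bar>real_of_int (m (Suc k))\<bar> \<le> (1 + real n) * 1 + shifted_eigenvalue n m"
    proof -
      have "\<bar>real_of_int (m (Suc k))\<bar> \<le> \<bar>x\<bar> + c" using c unfolding x_def by linarith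
      moreover have "1 + a \<le> (1 + e) * 1 + q" if "a \<le> b + c" "b \<le> 1 + d" "c \<le> e" "1 + d \<le> q" for a b c d e q :: real
      proof -
        have "a \<le> e + q" using that by linarith
        then show ?thesis by simp
      qed
      ultimately show ?thesis using \<open>\<bar>x\<bar> \<le> 1 + x\<^sup>2\<close> c(2) Q by blast
    qed
    also have "... \<le> (1 + real n) * shifted_eigenvalue n m + shifted_eigenvalue n m"
      using Q1 by (intro add_right_mono mult_left_mono) auto
    finally show ?thesis by (simp add: algebra_simps)
  qed
  then have "weight n m \<le> (\<Prod>k<n. (real n + 2) * shifted_eigenvalue n m)"
    unfolding weight_def by (intro prod_mono) auto
  then show ?thesis by simp
qed

lemma smooth_on_shifted_casimir: "open V ==> smooth_on V F ==> smooth_on V (shifted_casimir F)"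
  unfolding shifted_casimir_def[abs_def]
  by (intro smooth_on_add smooth_on_casimir smooth_on_mult smooth_on_const)

lemma smooth_on_shifted_casimir_iterate:
  "open V ==> smooth_on V F ==> smooth_on V ((shifted_casimir ^^ k) F)"
  by (induction k) (auto intro: smooth_on_shifted_casimir)

lemma integral_char_fun_shifted:
  fixes F :: "complex^'n^'n => complex"
  assumes haar: "normalized_haar \<mu>" and V: "open V" "unitary_group \<subseteq> V" and F: "smooth_on V F"
  shows "(\<integral>g. char_fun m g * shifted_casimir F g \<partial>\<mu>) = shifted_eigenvalue CARD('n) m * (\<integral>g. char_fun m g * F g \<partial>\<mu>)"
proof -
  have cont: "continuous_on unitary_group H" if "smooth_on V H" for H :: "complex^'n^'n => complex"
    using smooth_onD(2)[OF that] V(2) by (rule continuous_on_subset)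
  note int = haar_integrable[OF haar cont]
  have int1: "integrable \<mu> (%g. char_fun m g * casimir F g)"
    by (intro int smooth_on_mult smooth_on_char_fun smooth_on_casimir V F)
  have int2: "integrable \<mu> (%g. char_fun m g * F g)"
    by (intro int smooth_on_mult smooth_on_char_fun V F)
  have "(\<integral>g. char_fun m g * shifted_casimir F g \<partial>\<mu>) =
      (\<integral>g. char_fun m g * casimir F g + casimir_shift CARD('n) * (char_fun m g * F g) \<partial>\<mu>)"
    by (intro integral_cong_on refl) (simp add: shifted_casimir_def algebra_simps)
  also have "... = (\<integral>g. char_fun m g * casimir F g \<partial>\<mu>) + casimir_shift CARD('n) * (\<integral>g. char_fun m g * F g \<partial>\<mu>)"
    using int1 int2 by (simp add: Bochner_Integration.integral_add)
  also have "(\<integral>g. char_fun m g * casimir F g \<partial>\<mu>) = (\<integral>g. casimir (char_fun m) g * F g \<partial>\<mu>)"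
    by (rule casimir_symmetric[OF haar V smooth_on_char_fun F, symmetric])
  also have "... = (\<integral>g. casimir_eigenvalue CARD('n) m * (char_fun m g * F g) \<partial>\<mu>)"
    using haar_basics(2)[OF haar] by (intro integral_cong_on) (auto simp: casimir_char_fun)
  also have "... = casimir_eigenvalue CARD('n) m * (\<integral>g. char_fun m g * F g \<partial>\<mu>)" by simp
  finally show ?thesis
    unfolding shifted_eigenvalue_eq[symmetric] by (simp only: distrib_right)
qed

lemma integral_char_fun_iterate:
  fixes F :: "complex^'n^'n => complex"
  assumes haar: "normalized_haar \<mu>" and V: "open V" "unitary_group \<subseteq> V" and F: "smooth_on V F"
  shows "(\<integral>g. char_fun m g * (shifted_casimir ^^ k) F g \<partial>\<mu>) =
    shifted_eigenvalue CARD('n) m ^ k * (\<integral>g. char_fun m g * F g \<partial>\<mu>)"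
proof (induction k)
  case (Suc k)
  then show ?case
    using integral_char_fun_shifted[OF haar V smooth_on_shifted_casimir_iterate[OF V(1) F], of m k] by simp
qed simp

lemma character_distribution_eq:
  fixes \<phi> :: "complex^'n^'n => complex"
  assumes haar: "normalized_haar \<mu>" and "\<And>g. g \<in> unitary_group ==> \<phi> g = F g"
  shows "character_distribution \<mu> m \<phi> = (\<integral>g. char_fun m g * F g \<partial>\<mu>)"
  unfolding character_distribution_def using assms haar_basics(2)[OF haar]
  by (intro integral_cong_on) (auto simp: weyl_character_eq)

lemma mat_1_unitary: "mat 1 \<in> unitary_group"
  using hermitian_adjoint_simps(4) by (simp add: unitary_group_def flip: hermitian_adjoint_def)

text \<open>Integration by parts moves powers of the Casimir operator from the character to the
  test function.  Each of them gains a factor of the eigenvalue, which outweighs the polynomial growth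
  of the characters.\<close>
theorem character_distribution_decay:
  fixes \<phi> :: "complex^'n^'n => complex"
  assumes haar: "normalized_haar \<mu>" and test: "test_function \<phi>"
  obtains C where "C \<ge> 0"
    "\<And>m. m \<in> signatures CARD('n) ==> norm (character_distribution \<mu> m \<phi>) * weight CARD('n) m ^ K \<le> C"
proof -
  let ?n = "CARD('n)"
  interpret prob_space \<mu> using haar_basics[OF haar] by simp
  obtain V F where V: "open V" "unitary_group \<subseteq> V" and F: "smooth_on V F"
    and \<phi>: "\<And>g. g \<in> unitary_group ==> \<phi> g = F g"
    using test unfolding test_function_def smooth_on_def by blast
  define L where "L = K + 2 * ?n * ?n"
  define k where "k = ?n * L"
  define G where "G = (shifted_casimir ^^ k) F"
  have G: "smooth_on V G" unfolding G_def by (rule smooth_on_shifted_casimir_iterate[OF V(1) F])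
  have Gc: "continuous_on unitary_group G" using smooth_onD(2)[OF G] V(2) by (rule continuous_on_subset)
  obtain B where B: "\<And>g. g \<in> unitary_group ==> norm (G g) \<le> B"
    using unitary_bounded[OF Gc] by blast
  have B0: "0 \<le> B" using order_trans[OF norm_ge_zero B[OF mat_1_unitary]] .
  show thesis
  proof (rule that[of "B * fact ?n * ((real ?n + 2) ^ ?n) ^ L"])
    show "0 \<le> B * fact ?n * ((real ?n + 2) ^ ?n) ^ L" using B0 by simp
    fix m assume m: "m \<in> signatures ?n"
    define w where "w = weight ?n m"
    define Q where "Q = shifted_eigenvalue ?n m"
    have w1: "1 \<le> w" unfolding w_def by (rule weight_ge)
    have Q0: "0 < Q" unfolding Q_def shifted_eigenvalue_def by (rule add_pos_nonneg) (auto intro: sum_nonneg)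
    define I where "I = character_distribution \<mu> m \<phi>"
    have I: "I = (\<integral>g. char_fun m g * F g \<partial>\<mu>)"
      unfolding I_def by (rule character_distribution_eq[OF haar \<phi>])
    have "of_real (Q ^ k) * I = (\<integral>g. char_fun m g * G g \<partial>\<mu>)"
      unfolding I G_def Q_def using integral_char_fun_iterate[OF haar V F, of m k] by simp
    then have "Q ^ k * norm I = norm (\<integral>g. char_fun m g * G g \<partial>\<mu>)"
      using Q0 by (metis abs_of_pos norm_mult norm_of_real zero_less_power)
    also have "... \<le> (fact ?n * w ^ (2 * ?n * ?n) * B) * measure \<mu> (space \<mu>)"
    proof -
      have bound: "norm (char_fun m g * G g) \<le> fact ?n * w ^ (2 * ?n * ?n) * B" if "g \<in> space \<mu>" for g
      proof -
        have g: "g \<in> unitary_group" using that haar_basics(2)[OF haar] by simp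
        show ?thesis
          unfolding norm_mult w_def using norm_char_fun_le[OF g m] B[OF g] weight_ge[of ?n m] by (intro mult_mono) auto
      qed
      have int: "integrable \<mu> (%g. char_fun m g * G g)"
        by (intro haar_integrable[OF haar] continuous_on_mult continuous_on_char_fun Gc)
      have "norm (\<integral>g. char_fun m g * G g \<partial>\<mu>) \<le> (\<integral>g. norm (char_fun m g * G g) \<partial>\<mu>)"
        by (rule integral_norm_bound)
      also have "... \<le> fact ?n * w ^ (2 * ?n * ?n) * B"
        using int bound by (intro integral_le_const integrable_norm AE_I2) auto
      finally show ?thesis by (simp add: prob_space)
    qed
    finally have 1: "Q ^ k * norm I \<le> fact ?n * w ^ (2 * ?n * ?n) * B" by (simp add: prob_space)
    have "w ^ L \<le> (((real ?n + 2) * Q) ^ ?n) ^ L"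
      using weight_le_eigenvalue[of ?n m] w1 unfolding w_def Q_def by (intro power_mono) auto
    also have "... = ((real ?n + 2) ^ ?n) ^ L * Q ^ k" by (simp add: k_def power_mult power_mult_distrib)
    finally have "w ^ L * norm I \<le> ((real ?n + 2) ^ ?n) ^ L * (Q ^ k * norm I)"
      unfolding mult.assoc[symmetric] by (rule mult_right_mono) simp
    also have "... \<le> ((real ?n + 2) ^ ?n) ^ L * (fact ?n * w ^ (2 * ?n * ?n) * B)"
      using 1 by (intro mult_left_mono) auto
    finally have "w ^ (2 * ?n * ?n) * (norm I * w ^ K) \<le> w ^ (2 * ?n * ?n) * (B * fact ?n * ((real ?n + 2) ^ ?n) ^ L)"
      by (simp add: L_def power_add mult_ac)
    then show "norm (character_distribution \<mu> m \<phi>) * weight ?n m ^ K \<le> B * fact ?n * ((real ?n + 2) ^ ?n) ^ L"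
      using w1 unfolding I_def w_def by (subst (asm) mult_le_cancel_left_pos) auto
  qed
qed

section \<open>The function on the group\<close>

lemma norm_smult_vec: "norm (c *s (x :: complex^'n)) = norm c * norm x"
  unfolding norm_vec_def by (simp add: norm_mult L2_set_right_distrib)

lemma matrix_vector_norm_le: "norm (z *v x) \<le> op_norm z * norm (x :: complex^'n)"
  unfolding op_norm_def by (rule onorm) (simp add: matrix_vector_mul_bounded_linear)

lemma norm_axis_one: "norm (axis j (1 :: complex) :: complex^'n) = 1"
proof -
  have "cinner (axis j 1) (axis j 1 :: complex^'n) = (\<Sum>i\<in>UNIV. if i = j then 1 else 0)"
    unfolding cinner_def by (intro sum.cong refl) (simp add: axis_def)
  then have "cinner (axis j 1) (axis j 1 :: complex^'n) = 1" by simp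
  then have "complex_of_real ((norm (axis j (1 :: complex) :: complex^'n))\<^sup>2) = of_real 1" by (simp add: cinner_self)
  then have "(norm (axis j (1 :: complex) :: complex^'n))\<^sup>2 = 1" by (simp only: of_real_eq_iff)
  then show ?thesis using norm_ge_zero[of "axis j (1 :: complex) :: complex^'n"] by (simp add: power2_eq_1_iff)
qed

text \<open>Each root has an eigenvector.\<close>
lemma char_roots_norm_le:
  fixes z :: "complex^'n^'n"
  assumes w: "char_roots z w" and k: "k < CARD('n)"
  shows "norm (w k) \<le> op_norm z"
proof -
  have "det (mat (w k) - z) = 0"
    unfolding w[unfolded char_roots_def, rule_format] using k by (intro prod_zero) auto
  then have "\<not> invertible (mat (w k) - z)" by (simp add: invertible_det_nz)
  then obtain x where x: "x \<noteq> 0" "(mat (w k) - z) *v x = 0"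
    unfolding invertible_left_inverse matrix_left_invertible_ker by blast
  have "mat (w k) *v x = w k *s x"
    by (simp add: cart_eq_iff matrix_vector_mult_def mat_nth if_distrib if_distribR cong: if_cong)
  then have "z *v x = w k *s x" using x(2) by (simp add: matrix_vector_mult_diff_rdistrib)
  then have "norm (w k) * norm x \<le> op_norm z * norm x"
    using matrix_vector_norm_le[of z x] by (simp add: norm_smult_vec)
  then show ?thesis using x(1) by simp
qed

lemma norm_matrix_power_nth_le:
  fixes z :: "complex^'n^'n"
  shows "norm (matrix_power z k $ i $ j) \<le> op_norm z ^ k"
proof -
  have op0: "0 \<le> op_norm z" unfolding op_norm_def by (rule onorm_pos_le) (simp add: matrix_vector_mul_bounded_linear)
  have "norm (matrix_power z k *v x) \<le> op_norm z ^ k * norm x" for x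
  proof (induction k)
    case (Suc k)
    have "norm (matrix_power z (Suc k) *v x) \<le> op_norm z * norm (matrix_power z k *v x)"
      unfolding matrix_power_Suc_vec by (rule matrix_vector_norm_le)
    also have "... \<le> op_norm z * (op_norm z ^ k * norm x)" using Suc op0 by (rule mult_left_mono)
    finally show ?case by (simp add: mult.assoc)
  qed (simp add: matrix_power_def)
  from this[of "axis j 1"] have "norm (matrix_power z k *v axis j 1) \<le> op_norm z ^ k" by (simp add: norm_axis_one)
  moreover have "(matrix_power z k *v axis j 1) $ i = matrix_power z k $ i $ j"
    by (simp add: matrix_vector_mult_def axis_def if_distrib cong: if_cong)
  ultimately show ?thesis using Finite_Cartesian_Product.norm_nth_le order_trans by metis
qed

text \<open>Apply the spectral mapping formula to the partial sums of the binomial series and pass to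
  the limit.\<close>
lemma det_one_minus_powr_series:
  fixes z :: "complex^'n^'n"
  assumes z: "op_norm z < 1" and w: "char_roots z w"
  shows "det (one_minus_powr z \<sigma>) = (\<Prod>k<CARD('n). (1 - w k) powr \<sigma>)"
proof -
  define a where "a k = (-1) ^ k * (\<sigma> gchoose k)" for k
  define p where "p N = (\<Sum>k<N. monom (a k) k)" for N
  have op0: "0 \<le> op_norm z" unfolding op_norm_def by (rule onorm_pos_le) (simp add: matrix_vector_mul_bounded_linear)
  obtain r where r: "op_norm z < r" "r < 1" using z dense by blast
  have "summable (%k. (\<sigma> gchoose k) * complex_of_real r ^ k)"
    using gen_binomial_complex[of "of_real r" \<sigma>] r op0 by (auto simp: sums_iff)
  then have "summable (%k. norm ((\<sigma> gchoose k) * complex_of_real (op_norm z) ^ k))"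
    by (rule powser_insidea) (use r op0 in auto)
  then have sum: "summable (%k. norm (a k) * op_norm z ^ k)"
    using op0 by (simp add: a_def norm_mult norm_power)
  have "(%k. a k * matrix_power z k $ i $ j) sums (one_minus_powr z \<sigma> $ i $ j)" for i j
  proof -
    have "summable (%k. a k * matrix_power z k $ i $ j)"
    proof (rule summable_comparison_test'[OF sum])
      show "norm (a k * matrix_power z k $ i $ j) \<le> norm (a k) * op_norm z ^ k" for k
        unfolding norm_mult by (intro mult_left_mono norm_matrix_power_nth_le) auto
    qed
    then show ?thesis by (simp add: one_minus_powr_def a_def summable_sums)
  qed
  moreover have "mpoly (p N) z $ i $ j = (\<Sum>k<N. a k * matrix_power z k $ i $ j)" for N i j
    unfolding p_def mpoly_sum by (simp add: mpoly_monom mat_times_nth)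
  ultimately have "(%N. mpoly (p N) z) \<longlonglongrightarrow> one_minus_powr z \<sigma>"
    by (intro vec_tendstoI) (simp add: sums_def)
  then have "(%N. det (mpoly (p N) z)) \<longlonglongrightarrow> det (one_minus_powr z \<sigma>)" by (rule tendsto_det)
  moreover have "(%N. det (mpoly (p N) z)) \<longlonglongrightarrow> (\<Prod>k<CARD('n). (1 - w k) powr \<sigma>)"
    unfolding det_mpoly[OF w]
  proof (intro tendsto_prod)
    fix k assume "k \<in> {..<CARD('n)}"
    then have "norm (- w k) < 1" using char_roots_norm_le[OF w, of k] z by simp
    from gen_binomial_complex[OF this, of \<sigma>]
    have "(%k'. a k' * w k ^ k') sums (1 - w k) powr \<sigma>"
      by (simp add: a_def power_minus[of "w k"] mult_ac)
    then show "(%N. poly (p N) (w k)) \<longlonglongrightarrow> (1 - w k) powr \<sigma>"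
      by (simp add: p_def poly_sum poly_monom sums_def)
  qed
  ultimately show ?thesis by (rule LIMSEQ_unique)
qed

lemma op_norm_unitary:
  fixes z :: "complex^'n^'n"
  assumes "z \<in> unitary_group"
  shows "\<not> op_norm z < 1"
proof -
  have "norm (z *v axis undefined 1) \<le> op_norm z * norm (axis undefined 1 :: complex^'n)"
    by (rule matrix_vector_norm_le)
  then show ?thesis by (simp add: unitary_norm[OF assms] norm_axis_one)
qed

lemma op_norm_scaleR_unitary:
  fixes z :: "complex^'n^'n"
  assumes "z \<in> unitary_group" "0 \<le> r"
  shows "op_norm (r *\<^sub>R z) \<le> r"
  unfolding op_norm_def
proof (rule onorm_le)
  fix x :: "complex^'n"
  have "(r *\<^sub>R z) *v x = r *\<^sub>R (z *v x)"
    by (simp add: cart_eq_iff matrix_vector_mult_def scaleR_sum_right)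
  then show "norm ((r *\<^sub>R z) *v x) \<le> r * norm x" using assms by (simp add: unitary_norm)
qed

lemma isCont_one_minus_powr:
  fixes z :: complex
  assumes "norm z \<le> 1" "z \<noteq> 1"
  shows "isCont (%x. (1 - x) powr s) z"
  using one_minus_nonpos_Reals[OF assms] by (intro continuous_intros) auto

text \<open>The limit in the definition of the power of the determinant is the product over the
  eigenvalues.\<close>
text \<open>Along a sequence in the limit that defines the power of the determinant the eigenvalues
  converge to those of \<open>z\<close> within the unit disc, where the power is continuous off 1.\<close>
lemma det_one_minus_powr_unitary:
  fixes z :: "complex^'n^'n"
  assumes z: "z \<in> unitary_group" and w: "char_roots z w" and norm_w: "\<And>k. k < CARD('n) ==> norm (w k) = 1"
    and w1: "\<And>k. k < CARD('n) ==> w k \<noteq> 1"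
  shows "det_one_minus_powr z \<sigma> = (\<Prod>k<CARD('n). (1 - w k) powr \<sigma>)"
proof -
  define S where "S = {z' :: complex^'n^'n. op_norm z' < 1}"
  have "z islimpt S"
    unfolding islimpt_sequential
  proof (intro exI[of _ "%i. (1 - 1 / real (Suc i)) *\<^sub>R z"] conjI allI)
    show "(1 - 1 / real (Suc i)) *\<^sub>R z \<in> S - {z}" for i
    proof -
      have "op_norm ((1 - 1 / real (Suc i)) *\<^sub>R z) \<le> 1 - 1 / real (Suc i)"
        by (rule op_norm_scaleR_unitary[OF z]) simp
      also have "... < 1" by simp
      finally have "op_norm ((1 - 1 / real (Suc i)) *\<^sub>R z) < 1" .
      then show ?thesis using op_norm_unitary[OF z] by (auto simp: S_def)
    qed
    have "(%i. (1 - 1 / real (Suc i)) *\<^sub>R z) \<longlonglongrightarrow> (1 - 0) *\<^sub>R z"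
      by (intro tendsto_intros LIMSEQ_Suc[OF lim_1_over_n])
    then show "(%i. (1 - 1 / real (Suc i)) *\<^sub>R z) \<longlonglongrightarrow> z" by simp
  qed
  then have nontriv: "\<not> trivial_limit (at z within S)" by (simp add: trivial_limit_within)
  have "((%z'. det (one_minus_powr z' \<sigma>)) \<longlongrightarrow> (\<Prod>k<CARD('n). (1 - w k) powr \<sigma>)) (at z within S)"
    unfolding tendsto_at_iff_sequentially
  proof (intro allI impI)
    fix X :: "nat => complex^'n^'n" assume X: "\<forall>i. X i \<in> S - {z}" "X \<longlonglongrightarrow> z"
    define y where "y i = (SOME w. char_roots (X i) w)" for i
    have y: "char_roots (X i) (y i)" for i unfolding y_def by (rule someI_ex[OF char_roots_exist])
    have "det (one_minus_powr (X i) \<sigma>) = (\<Prod>k<CARD('n). (1 - y i k) powr \<sigma>)" for i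
      using X(1) y by (intro det_one_minus_powr_series) (auto simp: S_def)
    moreover have "(%i. \<Prod>k<CARD('n). (1 - y i k) powr \<sigma>) \<longlonglongrightarrow> (\<Prod>k<CARD('n). (1 - w k) powr \<sigma>)"
    proof (rule tendsto_prod_char_roots[OF X(2) y w])
      show "norm (y i k) \<le> 1" if "k < CARD('n)" for i k
      proof -
        have "op_norm (X i) < 1" using X(1) by (simp add: S_def)
        then show ?thesis using char_roots_norm_le[OF y that, of i] by linarith
      qed
      show "continuous (at (w k) within cball 0 1) (%x. (1 - x) powr \<sigma>)" if "k < CARD('n)" for k
        by (rule continuous_at_imp_continuous_at_within[OF isCont_one_minus_powr[OF _ w1[OF that]]]) (simp add: norm_w[OF that])
    qed
    ultimately show "((%z'. det (one_minus_powr z' \<sigma>)) \<circ> X) \<longlonglongrightarrow> (\<Prod>k<CARD('n). (1 - w k) powr \<sigma>)"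
      by (simp add: o_def)
  qed
  then have "Lim (at z within S) (%z'. det (one_minus_powr z' \<sigma>)) = (\<Prod>k<CARD('n). (1 - w k) powr \<sigma>)"
    by (rule tendsto_Lim[OF nontriv])
  then show ?thesis using op_norm_unitary[OF z] by (simp add: det_one_minus_powr_def S_def)
qed

lemma cnj_matrix_unitary:
  fixes z :: "complex^'n^'n"
  assumes z: "z \<in> unitary_group"
  shows "cnj_matrix z \<in> unitary_group"
proof -
  have cnj_mult: "cnj_matrix (A ** B) = cnj_matrix A ** cnj_matrix B" for A B :: "complex^'n^'n"
    by (simp add: cnj_matrix_def matrix_matrix_mult_def cart_eq_iff)
  have tr: "cnj_matrix (transpose A) = transpose (cnj_matrix A)" for A :: "complex^'n^'n"
    by (simp add: cnj_matrix_def cart_transpose_def cart_eq_iff)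
  have one: "cnj_matrix (mat 1 :: complex^'n^'n) = mat 1"
    by (simp add: cnj_matrix_def cart_eq_iff mat_nth)
  have "cnj_matrix z ** transpose (cnj_matrix (cnj_matrix z)) = cnj_matrix (z ** transpose (cnj_matrix z))"
    "transpose (cnj_matrix (cnj_matrix z)) ** cnj_matrix z = cnj_matrix (transpose (cnj_matrix z) ** z)"
    by (simp_all only: cnj_mult tr)
  moreover have "z ** transpose (cnj_matrix z) = mat 1" "transpose (cnj_matrix z) ** z = mat 1"
    using z by (simp_all add: unitary_group_def)
  ultimately show ?thesis by (simp add: unitary_group_def one)
qed

lemma char_roots_cnj:
  fixes z :: "complex^'n^'n"
  assumes "char_roots z w"
  shows "char_roots (cnj_matrix z) (%k. cnj (w k))"
  unfolding char_roots_def
proof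
  fix x
  have "mat x - cnj_matrix z = cnj_matrix (mat (cnj x) - z)"
    by (simp add: cnj_matrix_def cart_eq_iff mat_nth)
  moreover have "det (cnj_matrix A) = cnj (det A)" for A :: "complex^'n^'n"
    by (simp add: cart_det_def cnj_matrix_def)
  ultimately show "det (mat x - cnj_matrix z) = (\<Prod>k<CARD('n). x - cnj (w k))"
    using assms by (simp add: char_roots_def)
qed

definition regular_unitary :: "(complex^'n^'n) set" where
  "regular_unitary = {g \<in> unitary_group. det (mat 1 - g) \<noteq> 0}"

lemma regular_unitary_iff:
  fixes g :: "complex^'n^'n"
  assumes "g \<in> unitary_group"
  shows "g \<in> regular_unitary \<longleftrightarrow> (\<forall>k<CARD('n). eigs g k \<noteq> 1)"
  using char_roots_eigs[OF assms] assms by (auto simp: regular_unitary_def char_roots_def)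

theorem ell_eq:
  fixes g :: "complex^'n^'n"
  assumes g: "g \<in> regular_unitary"
  shows "ell s t g = 2 powr (- (s + t) * of_nat CARD('n)) * (\<Prod>k<CARD('n). circle_symbol s t (eigs g k))"
proof -
  have gU: "g \<in> unitary_group" using g by (simp add: regular_unitary_def)
  have e1: "eigs g k \<noteq> 1" if "k < CARD('n)" for k using g regular_unitary_iff[OF gU] that by blast
  have 1: "det_one_minus_powr g s = (\<Prod>k<CARD('n). (1 - eigs g k) powr s)"
    by (rule det_one_minus_powr_unitary[OF gU char_roots_eigs[OF gU]]) (use e1 in auto)
  have 2: "det_one_minus_powr (cnj_matrix g) t = (\<Prod>k<CARD('n). (1 - cnj (eigs g k)) powr t)"
    by (rule det_one_minus_powr_unitary[OF cnj_matrix_unitary[OF gU] char_roots_cnj[OF char_roots_eigs[OF gU]]])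
       (use e1 in auto)
  show ?thesis using g unfolding ell_def 1 2 circle_symbol_def
    by (simp add: regular_unitary_def prod.distrib mult.assoc)
qed

lemma ell_singular: "g \<in> unitary_group ==> g \<notin> regular_unitary ==> ell s t g = 0"
  by (simp add: regular_unitary_def ell_def)

text \<open>Both sides vanish at an eigenvalue 1, since \<open>0 powr s = 0\<close>.\<close>
lemma ell_eq_pos:
  fixes g :: "complex^'n^'n"
  assumes g: "g \<in> unitary_group" and "Re s > 0" "Re t > 0"
  shows "ell s t g = 2 powr (- (s + t) * of_nat CARD('n)) * (\<Prod>k<CARD('n). circle_symbol s t (eigs g k))"
proof (cases "g \<in> regular_unitary")
  case False
  then obtain k where "k < CARD('n)" "eigs g k = 1" using regular_unitary_iff[OF g] by blast
  then have "(\<Prod>k<CARD('n). circle_symbol s t (eigs g k)) = 0"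
    by (intro prod_zero) (auto simp: circle_symbol_def)
  then show ?thesis using ell_singular[OF g False] by simp
qed (rule ell_eq)

lemma sets_regular_unitary: "regular_unitary \<in> sets (borel :: (complex^'n^'n) measure)"
proof -
  have "continuous_on UNIV (%g :: complex^'n^'n. det (mat 1 - g))"
    unfolding cart_det_def by (intro continuous_intros)
  then have "open {g :: complex^'n^'n. det (mat 1 - g) \<noteq> 0}" by (intro open_Collect_neq continuous_on_const)
  moreover have "regular_unitary = unitary_group \<inter> {g :: complex^'n^'n. det (mat 1 - g) \<noteq> 0}"
    by (auto simp: regular_unitary_def)
  ultimately show ?thesis using compact_unitary_group by (metis borel_compact borel_open sets.Int)
qed

text \<open>The single eigenvalues are not continuous on the group, but products over all of them are.\<close>
lemma continuous_on_prod_eigs: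
  fixes S :: "(complex^'n^'n) set" and f :: "complex => complex"
  assumes S: "S \<subseteq> unitary_group"
    and f: "\<And>g k. g \<in> S ==> k < CARD('n) ==> continuous (at (eigs g k) within cball 0 1) f"
  shows "continuous_on S (%g. \<Prod>k<CARD('n). f (eigs g k))"
  unfolding continuous_on_sequentially
proof (intro allI ballI impI)
  fix X :: "nat => complex^'n^'n" and g assume g: "g \<in> S" "(\<forall>i. X i \<in> S) \<and> X \<longlonglongrightarrow> g"
  then have U: "g \<in> unitary_group" "\<And>i. X i \<in> unitary_group" using S by auto
  have "(%i. \<Prod>k<CARD('n). f (eigs (X i) k)) \<longlonglongrightarrow> (\<Prod>k<CARD('n). f (eigs g k))"
    by (rule tendsto_prod_char_roots[OF _ char_roots_eigs[OF U(2)] char_roots_eigs[OF U(1)]]) (use g f in auto)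
  then show "((%g. \<Prod>k<CARD('n). f (eigs g k)) \<circ> X) \<longlonglongrightarrow> (\<Prod>k<CARD('n). f (eigs g k))"
    by (simp add: o_def)
qed

lemma continuous_on_ell: "continuous_on regular_unitary (ell s t :: complex^'n^'n => complex)"
proof (rule continuous_on_cong[THEN iffD1, OF refl])
  show "2 powr (- (s + t) * of_nat CARD('n)) * (\<Prod>k<CARD('n). circle_symbol s t (eigs g k)) = ell s t g"
    if "g \<in> regular_unitary" for g :: "complex^'n^'n" using ell_eq[OF that] by simp
  show "continuous_on regular_unitary
     (%g :: complex^'n^'n. 2 powr (- (s + t) * of_nat CARD('n)) * (\<Prod>k<CARD('n). circle_symbol s t (eigs g k)))"
  proof (intro continuous_on_mult continuous_on_const continuous_on_prod_eigs)
    show sub: "regular_unitary \<subseteq> (unitary_group :: (complex^'n^'n) set)" by (auto simp: regular_unitary_def)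
    fix g :: "complex^'n^'n" and k assume g: "g \<in> regular_unitary" "k < CARD('n)"
    then have "eigs g k \<noteq> 1" using regular_unitary_iff[of g] sub by blast
    then have "1 - eigs g k \<notin> \<real>\<^sub>\<le>\<^sub>0" "1 - cnj (eigs g k) \<notin> \<real>\<^sub>\<le>\<^sub>0"
      using one_minus_nonpos_Reals[of "eigs g k"] one_minus_nonpos_Reals[of "cnj (eigs g k)"] by auto
    then have "isCont (circle_symbol s t) (eigs g k)"
      unfolding circle_symbol_def[abs_def] by (intro continuous_intros) auto
    then show "continuous (at (eigs g k) within cball 0 1) (circle_symbol s t)"
      by (rule continuous_at_imp_continuous_at_within)
  qed
qed

lemma haar_measurable_regular:
  fixes f :: "complex^'n^'n => complex"
  assumes haar: "normalized_haar \<mu>" and f: "continuous_on regular_unitary f"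
    and "\<And>g. g \<in> unitary_group ==> g \<notin> regular_unitary ==> f g = 0"
  shows "f \<in> borel_measurable \<mu>"
proof -
  have "(%g. indicator regular_unitary g *\<^sub>R f g) \<in> borel_measurable borel"
    by (rule borel_measurable_continuous_on_indicator[OF sets_regular_unitary f])
  then have "(%g. indicator regular_unitary g *\<^sub>R f g) \<in> borel_measurable (restrict_space borel unitary_group)"
    by (rule measurable_restrict_space1)
  then have "(%g. indicator regular_unitary g *\<^sub>R f g) \<in> borel_measurable \<mu>"
    using haar_basics(3)[OF haar] by (simp cong: measurable_cong_sets)
  then show ?thesis
    using assms(3) haar_basics(2)[OF haar]
    by (subst (asm) measurable_cong[where g = f]) (auto simp: indicator_def)
qed

lemma ell_measurable: "normalized_haar \<mu> ==> ell s t \<in> borel_measurable \<mu>"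
  by (rule haar_measurable_regular[OF _ continuous_on_ell ell_singular])

section \<open>Dependence on the exponents\<close>

text \<open>The logarithmic distance to the singular set, normalized to be non-negative.  As a
  function of a shift of both exponents \<open>ell\<close> is an exponential in it, and integrals of
  \<open>ell\<close> are Laplace integrals.\<close>
definition singularity :: "complex^'n^'n => real" where
  "singularity g = (if g \<in> regular_unitary then - ln (norm (det (mat 1 - g)) / 2 ^ CARD('n)) else 0)"

lemma norm_det_one_minus:
  fixes g :: "complex^'n^'n"
  assumes g: "g \<in> regular_unitary"
  shows "norm (det (mat 1 - g)) / 2 ^ CARD('n) = (\<Prod>k<CARD('n). norm (1 - eigs g k) / 2)"
    and "singularity g = (\<Sum>k<CARD('n). - ln (norm (1 - eigs g k) / 2))"
proof -
  have gU: "g \<in> unitary_group" using g by (simp add: regular_unitary_def)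
  have e1: "eigs g k \<noteq> 1" if "k < CARD('n)" for k using g regular_unitary_iff[OF gU] that by blast
  show 1: "norm (det (mat 1 - g)) / 2 ^ CARD('n) = (\<Prod>k<CARD('n). norm (1 - eigs g k) / 2)"
    using char_roots_eigs[OF gU] by (simp add: char_roots_def prod_norm[symmetric] prod_dividef)
  show "singularity g = (\<Sum>k<CARD('n). - ln (norm (1 - eigs g k) / 2))"
  proof -
    have "ln (\<Prod>k<CARD('n). norm (1 - eigs g k) / 2) = (\<Sum>k<CARD('n). ln (norm (1 - eigs g k) / 2))"
      by (rule ln_prod) (use e1 in auto)
    then show ?thesis unfolding singularity_def 1 using g by (simp add: sum_negf)
  qed
qed

lemma singularity_nonneg: "0 \<le> singularity (g :: complex^'n^'n)"
proof (cases "g \<in> regular_unitary")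
  case True
  then have gU: "g \<in> unitary_group" by (simp add: regular_unitary_def)
  have "0 \<le> - ln (norm (1 - eigs g k) / 2)" if "k < CARD('n)" for k
  proof -
    have "eigs g k \<noteq> 1" using True regular_unitary_iff[OF gU] that by blast
    moreover have "norm (1 - eigs g k) \<le> 2" using norm_triangle_ineq4[of 1 "eigs g k"] by simp
    ultimately show ?thesis by (simp add: ln_le_zero_iff)
  qed
  then show ?thesis unfolding norm_det_one_minus(2)[OF True] by (intro sum_nonneg) auto
qed (simp add: singularity_def)

lemma singularity_measurable:
  fixes \<mu> :: "(complex^'n^'n) measure"
  assumes "normalized_haar \<mu>"
  shows "singularity \<in> borel_measurable \<mu>"
proof -
  have "continuous_on regular_unitary (%g :: complex^'n^'n. - ln (norm (det (mat 1 - g)) / 2 ^ CARD('n)))"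
  proof (intro continuous_intros)
    show "continuous_on regular_unitary (%g :: complex^'n^'n. det (mat 1 - g))"
      unfolding cart_det_def by (intro continuous_intros)
  qed (auto simp: regular_unitary_def)
  then have "continuous_on regular_unitary (%g :: complex^'n^'n. complex_of_real (singularity g))"
    by (intro continuous_on_of_real) (simp add: singularity_def cong: continuous_on_cong)
  then have "(%g. complex_of_real (singularity g)) \<in> borel_measurable \<mu>"
    by (intro haar_measurable_regular[OF assms]) (auto simp: singularity_def)
  then have "(%g. Re (complex_of_real (singularity g))) \<in> borel_measurable \<mu>" by measurable
  then show ?thesis by simp
qed

lemma Ln_2: "Ln 2 = complex_of_real (ln 2)"
  using Ln_of_real[of 2] by simp

text \<open>For conjugate bases the logarithms add up to a real number.\<close>
lemma circle_symbol_shift: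
  assumes "norm z = 1" "z \<noteq> 1"
  shows "circle_symbol (s + u) (t + u) z = circle_symbol s t z * exp (2 * u * ln (norm (1 - z)))"
proof -
  have pos: "1 - z \<noteq> 0" "1 - cnj z \<noteq> 0" using assms by auto
  have "Ln (1 - cnj z) = cnj (Ln (1 - z))"
    using one_minus_nonpos_Reals[of z] assms cnj_Ln[of "1 - z"] by simp
  then have "Ln (1 - z) + Ln (1 - cnj z) = 2 * of_real (ln (norm (1 - z)))"
    using pos by (simp add: complex_add_cnj)
  then have "u * Ln (1 - z) + u * Ln (1 - cnj z) = 2 * u * ln (norm (1 - z))"
    by (simp flip: distrib_left)
  then show ?thesis
    using pos unfolding circle_symbol_def powr_def by (simp add: exp_add[symmetric] algebra_simps)
qed

theorem ell_shift:
  fixes g :: "complex^'n^'n"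
  assumes g: "g \<in> unitary_group"
  shows "ell (s + u) (t + u) g = ell s t g * exp (- (2 * u * singularity g))"
proof (cases "g \<in> regular_unitary")
  case True
  have e1: "eigs g k \<noteq> 1" if "k < CARD('n)" for k using True regular_unitary_iff[OF g] that by blast
  have pow: "2 powr (- ((s + u) + (t + u)) * of_nat CARD('n)) =
      2 powr (- (s + t) * of_nat CARD('n)) * (\<Prod>k<CARD('n). exp (- (2 * u * of_real (ln 2))))"
    by (simp add: powr_def exp_of_nat_mult[symmetric] exp_add[symmetric] algebra_simps Ln_2)
  have "(\<Prod>k<CARD('n). exp (- (2 * u * of_real (ln 2)))) * (\<Prod>k<CARD('n). exp (2 * u * ln (norm (1 - eigs g k)))) =
      (\<Prod>k<CARD('n). exp (- (2 * u * of_real (- ln (norm (1 - eigs g k) / 2)))))"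
    unfolding prod.distrib[symmetric]
    by (intro prod.cong refl) (use e1 in \<open>simp add: exp_add[symmetric] ln_div algebra_simps\<close>)
  also have "... = exp (- (2 * u * singularity g))"
    unfolding norm_det_one_minus(2)[OF True] by (simp add: exp_sum[symmetric] sum_distrib_left sum_negf)
  finally have fin: "(\<Prod>k<CARD('n). exp (- (2 * u * of_real (ln 2)))) * (\<Prod>k<CARD('n). exp (2 * u * ln (norm (1 - eigs g k)))) =
      exp (- (2 * u * singularity g))" .
  have "ell (s + u) (t + u) g = 2 powr (- ((s + u) + (t + u)) * of_nat CARD('n)) *
      (\<Prod>k<CARD('n). circle_symbol s t (eigs g k) * exp (2 * u * ln (norm (1 - eigs g k))))"
    unfolding ell_eq[OF True] using e1 by (simp add: circle_symbol_shift)
  also have "... = ell s t g * ((\<Prod>k<CARD('n). exp (- (2 * u * of_real (ln 2)))) * (\<Prod>k<CARD('n). exp (2 * u * ln (norm (1 - eigs g k)))))"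
    unfolding ell_eq[OF True] pow prod.distrib by (simp add: mult_ac)
  finally show ?thesis unfolding fin .
qed (simp add: ell_singular[OF g])

text \<open>The imaginary parts of the exponents contribute a bounded factor, since arguments are bounded by \<open>pi\<close>.\<close>
lemma norm_circle_symbol_le:
  assumes "norm z = 1" "z \<noteq> 1"
  shows "norm (circle_symbol s t z) \<le> exp (pi * (\<bar>Im s\<bar> + \<bar>Im t\<bar>)) * exp (Re (s + t) * ln (norm (1 - z)))"
proof -
  have one: "norm (x powr s) \<le> exp (pi * \<bar>Im s\<bar>) * exp (Re s * ln (norm x))" if "x \<noteq> 0" for x s
  proof -
    have "norm (x powr s) = exp (Re s * ln (norm x) - Im s * Im (Ln x))"
      using that by (simp add: powr_def)
    also have "... \<le> exp (pi * \<bar>Im s\<bar> + Re s * ln (norm x))"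
    proof -
      have "- (Im s * Im (Ln x)) \<le> \<bar>Im s\<bar> * \<bar>Im (Ln x)\<bar>" by (simp flip: abs_mult)
      also have "... \<le> \<bar>Im s\<bar> * pi"
        using mpi_less_Im_Ln[OF that] Im_Ln_le_pi[OF that] by (intro mult_left_mono) auto
      finally show ?thesis by (simp add: mult.commute)
    qed
    finally show ?thesis by (simp add: exp_add)
  qed
  have n: "norm (1 - cnj z) = norm (1 - z)"
    using complex_mod_cnj[of "1 - z"] by simp
  have "norm (circle_symbol s t z) \<le> (exp (pi * \<bar>Im s\<bar>) * exp (Re s * ln (norm (1 - z)))) *
      (exp (pi * \<bar>Im t\<bar>) * exp (Re t * ln (norm (1 - cnj z))))"
    unfolding circle_symbol_def norm_mult using assms by (intro mult_mono one) auto
  then show ?thesis by (simp add: n exp_add[symmetric] algebra_simps)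
qed

lemma norm_ell_le:
  fixes g :: "complex^'n^'n"
  assumes g: "g \<in> unitary_group"
  shows "norm (ell s t g) \<le> exp (pi * (\<bar>Im s\<bar> + \<bar>Im t\<bar>)) ^ CARD('n) *
    (indicator regular_unitary g * exp (- (Re (s + t) * singularity g)))"
proof (cases "g \<in> regular_unitary")
  case True
  have e1: "eigs g k \<noteq> 1" if "k < CARD('n)" for k using True regular_unitary_iff[OF g] that by blast
  have "norm (ell s t g) = norm (2 powr (- (s + t) * of_nat CARD('n))) * (\<Prod>k<CARD('n). norm (circle_symbol s t (eigs g k)))"
    unfolding ell_eq[OF True] norm_mult prod_norm[symmetric] by (rule refl)
  also have "norm (2 powr (- (s + t) * of_nat CARD('n)) :: complex) = (\<Prod>k<CARD('n). exp (- (Re (s + t) * ln 2)))"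
    by (simp add: powr_def exp_of_nat_mult[symmetric] Ln_2 algebra_simps)
  also have "(\<Prod>k<CARD('n). norm (circle_symbol s t (eigs g k))) \<le>
      (\<Prod>k<CARD('n). exp (pi * (\<bar>Im s\<bar> + \<bar>Im t\<bar>)) * exp (Re (s + t) * ln (norm (1 - eigs g k))))"
    using e1 by (intro prod_mono conjI norm_circle_symbol_le) auto
  also have "(\<Prod>k<CARD('n). exp (- (Re (s + t) * ln 2))) * \<dots> =
      exp (pi * (\<bar>Im s\<bar> + \<bar>Im t\<bar>)) ^ CARD('n) *
      (\<Prod>k<CARD('n). exp (- (Re (s + t) * (- ln (norm (1 - eigs g k) / 2)))))"
  proof -
    have "exp (- (Re (s + t) * ln 2)) * exp (Re (s + t) * ln (norm (1 - eigs g k))) =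
        exp (- (Re (s + t) * (- ln (norm (1 - eigs g k) / 2))))" if "k < CARD('n)" for k
      using e1[OF that] by (simp add: exp_add[symmetric] ln_div algebra_simps)
    then have "(\<Prod>k<CARD('n). exp (- (Re (s + t) * ln 2))) * (\<Prod>k<CARD('n). exp (Re (s + t) * ln (norm (1 - eigs g k)))) =
        (\<Prod>k<CARD('n). exp (- (Re (s + t) * (- ln (norm (1 - eigs g k) / 2)))))"
      unfolding prod.distrib[symmetric] by (intro prod.cong refl) simp
    then show ?thesis unfolding prod.distrib by (simp only: prod_constant card_lessThan mult.left_commute)
  qed
  also have "(\<Prod>k<CARD('n). exp (- (Re (s + t) * (- ln (norm (1 - eigs g k) / 2))))) = exp (- (Re (s + t) * singularity g))"
    unfolding norm_det_one_minus(2)[OF True] by (simp add: exp_sum[symmetric] sum_distrib_left sum_negf)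
  finally show ?thesis using True by (simp add: mult_left_mono)
qed (simp add: ell_singular[OF g])

section \<open>The expansion for large exponents\<close>

text \<open>The coefficient that the Cauchy--Binet formula gives.\<close>
definition coefficient :: "nat => complex => complex => (nat => int) => complex" where
  "coefficient n s t m = jdet n (%j k. fourier_coeff (s + of_nat (n - 1 - k)) t (m (Suc j)))"

text \<open>The part of the coefficient that is entire in \<open>s\<close> and \<open>t\<close>.\<close>
definition reduced_coefficient :: "nat => complex => complex => (nat => int) => complex" where
  "reduced_coefficient n s t m = (-1) powi (\<Sum>j=1..n. m j) * signature_differences n m *
     (\<Prod>j=1..n. rGamma (s - of_int (m j) + of_nat n) * rGamma (t + of_int (m j) + 1))"

lemma signature_differences_eq:
  "signature_differences n m = (\<Prod>b<n. \<Prod>a<b. of_int (m (Suc a)) - of_int (m (Suc b)))"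
proof -
  have "signature_differences n m = (\<Prod>(\<alpha>, \<beta>)\<in>{(\<alpha>, \<beta>). 1 \<le> \<alpha> \<and> \<alpha> < \<beta> \<and> \<beta> \<le> n}. of_int (m \<alpha>) - of_int (m \<beta>))"
    by (simp add: signature_differences_def)
  also have "... = (\<Prod>(b, a)\<in>(SIGMA b:{..<n}. {..<b}). of_int (m (Suc a)) - of_int (m (Suc b)))"
    by (rule prod.reindex_bij_witness[of _ "%(b, a). (Suc a, Suc b)" "%(a, b). (b - 1, a - 1)"]) auto
  also have "... = (\<Prod>b<n. \<Prod>a<b. of_int (m (Suc a)) - of_int (m (Suc b)))"
    by (simp add: prod.Sigma)
  finally show ?thesis .
qed

text \<open>All Gamma quotients in a row have a common factor, and what remains is monic of degree \<open>k\<close>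
  in \<open>- p\<close>.\<close>
lemma fourier_coeff_shift:
  assumes "k < n"
  shows "fourier_coeff (s + of_nat (n - 1 - k)) t p =
    ((-1) powi p * rGamma (s - of_int p + of_nat n) * rGamma (t + of_int p + 1)) *
    (Gamma (s + t + of_nat (n - k)) * poly (\<Prod>a<k. [:s + of_nat (n - k) + of_nat a, 1:]) (- of_int p))"
proof -
  have nk: "of_nat n = of_nat (n - 1 - k) + 1 + (of_nat k :: complex)" "of_nat (n - k) = 1 + (of_nat (n - 1 - k) :: complex)"
    using assms by (simp_all add: of_nat_diff)
  have "rGamma (1 + (s + of_nat (n - 1 - k)) - of_int p) =
      pochhammer (1 + (s + of_nat (n - 1 - k)) - of_int p) k * rGamma (1 + (s + of_nat (n - 1 - k)) - of_int p + of_nat k)"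
    by (rule pochhammer_rGamma)
  also have "1 + (s + of_nat (n - 1 - k)) - of_int p + of_nat k = s - of_int p + of_nat n"
    unfolding nk by simp
  also have "pochhammer (1 + (s + of_nat (n - 1 - k)) - of_int p) k = poly (\<Prod>a<k. [:s + of_nat (n - k) + of_nat a, 1:]) (- of_int p)"
    unfolding pochhammer_prod poly_prod nk(2) by (intro prod.cong) (auto simp: algebra_simps)
  finally have 1: "rGamma (1 + (s + of_nat (n - 1 - k)) - of_int p) =
      poly (\<Prod>a<k. [:s + of_nat (n - k) + of_nat a, 1:]) (- of_int p) * rGamma (s - of_int p + of_nat n)" .
  have 2: "1 + (s + of_nat (n - 1 - k)) + t = s + t + of_nat (n - k)" unfolding nk(2) by simp
  have 3: "1 + t + of_int p = t + of_int p + 1" by simp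
  show ?thesis unfolding fourier_coeff_def 1 2 3 by (simp only: mult_ac)
qed

text \<open>Take the common factors of rows and columns out of the determinant; the remaining monic
  polynomials at the points \<open>- m j\<close> give the product of differences.\<close>
theorem coefficient_eq:
  "coefficient n s t m = (\<Prod>j=1..n. Gamma (s + t + of_nat j)) * reduced_coefficient n s t m"
proof -
  define P where "P k = (\<Prod>a<k. [:s + of_nat (n - k) + of_nat a, 1:])" for k
  define r where "r j = (-1) powi m (Suc j) * rGamma (s - of_int (m (Suc j)) + of_nat n) * rGamma (t + of_int (m (Suc j)) + 1)" for j
  have P: "degree (P k) = k" "lead_coeff (P k) = 1" for k
  proof -
    show "lead_coeff (P k) = 1" unfolding P_def by (simp add: lead_coeff_prod)
    show "degree (P k) = k" unfolding P_def by (subst degree_prod_eq_sum_degree) auto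
  qed
  have "coefficient n s t m = jdet n (%j k. r j * (Gamma (s + t + of_nat (n - k)) * poly (P k) (- of_int (m (Suc j)))))"
    unfolding coefficient_def r_def P_def
  proof (rule jdet_cong)
    fix j k assume "j < n" "k < n"
    then show "fourier_coeff (s + of_nat (n - 1 - k)) t (m (Suc j)) =
        (-1) powi m (Suc j) * rGamma (s - of_int (m (Suc j)) + of_nat n) * rGamma (t + of_int (m (Suc j)) + 1) *
        (Gamma (s + t + of_nat (n - k)) * poly (\<Prod>a<k. [:s + of_nat (n - k) + of_nat a, 1:]) (- of_int (m (Suc j))))"
      by (intro fourier_coeff_shift)
  qed
  also have "... = (\<Prod>j<n. r j) * ((\<Prod>k<n. Gamma (s + t + of_nat (n - k))) * jdet n (%j k. poly (P k) (- of_int (m (Suc j)))))"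
    by (simp only: jdet_scale_rows jdet_scale_cols)
  also have "jdet n (%j k. poly (P k) (- of_int (m (Suc j)))) = signature_differences n m"
    unfolding signature_differences_eq by (subst jdet_monic_polys) (use P in auto)
  also have "(\<Prod>k<n. Gamma (s + t + of_nat (n - k))) = (\<Prod>j=1..n. Gamma (s + t + of_nat j))"
    by (rule prod.reindex_bij_witness[of _ "%j. n - j" "%k. n - k"]) auto
  also have "(\<Prod>j<n. r j) = (-1) powi (\<Sum>j=1..n. m j) *
     (\<Prod>j=1..n. rGamma (s - of_int (m j) + of_nat n) * rGamma (t + of_int (m j) + 1))"
  proof -
    have "(\<Prod>j\<in>A. (-1 :: complex) powi f j) = (-1) powi (\<Sum>j\<in>A. f j)" for A :: "nat set" and f
      by (induction A rule: infinite_finite_induct) (auto simp: power_int_add)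
    then show ?thesis
      by (simp add: r_def prod.distrib prod.atLeast1_atMost_eq sum.atLeast1_atMost_eq mult.assoc)
  qed
  finally show ?thesis by (simp only: reduced_coefficient_def mult_ac)
qed

lemma norm_coefficient_bound:
  assumes "Re s \<ge> R" "Re t \<ge> R" "R > 0"
  obtains C where "C \<ge> 0" "\<And>m. norm (coefficient n s t m) \<le> C * weight n m powr - (R + 1)"
proof -
  have "\<exists>C\<ge>0. \<forall>p. norm (fourier_coeff (s + of_nat i) t p) \<le> C * (1 + \<bar>real_of_int p\<bar>) powr - (R + 1)" for i
  proof -
    have "Re (s + of_nat i) \<ge> R" using assms(1) by simp
    from fourier_coeff_bound[OF this assms(2,3)] show ?thesis by metis
  qed
  then obtain C where C: "\<And>i. C i \<ge> 0" "\<And>i p. norm (fourier_coeff (s + of_nat i) t p) \<le> C i * (1 + \<bar>real_of_int p\<bar>) powr - (R + 1)"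
    by metis
  define D where "D = (\<Sum>i<n. C i)"
  have D: "D \<ge> 0" unfolding D_def using C(1) by (intro sum_nonneg) auto
  have "norm (coefficient n s t m) \<le> (fact n * D ^ n) * weight n m powr - (R + 1)" for m
  proof -
    have "norm (coefficient n s t m) = norm (jdet n (%k j. fourier_coeff (s + of_nat (n - 1 - k)) t (m (Suc j))))"
      unfolding coefficient_def by (subst jdet_transpose) simp
    also have "... \<le> fact n * (\<Prod>j<n. D * (1 + \<bar>real_of_int (m (Suc j))\<bar>) powr - (R + 1))"
    proof (rule norm_jdet_le)
      fix k j assume "k < n" "j < n"
      have "C (n - 1 - k) \<le> D" unfolding D_def using C(1) \<open>k < n\<close> by (intro member_le_sum) auto
      then show "norm (fourier_coeff (s + of_nat (n - 1 - k)) t (m (Suc j))) \<le> D * (1 + \<bar>real_of_int (m (Suc j))\<bar>) powr - (R + 1)"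
        using C(2)[of "n - 1 - k" "m (Suc j)"] by (meson mult_right_mono order_trans powr_ge_zero)
    qed
    also have "(\<Prod>j<n. D * (1 + \<bar>real_of_int (m (Suc j))\<bar>) powr - (R + 1)) = D ^ n * weight n m powr - (R + 1)"
      unfolding weight_def by (subst prod_powr_distrib) (auto simp: prod.distrib)
    finally show ?thesis by (simp add: mult.assoc)
  qed
  then show thesis using that[of "fact n * D ^ n"] D by simp
qed

lemma weight_summable:
  assumes "a > 1"
  shows "(%m. weight n m powr - a) summable_on signatures n"
proof -
  have "(%m. \<Prod>k<n. (1 + \<bar>real_of_int (m (Suc k))\<bar>) powr - a) summable_on entries n"
    using summable_on_prod_entries[of n "%k p. (1 + \<bar>real_of_int p\<bar>) powr - a"] summable_on_int_powr[OF assms] by simp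
  then have "(%m. weight n m powr - a) summable_on entries n"
    unfolding weight_def by (subst (asm) prod_powr_distrib[symmetric]) auto
  then show ?thesis using signatures_subset summable_on_subset_banach by blast
qed

lemma circle_symbol_add_nat:
  assumes s: "Re s > 0"
  shows "circle_symbol (s + of_nat i) t z = (1 - z) ^ i * circle_symbol s t z"
proof (cases "z = 1")
  case True
  then show ?thesis by (simp add: circle_symbol_def)
next
  case False
  then have "(1 - z) powr (s + of_nat i) = (1 - z) powr s * (1 - z) ^ i"
    by (simp add: powr_add powr_nat)
  then show ?thesis by (simp add: circle_symbol_def mult_ac)
qed

lemma vandermonde_one_minus:
  "jdet n (%l k. (1 - z l) ^ (n - 1 - k)) = (-1) ^ (n * (n - 1) div 2) * vandermonde n z"
proof -
  have "jdet n (%l k. (1 - z l) ^ (n - 1 - k)) = jdet n (%l k. poly (monom 1 (n - 1 - k)) (1 - z l))"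
    by (simp add: poly_monom)
  also have "... = (\<Prod>b<n. \<Prod>a<b. (1 - z a) - (1 - z b))"
    by (rule jdet_monic_polys_rev[of n "monom 1"]) (auto simp: degree_monom_eq lead_coeff_monom)
  also have "... = (\<Prod>b<n. \<Prod>a<b. (-1) * (z a - z b))"
    by simp
  also have "... = (\<Prod>b<n. (-1) ^ b) * (\<Prod>b<n. \<Prod>a<b. z a - z b)"
    by (simp only: prod.distrib prod_constant card_lessThan)
  also have "(\<Prod>b<n. (-1 :: complex) ^ b) = (-1) ^ (\<Sum>b<n. b)" by (simp add: power_sum)
  also have "(\<Sum>b<n. b) = n * (n - 1) div 2"
  proof -
    have "2 * (\<Sum>b<n. b) = n * (n - 1)"
      by (induction n) (auto simp: algebra_simps split: nat_diff_split)
    then show ?thesis by simp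
  qed
  finally show ?thesis by (simp add: vandermonde_eq)
qed

text \<open>The Fourier series of \<open>(1 - z) ^ (n - 1 - k) * circle_symbol s t z\<close>, for \<open>k < n\<close>, at the
  eigenvalues are the entries of a determinant.  It is the product of the values of
  \<open>circle_symbol\<close> and a Vandermonde determinant, and by the Cauchy--Binet formula it is also a sum
  of alternants.  Divide by the Vandermonde determinant.\<close>
lemma ell_expansion_distinct:
  fixes g :: "complex^'n^'n"
  assumes g: "g \<in> unitary_group" "distinct_eigenvalues g" and st: "Re s > 0" "Re t > 0"
  shows "((%m. coefficient CARD('n) s t m * char_fun m g) has_sum
    (-1) ^ (CARD('n) * (CARD('n) - 1) div 2) * (\<Prod>k<CARD('n). circle_symbol s t (eigs g k))) (signatures CARD('n))"
proof -
  let ?n = "CARD('n)"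
  define z where "z = eigs g"
  define V where "V = vandermonde ?n z"
  have V: "V \<noteq> 0" unfolding V_def z_def using g(2) unfolding distinct_eigenvalues_iff by (rule vandermonde_nonzero)
  have z: "norm (z l) = 1" for l by (simp add: z_def)
  have F: "((%p. fourier_coeff (s + of_nat i) t p * z l powi p) has_sum circle_symbol (s + of_nat i) t (z l)) UNIV" for i l
    using st z by (intro circle_symbol_fourier) auto
  have "((%m. jdet ?n (%j k. fourier_coeff (s + of_nat (?n - 1 - k)) t (m (Suc j))) * jdet ?n (%l j. z l powi m (Suc j))) has_sum
      jdet ?n (%l k. \<Sum>\<^sub>\<infinity>p. fourier_coeff (s + of_nat (?n - 1 - k)) t p * z l powi p)) (signatures ?n)"
  proof (rule cauchy_binet_infinite)
    fix k assume "k < ?n"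
    obtain R where R: "R > 0" "Re s \<ge> R" "Re t \<ge> R" using st that by (metis min.cobounded1 min.cobounded2 min_less_iff_conj)
    then have "Re (s + of_nat (?n - 1 - k)) \<ge> R" by simp
    then obtain C where C: "C \<ge> 0" "\<And>p. norm (fourier_coeff (s + of_nat (?n - 1 - k)) t p) \<le> C * (1 + \<bar>real_of_int p\<bar>) powr - (R + 1)"
      using R fourier_coeff_bound by metis
    show "fourier_coeff (s + of_nat (?n - 1 - k)) t abs_summable_on UNIV"
    proof (rule Infinite_Sum.abs_summable_on_comparison_test')
      show "(%p. C * (1 + \<bar>real_of_int p\<bar>) powr - (R + 1)) summable_on UNIV"
        by (intro summable_on_cmult_right summable_on_int_powr) (use R in simp)
    qed (use C in auto)
  qed (simp add: z norm_power_int)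
  also have "(%l k. \<Sum>\<^sub>\<infinity>p. fourier_coeff (s + of_nat (?n - 1 - k)) t p * z l powi p) =
      (%l k. circle_symbol s t (z l) * (1 - z l) ^ (?n - 1 - k))"
    using infsumI[OF F] st by (simp add: circle_symbol_add_nat mult.commute)
  also have "jdet ?n \<dots> = (\<Prod>l<?n. circle_symbol s t (z l)) * ((-1) ^ (?n * (?n - 1) div 2) * V)"
    unfolding jdet_scale_rows vandermonde_one_minus V_def ..
  finally have "((%m. coefficient ?n s t m * alternant ?n m z) has_sum
      (\<Prod>l<?n. circle_symbol s t (z l)) * ((-1) ^ (?n * (?n - 1) div 2) * V)) (signatures ?n)"
    by (simp add: coefficient_def alternant_def)
  then have "((%m. inverse V * (coefficient ?n s t m * alternant ?n m z)) has_sum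
      inverse V * ((\<Prod>l<?n. circle_symbol s t (z l)) * ((-1) ^ (?n * (?n - 1) div 2) * V))) (signatures ?n)"
    by (rule has_sum_cmult_right)
  moreover have "inverse V * (coefficient ?n s t m * alternant ?n m z) = coefficient ?n s t m * char_fun m g" for m
  proof -
    have "char_fun m g = inverse V * alternant ?n m z"
      unfolding char_fun_distinct[OF g] weyl_quotient_eq V_def z_def by (simp add: divide_inverse mult.commute)
    then show ?thesis by (simp only: mult.left_commute)
  qed
  moreover have "inverse V * (P * (c * V)) = c * P" for P c
    using V by (simp add: field_simps)
  ultimately show ?thesis by (simp only: z_def)
qed

text \<open>For large exponents the decay of the Fourier coefficients beats the growth of the characters.\<close>
lemma char_sum_majorant:
  assumes R: "Re s \<ge> R" "Re t \<ge> R" "R > 2 * real CARD('n) * real CARD('n)"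
  obtains M where "M summable_on signatures CARD('n)"
    "\<And>m g :: complex^'n^'n. m \<in> signatures CARD('n) ==> g \<in> unitary_group ==>
      norm (coefficient CARD('n) s t m * char_fun m g) \<le> M m"
proof -
  let ?n = "CARD('n)"
  have "0 \<le> 2 * real ?n * real ?n" by simp
  then have R0: "R > 0" using R(3) by linarith
  obtain C where C: "C \<ge> 0" "\<And>m. norm (coefficient ?n s t m) \<le> C * weight ?n m powr - (R + 1)"
    using norm_coefficient_bound[OF R(1,2) R0] by blast
  define M where "M m = (C * fact ?n) * weight ?n m powr - (R + 1 - 2 * real ?n * real ?n)" for m
  have "M summable_on signatures ?n"
    unfolding M_def by (intro summable_on_cmult_right weight_summable) (use R(3) in simp)
  moreover have "norm (coefficient ?n s t m * char_fun m g) \<le> M m"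
    if m: "m \<in> signatures ?n" and g: "g \<in> unitary_group" for m and g :: "complex^'n^'n"
  proof -
    have w: "weight ?n m > 0" using weight_ge[of ?n m] by linarith
    have "norm (coefficient ?n s t m * char_fun m g) \<le>
        (C * weight ?n m powr - (R + 1)) * (fact ?n * weight ?n m ^ (2 * ?n * ?n))"
      unfolding norm_mult using C by (intro mult_mono norm_char_fun_le g m) auto
    also have "... = (C * fact ?n) * (weight ?n m powr - (R + 1) * weight ?n m powr (2 * real ?n * real ?n))"
      using powr_realpow[OF w, of "2 * ?n * ?n"] by simp
    also have "... = M m" unfolding M_def powr_add[symmetric] by (simp add: algebra_simps)
    finally show ?thesis .
  qed
  ultimately show thesis using that by blast
qed

lemma continuous_on_symbol_product:
  assumes "Re s > 0" "Re t > 0"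
  shows "continuous_on unitary_group (%g :: complex^'n^'n. \<Prod>k<CARD('n). circle_symbol s t (eigs g k))"
proof (rule continuous_on_prod_eigs[OF order_refl])
  have pw: "continuous_on (cball 0 1) (%z. (1 - z) powr s)" if "Re s > 0" for s
  proof (rule continuous_on_powr_complex)
    show "cball 0 1 \<subseteq> {z. Re (1 - z) \<ge> 0 \<or> Im (1 - z) \<noteq> 0}"
    proof
      fix z :: complex assume "z \<in> cball 0 1"
      then have "Re z \<le> 1" using complex_Re_le_cmod[of z] by simp
      then show "z \<in> {z. Re (1 - z) \<ge> 0 \<or> Im (1 - z) \<noteq> 0}" by simp
    qed
  qed (auto intro!: continuous_intros that)
  have "continuous_on (cball 0 1) (circle_symbol s t)"
    unfolding circle_symbol_def[abs_def]
  proof (intro continuous_on_mult pw assms)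
    show "continuous_on (cball 0 1) (%z. (1 - cnj z) powr t)"
      by (rule continuous_on_compose2[OF pw[OF assms(2)], of _ cnj]) (auto intro!: continuous_intros)
  qed
  then show "continuous (at (eigs g k) within cball 0 1) (circle_symbol s t)" for g :: "complex^'n^'n" and k
    by (simp add: continuous_on_eq_continuous_within)
qed

text \<open>The series of characters converges uniformly, so its sum is continuous; it agrees with the
  continuous function \<open>ell\<close>, up to the power of 2, on the dense set of matrices with distinct
  eigenvalues.\<close>
lemma ell_expansion_uniform:
  assumes R: "Re s \<ge> R" "Re t \<ge> R" "R > 2 * real CARD('n) * real CARD('n)"
  shows "uniform_limit unitary_group (%X g :: complex^'n^'n. \<Sum>m\<in>X. coefficient CARD('n) s t m * char_fun m g)
    (%g. (-1) ^ (CARD('n) * (CARD('n) - 1) div 2) * (\<Prod>k<CARD('n). circle_symbol s t (eigs g k)))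
    (finite_subsets_at_top (signatures CARD('n)))"
proof -
  let ?n = "CARD('n)"
  define f where "f g = (\<Sum>\<^sub>\<infinity>m\<in>signatures ?n. coefficient ?n s t m * char_fun m g)" for g :: "complex^'n^'n"
  define p where "p X g = (\<Sum>m\<in>X. coefficient ?n s t m * char_fun m g)" for X and g :: "complex^'n^'n"
  define h where "h g = (-1) ^ (?n * (?n - 1) div 2) * (\<Prod>k<?n. circle_symbol s t (eigs g k))" for g :: "complex^'n^'n"
  have "0 \<le> 2 * real ?n * real ?n" by simp
  then have st: "Re s > 0" "Re t > 0" using R by linarith+
  obtain M where M: "M summable_on signatures ?n"
    "\<And>m g :: complex^'n^'n. m \<in> signatures ?n ==> g \<in> unitary_group ==> norm (coefficient ?n s t m * char_fun m g) \<le> M m"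
    using char_sum_majorant[OF R] by blast
  have unif: "uniform_limit unitary_group p f (finite_subsets_at_top (signatures ?n))"
    unfolding f_def p_def using M by (intro Weierstrass_m_test_general) auto
  have fc: "continuous_on unitary_group f"
  proof (rule uniform_limit_theorem[OF _ unif])
    show "\<forall>\<^sub>F X in finite_subsets_at_top (signatures ?n). continuous_on unitary_group (p X)"
      unfolding p_def by (intro always_eventually allI continuous_on_sum continuous_on_mult continuous_on_const continuous_on_char_fun)
  qed simp
  have hc: "continuous_on unitary_group h"
    unfolding h_def by (intro continuous_on_mult continuous_on_const continuous_on_symbol_product st)
  have eq: "f g = h g" if g: "g \<in> unitary_group" for g
  proof -
    obtain X where X: "\<And>i. X i \<in> unitary_group" "\<And>i. distinct_eigenvalues (X i)" "X \<longlonglongrightarrow> g"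
      using distinct_eigenvalues_dense[OF g] by blast
    have fh: "f (X i) = h (X i)" for i
      unfolding f_def h_def by (rule infsumI[OF ell_expansion_distinct[OF X(1,2) st]])
    have lim: "(%i. f (X i)) \<longlonglongrightarrow> f g" "(%i. h (X i)) \<longlonglongrightarrow> h g"
      using fc hc X g unfolding continuous_on_sequentially by (auto simp: o_def)
    show ?thesis by (rule LIMSEQ_unique[OF lim(1)[unfolded fh] lim(2)])
  qed
  have "uniform_limit unitary_group p h (finite_subsets_at_top (signatures ?n))"
    using unif unfolding uniform_limit_iff by (simp add: eq)
  then show ?thesis unfolding h_def p_def .
qed

theorem ell_integral_expansion:
  fixes \<phi> :: "complex^'n^'n => complex"
  assumes haar: "normalized_haar \<mu>" and \<phi>: "continuous_on unitary_group \<phi>"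
    and R: "Re s \<ge> R" "Re t \<ge> R" "R > 2 * real CARD('n) * real CARD('n)"
  shows "((%m. coefficient CARD('n) s t m * character_distribution \<mu> m \<phi>) has_sum
    (-1) ^ (CARD('n) * (CARD('n) - 1) div 2) * 2 powr ((s + t) * of_nat CARD('n)) * (\<integral>g. ell s t g * \<phi> g \<partial>\<mu>))
    (signatures CARD('n))"
proof -
  let ?n = "CARD('n)"
  interpret prob_space \<mu> using haar_basics[OF haar] by simp
  define h where "h g = (-1) ^ (?n * (?n - 1) div 2) * (\<Prod>k<?n. circle_symbol s t (eigs g k))" for g :: "complex^'n^'n"
  define p where "p X g = (\<Sum>m\<in>X. coefficient ?n s t m * char_fun m g)" for X and g :: "complex^'n^'n"
  have "0 \<le> 2 * real ?n * real ?n" by simp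
  then have st: "Re s > 0" "Re t > 0" using R by linarith+
  have unif: "uniform_limit unitary_group p h (finite_subsets_at_top (signatures ?n))"
    unfolding p_def h_def by (rule ell_expansion_uniform[OF R])
  have hc: "continuous_on unitary_group h"
    unfolding h_def by (intro continuous_on_mult continuous_on_const continuous_on_symbol_product st)
  have pc: "continuous_on unitary_group (p X)" for X
    unfolding p_def by (intro continuous_on_sum continuous_on_mult continuous_on_const continuous_on_char_fun)
  note int = haar_integrable[OF haar]
  obtain B where B: "\<And>g. g \<in> unitary_group ==> norm (\<phi> g) \<le> B"
    using unitary_bounded[OF \<phi>] by blast
  have B0: "0 \<le> B" using order_trans[OF norm_ge_zero B[OF mat_1_unitary]] .
  have sum: "(\<integral>g. p X g * \<phi> g \<partial>\<mu>) = (\<Sum>m\<in>X. coefficient ?n s t m * character_distribution \<mu> m \<phi>)" for X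
  proof -
    have "(\<integral>g. p X g * \<phi> g \<partial>\<mu>) = (\<integral>g. (\<Sum>m\<in>X. coefficient ?n s t m * (char_fun m g * \<phi> g)) \<partial>\<mu>)"
      by (simp add: p_def sum_distrib_right mult.assoc)
    also have "... = (\<Sum>m\<in>X. \<integral>g. coefficient ?n s t m * (char_fun m g * \<phi> g) \<partial>\<mu>)"
      by (intro integral_of_sum int continuous_on_mult continuous_on_const continuous_on_char_fun \<phi>)
    also have "... = (\<Sum>m\<in>X. coefficient ?n s t m * character_distribution \<mu> m \<phi>)"
      by (simp add: character_distribution_eq[OF haar refl])
    finally show ?thesis .
  qed
  have "((%X. \<integral>g. p X g * \<phi> g \<partial>\<mu>) \<longlongrightarrow> (\<integral>g. h g * \<phi> g \<partial>\<mu>)) (finite_subsets_at_top (signatures ?n))"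
  proof (rule tendstoI)
    fix e :: real assume e: "e > 0"
    define d where "d = (e / 2) / (B + 1)"
    have d: "d > 0" using e B0 by (simp add: d_def)
    have "B + 1 \<noteq> 0" using B0 by simp
    from nonzero_eq_divide_eq[OF this, of d "e / 2"] have "d * (B + 1) = e / 2" using d_def by blast
    then have dB: "d * B < e" using d e by (simp add: distrib_left)
    show "\<forall>\<^sub>F X in finite_subsets_at_top (signatures ?n). dist (\<integral>g. p X g * \<phi> g \<partial>\<mu>) (\<integral>g. h g * \<phi> g \<partial>\<mu>) < e"
      using uniform_limitD[OF unif d]
    proof eventually_elim
      case (elim X)
      have i: "integrable \<mu> (%g. p X g * \<phi> g)" "integrable \<mu> (%g. h g * \<phi> g)"
        by (intro int continuous_on_mult pc hc \<phi>)+
      have "(\<integral>g. p X g * \<phi> g \<partial>\<mu>) - (\<integral>g. h g * \<phi> g \<partial>\<mu>) = (\<integral>g. (p X g - h g) * \<phi> g \<partial>\<mu>)"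
        using i by (simp add: Bochner_Integration.integral_diff algebra_simps)
      also have "norm \<dots> \<le> (\<integral>g. norm ((p X g - h g) * \<phi> g) \<partial>\<mu>)" by (rule integral_norm_bound)
      also have "... \<le> d * B"
      proof (rule integral_le_const)
        show "integrable \<mu> (%g. norm ((p X g - h g) * \<phi> g))"
          by (intro integrable_norm int continuous_on_mult continuous_on_diff pc hc \<phi>)
        show "AE g in \<mu>. norm ((p X g - h g) * \<phi> g) \<le> d * B"
        proof (rule AE_I2)
          fix g assume "g \<in> space \<mu>"
          then have "g \<in> unitary_group" using haar_basics(2)[OF haar] by simp
          then show "norm ((p X g - h g) * \<phi> g) \<le> d * B"
            unfolding norm_mult using elim B d by (intro mult_mono) (auto simp: dist_norm intro: less_imp_le)
        qed
      qed
      finally show ?case using dB by (simp add: dist_norm)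
    qed
  qed
  then have "((%m. coefficient ?n s t m * character_distribution \<mu> m \<phi>) has_sum (\<integral>g. h g * \<phi> g \<partial>\<mu>)) (signatures ?n)"
    by (simp add: has_sum_def sum)
  also have "(\<integral>g. h g * \<phi> g \<partial>\<mu>) = (\<integral>g. ((-1) ^ (?n * (?n - 1) div 2) * 2 powr ((s + t) * of_nat ?n)) * (ell s t g * \<phi> g) \<partial>\<mu>)"
  proof (rule integral_cong_on)
    fix g assume "g \<in> space \<mu>"
    then have g: "g \<in> unitary_group" using haar_basics(2)[OF haar] by simp
    have "2 powr ((s + t) * of_nat ?n) * 2 powr (- (s + t) * of_nat ?n) = (1 :: complex)"
      by (simp add: powr_add[symmetric] flip: distrib_right)
    then have "2 powr ((s + t) * of_nat ?n) * ell s t g = (\<Prod>k<?n. circle_symbol s t (eigs g k))"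
      unfolding ell_eq_pos[OF g st] by (simp add: mult.assoc[symmetric])
    from this[symmetric] show "h g * \<phi> g = ((-1) ^ (?n * (?n - 1) div 2) * 2 powr ((s + t) * of_nat ?n)) * (ell s t g * \<phi> g)"
      unfolding h_def by (simp only: mult_ac)
  qed simp
  also have "... = (-1) ^ (?n * (?n - 1) div 2) * 2 powr ((s + t) * of_nat ?n) * (\<integral>g. ell s t g * \<phi> g \<partial>\<mu>)" by simp
  finally show ?thesis .
qed

section \<open>The series is entire in the exponents\<close>

lemma continuous_on_rGamma_compose:
  fixes f :: "'a::topological_space => complex"
  assumes "continuous_on S f"
  shows "continuous_on S (%x. rGamma (f x))"
  by (rule continuous_on_compose2[OF continuous_on_rGamma[of UNIV] assms]) simp

text \<open>By the functional equation the quotient of the values at \<open>p + 1\<close> and \<open>p\<close> is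
  \<open>1 + O(1 / p)\<close> uniformly for bounded \<open>s\<close> and \<open>t\<close>, and finitely many values are bounded by
  compactness.\<close>
lemma rGamma_product_bound_nat:
  assumes R: "R \<ge> 0"
  obtains C and K :: nat where "C \<ge> 0"
    "\<And>s t p. norm s \<le> R ==> norm t \<le> R ==>
      norm (rGamma (s - of_nat p + of_nat n) * rGamma (t + of_nat p + 1) :: complex) \<le> C * (1 + real p) ^ K"
proof -
  define q where "q p = (%(s, t). rGamma (s - of_nat p + of_nat n) * rGamma (t + of_nat p + 1) :: complex)" for p
  define K where "K = nat \<lceil>2 * (2 * R + real n)\<rceil>"
  define P where "P = nat \<lceil>2 * R\<rceil>"
  have K: "real K \<ge> 2 * (2 * R + real n)" and P: "real P \<ge> 2 * R" unfolding K_def P_def by linarith+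
  have "\<exists>B. \<forall>x\<in>cball 0 R \<times> cball 0 R. norm (q p x) \<le> B" for p
  proof -
    have "continuous_on (cball 0 R \<times> cball 0 R) (q p)"
      unfolding q_def case_prod_beta by (intro continuous_intros continuous_on_rGamma_compose)
    then have "compact (q p ` (cball 0 R \<times> cball 0 R))"
      by (rule compact_continuous_image) (intro compact_Times compact_cball)
    then show ?thesis using compact_imp_bounded bounded_iff by (metis imageI)
  qed
  then obtain B where B: "\<And>p x. x \<in> cball 0 R \<times> cball 0 R ==> norm (q p x) \<le> B p" by metis
  have "(0, 0) \<in> cball (0 :: complex) R \<times> cball (0 :: complex) R" using R by simp
  then have B0: "B p \<ge> 0" for p using B order_trans[OF norm_ge_zero] by blast
  define C where "C = (\<Sum>p\<le>P. B p)"
  have C: "C \<ge> 0" unfolding C_def using B0 by (intro sum_nonneg) auto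
  have step: "norm (q (Suc p) (s, t)) \<le> ((2 + real p) / (1 + real p)) ^ K * norm (q p (s, t))"
    if st: "norm s \<le> R" "norm t \<le> R" and p: "p \<ge> P" for p s t
  proof -
    define d where "d = t + of_nat p + 1"
    have "norm (of_nat (Suc p) :: complex) \<le> norm d + norm t"
      using norm_triangle_ineq4[of d t] by (simp add: d_def add.commute)
    then have d: "norm d \<ge> (1 + real p) / 2" using st P p by (simp del: of_nat_Suc)
    have "rGamma (t + of_nat p + 1) = d * rGamma (t + of_nat (Suc p) + 1)"
      using rGamma_plus1[of d] by (simp add: d_def add_ac)
    moreover have "rGamma (s - of_nat (Suc p) + of_nat n) = (s - of_nat (Suc p) + of_nat n) * rGamma (s - of_nat p + of_nat n)"
      using rGamma_plus1[of "s - of_nat (Suc p) + of_nat n"] by (simp add: algebra_simps)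
    ultimately have "d * q (Suc p) (s, t) = (s - of_nat (Suc p) + of_nat n) * q p (s, t)"
      by (simp add: q_def mult_ac)
    then have e: "norm d * norm (q (Suc p) (s, t)) = norm (s - of_nat (Suc p) + of_nat n) * norm (q p (s, t))"
      by (metis norm_mult)
    have "norm (s - of_nat (Suc p) + of_nat n) \<le> norm d + (2 * R + real n)"
    proof -
      have "s - of_nat (Suc p) + of_nat n = (s + t + of_nat n) - d" by (simp add: d_def)
      then have "norm (s - of_nat (Suc p) + of_nat n) \<le> norm (s + t + of_nat n) + norm d" by (metis norm_triangle_ineq4)
      moreover have "norm (s + t + of_nat n) \<le> norm s + norm t + norm (of_nat n :: complex)"
        by (meson norm_triangle_ineq norm_triangle_mono order_refl)
      ultimately show ?thesis using st by simp
    qed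
    also have "2 * R + real n \<le> norm d * (real K / (1 + real p))"
    proof -
      have half: "(a / 2) * (k / a) = k / 2" if "a \<noteq> 0" for a k :: real using that by simp
      have eq: "((1 + real p) / 2) * (real K / (1 + real p)) = real K / 2" by (rule half) simp
      have "2 * R + real n \<le> ((1 + real p) / 2) * (real K / (1 + real p))" unfolding eq using K by simp
      also have "... \<le> norm d * (real K / (1 + real p))" using d by (intro mult_right_mono) auto
      finally show ?thesis .
    qed
    finally have "norm (s - of_nat (Suc p) + of_nat n) \<le> norm d * (1 + real K * (1 / (1 + real p)))"
      by (simp add: distrib_left)
    also have "1 + real K * (1 / (1 + real p)) \<le> (1 + 1 / (1 + real p)) ^ K"
      by (rule Bernoulli_inequality) (simp add: order_trans[of _ 0])
    also have "1 + 1 / (1 + real p) = (2 + real p) / (1 + real p)" by (simp add: field_simps)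
    finally have "norm d * norm (q (Suc p) (s, t)) \<le> norm d * ((2 + real p) / (1 + real p)) ^ K * norm (q p (s, t))"
      unfolding e by (intro mult_right_mono) (auto simp: mult_left_mono)
    moreover have "norm d > 0" using d by (smt (verit) divide_pos_pos of_nat_0_le_iff)
    ultimately show ?thesis by (simp add: mult.assoc)
  qed
  have "norm (q p (s, t)) \<le> C * (1 + real p) ^ K" if st: "norm s \<le> R" "norm t \<le> R" for p s t
  proof (cases "p \<le> P")
    case True
    have "norm (q p (s, t)) \<le> B p" using st by (intro B) auto
    also have "... \<le> C" unfolding C_def using True B0 by (intro member_le_sum) auto
    also have "... \<le> C * (1 + real p) ^ K" using C mult_left_mono[of 1 "(1 + real p) ^ K" C] by (simp add: one_le_power)
    finally show ?thesis .
  next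
    case False
    then have "P \<le> p" by simp
    then show ?thesis
    proof (induction p rule: dec_induct)
      case base
      have "norm (q P (s, t)) \<le> B P" using st by (intro B) auto
      also have "... \<le> C" unfolding C_def using B0 by (intro member_le_sum) auto
      also have "... \<le> C * (1 + real P) ^ K" using C mult_left_mono[of 1 "(1 + real P) ^ K" C] by (simp add: one_le_power)
      finally show ?case .
    next
      case (step p)
      have "norm (q (Suc p) (s, t)) \<le> ((2 + real p) / (1 + real p)) ^ K * norm (q p (s, t))"
        using \<open>P \<le> p\<close> by (intro \<open>\<And>s t p. _ ==> _ ==> _ ==> norm (q (Suc p) (s, t)) \<le> _\<close> st)
      also have "... \<le> ((2 + real p) / (1 + real p)) ^ K * (C * (1 + real p) ^ K)"
        using step.IH by (intro mult_left_mono) auto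
      also have "... = C * (1 + real (Suc p)) ^ K" by (simp add: power_divide)
      finally show ?case .
    qed
  qed
  then show thesis using that[OF C, of K] by (simp add: q_def)
qed

text \<open>For negative \<open>p\<close> the two factors change roles.\<close>
lemma rGamma_product_bound:
  assumes R: "R \<ge> 0"
  obtains C and K :: nat where "C \<ge> 0"
    "\<And>s t p. norm s \<le> R ==> norm t \<le> R ==>
      norm (rGamma (s - of_int p + of_nat n) * rGamma (t + of_int p + 1) :: complex) \<le> C * (1 + \<bar>real_of_int p\<bar>) ^ K"
proof -
  obtain C K where C: "C \<ge> 0"
    "\<And>s t p. norm s \<le> R ==> norm t \<le> R ==>
      norm (rGamma (s - of_nat p + of_nat n) * rGamma (t + of_nat p + 1) :: complex) \<le> C * (1 + real p) ^ K"
    using rGamma_product_bound_nat[OF R, of n] by blast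
  have R': "R + real n + 1 \<ge> 0" using R by simp
  obtain D L where D: "D \<ge> 0"
    "\<And>s t p. norm s \<le> R + real n + 1 ==> norm t \<le> R + real n + 1 ==>
      norm (rGamma (s - of_nat p + of_nat n) * rGamma (t + of_nat p + 1) :: complex) \<le> D * (1 + real p) ^ L"
    using rGamma_product_bound_nat[OF R', of n] by blast
  have "norm (rGamma (s - of_int p + of_nat n) * rGamma (t + of_int p + 1)) \<le> (C + D) * (1 + \<bar>real_of_int p\<bar>) ^ (K + L)"
    if st: "norm s \<le> R" "norm t \<le> R" for s t :: complex and p
  proof (cases p rule: int_cases2)
    case (nonneg k)
    have "norm (rGamma (s - of_int p + of_nat n) * rGamma (t + of_int p + 1)) \<le> C * (1 + real k) ^ K"
      using C(2)[OF st, of k] nonneg by simp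
    also have "... \<le> (C + D) * (1 + real k) ^ (K + L)"
      using C(1) D(1) by (intro mult_mono power_increasing) auto
    finally show ?thesis using nonneg by simp
  next
    case (nonpos k)
    have "norm (t + 1 - of_nat n) \<le> norm (t + 1) + norm (of_nat n :: complex)" by (rule norm_triangle_ineq4)
    moreover have "norm (t + 1) \<le> norm t + 1" using norm_triangle_ineq[of t 1] by simp
    ultimately have a: "norm (t + 1 - of_nat n) \<le> R + real n + 1" using st by simp
    have "norm (s + of_nat n - 1) \<le> norm (s + of_nat n) + 1" using norm_triangle_ineq4[of "s + of_nat n" 1] by simp
    moreover have "norm (s + of_nat n) \<le> norm s + real n" using norm_triangle_ineq[of s "of_nat n"] by simp
    ultimately have b: "norm (s + of_nat n - 1) \<le> R + real n + 1" using st by simp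
    have "norm (rGamma (s - of_int p + of_nat n) * rGamma (t + of_int p + 1)) \<le> D * (1 + real k) ^ L"
      using D(2)[OF a b, of k] nonpos by (simp add: algebra_simps)
    also have "... \<le> (C + D) * (1 + real k) ^ (K + L)"
      using C(1) D(1) by (intro mult_mono power_increasing) auto
    finally show ?thesis using nonpos by simp
  qed
  then show thesis using that[of "C + D" "K + L"] C(1) D(1) by simp
qed

lemma norm_signature_differences_le: "norm (signature_differences n m) \<le> (2 * weight n m) ^ (n * n)"
proof -
  have w: "1 \<le> weight n m" by (rule weight_ge)
  have "norm (signature_differences n m) = (\<Prod>b<n. \<Prod>a<b. norm (of_int (m (Suc a)) - of_int (m (Suc b)) :: complex))"
    by (simp add: signature_differences_eq prod_norm)
  also have "... \<le> (\<Prod>b<n. (2 * weight n m) ^ n)"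
  proof (intro prod_mono conjI prod_nonneg)
    fix b assume b: "b \<in> {..<n}"
    have "(\<Prod>a<b. norm (of_int (m (Suc a)) - of_int (m (Suc b)) :: complex)) \<le> (\<Prod>a<b. 2 * weight n m)"
    proof (intro prod_mono conjI)
      fix a assume a: "a \<in> {..<b}"
      have "norm (of_int (m (Suc a)) - of_int (m (Suc b)) :: complex) \<le> \<bar>real_of_int (m (Suc a))\<bar> + \<bar>real_of_int (m (Suc b))\<bar>"
        using norm_triangle_ineq4[of "of_int (m (Suc a)) :: complex" "of_int (m (Suc b))"] by simp
      then show "norm (of_int (m (Suc a)) - of_int (m (Suc b)) :: complex) \<le> 2 * weight n m"
        using a b weight_ge_entry[of a n m] weight_ge_entry[of b n m] by simp
    qed simp
    also have "... = (2 * weight n m) ^ b" by (simp only: prod_constant card_lessThan)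
    also have "... \<le> (2 * weight n m) ^ n" by (rule power_increasing) (use w b in auto)
    finally show "(\<Prod>a<b. norm (of_int (m (Suc a)) - of_int (m (Suc b)) :: complex)) \<le> (2 * weight n m) ^ n" .
  qed simp
  also have "... = (2 * weight n m) ^ (n * n)" by (simp add: power_mult)
  finally show ?thesis .
qed

lemma norm_reduced_coefficient_bound:
  assumes R: "R \<ge> 0"
  obtains C and K :: nat where "C \<ge> 0"
    "\<And>s t m. norm s \<le> R ==> norm t \<le> R ==> norm (reduced_coefficient n s t m) \<le> C * weight n m ^ K"
proof -
  obtain C K where C: "C \<ge> 0"
    "\<And>s t p. norm s \<le> R ==> norm t \<le> R ==>
      norm (rGamma (s - of_int p + of_nat n) * rGamma (t + of_int p + 1) :: complex) \<le> C * (1 + \<bar>real_of_int p\<bar>) ^ K"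
    using rGamma_product_bound[OF R, of n] by blast
  have "norm (reduced_coefficient n s t m) \<le> (2 ^ (n * n) * C ^ n) * weight n m ^ (n * n + K)"
    if st: "norm s \<le> R" "norm t \<le> R" for s t m
  proof -
    have "(\<Prod>j=1..n. norm (rGamma (s - of_int (m j) + of_nat n) * rGamma (t + of_int (m j) + 1))) \<le>
        (\<Prod>j=1..n. C * (1 + \<bar>real_of_int (m j)\<bar>) ^ K)"
      using C(2)[OF st] by (intro prod_mono) auto
    also have "... = C ^ n * weight n m ^ K"
      by (simp add: weight_def prod.distrib prod.atLeast1_atMost_eq prod_power_distrib)
    finally have 1: "(\<Prod>j=1..n. norm (rGamma (s - of_int (m j) + of_nat n) * rGamma (t + of_int (m j) + 1))) \<le> C ^ n * weight n m ^ K" .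
    have "norm (reduced_coefficient n s t m) = norm (signature_differences n m) *
        (\<Prod>j=1..n. norm (rGamma (s - of_int (m j) + of_nat n) * rGamma (t + of_int (m j) + 1)))"
      unfolding reduced_coefficient_def norm_mult[of _ "prod _ _"] prod_norm by (simp add: norm_mult norm_power_int)
    also have "... \<le> (2 * weight n m) ^ (n * n) * (C ^ n * weight n m ^ K)"
      using 1 norm_signature_differences_le weight_ge[of n m] by (intro mult_mono prod_nonneg) auto
    also have "... = (2 ^ (n * n) * C ^ n) * weight n m ^ (n * n + K)"
      by (simp add: power_mult_distrib power_add)
    finally show ?thesis .
  qed
  then show thesis using that[of "2 ^ (n * n) * C ^ n" "n * n + K"] C(1) by simp
qed

definition rapidly_decaying :: "nat => ((nat => int) => complex) => bool" where
  "rapidly_decaying n I \<longleftrightarrow> (\<forall>K. \<exists>C\<ge>0. \<forall>m\<in>signatures n. norm (I m) * weight n m ^ K \<le> C)"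

definition reduced_sum :: "nat => ((nat => int) => complex) => complex \<times> complex => complex" where
  "reduced_sum n I = (%(s, t). \<Sum>\<^sub>\<infinity>m\<in>signatures n. reduced_coefficient n s t m * I m)"

lemma reduced_sum_majorant:
  assumes I: "rapidly_decaying n I" and R: "R \<ge> 0"
  obtains M where "M summable_on signatures n"
    "\<And>m s t. m \<in> signatures n ==> norm s \<le> R ==> norm t \<le> R ==> norm (reduced_coefficient n s t m * I m) \<le> M m"
proof -
  obtain C K where C: "C \<ge> 0" "\<And>s t m. norm s \<le> R ==> norm t \<le> R ==> norm (reduced_coefficient n s t m) \<le> C * weight n m ^ K"
    using norm_reduced_coefficient_bound[OF R] by blast
  obtain D where D: "D \<ge> 0" "\<And>m. m \<in> signatures n ==> norm (I m) * weight n m ^ (K + 2) \<le> D"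
    using I unfolding rapidly_decaying_def by blast
  show thesis
  proof (rule that[of "%m. (C * D) * weight n m powr - 2"])
    show "(%m. (C * D) * weight n m powr - 2) summable_on signatures n"
      by (intro summable_on_cmult_right weight_summable) simp
    fix m and s t :: complex assume m: "m \<in> signatures n" and st: "norm s \<le> R" "norm t \<le> R"
    define w where "w = weight n m"
    have w: "w > 0" using weight_ge[of n m] by (simp add: w_def)
    have "norm (reduced_coefficient n s t m * I m) * w\<^sup>2 \<le> (C * w ^ K) * norm (I m) * w\<^sup>2"
      unfolding norm_mult using C(2)[OF st, of m] by (intro mult_right_mono) (auto simp: w_def)
    also have "... = C * (norm (I m) * w ^ (K + 2))" by (simp only: power_add mult_ac)
    also have "... \<le> C * D" using D(2)[OF m] C(1) by (intro mult_left_mono) (auto simp: w_def)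
    finally have "norm (reduced_coefficient n s t m * I m) \<le> (C * D) / w\<^sup>2" using w by (simp add: pos_le_divide_eq)
    also have "... = (C * D) * w powr - 2" using w by (simp add: powr_minus powr_numeral divide_inverse)
    finally show "norm (reduced_coefficient n s t m * I m) \<le> (C * D) * weight n m powr - 2" by (simp add: w_def)
  qed
qed

lemma reduced_sum_summable:
  assumes I: "rapidly_decaying n I"
  shows "(%m. reduced_coefficient n s t m * I m) summable_on signatures n"
proof -
  obtain M where M: "M summable_on signatures n"
    "\<And>m s' t'. m \<in> signatures n ==> norm s' \<le> norm s + norm t ==> norm t' \<le> norm s + norm t ==>
      norm (reduced_coefficient n s' t' m * I m) \<le> M m"
    using reduced_sum_majorant[OF I, of "norm s + norm t"] by (metis add_nonneg_nonneg norm_ge_zero)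
  have "(%m. norm (reduced_coefficient n s t m * I m)) summable_on signatures n"
    by (rule Infinite_Sum.abs_summable_on_comparison_test'[OF M(1)]) (rule M(2), auto)
  then show ?thesis by (rule abs_summable_summable)
qed

text \<open>The bound on bounded sets of exponents gives locally uniform convergence, hence continuity and
  holomorphy in each variable, and Osgood's lemma applies.\<close>
theorem reduced_sum_entire:
  assumes I: "rapidly_decaying n I"
  shows "holomorphic2_on (reduced_sum n I) UNIV"
proof -
  let ?F = "finite_subsets_at_top (signatures n)"
  define p where "p X = (%(s, t). \<Sum>m\<in>X. reduced_coefficient n s t m * I m)" for X
  have unif: "uniform_limit (cball 0 R \<times> cball 0 R) p (reduced_sum n I) ?F" if R: "R > 0" for R
  proof -
    obtain M where M: "M summable_on signatures n"
      "\<And>m s t. m \<in> signatures n ==> norm s \<le> R ==> norm t \<le> R ==> norm (reduced_coefficient n s t m * I m) \<le> M m"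
      using reduced_sum_majorant[OF I, of R] R by (metis less_imp_le)
    have "uniform_limit (cball 0 R \<times> cball 0 R) (%X x. \<Sum>m\<in>X. (%(s, t). reduced_coefficient n s t m * I m) x)
        (%x. \<Sum>\<^sub>\<infinity>m\<in>signatures n. (%(s, t). reduced_coefficient n s t m * I m) x) ?F"
      by (rule Weierstrass_m_test_general[OF _ M(1)]) (auto intro: M(2))
    then show ?thesis unfolding p_def[abs_def] reduced_sum_def by (simp only: case_prod_unfold)
  qed
  have term_cont: "continuous_on S (%(s, t). reduced_coefficient n s t m)" for S m
    unfolding reduced_coefficient_def case_prod_beta by (intro continuous_intros continuous_on_rGamma_compose)
  have pc: "continuous_on S (p X)" for S X
    using term_cont unfolding p_def case_prod_beta by (intro continuous_on_sum continuous_on_mult continuous_on_const) auto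
  have hol_s: "(%s. reduced_coefficient n s t m) holomorphic_on S" for t m S
    unfolding reduced_coefficient_def by (intro holomorphic_intros holomorphic_rGamma')
  have hol_t: "(%t. reduced_coefficient n s t m) holomorphic_on S" for s m S
    unfolding reduced_coefficient_def by (intro holomorphic_intros holomorphic_rGamma')
  show ?thesis
  proof (rule osgood)
    have nhd: "isCont (reduced_sum n I) x" for x
    proof -
      obtain s t where x: "x = (s, t)" by (cases x)
      define R where "R = norm s + norm t + 1"
      have R: "R > 0" by (simp add: R_def add_nonneg_pos)
      have "continuous_on (cball 0 R \<times> cball 0 R) (reduced_sum n I)"
        by (rule uniform_limit_theorem[OF _ unif[OF R]]) (auto intro: always_eventually pc)
      then have "continuous_on (ball 0 R \<times> ball 0 R) (reduced_sum n I)"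
        by (rule continuous_on_subset) auto
      moreover have "open (ball (0 :: complex) R \<times> ball (0 :: complex) R)" by (intro open_Times open_ball)
      moreover have "norm s < R" "norm t < R"
        unfolding R_def using norm_ge_zero[of s] norm_ge_zero[of t] by linarith+
      then have "x \<in> ball 0 R \<times> ball 0 R" by (simp add: x)
      ultimately show ?thesis using continuous_on_eq_continuous_at by blast
    qed
    then show "continuous_on UNIV (reduced_sum n I)" by (simp add: continuous_at_imp_continuous_on)
    have entire: "f holomorphic_on UNIV"
      if q: "\<And>R. R > 0 ==> uniform_limit (cball 0 R) q f ?F" "\<And>X S. q X holomorphic_on S" for q f
      unfolding holomorphic_on_open[OF open_UNIV]
    proof
      fix x :: complex
      define R where "R = norm x + 1"
      have R: "R > 0" "norm x < R" unfolding R_def using norm_ge_zero[of x] by linarith+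
      have ev: "\<forall>\<^sub>F X in ?F. continuous_on (cball 0 R) (q X) \<and> q X holomorphic_on ball 0 R"
        by (intro always_eventually allI conjI holomorphic_on_imp_continuous_on q(2))
      have "f holomorphic_on ball 0 R"
        by (rule holomorphic_uniform_limit[OF ev q(1)[OF R(1)]]) auto
      then show "\<exists>f'. (f has_field_derivative f') (at x)" using R(2) by (simp add: holomorphic_on_open)
    qed
    show "(%s. reduced_sum n I (s, t)) holomorphic_on UNIV" for t
    proof (rule entire)
      show "uniform_limit (cball 0 R) (%X s. p X (s, t)) (%s. reduced_sum n I (s, t)) ?F" if "R > 0" for R
      proof (rule uniform_limit_compose'[OF unif])
        show "R + norm t > 0" using that by (simp add: add_pos_nonneg)
        show "(%x. (x, t)) \<in> cball 0 R \<rightarrow> cball 0 (R + norm t) \<times> cball 0 (R + norm t)"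
          using that by (auto simp: dist_norm add_increasing2)
      qed
      show "(%s. p X (s, t)) holomorphic_on S" for X S
        unfolding p_def using hol_s by (auto intro!: holomorphic_intros)
    qed
    show "(%t. reduced_sum n I (s, t)) holomorphic_on UNIV" for s
    proof (rule entire)
      show "uniform_limit (cball 0 R) (%X t. p X (s, t)) (%t. reduced_sum n I (s, t)) ?F" if "R > 0" for R
      proof (rule uniform_limit_compose'[OF unif])
        show "R + norm s > 0" using that by (simp add: add_pos_nonneg)
        show "(%x. (s, x)) \<in> cball 0 R \<rightarrow> cball 0 (R + norm s) \<times> cball 0 (R + norm s)"
          using that by (auto simp: dist_norm add_increasing2)
      qed
      show "(%t. p X (s, t)) holomorphic_on S" for X S
        unfolding p_def using hol_t by (auto intro!: holomorphic_intros)
    qed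
  qed
qed

section \<open>The meromorphic continuation\<close>

lemma character_distribution_rapidly_decaying:
  fixes \<phi> :: "complex^'n^'n => complex"
  assumes "normalized_haar \<mu>" "test_function \<phi>"
  shows "rapidly_decaying CARD('n) (%m. character_distribution \<mu> m \<phi>)"
  unfolding rapidly_decaying_def using character_distribution_decay[OF assms] by metis

text \<open>The right-hand side of the expansion as a function of the exponents.\<close>
definition continuation :: "nat => ((nat => int) => complex) => complex \<times> complex => complex" where
  "continuation n I = (%(s, t). (-1) ^ (n * (n - 1) div 2) * 2 powr (- (s + t) * of_nat n) *
     (\<Prod>j=1..n. Gamma (s + t + of_nat j)) * reduced_sum n I (s, t))"

lemma holomorphic2_on_exponential_factor: "holomorphic2_on (%(s, t). c * 2 powr (- (s + t) * of_nat n)) S"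
proof -
  have "(%z. c * 2 powr (- z * of_nat n)) holomorphic_on UNIV" by (intro holomorphic_intros) auto
  from holomorphic2_on_compose_add[OF this open_UNIV] show ?thesis by simp
qed

lemma open_not_nonpos_Ints: "open {z :: complex. z + 1 \<notin> \<int>\<^sub>\<le>\<^sub>0}"
proof -
  have "open ((%z :: complex. z + 1) -` (- \<int>\<^sub>\<le>\<^sub>0))"
    by (intro continuous_open_vimage open_Compl closed_nonpos_Ints continuous_intros)
  then show ?thesis by (simp add: vimage_def)
qed

lemma plus_of_nat_nonpos_Ints:
  fixes z :: complex
  assumes "z + 1 \<notin> \<int>\<^sub>\<le>\<^sub>0" "j \<ge> 1"
  shows "z + of_nat j \<notin> \<int>\<^sub>\<le>\<^sub>0"
proof
  assume "z + of_nat j \<in> \<int>\<^sub>\<le>\<^sub>0"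
  then obtain k where k: "z + of_nat j = - of_nat k" by (auto elim: nonpos_Ints_cases')
  have "z + 1 = (z + of_nat j) - of_nat (j - 1)" using assms(2) by (simp add: of_nat_diff)
  also have "... = - of_nat (k + (j - 1))" unfolding k by simp
  finally have "z + 1 \<in> \<int>\<^sub>\<le>\<^sub>0" by (metis minus_of_nat_in_nonpos_Ints)
  then show False using assms(1) by contradiction
qed

lemma continuation_holomorphic:
  assumes I: "rapidly_decaying n I"
  shows "holomorphic2_on (continuation n I) {(s, t). s + t + 1 \<notin> \<int>\<^sub>\<le>\<^sub>0}"
proof -
  let ?S = "{(s, t). s + t + 1 \<notin> \<int>\<^sub>\<le>\<^sub>0}"
  have "(%z. \<Prod>j=1..n. Gamma (z + of_nat j)) holomorphic_on {z. z + 1 \<notin> \<int>\<^sub>\<le>\<^sub>0}"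
    using plus_of_nat_nonpos_Ints by (intro holomorphic_intros) auto
  then have "holomorphic2_on (%(s, t). \<Prod>j=1..n. Gamma ((s + t) + of_nat j)) ?S"
    by (rule holomorphic2_on_compose_add[OF _ open_not_nonpos_Ints]) auto
  from holomorphic2_on_mult[OF holomorphic2_on_mult[OF holomorphic2_on_exponential_factor this]
      holomorphic2_on_subset[OF reduced_sum_entire[OF I] subset_UNIV]]
  show ?thesis unfolding continuation_def by (simp only: case_prod_unfold prod.collapse)
qed

lemma Gamma_inverse_rGamma: "Gamma (z :: complex) = inverse (rGamma z)"
  by (simp add: rGamma_inverse_Gamma)

text \<open>The only poles are those of the Gamma factors; the product of their reciprocals
  is a holomorphic denominator.\<close>
lemma continuation_meromorphic:
  assumes I: "rapidly_decaying n I"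
  shows "meromorphic2 (continuation n I)"
  unfolding meromorphic2_def
proof (intro allI exI conjI)
  fix p :: "complex \<times> complex"
  define h where "h = (%x. (%(s, t). (-1) ^ (n * (n - 1) div 2) * 2 powr (- (s + t) * of_nat n)) x * reduced_sum n I x)"
  define k where "k = (%(s, t). \<Prod>j=1..n. rGamma ((s + t) + of_nat j) :: complex)"
  show "(1 :: real) > 0" by simp
  show "holomorphic2_on h (ball p 1)"
    unfolding h_def by (intro holomorphic2_on_mult holomorphic2_on_exponential_factor
        holomorphic2_on_subset[OF reduced_sum_entire[OF I] subset_UNIV])
  have "(%z. \<Prod>j=1..n. rGamma (z + of_nat j) :: complex) holomorphic_on UNIV" by (intro holomorphic_intros)
  then show "holomorphic2_on k (ball p 1)"
    unfolding k_def by (rule holomorphic2_on_compose_add[OF _ open_UNIV]) simp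
  show "\<exists>q\<in>ball p 1. k q \<noteq> 0"
  proof -
    obtain a b where p: "p = (a, b)" by (cases p)
    obtain x :: real where x: "\<bar>x\<bar> < 1" "Im (a + b) + x \<noteq> 0"
    proof (cases "Im (a + b) = 0")
      case True
      show ?thesis by (rule that[of "1 / 2"]) (use True in auto)
    qed (use that[of 0] in auto)
    have "norm (a - (a + \<i> * of_real x)) < 1" using x(1) by (simp add: norm_mult)
    then have "(a + \<i> * of_real x, b) \<in> ball p 1" by (simp add: p dist_Pair_Pair dist_norm)
    moreover have "a + \<i> * of_real x + b + of_nat j \<notin> \<int>\<^sub>\<le>\<^sub>0" for j
    proof
      assume "a + \<i> * of_real x + b + of_nat j \<in> \<int>\<^sub>\<le>\<^sub>0"
      then obtain i where "a + \<i> * of_real x + b + of_nat j = - of_nat i" by (auto elim: nonpos_Ints_cases')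
      then have "Im (a + \<i> * of_real x + b + of_nat j) = Im (- of_nat i)" by simp
      then show False using x(2) by simp
    qed
    then have "k (a + \<i> * of_real x, b) \<noteq> 0" by (simp add: k_def rGamma_eq_zero_iff)
    ultimately show ?thesis by blast
  qed
  show "\<forall>q\<in>ball p 1. k q \<noteq> 0 \<longrightarrow> continuation n I q = h q / k q"
    by (auto simp: continuation_def h_def k_def Gamma_inverse_rGamma prod_inversef[symmetric] divide_inverse mult_ac)
qed

text \<open>Compare coefficients and solve for the integral; the sign is its own inverse.\<close>
lemma ell_integral_large:
  fixes \<phi> :: "complex^'n^'n => complex"
  assumes haar: "normalized_haar \<mu>" and \<phi>: "continuous_on unitary_group \<phi>"
    and R: "Re s \<ge> R" "Re t \<ge> R" "R > 2 * real CARD('n) * real CARD('n)"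
    and I: "rapidly_decaying CARD('n) (%m. character_distribution \<mu> m \<phi>)"
  shows "(\<integral>g. ell s t g * \<phi> g \<partial>\<mu>) = continuation CARD('n) (%m. character_distribution \<mu> m \<phi>) (s, t)"
proof -
  let ?n = "CARD('n)" and ?I = "%m. character_distribution \<mu> m \<phi>"
  define sgn where "sgn = (-1 :: complex) ^ (?n * (?n - 1) div 2)"
  define G where "G = (\<Prod>j=1..?n. Gamma (s + t + of_nat j))"
  define J where "J = (\<integral>g. ell s t g * \<phi> g \<partial>\<mu>)"
  have "((%m. coefficient ?n s t m * ?I m) has_sum sgn * 2 powr ((s + t) * of_nat ?n) * J) (signatures ?n)"
    unfolding sgn_def J_def by (rule ell_integral_expansion[OF haar \<phi> R])
  moreover have "((%m. reduced_coefficient ?n s t m * ?I m) has_sum reduced_sum ?n ?I (s, t)) (signatures ?n)"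
    using reduced_sum_summable[OF I] by (simp add: reduced_sum_def)
  then have "((%m. coefficient ?n s t m * ?I m) has_sum G * reduced_sum ?n ?I (s, t)) (signatures ?n)"
    unfolding coefficient_eq G_def mult.assoc by (rule has_sum_cmult_right)
  ultimately have eq: "sgn * 2 powr ((s + t) * of_nat ?n) * J = G * reduced_sum ?n ?I (s, t)"
    by (rule has_sum_unique)
  have "sgn * 2 powr (- (s + t) * of_nat ?n) * (G * reduced_sum ?n ?I (s, t)) =
      (sgn * sgn) * (2 powr (- (s + t) * of_nat ?n) * 2 powr ((s + t) * of_nat ?n)) * J"
    unfolding eq[symmetric] by (simp only: mult_ac)
  also have "2 powr (- (s + t) * of_nat ?n) * 2 powr ((s + t) * of_nat ?n) = (1 :: complex)"
    by (simp add: powr_add[symmetric] flip: distrib_right)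
  also have "sgn * sgn = 1" by (simp add: sgn_def flip: power_add mult_2)
  finally show ?thesis by (simp add: continuation_def J_def sgn_def G_def mult.assoc)
qed

lemma continuation_line_holomorphic:
  assumes I: "rapidly_decaying n I"
  shows "(%w. continuation n I (s + w * (1 / 2), t + w * (1 / 2))) holomorphic_on {w. Re w > - 1 - Re (s + t)}"
proof (rule holomorphic2_on_line[OF continuation_holomorphic[OF I]])
  have "continuous_on UNIV (%p :: complex \<times> complex. fst p + snd p)" by (intro continuous_intros)
  then have "open ((%p :: complex \<times> complex. fst p + snd p) -` {z. z + 1 \<notin> \<int>\<^sub>\<le>\<^sub>0})"
    by (intro open_vimage open_not_nonpos_Ints)
  then show "open {(s, t). s + t + 1 \<notin> (\<int>\<^sub>\<le>\<^sub>0 :: complex set)}" by (simp add: vimage_def case_prod_beta')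
  show "open {w. Re w > - 1 - Re (s + t)}" by (rule open_halfspace_Re_gt)
  fix w assume w: "w \<in> {w. Re w > - 1 - Re (s + t)}"
  have "s + w * (1 / 2) + (t + w * (1 / 2)) + 1 \<notin> \<int>\<^sub>\<le>\<^sub>0"
  proof
    assume "s + w * (1 / 2) + (t + w * (1 / 2)) + 1 \<in> \<int>\<^sub>\<le>\<^sub>0"
    then obtain k where "s + w * (1 / 2) + (t + w * (1 / 2)) + 1 = - of_nat k" by (auto elim: nonpos_Ints_cases')
    then have "Re (s + w * (1 / 2) + (t + w * (1 / 2)) + 1) = Re (- of_nat k)" by simp
    then show False using w by simp
  qed
  then show "(s + w * (1 / 2), t + w * (1 / 2)) \<in> {(s, t). s + t + 1 \<notin> \<int>\<^sub>\<le>\<^sub>0}" by simp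
qed

lemma test_function_const: "test_function (%_. c)"
  unfolding test_function_def using smooth_on_const[of UNIV c] unfolding smooth_on_def
  by (intro exI[of _ UNIV] exI[of _ "%_. c"]) auto

lemma indicator_singularity_eq:
  fixes g :: "complex^'n^'n"
  assumes g: "g \<in> unitary_group"
  shows "complex_of_real (indicator regular_unitary g * exp (- u * singularity g)) = ell (of_real (u / 2)) (of_real (u / 2)) g"
proof -
  have "ell 0 0 g = indicator regular_unitary g"
  proof (cases "g \<in> regular_unitary")
    case True
    then have "circle_symbol 0 0 (eigs g k) = 1" if "k < CARD('n)" for k
      using regular_unitary_iff[OF g] that by (auto simp: circle_symbol_def)
    then show ?thesis using True ell_eq[OF True, of 0 0] by simp
  qed (simp add: ell_singular[OF g])
  then show ?thesis using ell_shift[OF g, of 0 "of_real (u / 2)" 0] 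
    by (cases "g \<in> regular_unitary") (auto simp flip: exp_of_real)
qed

text \<open>Landau's theorem for the trivial test function: where the continuation is regular the integral
  of the non-negative function converges.\<close>
text \<open>Landau's theorem for the trivial test function: the continuation has no pole with
  \<open>Re (s + t) > -1\<close>, so the integral of the non-negative function converges there.\<close>
lemma singularity_integrable:
  fixes \<mu> :: "(complex^'n^'n) measure"
  assumes haar: "normalized_haar \<mu>" and u: "u > -1"
  shows "integrable \<mu> (%g. indicator regular_unitary g * exp (- u * singularity g))"
proof -
  let ?E = "%v g :: complex^'n^'n. indicator regular_unitary g * exp (- v * singularity g)"
  let ?I = "%m. character_distribution \<mu> m (%_. 1)"
  interpret prob_space \<mu> using haar_basics[OF haar] by simp
  have I: "rapidly_decaying CARD('n) ?I"
    by (rule character_distribution_rapidly_decaying[OF haar test_function_const])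
  have meas_ind: "(indicator regular_unitary :: complex^'n^'n => real) \<in> borel_measurable \<mu>"
  proof -
    have "(%g. complex_of_real (indicator regular_unitary g)) \<in> borel_measurable \<mu>"
      by (rule haar_measurable_regular[OF haar]) (auto intro: continuous_on_cong[THEN iffD2, OF refl _ continuous_on_const[of _ 1]])
    then have "(%g. Re (complex_of_real (indicator regular_unitary g))) \<in> borel_measurable \<mu>" by measurable
    then show ?thesis by simp
  qed
  define K where "K = 2 * (2 * real CARD('n) * real CARD('n) + 1)"
  have K0: "K > 0" by (simp add: K_def add_nonneg_pos)
  show ?thesis
  proof (rule landau_integrable[where K = K and ?x0.0 = "-1" and F = "%w. continuation CARD('n) ?I (0 + w * (1 / 2), 0 + w * (1 / 2))"])
    show "(indicator regular_unitary :: complex^'n^'n => real) \<in> borel_measurable \<mu>" by (rule meas_ind)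
    show "singularity \<in> borel_measurable \<mu>" by (rule singularity_measurable[OF haar])
    show "(%w. continuation CARD('n) ?I (0 + w * (1 / 2), 0 + w * (1 / 2))) holomorphic_on {w. Re w > -1}"
      using continuation_line_holomorphic[OF I, of 0 0] by simp
    fix v assume v: "v > K"
    show "integrable \<mu> (%g. ?E v g)"
    proof (rule integrable_const_bound[of _ 1])
      show "AE g in \<mu>. norm (?E v g) \<le> 1"
      proof (rule AE_I2)
        have "0 \<le> v * singularity g" for g :: "complex^'n^'n"
          using v K0 singularity_nonneg[of g] by (intro mult_nonneg_nonneg) auto
        then show "norm (?E v g) \<le> 1" for g :: "complex^'n^'n"
          by (auto simp: indicator_def)
      qed
      show "(%g. ?E v g) \<in> borel_measurable \<mu>"
        using meas_ind singularity_measurable[OF haar] by measurable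
    qed
    have "complex_of_real (\<integral>g. ?E v g \<partial>\<mu>) =
        (\<integral>g. complex_of_real (?E v g) \<partial>\<mu>)"
      by (rule integral_complex_of_real[symmetric])
    also have "... = (\<integral>g. ell (of_real (v / 2)) (of_real (v / 2)) g * 1 \<partial>\<mu>)"
      using haar_basics(2)[OF haar] by (intro integral_cong_on refl) (simp only: indicator_singularity_eq mult_1_right)
    also have "... = continuation CARD('n) ?I (of_real (v / 2), of_real (v / 2))"
      using v by (intro ell_integral_large[OF haar continuous_on_const, of "v / 2"] I) (auto simp: K_def)
    finally show "complex_of_real (\<integral>g. ?E v g \<partial>\<mu>) =
        continuation CARD('n) ?I (0 + of_real v * (1 / 2), 0 + of_real v * (1 / 2))" by simp
  qed (use singularity_nonneg u in auto)
qed

lemma ell_integrable: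
  fixes \<phi> :: "complex^'n^'n => complex"
  assumes haar: "normalized_haar \<mu>" and \<phi>: "continuous_on unitary_group \<phi>" and st: "Re (s + t) > -1"
  shows "integrable \<mu> (%g. ell s t g * \<phi> g)"
proof -
  obtain B where B: "\<And>g. g \<in> unitary_group ==> norm (\<phi> g) \<le> B"
    using unitary_bounded[OF \<phi>] by blast
  define C where "C = exp (pi * (\<bar>Im s\<bar> + \<bar>Im t\<bar>)) ^ CARD('n)"
  show ?thesis
  proof (rule Bochner_Integration.integrable_bound)
    show "integrable \<mu> (%g. (C * B) * (indicator regular_unitary g * exp (- Re (s + t) * singularity g)))"
      by (intro integrable_mult_right singularity_integrable[OF haar st])
    show "(%g. ell s t g * \<phi> g) \<in> borel_measurable \<mu>"
      using ell_measurable[OF haar] haar_measurable[OF haar \<phi>] by measurable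
    show "AE g in \<mu>. norm (ell s t g * \<phi> g) \<le> norm ((C * B) * (indicator regular_unitary g * exp (- Re (s + t) * singularity g)))"
    proof (rule AE_I2)
      fix g assume "g \<in> space \<mu>"
      then have g: "g \<in> unitary_group" using haar_basics(2)[OF haar] by simp
      have "norm (ell s t g * \<phi> g) \<le> (C * (indicator regular_unitary g * exp (- (Re (s + t) * singularity g)))) * B"
        unfolding norm_mult C_def by (intro mult_mono norm_ell_le[OF g] B[OF g]) auto
      also have "... = (C * B) * (indicator regular_unitary g * exp (- Re (s + t) * singularity g))"
        by (simp add: algebra_simps)
      also have "... \<le> norm ((C * B) * (indicator regular_unitary g * exp (- Re (s + t) * singularity g)))"
        by simp
      finally show "norm (ell s t g * \<phi> g) \<le> norm ((C * B) * (indicator regular_unitary g * exp (- Re (s + t) * singularity g)))" .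
    qed
  qed
qed

text \<open>The integral converges absolutely on the whole half-plane by the trivial case, so that it agrees with
  the continuation along the line \<open>(s + u / 2, t + u / 2)\<close>.\<close>
theorem ell_integral_eq:
  fixes \<phi> :: "complex^'n^'n => complex"
  assumes haar: "normalized_haar \<mu>" and \<phi>: "continuous_on unitary_group \<phi>" and st: "Re (s + t) > -1"
    and I: "rapidly_decaying CARD('n) (%m. character_distribution \<mu> m \<phi>)"
  shows "(\<integral>g. ell s t g * \<phi> g \<partial>\<mu>) = continuation CARD('n) (%m. character_distribution \<mu> m \<phi>) (s, t)"
proof -
  let ?I = "%m. character_distribution \<mu> m \<phi>"
  define h where "h g = ell s t g * \<phi> g" for g
  have shift: "h g * exp (- of_real (u * singularity g)) = ell (s + of_real u * (1 / 2)) (t + of_real u * (1 / 2)) g * \<phi> g"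
    if "g \<in> space \<mu>" for g u
    using ell_shift[of g s "of_real u * (1 / 2)" t] that haar_basics(2)[OF haar]
    by (simp add: h_def mult_ac)
  define K where "K = 2 * (2 * real CARD('n) * real CARD('n) + 1 + \<bar>Re s\<bar> + \<bar>Re t\<bar>)"
  have "(\<integral>g. h g * exp (- of_real (0 * singularity g)) \<partial>\<mu>) =
      (%w. continuation CARD('n) ?I (s + w * (1 / 2), t + w * (1 / 2))) (of_real 0)"
  proof (rule laplace_continuation[where ?x0.0 = "- 1 - Re (s + t)" and K = K])
    show "h \<in> borel_measurable \<mu>"
      unfolding h_def using ell_measurable[OF haar] haar_measurable[OF haar \<phi>] by measurable
    show "singularity \<in> borel_measurable \<mu>" by (rule singularity_measurable[OF haar])
    show "(%w. continuation CARD('n) ?I (s + w * (1 / 2), t + w * (1 / 2))) holomorphic_on {w. Re w > - 1 - Re (s + t)}"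
      by (rule continuation_line_holomorphic[OF I])
    fix u
    have int_eq: "(\<integral>g. h g * exp (- of_real (u * singularity g)) \<partial>\<mu>) =
        (\<integral>g. ell (s + of_real u * (1 / 2)) (t + of_real u * (1 / 2)) g * \<phi> g \<partial>\<mu>)"
      by (intro integral_cong_on refl shift)
    show "integrable \<mu> (%g. h g * exp (- of_real (u * singularity g)))" if "u > - 1 - Re (s + t)"
    proof -
      have "integrable \<mu> (%g. ell (s + of_real u * (1 / 2)) (t + of_real u * (1 / 2)) g * \<phi> g)"
        by (rule ell_integrable[OF haar \<phi>]) (use that in simp)
      then show ?thesis using shift by (subst Bochner_Integration.integrable_cong[OF refl]) auto
    qed
    show "(\<integral>g. h g * exp (- of_real (u * singularity g)) \<partial>\<mu>) =
        continuation CARD('n) ?I (s + of_real u * (1 / 2), t + of_real u * (1 / 2))" if "u > K"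
      unfolding int_eq using that abs_ge_minus_self[of "Re s"] abs_ge_minus_self[of "Re t"]
      by (intro ell_integral_large[OF haar \<phi>, of "2 * real CARD('n) * real CARD('n) + 1"] I)
         (auto simp: K_def)
  qed (use singularity_nonneg st in auto)
  then show ?thesis by (simp add: h_def)
qed

theorem ell_distribution_eq:
  fixes \<phi> :: "complex^'n^'n => complex"
  assumes haar: "normalized_haar \<mu>" and test: "test_function \<phi>" and regular: "\<sigma> + \<tau> + 1 \<notin> \<int>\<^sub>\<le>\<^sub>0"
  shows "ell_distribution \<mu> \<sigma> \<tau> \<phi> = continuation CARD('n) (%m. character_distribution \<mu> m \<phi>) (\<sigma>, \<tau>)"
proof -
  let ?I = "%m. character_distribution \<mu> m \<phi>"
  have I: "rapidly_decaying CARD('n) ?I" by (rule character_distribution_rapidly_decaying[OF haar test])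
  obtain V F where V: "unitary_group \<subseteq> V" "continuous_on V F" "\<And>g. g \<in> unitary_group ==> \<phi> g = F g"
    using test unfolding test_function_def by (metis times_cont_diff_on.simps(1))
  then have \<phi>: "continuous_on unitary_group \<phi>"
    by (metis (mono_tags, lifting) continuous_on_cong continuous_on_subset)
  have sum_cont: "continuous_on UNIV (%p :: complex \<times> complex. fst p + snd p)" by (intro continuous_intros)
  have "open ((%p :: complex \<times> complex. fst p + snd p) -` {z. z + 1 \<notin> \<int>\<^sub>\<le>\<^sub>0})"
    using sum_cont by (intro open_vimage open_not_nonpos_Ints)
  then have openS: "open {(s, t). s + t + 1 \<notin> (\<int>\<^sub>\<le>\<^sub>0 :: complex set)}" by (simp add: vimage_def case_prod_beta')
  moreover have "(\<sigma>, \<tau>) \<in> {(s, t). s + t + 1 \<notin> \<int>\<^sub>\<le>\<^sub>0}" using regular by simp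
  ultimately obtain r where r: "r > 0" "ball (\<sigma>, \<tau>) r \<subseteq> {(s, t). s + t + 1 \<notin> \<int>\<^sub>\<le>\<^sub>0}"
    using open_contains_ball by blast
  have "open ((%p :: complex \<times> complex. fst p + snd p) -` {z. Re z > -1})"
    using sum_cont by (intro open_vimage open_halfspace_Re_gt)
  then have openD: "open {(s, t). Re (s + t) > -1}" by (simp add: vimage_def case_prod_beta')
  have ne: "{(s, t). Re (s + t) > -1} \<noteq> {}" by (auto intro!: exI[of _ 0])
  show ?thesis
    unfolding ell_distribution_def
  proof (rule continuation_value_eq[OF continuation_meromorphic[OF I] openD ne _ r(1)])
    show "holomorphic2_on (continuation CARD('n) ?I) (ball (\<sigma>, \<tau>) r)"
      by (rule holomorphic2_on_subset[OF continuation_holomorphic[OF I] r(2)])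
    show "continuation CARD('n) ?I q = (case q of (s, t) => \<integral>g. ell s t g * \<phi> g \<partial>\<mu>)"
      if "q \<in> {(s, t). Re (s + t) > -1}" for q
      using that by (auto simp: ell_integral_eq[OF haar \<phi> _ I])
  qed
qed

section \<open>The forms of the expansion\<close>

lemma sin_shift_int: "sin (of_real pi * (z + of_int k)) = (-1) powi k * sin (of_real pi * z :: complex)"
proof -
  have c: "cos (of_real pi * of_int k :: complex) = (-1) powi k"
  proof -
    have "(of_real pi * of_int k :: complex) = of_real (pi * of_int k)" by simp
    then have "cos (of_real pi * of_int k :: complex) = of_real (cos (pi * of_int k))" by (simp only: cos_of_real)
    then show ?thesis by (simp add: power_int_minus_left)
  qed
  have "(of_real pi * of_int k :: complex) = of_real (pi * of_int k)" by simp
  then have "sin (of_real pi * of_int k :: complex) = of_real (sin (pi * of_int k))" by (simp only: sin_of_real)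
  then have s: "sin (of_real pi * of_int k :: complex) = 0" by (simp add: sin_zero_iff_int2)
  show ?thesis by (simp add: distrib_left sin_add c s)
qed

text \<open>Euler's reflection formula at \<open>s - m + n\<close>.\<close>
lemma sin_Gamma:
  fixes s :: complex
  assumes "s \<notin> \<int>"
  shows "sin (- of_real pi * s) * Gamma (- s + of_int m - of_nat n + 1) =
    - ((-1) powi (int n - m)) * of_real pi * rGamma (s - of_int m + of_nat n)"
proof -
  define x where "x = s - of_int m + of_nat n"
  have sx: "sin (of_real pi * x) = (-1) powi (int n - m) * sin (of_real pi * s)"
    using sin_shift_int[of s "int n - m"] by (simp add: x_def algebra_simps)
  have one: "(-1 :: complex) powi k * (-1) powi k = 1" for k :: int
    by (simp flip: power_int_mult_distrib)
  have "rGamma x * rGamma (1 - x) = sin (of_real pi * x) / of_real pi"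
    by (rule rGamma_reflection_complex)
  have xZ: "1 - x \<notin> \<int>\<^sub>\<le>\<^sub>0"
  proof
    assume "1 - x \<in> \<int>\<^sub>\<le>\<^sub>0"
    then have "1 - x \<in> \<int>" by (rule nonpos_Ints_Int)
    then have "1 - (1 - x) + of_int m - of_nat n \<in> \<int>" by (intro Ints_add Ints_diff) auto
    then show False using assms by (simp add: x_def)
  qed
  then have r: "rGamma (1 - x) * Gamma (1 - x) = 1"
    by (simp add: rGamma_inverse_Gamma Gamma_eq_zero_iff)
  have "sin (- of_real pi * s) * Gamma (1 - x) = - sin (of_real pi * s) * Gamma (1 - x)" by simp
  also have "sin (of_real pi * s) = (-1) powi (int n - m) * (of_real pi * (rGamma x * rGamma (1 - x)))"
    using one[of "int n - m"] by (simp add: rGamma_reflection_complex sx flip: mult.assoc)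
  also have "- ((-1) powi (int n - m) * (of_real pi * (rGamma x * rGamma (1 - x)))) * Gamma (1 - x) =
      - ((-1) powi (int n - m)) * of_real pi * rGamma x * (rGamma (1 - x) * Gamma (1 - x))"
    by (simp only: mult_ac mult_minus_left mult_minus_right)
  finally have "sin (- of_real pi * s) * Gamma (1 - x) = - ((-1) powi (int n - m)) * of_real pi * rGamma x"
    unfolding r mult_1_right .
  moreover have "- s + of_int m - of_nat n + 1 = 1 - x" by (simp add: x_def)
  ultimately show ?thesis by (simp only: x_def)
qed

text \<open>The signs \<open>(-1) ^ (n + 1)\<close> cancel in the product, since \<open>n * (n + 1)\<close> is even.\<close>
lemma sin_Gamma_prod:
  fixes s t :: complex
  assumes "s \<notin> \<int>"
  shows "sin (- of_real pi * s) ^ n * (\<Prod>j=1..n. Gamma (- s + of_int (m j) - of_nat n + 1) / Gamma (t + of_int (m j) + 1)) =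
    of_real pi ^ n * ((-1) powi (\<Sum>j=1..n. m j) * (\<Prod>j=1..n. rGamma (s - of_int (m j) + of_nat n) * rGamma (t + of_int (m j) + 1)))"
proof -
  have neg: "(\<Prod>j\<in>A. (-1 :: complex) powi f j) = (-1) powi (\<Sum>j\<in>A. f j)" for A :: "nat set" and f
    by (induction A rule: infinite_finite_induct) (auto simp: power_int_add)
  have "sin (- of_real pi * s) ^ n * (\<Prod>j=1..n. Gamma (- s + of_int (m j) - of_nat n + 1) / Gamma (t + of_int (m j) + 1)) =
      (\<Prod>j=1..n. (sin (- of_real pi * s) * Gamma (- s + of_int (m j) - of_nat n + 1)) * rGamma (t + of_int (m j) + 1))"
  proof -
    have "S ^ n * (\<Prod>j=1..n. A j / B j) = (\<Prod>j=1..n. (S * A j) * inverse (B j))" for S :: complex and A B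
      by (simp add: prod.distrib divide_inverse mult.assoc)
    then show ?thesis by (simp only: rGamma_inverse_Gamma)
  qed
  also have "... = (\<Prod>j=1..n. of_real pi * (((-1) powi (1 + int n - m j)) *
      (rGamma (s - of_int (m j) + of_nat n) * rGamma (t + of_int (m j) + 1))))"
    unfolding sin_Gamma[OF assms] by (intro prod.cong refl) (simp add: power_int_add power_int_diff mult_ac)
  also have "... = of_real pi ^ n * ((-1) powi (\<Sum>j=1..n. 1 + int n - m j) *
      (\<Prod>j=1..n. rGamma (s - of_int (m j) + of_nat n) * rGamma (t + of_int (m j) + 1)))"
    by (simp only: prod.distrib neg prod_constant card_atLeastAtMost diff_Suc_1 One_nat_def diff_Suc_Suc diff_zero)
  also have "(-1 :: complex) powi (\<Sum>j=1..n. 1 + int n - m j) = (-1) powi (\<Sum>j=1..n. m j)"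
  proof -
    have "(\<Sum>j=1..n. 1 + int n - m j) = int n * (int n + 1) - (\<Sum>j=1..n. m j)"
      by (simp add: sum_subtractf algebra_simps)
    moreover have "even (int n * (int n + 1))" by simp
    ultimately show ?thesis by (simp add: power_int_minus_left)
  qed
  finally show ?thesis .
qed

lemma eventually_not_Ints: "\<forall>\<^sub>F s in at (z :: complex). s \<notin> \<int>"
proof (cases "z \<in> \<int>")
  case True
  then obtain k where k: "z = of_int k" by (auto elim: Ints_cases)
  have "s \<notin> \<int>" if "s \<noteq> z" "dist s z < 1" for s
  proof
    assume "s \<in> \<int>"
    then obtain l where l: "s = of_int l" by (auto elim: Ints_cases)
    have "dist s z = \<bar>real_of_int (l - k)\<bar>" by (simp add: k l dist_norm flip: of_int_diff)
    then show False using that by (simp add: k l flip: of_int_abs)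
  qed
  then show ?thesis unfolding eventually_at by (intro exI[of _ 1]) auto
next
  case False
  then have "\<forall>\<^sub>F s in nhds z. s \<in> - \<int>" by (intro eventually_nhds_in_open open_Compl closed_Ints) auto
  then show ?thesis unfolding eventually_at_filter by (auto elim: eventually_mono)
qed

text \<open>Off the integers the function equals an entire function, whose value is therefore the one after
  removing the singularities.\<close>
lemma remove_sings_sin_Gamma:
  "remove_sings (%s. sin (- of_real pi * s) ^ n * (\<Prod>j=1..n. Gamma (- s + of_int (m j) - of_nat n + 1) / Gamma (t + of_int (m j) + 1))) \<sigma> =
    of_real pi ^ n * ((-1) powi (\<Sum>j=1..n. m j) * (\<Prod>j=1..n. rGamma (\<sigma> - of_int (m j) + of_nat n) * rGamma (t + of_int (m j) + 1)))"
proof (rule remove_sings_eqI, rule Lim_transform_eventually)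
  let ?h = "%s. of_real pi ^ n * ((-1) powi (\<Sum>j=1..n. m j) *
      (\<Prod>j=1..n. rGamma (s - of_int (m j) + of_nat n) * rGamma (t + of_int (m j) + 1))) :: complex"
  have "continuous_on UNIV ?h" by (intro continuous_intros continuous_on_rGamma_compose)
  then show "?h \<midarrow>\<sigma>\<rightarrow> ?h \<sigma>" by (simp add: continuous_on_def)
  show "\<forall>\<^sub>F s in at \<sigma>. ?h s = sin (- of_real pi * s) ^ n *
      (\<Prod>j=1..n. Gamma (- s + of_int (m j) - of_nat n + 1) / Gamma (t + of_int (m j) + 1))"
    using eventually_not_Ints 
  proof eventually_elim
    case (elim s)
    show ?case by (rule sin_Gamma_prod[OF elim, symmetric])
  qed
qed

theorem theorem3p11:
  fixes \<mu> :: "(complex^'n^'n) measure"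
    and \<phi> :: "complex^'n^'n \<Rightarrow> complex"
    and \<sigma> \<tau> :: complex
    and n :: nat
  assumes n: "n = CARD('n)"
    and haar: "normalized_haar \<mu>"
    and test: "test_function \<phi>"
    and re: "Re (\<sigma> + \<tau>) < 1"
    and regular: "\<sigma> + \<tau> + 1 \<notin> \<int>\<^sub>\<le>\<^sub>0"
  shows
    "\<comment> \<open>the first expansion, which is literally meaningful if \<open>\<sigma>\<close> is not an integer\<close>
     (\<sigma> \<notin> \<int> \<longrightarrow>
       (\<lambda>m. signature_differences n m *
            (\<Prod>j=1..n. Gamma (- \<sigma> + of_int (m j) - of_nat n + 1) / Gamma (\<tau> + of_int (m j) + 1)) *
            character_distribution \<mu> m \<phi>) summable_on signatures n \<and>
       ell_distribution \<mu> \<sigma> \<tau> \<phi> =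
         (-1) ^ (n * (n - 1) div 2) * sin (- of_real pi * \<sigma>) ^ n *
         2 powr (- (\<sigma> + \<tau>) * of_nat n) / of_real pi ^ n *
         (\<Prod>j=1..n. Gamma (\<sigma> + \<tau> + of_nat j)) *
         (\<Sum>\<^sub>\<infinity>m\<in>signatures n.
            signature_differences n m *
            (\<Prod>j=1..n. Gamma (- \<sigma> + of_int (m j) - of_nat n + 1) / Gamma (\<tau> + of_int (m j) + 1)) *
            character_distribution \<mu> m \<phi>)) \<and>
     \<comment> \<open>the first expansion for all \<open>\<sigma>\<close>: the removable singularities at the integers, where the
        sine vanishes and the Gamma functions have poles, are removed\<close>
     (\<lambda>m. signature_differences n m *
          remove_sings (\<lambda>s. sin (- of_real pi * s) ^ n *
            (\<Prod>j=1..n. Gamma (- s + of_int (m j) - of_nat n + 1) / Gamma (\<tau> + of_int (m j) + 1))) \<sigma> *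
          character_distribution \<mu> m \<phi>) summable_on signatures n \<and>
     ell_distribution \<mu> \<sigma> \<tau> \<phi> =
       (-1) ^ (n * (n - 1) div 2) *
       2 powr (- (\<sigma> + \<tau>) * of_nat n) / of_real pi ^ n *
       (\<Prod>j=1..n. Gamma (\<sigma> + \<tau> + of_nat j)) *
       (\<Sum>\<^sub>\<infinity>m\<in>signatures n.
          signature_differences n m *
          remove_sings (\<lambda>s. sin (- of_real pi * s) ^ n *
            (\<Prod>j=1..n. Gamma (- s + of_int (m j) - of_nat n + 1) / Gamma (\<tau> + of_int (m j) + 1))) \<sigma> *
          character_distribution \<mu> m \<phi>) \<and>
     \<comment> \<open>the second expansion; \<open>Gamma\<close> is 0 at its poles, so that \<open>1 / Gamma\<close> is 0 there, too\<close>
     (\<lambda>m. (-1) powi (\<Sum>j=1..n. m j) * signature_differences n m /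
          (\<Prod>j=1..n. Gamma (\<sigma> - of_int (m j) + of_nat n) * Gamma (\<tau> + of_int (m j) + 1)) *
          character_distribution \<mu> m \<phi>) summable_on signatures n \<and>
     ell_distribution \<mu> \<sigma> \<tau> \<phi> =
       (-1) ^ (n * (n - 1) div 2) * 2 powr (- (\<sigma> + \<tau>) * of_nat n) *
       (\<Prod>j=1..n. Gamma (\<sigma> + \<tau> + of_nat j)) *
       (\<Sum>\<^sub>\<infinity>m\<in>signatures n.
          (-1) powi (\<Sum>j=1..n. m j) * signature_differences n m /
          (\<Prod>j=1..n. Gamma (\<sigma> - of_int (m j) + of_nat n) * Gamma (\<tau> + of_int (m j) + 1)) *
          character_distribution \<mu> m \<phi>)"
proof -
  define I where "I m = character_distribution \<mu> m \<phi>" for m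
  let ?A = "\<lambda>m. signature_differences n m * (\<Prod>j=1..n. Gamma (- \<sigma> + of_int (m j) - of_nat n + 1) / Gamma (\<tau> + of_int (m j) + 1)) * I m"
  let ?B = "\<lambda>m. reduced_coefficient n \<sigma> \<tau> m * I m"
  define S where "S = (\<Sum>\<^sub>\<infinity>m\<in>signatures n. ?B m)"
  define pre where "pre = (-1) ^ (n * (n - 1) div 2) * 2 powr (- (\<sigma> + \<tau>) * of_nat n) * (\<Prod>j=1..n. Gamma (\<sigma> + \<tau> + of_nat j))"
  have decay: "rapidly_decaying n I"
    unfolding n I_def by (rule character_distribution_rapidly_decaying[OF haar test])
  have summable: "(\<lambda>m. ?B m) summable_on signatures n"
    by (rule reduced_sum_summable[OF decay])
  have ell: "ell_distribution \<mu> \<sigma> \<tau> \<phi> = pre * S"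
    using ell_distribution_eq[OF haar test regular] unfolding n pre_def S_def I_def
    by (simp add: continuation_def reduced_sum_def)
  have pi0: "complex_of_real pi \<noteq> 0" by simp
  have second: "(-1) powi (\<Sum>j=1..n. m j) * signature_differences n m /
      (\<Prod>j=1..n. Gamma (\<sigma> - of_int (m j) + of_nat n) * Gamma (\<tau> + of_int (m j) + 1)) * I m =
      ?B m" for m
    by (simp add: reduced_coefficient_def rGamma_inverse_Gamma divide_inverse prod.distrib prod_inversef[symmetric])
  have removed: "signature_differences n m *
      remove_sings (\<lambda>s. sin (- of_real pi * s) ^ n *
        (\<Prod>j=1..n. Gamma (- s + of_int (m j) - of_nat n + 1) / Gamma (\<tau> + of_int (m j) + 1))) \<sigma> * I m =
      of_real pi ^ n * ?B m" for m
    unfolding remove_sings_sin_Gamma reduced_coefficient_def by (simp only: mult_ac)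
  have first: "?A m =
      (of_real pi ^ n / sin (- of_real pi * \<sigma>) ^ n) * ?B m"
    and sin0: "sin (- of_real pi * \<sigma>) \<noteq> 0" if "\<sigma> \<notin> \<int>" for m
  proof -
    show s0: "sin (- of_real pi * \<sigma>) \<noteq> 0"
    proof
      assume "sin (- of_real pi * \<sigma>) = 0"
      then have "sin (of_real pi * \<sigma>) = 0" by simp
      then obtain k :: int where "of_real pi * \<sigma> = of_real (of_int k * pi)" by (auto simp: sin_eq_0)
      then have "of_real pi * \<sigma> = of_real pi * of_int k" by (simp add: mult.commute)
      then have "\<sigma> = of_int k" using mult_left_cancel[OF pi0] by blast
      then show False using that by simp
    qed
    have "sin (- of_real pi * \<sigma>) ^ n * (?A m) =
        of_real pi ^ n * ?B m"
      using sin_Gamma_prod[OF that, where n = n and m = m and t = \<tau>]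
      by (simp only: reduced_coefficient_def mult_ac)
    then show "?A m =
        (of_real pi ^ n / sin (- of_real pi * \<sigma>) ^ n) * ?B m"
      unfolding times_divide_eq_left using s0 by (intro nonzero_eq_divide_eq[THEN iffD2]) (auto simp: mult.commute)
  qed
  have inf_cmult: "(\<Sum>\<^sub>\<infinity>m\<in>signatures n. c * ?B m) = c * S" for c
    unfolding S_def by (rule infsum_cmult_right[OF summable])
  have summable_cmult: "(\<lambda>m. c * ?B m) summable_on signatures n" for c
    by (rule summable_on_cmult_right[OF summable])
  show ?thesis
    unfolding I_def[symmetric] second removed ell
  proof (intro conjI impI)
    assume \<sigma>: "\<sigma> \<notin> \<int>"
    show "(\<lambda>m. ?A m) summable_on signatures n"
      unfolding first[OF \<sigma>] by (rule summable_cmult)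
    show "pre * S = (-1) ^ (n * (n - 1) div 2) * sin (- of_real pi * \<sigma>) ^ n *
         2 powr (- (\<sigma> + \<tau>) * of_nat n) / of_real pi ^ n *
         (\<Prod>j=1..n. Gamma (\<sigma> + \<tau> + of_nat j)) *
         (\<Sum>\<^sub>\<infinity>m\<in>signatures n. ?A m)"
      unfolding first[OF \<sigma>] inf_cmult pre_def using sin0[OF \<sigma>] pi0 by simp
  next
    show "(\<lambda>m. of_real pi ^ n * ?B m) summable_on signatures n"
      by (rule summable_cmult)
    show "pre * S = (-1) ^ (n * (n - 1) div 2) * 2 powr (- (\<sigma> + \<tau>) * of_nat n) / of_real pi ^ n *
        (\<Prod>j=1..n. Gamma (\<sigma> + \<tau> + of_nat j)) *
        (\<Sum>\<^sub>\<infinity>m\<in>signatures n. of_real pi ^ n * ?B m)"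
      unfolding inf_cmult pre_def using pi0 by simp
    show "(\<lambda>m. ?B m) summable_on signatures n" by (rule summable)
    show "pre * S = (-1) ^ (n * (n - 1) div 2) * 2 powr (- (\<sigma> + \<tau>) * of_nat n) *
        (\<Prod>j=1..n. Gamma (\<sigma> + \<tau> + of_nat j)) *
        (\<Sum>\<^sub>\<infinity>m\<in>signatures n. ?B m)"
      by (simp add: pre_def S_def)
  qed
qed

end
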